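(* Assume the following. (1) The rows of $\mathbf{Z}$ are i.i.d. real or complex random vectors, either standard normal distributed, or distributed as $\sqrt{M}\,\mathbf{u}$ where $\mathbf{u}$ is uniformly (Haar) distributed on the unit sphere in $\mathbb{R}^M$ or $\mathbb{C}^M$. (2) $\mathbf{C}_N=\mathrm{diag}(c_1,\dots,c_N)$ with $c_n\ge0$ (the $c_n$ may depend on $N$), and there exist constants $C>0$, $\kappa>0$ such that $\frac1N\mathrm{tr}\,\mathbf{C}_N^2\le C$ and $\|\mathbf{C}_N\|\le\kappa\log M$. (3) The spectral density $f\in L^1(-\pi,\pi)$ of $\mathbf{R}_M$ is positive and is bounded on $[-\pi,\pi]\setminus(-\delta,\delta)$ for every $\delta>0$. (4) $\operatorname{ess\,inf}_{\theta\in(-\pi,\pi)}f(\theta)>0$. (5) $f$ is even and $f(x)=L(|x|^{-1})/|x|^a$ for $x\in[-\pi,\pi]\setminus\{0\}$, where $a\in(0,1)$ and $L$, defined on $[\pi^{-1},\infty)$, is slowly varying at $\infty$. Then for any sequence $x_M$ satisfying $M^{-\gamma}\lesssim x_M\lesssim C/\kappa$ for some $\gamma>0$, there exists $K>0$ such that, for any integer $\beta>2+a+\gamma$, for all large enough $M$ and any $N\ge1$, $$\mathbb{P}\left(\left\|\mathbf{R}_M^{-1/2}\hat{\mathbf{R}}_M\mathbf{R}_M^{-1/2}-\xi_N\mathbf{I}\right\|>x_M\right)\le 2\exp\left(-\frac{Nx_M^2}{CK\log^2M}+\beta\log M\right).$$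
   Context: For integers $M,N\ge1$, let $\mathbf{X}=\mathbf{C}_N^{1/2}\mathbf{Z}\mathbf{R}_M^{1/2}$, where $\mathbf{C}_N$ is an $N\times N$ deterministic matrix, $\mathbf{Z}$ is an $N\times M$ random matrix, and $\mathbf{R}_M=(r_{i-j})_{i,j=1}^M$ is the Toeplitz matrix with spectral density $f$, i.e. $r_k=\frac{1}{2\pi}\int_{-\pi}^{\pi}f(x)e^{-\mathbf{i}kx}\,dx$. Put $\xi_N=\frac1N\mathrm{tr}\,\mathbf{C}_N$. Let $S_{i,j}$ denote the entries of the $M\times M$ matrix $\frac1N\mathbf{X}^*\mathbf{X}$, and define $$\hat r_k=\frac{1}{M-|k|}\sum_i S_{i+k,i}\,\mathbf{1}_{\{1\le i,\ i+k\le M\}}\quad(|k|\le M-1),$$ where the sum is over $i$ with both $1\le i\le M$ and $1\le i+k\le M$, and $\hat{\mathbf{R}}_M=(\hat r_{i-j})_{1\le i,j\le M}$. $\|\cdot\|$ is the operator (spectral) norm. For positive sequences, $a_M\lesssim b_M$ means that there is a constant $k>0$ (not depending on $M$) with $a_M\le k b_M$ for all $M$. *)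

theory Defs
  imports
    "HOL-Probability.Probability"
    "Jordan_Normal_Form.Gauss_Jordan_Elimination"
    "Jordan_Normal_Form.Schur_Decomposition"
begin

unbundle no vec_syntax
unbundle no inner_syntax

text \<open>Dimensions vary inside the statement, so matrices are those of \<^theory>\<open>Jordan_Normal_Form.Matrix\<close>,
  with complex entries and indices starting at 0; real matrices are complex ones with real entries.\<close>

definition mat_trace :: "complex mat \<Rightarrow> complex" where
  "mat_trace A = (\<Sum>i<dim_row A. A $$ (i, i))"

definition l2_norm :: "complex Matrix.vec \<Rightarrow> real" where
  "l2_norm v = L2_set (\<lambda>i. cmod (v $ i)) {..<dim_vec v}"

definition op_norm :: "complex mat \<Rightarrow> real" where
  "op_norm A = (SUP v \<in> {v \<in> carrier_vec (dim_col A). l2_norm v \<le> 1}. l2_norm (A *\<^sub>v v))"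

definition pos_semidef :: "nat \<Rightarrow> complex mat \<Rightarrow> bool" where
  "pos_semidef n A \<longleftrightarrow> A \<in> carrier_mat n n \<and> mat_adjoint A = A \<and>
     (\<forall>v \<in> carrier_vec n. 0 \<le> Re ((A *\<^sub>v v) \<bullet>c v))"

text \<open>The positive semidefinite square root; it exists and is unique for positive semidefinite
  arguments, and is unspecified otherwise.\<close>

definition mat_sqrt :: "complex mat \<Rightarrow> complex mat" where
  "mat_sqrt A = (THE B. pos_semidef (dim_row A) B \<and> B * B = A)"

definition mat_inv_sqrt :: "complex mat \<Rightarrow> complex mat" where
  "mat_inv_sqrt A = the (mat_inverse (mat_sqrt A))"

definition toeplitz :: "nat \<Rightarrow> (int \<Rightarrow> complex) \<Rightarrow> complex mat" where
  "toeplitz M r = mat M M (\<lambda>(i, j). r (int i - int j))"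

definition autocov :: "(real \<Rightarrow> real) \<Rightarrow> int \<Rightarrow> complex" where
  "autocov f k = complex_of_real (1 / (2 * pi)) *
     set_lebesgue_integral lebesgue {-pi..pi}
       (\<lambda>t. complex_of_real (f t) * exp (- \<i> * of_int k * complex_of_real t))"

definition data_matrix :: "complex mat \<Rightarrow> complex mat \<Rightarrow> complex mat \<Rightarrow> complex mat" where
  "data_matrix C Z R = mat_sqrt C * Z * mat_sqrt R"

definition sample_cov :: "complex mat \<Rightarrow> complex mat" where
  "sample_cov X = complex_of_real (1 / real (dim_row X)) \<cdot>\<^sub>m (mat_adjoint X * X)"

text \<open>The row index i + k and the column index i both run through 0, ..., M - 1, where M is the size of S.\<close>

definition autocov_est :: "complex mat \<Rightarrow> int \<Rightarrow> complex" where
  "autocov_est S k = complex_of_real (1 / (real (dim_row S) - \<bar>real_of_int k\<bar>)) *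
     (\<Sum>i \<in> {i. 0 \<le> i \<and> i < int (dim_row S) \<and> 0 \<le> i + k \<and> i + k < int (dim_row S)}.
        S $$ (nat (i + k), nat i))"

definition toeplitz_est :: "complex mat \<Rightarrow> complex mat" where
  "toeplitz_est X = toeplitz (dim_col X) (autocov_est (sample_cov X))"

definition real_std_normal :: "complex measure" where
  "real_std_normal = distr (density lborel (\<lambda>x. ennreal (std_normal_density x))) borel complex_of_real"

text \<open>The circularly symmetric complex normal law with unit variance: independent real and
  imaginary parts, each of variance 1/2.\<close>

definition complex_std_normal :: "complex measure" where
  "complex_std_normal =
     (let \<nu> = density lborel (\<lambda>x. ennreal (normal_density 0 (1 / sqrt 2) x))
      in distr (\<nu> \<Otimes>\<^sub>M \<nu>) borel (\<lambda>(x, y). Complex x y))"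

abbreviation row_space :: "nat \<Rightarrow> (nat \<Rightarrow> complex) measure" where
  "row_space M \<equiv> PiM {..<M} (\<lambda>_. borel)"

text \<open>The uniform (Haar) law on the unit sphere: the probability measure carried by the sphere and
  invariant under the orthogonal group (F = \<open>\<real>\<close>) or the unitary group (F = UNIV).\<close>

definition haar_sphere :: "complex set \<Rightarrow> nat \<Rightarrow> (nat \<Rightarrow> complex) measure \<Rightarrow> bool" where
  "haar_sphere F M \<mu> \<longleftrightarrow>
     prob_space \<mu> \<and> sets \<mu> = sets (row_space M) \<and>
     (AE u in \<mu>. (\<forall>j<M. u j \<in> F) \<and> (\<Sum>j<M. (cmod (u j))\<^sup>2) = 1) \<and>
     (\<forall>U \<in> carrier_mat M M. (\<forall>i<M. \<forall>j<M. U $$ (i, j) \<in> F) \<and> mat_adjoint U * U = 1\<^sub>m M \<longrightarrow>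
        distr \<mu> (row_space M) (\<lambda>u. \<lambda>i\<in>{..<M}. \<Sum>j<M. U $$ (i, j) * u j) = \<mu>)"

definition scaled_haar_sphere :: "complex set \<Rightarrow> nat \<Rightarrow> (nat \<Rightarrow> complex) measure \<Rightarrow> bool" where
  "scaled_haar_sphere F M \<mu> \<longleftrightarrow>
     (\<exists>\<nu>. haar_sphere F M \<nu> \<and>
          \<mu> = distr \<nu> (row_space M) (\<lambda>u. \<lambda>j\<in>{..<M}. complex_of_real (sqrt (real M)) * u j))"

datatype row_ensemble = Real_Normal | Complex_Normal | Real_Sphere | Complex_Sphere

fun row_law :: "row_ensemble \<Rightarrow> nat \<Rightarrow> (nat \<Rightarrow> complex) measure \<Rightarrow> bool" where
  "row_law Real_Normal M \<mu> \<longleftrightarrow> \<mu> = PiM {..<M} (\<lambda>_. real_std_normal)"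
| "row_law Complex_Normal M \<mu> \<longleftrightarrow> \<mu> = PiM {..<M} (\<lambda>_. complex_std_normal)"
| "row_law Real_Sphere M \<mu> \<longleftrightarrow> scaled_haar_sphere \<real> M \<mu>"
| "row_law Complex_Sphere M \<mu> \<longleftrightarrow> scaled_haar_sphere UNIV M \<mu>"

definition mat_row_fun :: "nat \<Rightarrow> complex mat \<Rightarrow> nat \<Rightarrow> nat \<Rightarrow> complex" where
  "mat_row_fun M A i = (\<lambda>j\<in>{..<M}. A $$ (i, j))"

definition iid_rows ::
  "row_ensemble \<Rightarrow> nat \<Rightarrow> nat \<Rightarrow> 'w measure \<Rightarrow> ('w \<Rightarrow> complex mat) \<Rightarrow> bool" where
  "iid_rows E M N P Z \<longleftrightarrow>
     (\<forall>\<omega> \<in> space P. Z \<omega> \<in> carrier_mat N M) \<and>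
     prob_space.indep_vars P (\<lambda>_. row_space M) (\<lambda>i \<omega>. mat_row_fun M (Z \<omega>) i) {..<N} \<and>
     (\<exists>\<mu>. row_law E M \<mu> \<and>
        (\<forall>i<N. distr P (row_space M) (\<lambda>\<omega>. mat_row_fun M (Z \<omega>) i) = \<mu>))"

text \<open>Slow variation at infinity for a positive, Lebesgue measurable function on [A, \<infinity>).\<close>

definition slowly_varying_on :: "real \<Rightarrow> (real \<Rightarrow> real) \<Rightarrow> bool" where
  "slowly_varying_on A L \<longleftrightarrow>
     L \<in> borel_measurable (lebesgue_on {A..}) \<and> (\<forall>x\<ge>A. 0 < L x) \<and>
     (\<forall>t>0. ((\<lambda>x. L (t * x) / L x) \<longlongrightarrow> 1) at_top)"

definition essinf :: "'a measure \<Rightarrow> ('a \<Rightarrow> real) \<Rightarrow> ereal" where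
  "essinf M f = - esssup M (\<lambda>x. ereal (- f x))"

text \<open>Sequences are indexed by M \<ge> 1; the value at 0 is irrelevant.\<close>

definition lesssim :: "(nat \<Rightarrow> real) \<Rightarrow> (nat \<Rightarrow> real) \<Rightarrow> bool" (infix \<open>\<lesssim>\<close> 50) where
  "a \<lesssim> b \<longleftrightarrow> (\<exists>k>0. \<forall>M\<ge>1. a M \<le> k * b M)"

end

theory Submission imports Defs begin

text \<open>Write \<open>R = toeplitz M (autocov f)\<close> and let \<open>E\<close> be the Hermitian Toeplitz matrix with coefficients
\<open>T k = autocov_est S k - \<xi> * autocov f k\<close>. The whitened error is \<open>R\<^sup>-\<^sup>1\<^sup>/\<^sup>2 E R\<^sup>-\<^sup>1\<^sup>/\<^sup>2\<close>, so its norm is the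
largest ratio of the quadratic forms of \<open>E\<close> and of \<open>R\<close> (\<open>whitened_op_norm_le\<close>). The form of a Toeplitz matrix at
\<open>v\<close> integrates its spectral function against the squared modulus of the trigonometric polynomial of \<open>v\<close>, and a
spectral function of \<open>E\<close> is its symbol \<open>g(t) = \<Sum>k. T k * cis (k * t)\<close>. Hence the norm is at most \<open>B\<close> as soon as
\<open>\<bar>g\<bar> \<le> B * f\<close> almost everywhere (\<open>toeplitz_form_mono\<close>), and everything reduces to bounding one random
trigonometric polynomial by a multiple of \<open>f\<close>.

At a fixed frequency \<open>\<theta>\<close>, \<open>g(\<theta>)\<close> is a weighted sum, over the independent rows \<open>z\<close> of \<open>Z\<close>, of centred quadratic
forms in \<open>z\<close> with matrix (up to transposition) \<open>A = R\<^sup>1\<^sup>/\<^sup>2 D R\<^sup>1\<^sup>/\<^sup>2\<close>, where each entry of \<open>D\<close> is a phase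
divided by the length of its diagonal (\<open>symbol_deviation\<close>). Two facts control it.

\<^item> The exponential moments of such a form are bounded in terms of the Frobenius norm of \<open>A\<close> only. For a Gaussian
  vector the form is compared with the difference of two independent copies; a rotation of the pair by 45 degrees
  turns this difference into a bilinear form, and two Gaussian integrations finish (\<open>gauss_chaos_mgf\<close>). For \<open>u\<close>
  uniform on the unit sphere and an independent Gaussian pair \<open>g\<close>, \<open>h\<close>, the vector \<open>\<bar>g\<bar> u + h\<close> is distributed as
  \<open>sqrt 2\<close> times a Gaussian vector, and the form at \<open>u\<close> is, up to an affine map, a conditional expectation of the form at this vector, so
  Jensen's inequality transfers the Gaussian bound (\<open>sphere_chaos_mgf\<close>).

\<^item> The Frobenius norm of \<open>A\<close> is \<open>O(\<phi> * ln M)\<close>, where the profile \<open>\<phi>\<close>, taken at \<open>\<tau> = max \<bar>\<theta>\<bar> (1 / M)\<close>, is the supremum of \<open>f\<close>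
  over the frequencies at least \<open>\<tau>\<close> (\<open>frobenius_profile\<close>). The squared norm is \<open>tr (R D R D)\<close>, a double
  integral of \<open>f \<otimes> f\<close> against the energies of the transforms by \<open>D\<close> of pure waves; splitting \<open>f\<close> at \<open>\<tau>/2\<close>, the bounded part
  is handled by Parseval's identity, and the singular part, whose mass is \<open>O(\<tau> * \<phi>)\<close> because the singularity
  has exponent below 1, by the decay of the transform of a wave away from its own frequency.

The Chernoff bound over the rows then gives the stated exponent at a single \<open>\<theta>\<close>, with \<open>y * \<phi>\<close> as deviation.
To pass to all frequencies, \<open>g\<close> is sampled on a grid of step \<open>h\<close>. Its coefficients are bounded by its supremum, so
it is Lipschitz with constant \<open>2 M\<^sup>2\<close> times that supremum; this fits below the lower bound of \<open>f\<close> once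
\<open>h\<close> is a small multiple of \<open>1 / (M\<^sup>2 \<phi> (1 / M))\<close>. The Potter bounds for slowly varying functions give \<open>\<phi> (1 / M) = O(M\<^sup>b)\<close>
for some \<open>b < a + \<gamma>\<close>, and they also give \<open>\<phi> \<le> C * f\<close> at all smaller frequencies, so that grid points chosen
farther from the origin are enough (\<open>spectral_profile\<close>, \<open>op_norm_le_of_grid\<close>). The grid has \<open>O(M\<^sup>2\<^sup>+\<^sup>b)\<close> points, and
the union bound over them is absorbed by \<open>\<beta> > 2 + a + \<gamma>\<close>.\<close>

section \<open>Gaussian vectors\<close>

definition std_gauss :: "real measure" where
  "std_gauss = density lborel (\<lambda>x. ennreal (std_normal_density x))"

definition gauss :: "nat set \<Rightarrow> (nat \<Rightarrow> real) measure" where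
  "gauss J = PiM J (\<lambda>_. std_gauss)"

definition quad_form :: "nat set \<Rightarrow> (nat \<Rightarrow> nat \<Rightarrow> real) \<Rightarrow> (nat \<Rightarrow> real) \<Rightarrow> real" where
  "quad_form J B g = (\<Sum>i\<in>J. \<Sum>j\<in>J. B i j * g i * g j)"

lemma sets_std_gauss [simp, measurable_cong]: "sets std_gauss = sets borel"
  and space_std_gauss [simp]: "space std_gauss = UNIV"
  by (simp_all add: std_gauss_def)

lemma prob_space_std_gauss: "prob_space std_gauss"
  unfolding std_gauss_def by (rule prob_space_normal_density) simp

lemma sets_gauss [measurable_cong]: "sets (gauss J) = sets (PiM J (\<lambda>_. borel))"
  unfolding gauss_def by (intro sets_PiM_cong) simp_all

lemma space_gauss: "space (gauss J) = PiE J (\<lambda>_. UNIV)"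
  unfolding gauss_def by (simp add: space_PiM)

lemma prob_space_gauss: "prob_space (gauss J)"
  unfolding gauss_def by (intro prob_space_PiM prob_space_std_gauss)

lemma measurable_quad_form [measurable]: "quad_form J B \<in> borel_measurable (gauss J)"
  unfolding quad_form_def [abs_def] by measurable

lemma product_prob_std_gauss: "product_prob_space (\<lambda>_::nat. std_gauss)"
  by (intro product_prob_spaceI prob_space_std_gauss)

text \<open>Completing the square turns the integrand into a multiple of another normal density.\<close>

lemma std_gauss_exp_quad:
  fixes a c :: real
  assumes "c < 1/2"
  shows "(\<integral>\<^sup>+x. ennreal (exp (a * x + c * x\<^sup>2)) \<partial>std_gauss)
           = ennreal (1 / sqrt (1 - 2 * c) * exp (a\<^sup>2 / (2 * (1 - 2 * c))))"
proof -
  define d where "d = 1 - 2 * c"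
  have d: "d > 0" using assms by (simp add: d_def)
  define K where "K = 1 / sqrt d * exp (a\<^sup>2 / (2 * d))"
  have K: "K \<ge> 0" using d by (simp add: K_def)
  have eq: "std_normal_density x * exp (a * x + c * x\<^sup>2) = K * normal_density (a / d) (1 / sqrt d) x" for x
  proof -
    have e: "- x\<^sup>2 / 2 + (a * x + c * x\<^sup>2) = a\<^sup>2 / (2 * d) + - (x - a / d)\<^sup>2 / (2 * (1 / sqrt d)\<^sup>2)"
    proof -
      have c: "c = (1 - d) / 2" by (simp add: d_def)
      show ?thesis using d unfolding c by (simp add: power_divide field_simps power2_eq_square)
    qed
    have s: "sqrt (2 * pi * (1 / sqrt d)\<^sup>2) = sqrt (2 * pi) / sqrt d"
      using d by (simp add: power_divide real_sqrt_divide)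
    have "std_normal_density x * exp (a * x + c * x\<^sup>2) = 1 / sqrt (2 * pi) * exp (- x\<^sup>2 / 2 + (a * x + c * x\<^sup>2))"
      unfolding std_normal_density_def exp_add by simp
    also have "\<dots> = 1 / sqrt (2 * pi) * (exp (a\<^sup>2 / (2 * d)) * exp (- (x - a / d)\<^sup>2 / (2 * (1 / sqrt d)\<^sup>2)))"
      unfolding e exp_add ..
    also have "\<dots> = K * normal_density (a / d) (1 / sqrt d) x"
      unfolding normal_density_def s K_def using d by simp
    finally show ?thesis .
  qed
  interpret N: prob_space "density lborel (normal_density (a / d) (1 / sqrt d))"
    using d by (intro prob_space_normal_density) simp
  have one: "(\<integral>\<^sup>+x. ennreal (normal_density (a / d) (1 / sqrt d) x) \<partial>lborel) = 1"
    using N.emeasure_space_1 by (simp add: emeasure_density)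
  have "(\<integral>\<^sup>+x. ennreal (exp (a * x + c * x\<^sup>2)) \<partial>std_gauss)
      = (\<integral>\<^sup>+x. ennreal (std_normal_density x * exp (a * x + c * x\<^sup>2)) \<partial>lborel)"
    unfolding std_gauss_def by (subst nn_integral_density) (auto simp: ennreal_mult)
  also have "\<dots> = (\<integral>\<^sup>+x. ennreal K * ennreal (normal_density (a / d) (1 / sqrt d) x) \<partial>lborel)"
    unfolding eq using K by (simp add: ennreal_mult)
  also have "\<dots> = ennreal K" using one by (subst nn_integral_cmult) auto
  finally show ?thesis by (simp add: K_def d_def)
qed

lemma gauss_exp_quad:
  assumes "finite J" and "\<And>i. i \<in> J \<Longrightarrow> c i < (1/2::real)"
  shows "(\<integral>\<^sup>+g. ennreal (exp (\<Sum>i\<in>J. a i * g i + c i * (g i)\<^sup>2)) \<partial>gauss J)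
           = ennreal (\<Prod>i\<in>J. 1 / sqrt (1 - 2 * c i) * exp ((a i)\<^sup>2 / (2 * (1 - 2 * c i))))"
proof -
  interpret product_prob_space "\<lambda>_::nat. std_gauss" by (rule product_prob_std_gauss)
  have "(\<integral>\<^sup>+g. ennreal (exp (\<Sum>i\<in>J. a i * g i + c i * (g i)\<^sup>2)) \<partial>gauss J)
      = (\<integral>\<^sup>+g. (\<Prod>i\<in>J. ennreal (exp (a i * g i + c i * (g i)\<^sup>2))) \<partial>PiM J (\<lambda>_. std_gauss))"
    unfolding exp_sum [OF assms(1)] gauss_def by (simp add: prod_ennreal)
  also have "\<dots> = (\<Prod>i\<in>J. \<integral>\<^sup>+x. ennreal (exp (a i * x + c i * x\<^sup>2)) \<partial>std_gauss)"
  proof (rule product_nn_integral_prod [OF assms(1), of "\<lambda>i x. ennreal (exp (a i * x + c i * x\<^sup>2))"])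
    have m: "(\<lambda>x. ennreal (exp (\<alpha> * x + \<beta> * x\<^sup>2))) \<in> borel_measurable std_gauss" for \<alpha> \<beta> :: real
      by measurable
    show "(\<lambda>x. ennreal (exp (a i * x + c i * x\<^sup>2))) \<in> borel_measurable std_gauss" for i by (rule m)
  qed
  also have "\<dots> = (\<Prod>i\<in>J. ennreal (1 / sqrt (1 - 2 * c i) * exp ((a i)\<^sup>2 / (2 * (1 - 2 * c i)))))"
    using assms(2) by (intro prod.cong refl std_gauss_exp_quad)
  also have "\<dots> = ennreal (\<Prod>i\<in>J. 1 / sqrt (1 - 2 * c i) * exp ((a i)\<^sup>2 / (2 * (1 - 2 * c i))))"
  proof (rule prod_ennreal)
    fix i assume "i \<in> J"
    then have "0 \<le> 1 - 2 * c i" using assms(2) [of i] by simp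
    then show "0 \<le> 1 / sqrt (1 - 2 * c i) * exp ((a i)\<^sup>2 / (2 * (1 - 2 * c i)))" by simp
  qed
  finally show ?thesis .
qed

lemma gauss_exp_linear:
  assumes "finite J"
  shows "(\<integral>\<^sup>+g. ennreal (exp (\<Sum>i\<in>J. a i * g i)) \<partial>gauss J) = ennreal (exp ((\<Sum>i\<in>J. (a i)\<^sup>2) / 2))"
  using gauss_exp_quad [OF assms, of "\<lambda>_. 0" a] assms by (simp add: exp_sum sum_divide_distrib)

lemma std_gauss_moments:
  "integrable std_gauss (\<lambda>x. x)" "(\<integral>x. x \<partial>std_gauss) = 0"
  "integrable std_gauss (\<lambda>x. x * x)" "(\<integral>x. x * x \<partial>std_gauss) = 1"
proof -
  show "integrable std_gauss (\<lambda>x. x)"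
    unfolding std_gauss_def using integrable_std_normal_moment [of 1]
    by (subst integrable_density) auto
  show "(\<integral>x. x \<partial>std_gauss) = 0"
    unfolding std_gauss_def using integral_std_normal_moment_odd [of 0]
    by (subst integral_density) auto
  show "integrable std_gauss (\<lambda>x. x * x)"
    unfolding std_gauss_def using integrable_std_normal_moment [of 2]
    by (subst integrable_density) (auto simp: power2_eq_square)
  show "(\<integral>x. x * x \<partial>std_gauss) = 1"
    unfolding std_gauss_def using integral_std_normal_moment_even [of 1]
    by (subst integral_density) (auto simp: power2_eq_square)
qed

lemma gauss_second_moment:
  assumes J: "finite J" "i \<in> J" "j \<in> J"
  shows "integrable (gauss J) (\<lambda>g. g i * g j)" "(\<integral>g. g i * g j \<partial>gauss J) = (if i = j then 1 else 0)"
proof -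
  interpret product_prob_space "\<lambda>_::nat. std_gauss" by (rule product_prob_std_gauss)
  interpret S: prob_space std_gauss by (rule prob_space_std_gauss)
  define f where "f k = (\<lambda>x::real. (if k = i then x else 1) * (if k = j then x else 1))" for k
  have f: "(\<Prod>k\<in>J. f k (g k)) = g i * g j" for g
    using J by (simp add: f_def prod.distrib)
  have int: "integrable std_gauss (f k)" for k
    unfolding f_def by (cases "k = i"; cases "k = j"; simp add: std_gauss_moments)
  have "integrable (PiM J (\<lambda>_. std_gauss)) (\<lambda>g. \<Prod>k\<in>J. f k (g k))"
    by (rule product_integrable_prod [OF J(1)]) (rule int)
  then show "integrable (gauss J) (\<lambda>g. g i * g j)" by (simp add: f gauss_def)
  have "(\<integral>g. (\<Prod>k\<in>J. f k (g k)) \<partial>PiM J (\<lambda>_. std_gauss)) = (\<Prod>k\<in>J. \<integral>x. f k x \<partial>std_gauss)"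
    by (rule product_integral_prod [OF J(1)]) (rule int)
  also have "\<dots> = (if i = j then 1 else 0)"
  proof (cases "i = j")
    case True
    have "(\<integral>x. f k x \<partial>std_gauss) = 1" for k
      using True std_gauss_moments(4) by (cases "k = j") (simp_all add: f_def M.prob_space [simplified])
    then show ?thesis using True by simp
  next
    case False
    have "(\<integral>x. f i x \<partial>std_gauss) = 0"
      using False std_gauss_moments(2) by (simp add: f_def)
    then have "(\<Prod>k\<in>J. \<integral>x. f k x \<partial>std_gauss) = 0" using J by (intro prod_zero) auto
    then show ?thesis using False by simp
  qed
  finally show "(\<integral>g. g i * g j \<partial>gauss J) = (if i = j then 1 else 0)" by (simp add: f gauss_def)
qed

lemma gauss_first_moment:
  assumes J: "finite J" "i \<in> J"
  shows "integrable (gauss J) (\<lambda>g. g i)" "(\<integral>g. g i \<partial>gauss J) = 0"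
proof -
  interpret product_prob_space "\<lambda>_::nat. std_gauss" by (rule product_prob_std_gauss)
  interpret S: prob_space std_gauss by (rule prob_space_std_gauss)
  define f where "f k = (\<lambda>x::real. (if k = i then x else 1))" for k
  have f: "(\<Prod>k\<in>J. f k (g k)) = g i" for g
    using J by (simp add: f_def)
  have int: "integrable std_gauss (f k)" for k
    unfolding f_def by (cases "k = i"; simp add: std_gauss_moments)
  have "integrable (PiM J (\<lambda>_. std_gauss)) (\<lambda>g. \<Prod>k\<in>J. f k (g k))"
    by (rule product_integrable_prod [OF J(1)]) (rule int)
  then show "integrable (gauss J) (\<lambda>g. g i)" by (simp add: f gauss_def)
  have "(\<integral>g. (\<Prod>k\<in>J. f k (g k)) \<partial>PiM J (\<lambda>_. std_gauss)) = (\<Prod>k\<in>J. \<integral>x. f k x \<partial>std_gauss)"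
    by (rule product_integral_prod [OF J(1)]) (rule int)
  also have "\<dots> = 0"
    using J std_gauss_moments(2) by (intro prod_zero) (auto simp: f_def intro!: bexI [of _ i])
  finally show "(\<integral>g. g i \<partial>gauss J) = 0" by (simp add: f gauss_def)
qed

lemma gauss_quad_form_mean:
  assumes "finite J"
  shows "integrable (gauss J) (quad_form J B)" "(\<integral>g. quad_form J B g \<partial>gauss J) = (\<Sum>i\<in>J. B i i)"
proof -
  have int: "integrable (gauss J) (\<lambda>g. B i j * g i * g j)" if "i \<in> J" "j \<in> J" for i j
    using integrable_mult_right [OF gauss_second_moment(1) [OF assms that], of "B i j"] by (simp add: mult.assoc)
  have val: "(\<integral>g. B i j * g i * g j \<partial>gauss J) = (if i = j then B i j else 0)" if "i \<in> J" "j \<in> J" for i j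
    using gauss_second_moment(2) [OF assms that] by (simp add: mult.assoc)
  show "integrable (gauss J) (quad_form J B)"
    unfolding quad_form_def [abs_def] by (intro Bochner_Integration.integrable_sum int) auto
  have "(\<integral>g. quad_form J B g \<partial>gauss J) = (\<Sum>i\<in>J. \<Sum>j\<in>J. (\<integral>g. B i j * g i * g j \<partial>gauss J))"
    unfolding quad_form_def [abs_def] by (simp add: Bochner_Integration.integral_sum int)
  also have "\<dots> = (\<Sum>i\<in>J. \<Sum>j\<in>J. if i = j then B i j else 0)"
    by (intro sum.cong refl val)
  also have "\<dots> = (\<Sum>i\<in>J. B i i)" using assms by simp
  finally show "(\<integral>g. quad_form J B g \<partial>gauss J) = (\<Sum>i\<in>J. B i i)" .
qed

text \<open>Jensen's inequality. When \<open>exp X\<close> is not integrable the right-hand side is infinite.\<close>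

lemma exp_mean_le_nn_integral_exp:
  assumes "prob_space M" and X: "integrable M X"
  shows "ennreal (exp (\<integral>x. X x \<partial>M)) \<le> (\<integral>\<^sup>+x. ennreal (exp (X x)) \<partial>M)"
proof -
  interpret prob_space M by fact
  have [measurable]: "X \<in> borel_measurable M" using X by auto
  show ?thesis
  proof (cases "integrable M (\<lambda>x. exp (X x))")
    case True
    have "exp (\<integral>x. X x \<partial>M) \<le> (\<integral>x. exp (X x) \<partial>M)"
      by (rule jensens_inequality [where I = UNIV]) (use True X in \<open>auto simp: exp_convex\<close>)
    then show ?thesis using True by (subst nn_integral_eq_integral) (auto intro: ennreal_leI)
  next
    case False
    then have "(\<integral>\<^sup>+x. ennreal (exp (X x)) \<partial>M) = \<infinity>"
      by (auto simp: integrable_iff_bounded less_top [symmetric])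
    then show ?thesis by simp
  qed
qed

text \<open>A family of independent pairs is the same as a pair of independent families. This is what allows an identity in law
  for a pair of real Gaussians to be applied in every coordinate at once.\<close>

lemma PiM_pair_eq_distr:
  assumes "prob_space M" and J: "finite (J :: nat set)"
  shows "PiM J (\<lambda>_. M \<Otimes>\<^sub>M M) =
    distr (PiM J (\<lambda>_. M) \<Otimes>\<^sub>M PiM J (\<lambda>_. M)) (PiM J (\<lambda>_. M \<Otimes>\<^sub>M M)) (\<lambda>(g, h). \<lambda>i\<in>J. (g i, h i))"
    (is "_ = distr ?PP _ ?z")
proof -
  interpret M: prob_space M by fact
  interpret P: product_prob_space "\<lambda>_::nat. M" by (intro product_prob_spaceI assms)
  interpret MM: prob_space "M \<Otimes>\<^sub>M M" by (intro prob_space_pair assms)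
  interpret P2: product_prob_space "\<lambda>_::nat. M \<Otimes>\<^sub>M M" by (intro product_prob_spaceI MM.prob_space_axioms)
  interpret PJ: prob_space "PiM J (\<lambda>_. M)" by (intro prob_space_PiM assms)
  have z[measurable]: "?z \<in> ?PP \<rightarrow>\<^sub>M PiM J (\<lambda>_. M \<Otimes>\<^sub>M M)" by measurable
  show ?thesis
  proof (rule sym, rule P2.PiM_eqI [OF J])
    fix A assume A: "\<And>i. i \<in> J \<Longrightarrow> A i \<in> sets (M \<Otimes>\<^sub>M M)"
    then have [measurable]: "PiE J A \<in> sets (PiM J (\<lambda>_. M \<Otimes>\<^sub>M M))"
      using J by (intro sets_PiM_I_finite) auto
    have ind: "indicator (PiE J A) (?z gh) = (\<Prod>i\<in>J. indicator (A i) (fst gh i, snd gh i) :: ennreal)" for gh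
      using J by (auto simp: indicator_def PiE_iff prod_zero_iff split: prod.split)
    have m: "(\<lambda>gh. \<Prod>i\<in>J. indicator (A i) (fst gh i, snd gh i) :: ennreal) \<in> borel_measurable ?PP"
    proof (rule borel_measurable_prod_ennreal)
      fix i assume i: "i \<in> J"
      note A [OF i, measurable]
      have "(\<lambda>gh. (fst gh i, snd gh i)) \<in> ?PP \<rightarrow>\<^sub>M M \<Otimes>\<^sub>M M" using i by measurable
      from measurable_compose [OF this borel_measurable_indicator [OF A [OF i]]]
      show "(\<lambda>gh. indicator (A i) (fst gh i, snd gh i) :: ennreal) \<in> borel_measurable ?PP" by simp
    qed
    have "emeasure (distr ?PP (PiM J (\<lambda>_. M \<Otimes>\<^sub>M M)) ?z) (PiE J A)
        = (\<integral>\<^sup>+x. indicator (PiE J A) x \<partial>distr ?PP (PiM J (\<lambda>_. M \<Otimes>\<^sub>M M)) ?z)"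
      by simp
    also have "\<dots> = (\<integral>\<^sup>+gh. (\<Prod>i\<in>J. indicator (A i) (fst gh i, snd gh i)) \<partial>?PP)"
      by (subst nn_integral_distr) (auto simp: ind)
    also have "\<dots> = (\<integral>\<^sup>+g. \<integral>\<^sup>+h. (\<Prod>i\<in>J. indicator (A i) (g i, h i)) \<partial>PiM J (\<lambda>_. M) \<partial>PiM J (\<lambda>_. M))"
      using PJ.nn_integral_fst [OF m] by simp
    also have "\<dots> = (\<integral>\<^sup>+g. (\<Prod>i\<in>J. \<integral>\<^sup>+y. indicator (A i) (g i, y) \<partial>M) \<partial>PiM J (\<lambda>_. M))"
    proof (rule nn_integral_cong)
      fix g assume g: "g \<in> space (PiM J (\<lambda>_. M))"
      show "(\<integral>\<^sup>+h. (\<Prod>i\<in>J. indicator (A i) (g i, h i)) \<partial>PiM J (\<lambda>_. M))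
          = (\<Prod>i\<in>J. \<integral>\<^sup>+y. indicator (A i) (g i, y) \<partial>M)"
      proof (rule P.product_nn_integral_prod [OF J, of "\<lambda>i y. indicator (A i) (g i, y)"])
        fix i assume i: "i \<in> J"
        note A [OF i, measurable]
        have "g i \<in> space M" using g i by (auto simp: space_PiM)
        then show "(\<lambda>y. indicator (A i) (g i, y) :: ennreal) \<in> borel_measurable M" by measurable
      qed
    qed
    also have "\<dots> = (\<Prod>i\<in>J. \<integral>\<^sup>+x. \<integral>\<^sup>+y. indicator (A i) (x, y) \<partial>M \<partial>M)"
    proof (rule P.product_nn_integral_prod [OF J, of "\<lambda>i x. \<integral>\<^sup>+y. indicator (A i) (x, y) \<partial>M"])
      fix i assume i: "i \<in> J"
      note A [OF i, measurable]
      show "(\<lambda>x. \<integral>\<^sup>+y. indicator (A i) (x, y) \<partial>M) \<in> borel_measurable M" by measurable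
    qed
    also have "\<dots> = (\<Prod>i\<in>J. emeasure (M \<Otimes>\<^sub>M M) (A i))"
      using A by (intro prod.cong refl M.emeasure_pair_measure [symmetric]) auto
    finally show "emeasure (distr ?PP (PiM J (\<lambda>_. M \<Otimes>\<^sub>M M)) ?z) (PiE J A) = (\<Prod>i\<in>J. emeasure (M \<Otimes>\<^sub>M M) (A i))" .
  qed simp
qed

text \<open>The joint density depends on \<open>x\<^sup>2 + y\<^sup>2\<close> only, and the map preserves it; the two substitutions in the
  proof have Jacobians \<open>sqrt 2\<close> and \<open>1 / sqrt 2\<close>.\<close>

lemma std_gauss_pair_rotate:
  "distr (std_gauss \<Otimes>\<^sub>M std_gauss) (std_gauss \<Otimes>\<^sub>M std_gauss)
     (\<lambda>(x, y). ((x + y) / sqrt 2, (x - y) / sqrt 2)) = std_gauss \<Otimes>\<^sub>M std_gauss"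
  (is "distr ?P ?P ?T = ?P")
proof -
  interpret S: prob_space std_gauss by (rule prob_space_std_gauss)
  define w where "w x = ennreal (std_normal_density x)" for x
  have [measurable]: "w \<in> borel_measurable borel" unfolding w_def [abs_def] by measurable
  have sg: "(\<integral>\<^sup>+x. f x \<partial>std_gauss) = (\<integral>\<^sup>+x. w x * f x \<partial>lborel)" if "f \<in> borel_measurable borel" for f
    unfolding std_gauss_def w_def using that by (subst nn_integral_density) auto
  have ww: "w ((x + y) / sqrt 2) * w ((x - y) / sqrt 2) = w x * w y" for x y
  proof -
    have "((x + y) / sqrt 2)\<^sup>2 + ((x - y) / sqrt 2)\<^sup>2 = x\<^sup>2 + y\<^sup>2"
      by (simp add: power_divide power2_eq_square field_simps)
    then have "exp (- ((x + y) / sqrt 2)\<^sup>2 / 2) * exp (- ((x - y) / sqrt 2)\<^sup>2 / 2) = exp (- x\<^sup>2 / 2) * exp (- y\<^sup>2 / 2)"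
      by (simp add: exp_add [symmetric] add_divide_distrib [symmetric])
    then show ?thesis unfolding w_def std_normal_density_def
      by (simp add: ennreal_mult [symmetric] mult.assoc mult.left_commute)
  qed
  have main: "(\<integral>\<^sup>+x. \<integral>\<^sup>+y. F ((x + y) / sqrt 2, (x - y) / sqrt 2) \<partial>std_gauss \<partial>std_gauss)
      = (\<integral>\<^sup>+x. \<integral>\<^sup>+y. F (x, y) \<partial>std_gauss \<partial>std_gauss)"
    if F[measurable]: "F \<in> borel_measurable (borel \<Otimes>\<^sub>M borel)" for F :: "real \<times> real \<Rightarrow> ennreal"
  proof -
    define G where "G u v = w u * w v * F (u, v)" for u v
    have [measurable]: "(\<lambda>(u, v). G u v) \<in> borel_measurable (borel \<Otimes>\<^sub>M borel)"
      unfolding G_def by measurable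
    have Gm2: "(\<lambda>(u, x). G u (sqrt 2 * x - u)) \<in> borel_measurable (lborel \<Otimes>\<^sub>M lborel)"
      unfolding G_def by measurable
    have Gm: "(\<lambda>y. G (f y) (g y)) \<in> borel_measurable borel"
      if "f \<in> borel_measurable borel" "g \<in> borel_measurable borel" for f g :: "real \<Rightarrow> real"
      using that by measurable
    have "(\<integral>\<^sup>+x. \<integral>\<^sup>+y. F ((x + y) / sqrt 2, (x - y) / sqrt 2) \<partial>std_gauss \<partial>std_gauss)
        = (\<integral>\<^sup>+x. w x * (\<integral>\<^sup>+y. w y * F ((x + y) / sqrt 2, (x - y) / sqrt 2) \<partial>lborel) \<partial>lborel)"
      by (subst sg, measurable, subst sg, measurable)
    also have "\<dots> = (\<integral>\<^sup>+x. \<integral>\<^sup>+y. G ((x + y) / sqrt 2) ((x - y) / sqrt 2) \<partial>lborel \<partial>lborel)"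
      unfolding G_def ww by (simp add: nn_integral_cmult [symmetric] mult.assoc)
    also have "\<dots> = (\<integral>\<^sup>+x. sqrt 2 * (\<integral>\<^sup>+u. G u (sqrt 2 * x - u) \<partial>lborel) \<partial>lborel)"
    proof (rule nn_integral_cong)
      fix x :: real
      have e1: "(x + (- x + sqrt 2 * u)) / sqrt 2 = u" for u
        by simp
      have e: "(x - (- x + sqrt 2 * u)) / sqrt 2 = sqrt 2 * x - u" for u
      proof -
        have "(x - (- x + sqrt 2 * u)) = sqrt 2 * (sqrt 2 * x - u)" by (simp add: algebra_simps)
        then show ?thesis by simp
      qed
      have m: "(\<lambda>y. G ((x + y) / sqrt 2) ((x - y) / sqrt 2)) \<in> borel_measurable borel"
        by (rule Gm) measurable
      show "(\<integral>\<^sup>+y. G ((x + y) / sqrt 2) ((x - y) / sqrt 2) \<partial>lborel) = sqrt 2 * (\<integral>\<^sup>+u. G u (sqrt 2 * x - u) \<partial>lborel)"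
        by (subst nn_integral_real_affine [OF m, where c = "sqrt 2" and t = "- x"]) (simp, simp only: e e1, simp)
    qed
    also have "\<dots> = sqrt 2 * (\<integral>\<^sup>+x. \<integral>\<^sup>+u. G u (sqrt 2 * x - u) \<partial>lborel \<partial>lborel)"
      by (subst nn_integral_cmult) measurable
    also have "\<dots> = sqrt 2 * (\<integral>\<^sup>+u. \<integral>\<^sup>+x. G u (sqrt 2 * x - u) \<partial>lborel \<partial>lborel)"
      by (subst lborel_pair.Fubini' [OF Gm2]) simp
    also have "\<dots> = (\<integral>\<^sup>+u. sqrt 2 * (\<integral>\<^sup>+x. G u (sqrt 2 * x - u) \<partial>lborel) \<partial>lborel)"
      by (subst nn_integral_cmult) measurable
    also have "\<dots> = (\<integral>\<^sup>+u. \<integral>\<^sup>+v. G u v \<partial>lborel \<partial>lborel)"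
    proof (rule nn_integral_cong)
      fix u :: real
      have Gu: "G u \<in> borel_measurable borel"
        by (rule Gm [of "\<lambda>_. u" "\<lambda>v. v"]) measurable
      show "sqrt 2 * (\<integral>\<^sup>+x. G u (sqrt 2 * x - u) \<partial>lborel) = (\<integral>\<^sup>+v. G u v \<partial>lborel)"
        by (subst nn_integral_real_affine [OF Gu, where c = "sqrt 2" and t = "- u"]) simp_all
    qed
    also have "\<dots> = (\<integral>\<^sup>+u. w u * (\<integral>\<^sup>+v. w v * F (u, v) \<partial>lborel) \<partial>lborel)"
      unfolding G_def by (simp add: nn_integral_cmult [symmetric] mult.assoc)
    also have "\<dots> = (\<integral>\<^sup>+x. \<integral>\<^sup>+y. F (x, y) \<partial>std_gauss \<partial>std_gauss)"
      by (subst sg, measurable, subst sg, measurable)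
    finally show ?thesis .
  qed
  have T[measurable]: "?T \<in> ?P \<rightarrow>\<^sub>M ?P" by measurable
  show ?thesis
  proof (rule measure_eqI)
    fix A assume "A \<in> sets (distr ?P ?P ?T)"
    then have A[measurable]: "A \<in> sets ?P" by simp
    then have A'[measurable]: "A \<in> sets (borel \<Otimes>\<^sub>M borel)"
      using sets_pair_measure_cong [OF sets_std_gauss sets_std_gauss] by simp
    have "emeasure (distr ?P ?P ?T) A = (\<integral>\<^sup>+z. indicator A (?T z) \<partial>?P)"
      by (subst nn_integral_indicator [symmetric], simp, subst nn_integral_distr) (auto simp: case_prod_beta)
    also have "\<dots> = (\<integral>\<^sup>+x. \<integral>\<^sup>+y. indicator A ((x + y) / sqrt 2, (x - y) / sqrt 2) \<partial>std_gauss \<partial>std_gauss)"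
      by (subst S.nn_integral_fst [symmetric, OF measurable_compose [OF T borel_measurable_indicator [OF A]]]) simp
    also have "\<dots> = (\<integral>\<^sup>+x. \<integral>\<^sup>+y. indicator A (x, y) \<partial>std_gauss \<partial>std_gauss)"
      by (rule main) measurable
    also have "\<dots> = emeasure ?P A" by (rule S.emeasure_pair_measure [symmetric, OF A])
    finally show "emeasure (distr ?P ?P ?T) A = emeasure ?P A" .
  qed simp
qed

lemma gauss_pair_rotate:
  assumes J: "finite J" and F: "F \<in> borel_measurable (PiM J (\<lambda>_. std_gauss \<Otimes>\<^sub>M std_gauss))"
  shows "(\<integral>\<^sup>+g. \<integral>\<^sup>+h. F (\<lambda>i\<in>J. (g i, h i)) \<partial>gauss J \<partial>gauss J)
    = (\<integral>\<^sup>+g. \<integral>\<^sup>+h. F (\<lambda>i\<in>J. ((g i + h i) / sqrt 2, (g i - h i) / sqrt 2)) \<partial>gauss J \<partial>gauss J)"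
proof -
  let ?P = "std_gauss \<Otimes>\<^sub>M std_gauss"
  define T where "T = (\<lambda>(x, y). ((x + y) / sqrt 2, (x - y) / sqrt (2::real)))"
  interpret S: prob_space std_gauss by (rule prob_space_std_gauss)
  interpret P: prob_space ?P by (intro prob_space_pair prob_space_std_gauss)
  interpret G: prob_space "gauss J" by (rule prob_space_gauss)
  note F[measurable]
  have T[measurable]: "T \<in> ?P \<rightarrow>\<^sub>M ?P" unfolding T_def by measurable
  have compT[measurable]: "compose J T \<in> PiM J (\<lambda>_. ?P) \<rightarrow>\<^sub>M PiM J (\<lambda>_. ?P)"
    unfolding compose_def [abs_def] by measurable
  have zip: "(\<integral>\<^sup>+g. \<integral>\<^sup>+h. H (\<lambda>i\<in>J. (g i, h i)) \<partial>gauss J \<partial>gauss J) = (\<integral>\<^sup>+z. H z \<partial>PiM J (\<lambda>_. ?P))"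
    if H[measurable]: "H \<in> borel_measurable (PiM J (\<lambda>_. ?P))" for H :: "_ \<Rightarrow> ennreal"
  proof -
    have z[measurable]: "(\<lambda>(g, h). \<lambda>i\<in>J. (g i, h i)) \<in> gauss J \<Otimes>\<^sub>M gauss J \<rightarrow>\<^sub>M PiM J (\<lambda>_. ?P)"
      unfolding gauss_def by measurable
    have "(\<integral>\<^sup>+z. H z \<partial>PiM J (\<lambda>_. ?P))
        = (\<integral>\<^sup>+z. H z \<partial>distr (gauss J \<Otimes>\<^sub>M gauss J) (PiM J (\<lambda>_. ?P)) (\<lambda>(g, h). \<lambda>i\<in>J. (g i, h i)))"
      unfolding gauss_def PiM_pair_eq_distr [OF prob_space_std_gauss J, symmetric] ..
    also have "\<dots> = (\<integral>\<^sup>+gh. H (case gh of (g, h) \<Rightarrow> \<lambda>i\<in>J. (g i, h i)) \<partial>(gauss J \<Otimes>\<^sub>M gauss J))"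
      by (rule nn_integral_distr) measurable
    also have "\<dots> = (\<integral>\<^sup>+g. \<integral>\<^sup>+h. H (\<lambda>i\<in>J. (g i, h i)) \<partial>gauss J \<partial>gauss J)"
      using G.nn_integral_fst [OF measurable_compose [OF z H], symmetric] by simp
    finally show ?thesis ..
  qed
  have "PiM J (\<lambda>_. ?P) = PiM J (\<lambda>_. distr ?P ?P T)"
    unfolding T_def std_gauss_pair_rotate ..
  also have "\<dots> = distr (PiM J (\<lambda>_. ?P)) (PiM J (\<lambda>_. ?P)) (compose J T)"
    by (rule distr_PiM_finite_prob_space' [symmetric]) (auto simp: J P.prob_space_axioms)
  finally have inv: "PiM J (\<lambda>_. ?P) = distr (PiM J (\<lambda>_. ?P)) (PiM J (\<lambda>_. ?P)) (compose J T)" .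
  have "(\<integral>\<^sup>+g. \<integral>\<^sup>+h. F (\<lambda>i\<in>J. (g i, h i)) \<partial>gauss J \<partial>gauss J) = (\<integral>\<^sup>+z. F z \<partial>PiM J (\<lambda>_. ?P))"
    by (rule zip) measurable
  also have "\<dots> = (\<integral>\<^sup>+z. F (compose J T z) \<partial>PiM J (\<lambda>_. ?P))"
    by (subst inv, subst nn_integral_distr) measurable
  also have "\<dots> = (\<integral>\<^sup>+g. \<integral>\<^sup>+h. F (compose J T (\<lambda>i\<in>J. (g i, h i))) \<partial>gauss J \<partial>gauss J)"
    by (rule zip [symmetric]) measurable
  also have "\<dots> = (\<integral>\<^sup>+g. \<integral>\<^sup>+h. F (\<lambda>i\<in>J. ((g i + h i) / sqrt 2, (g i - h i) / sqrt 2)) \<partial>gauss J \<partial>gauss J)"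
    by (intro nn_integral_cong arg_cong [where f = F]) (auto simp: compose_def T_def fun_eq_iff)
  finally show ?thesis .
qed

section \<open>Exponential moments of Gaussian quadratic forms\<close>

lemma inverse_sqrt_le_exp:
  fixes x :: real
  assumes "0 \<le> x" "x \<le> 1/4"
  shows "1 / sqrt (1 - 2 * x) \<le> exp (2 * x)"
proof -
  have a: "exp (- (4 * x)) * (1 + 4 * x) \<le> exp (- (4 * x)) * exp (4 * x)"
    using exp_ge_add_one_self [of "4 * x"] by (intro mult_left_mono) auto
  then have a: "exp (- (4 * x)) * (1 + 4 * x) \<le> 1" by (simp add: exp_minus field_simps)
  have "x * x \<le> x * (1/4)" using assms by (intro mult_left_mono) auto
  then have "1 \<le> (1 - 2 * x) * (1 + 4 * x)" by (simp add: algebra_simps)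
  then have "exp (- (4 * x)) * (1 + 4 * x) \<le> (1 - 2 * x) * (1 + 4 * x)" using a by linarith
  then have b: "exp (- (4 * x)) \<le> 1 - 2 * x" using assms by (simp add: mult_le_cancel_right)
  have "exp (- (2 * x)) = sqrt (exp (- (4 * x)))"
    by (rule real_sqrt_unique [symmetric]) (auto simp: power2_eq_square exp_add [symmetric])
  also have "\<dots> \<le> sqrt (1 - 2 * x)" using b by simp
  finally have c: "exp (- (2 * x)) \<le> sqrt (1 - 2 * x)" .
  have p: "0 < sqrt (1 - 2 * x)" using assms by simp
  have "1 / sqrt (1 - 2 * x) \<le> 1 / exp (- (2 * x))"
    using c p by (intro divide_left_mono mult_pos_pos) simp_all
  then show ?thesis by (simp add: exp_minus inverse_eq_divide)
qed

text \<open>The exponential of a square is a Gaussian average of exponentials of linear forms (the Hubbard-Stratonovich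
  transformation), and linear forms have explicit exponential moments.\<close>

lemma gauss_linear_square_mgf:
  assumes J: "finite J" and s: "0 \<le> s" "4 * s * (\<Sum>j\<in>J. (w j)\<^sup>2) \<le> 1"
  shows "(\<integral>\<^sup>+g. ennreal (exp (s * (\<Sum>j\<in>J. w j * g j)\<^sup>2)) \<partial>gauss J) \<le> ennreal (exp (2 * s * (\<Sum>j\<in>J. (w j)\<^sup>2)))"
proof -
  define W where "W = (\<Sum>j\<in>J. (w j)\<^sup>2)"
  have W: "W \<ge> 0" "4 * s * W \<le> 1" using s by (simp_all add: W_def sum_nonneg)
  interpret S: prob_space std_gauss by (rule prob_space_std_gauss)
  interpret G: prob_space "gauss J" by (rule prob_space_gauss)
  interpret PS: pair_sigma_finite "gauss J" std_gauss ..
  have "(\<integral>\<^sup>+g. ennreal (exp (s * (\<Sum>j\<in>J. w j * g j)\<^sup>2)) \<partial>gauss J)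
      = (\<integral>\<^sup>+g. \<integral>\<^sup>+y. ennreal (exp (sqrt (2 * s) * (\<Sum>j\<in>J. w j * g j) * y)) \<partial>std_gauss \<partial>gauss J)"
    using std_gauss_exp_quad [of 0] s(1) by (intro nn_integral_cong) (simp add: power_mult_distrib)
  also have "\<dots> = (\<integral>\<^sup>+y. \<integral>\<^sup>+g. ennreal (exp (sqrt (2 * s) * (\<Sum>j\<in>J. w j * g j) * y)) \<partial>gauss J \<partial>std_gauss)"
    by (rule PS.Fubini' [symmetric]) measurable
  also have "\<dots> = (\<integral>\<^sup>+y. ennreal (exp (s * W * y\<^sup>2)) \<partial>std_gauss)"
  proof (rule nn_integral_cong)
    fix y :: real
    have "(\<integral>\<^sup>+g. ennreal (exp (sqrt (2 * s) * (\<Sum>j\<in>J. w j * g j) * y)) \<partial>gauss J)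
        = (\<integral>\<^sup>+g. ennreal (exp (\<Sum>j\<in>J. (sqrt (2 * s) * y * w j) * g j)) \<partial>gauss J)"
      by (simp add: sum_distrib_left sum_distrib_right mult_ac)
    also have "\<dots> = ennreal (exp ((\<Sum>j\<in>J. (sqrt (2 * s) * y * w j)\<^sup>2) / 2))"
      by (rule gauss_exp_linear [OF J])
    also have "(\<Sum>j\<in>J. (sqrt (2 * s) * y * w j)\<^sup>2) / 2 = s * W * y\<^sup>2"
      using s(1) by (simp add: power_mult_distrib W_def sum_distrib_left sum_distrib_right sum_divide_distrib mult_ac)
    finally show "(\<integral>\<^sup>+g. ennreal (exp (sqrt (2 * s) * (\<Sum>j\<in>J. w j * g j) * y)) \<partial>gauss J) = ennreal (exp (s * W * y\<^sup>2))" .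
  qed
  also have "\<dots> = ennreal (1 / sqrt (1 - 2 * (s * W)))"
    using std_gauss_exp_quad [of "s * W" 0] W by simp
  also have "\<dots> \<le> ennreal (exp (2 * (s * W)))"
    using inverse_sqrt_le_exp [of "s * W"] W s by (intro ennreal_leI) auto
  finally show ?thesis by (simp add: W_def mult.assoc)
qed

text \<open>With \<open>\<beta> k\<close> the squared length of the \<open>k\<close>-th row and \<open>F\<close> the sum of the \<open>\<beta> k\<close>, convexity of \<open>exp\<close> with the weights \<open>\<beta> k / F\<close> reduces the sum of squares to single squares, each rescaled to
  the same variance. Hence only the Frobenius norm enters.\<close>

lemma gauss_sum_squares_mgf:
  assumes J: "finite J" and s: "0 \<le> s" "4 * s * (\<Sum>k\<in>J. \<Sum>j\<in>J. (b k j)\<^sup>2) \<le> 1"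
  shows "(\<integral>\<^sup>+g. ennreal (exp (s * (\<Sum>k\<in>J. (\<Sum>j\<in>J. b k j * g j)\<^sup>2))) \<partial>gauss J)
           \<le> ennreal (exp (2 * s * (\<Sum>k\<in>J. \<Sum>j\<in>J. (b k j)\<^sup>2)))"
proof -
  define \<beta> where "\<beta> k = (\<Sum>j\<in>J. (b k j)\<^sup>2)" for k
  define F where "F = (\<Sum>k\<in>J. \<beta> k)"
  have \<beta>: "\<beta> k \<ge> 0" for k by (simp add: \<beta>_def sum_nonneg)
  interpret G: prob_space "gauss J" by (rule prob_space_gauss)
  have zero: "b k j = 0" if "\<beta> k = 0" "j \<in> J" for k j
    using that J by (simp add: \<beta>_def sum_nonneg_eq_0_iff)
  show ?thesis
  proof (cases "F = 0")
    case True
    then have "\<And>k. k \<in> J \<Longrightarrow> \<beta> k = 0" using J \<beta> by (simp add: F_def sum_nonneg_eq_0_iff)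
    then have "(\<Sum>k\<in>J. (\<Sum>j\<in>J. b k j * g j)\<^sup>2) = 0" for g
      using zero by simp
    then show ?thesis using True unfolding F_def \<beta>_def by (simp add: G.emeasure_space_1)
  next
    case False
    then have F: "F > 0" using \<beta> by (simp add: F_def sum_nonneg less_le)
    define y where "y k g = s * F / \<beta> k * (\<Sum>j\<in>J. b k j * g j)\<^sup>2" for k g
    have "(\<integral>\<^sup>+g. ennreal (exp (s * (\<Sum>k\<in>J. (\<Sum>j\<in>J. b k j * g j)\<^sup>2))) \<partial>gauss J)
        \<le> (\<integral>\<^sup>+g. (\<Sum>k\<in>J. ennreal (\<beta> k / F) * ennreal (exp (y k g))) \<partial>gauss J)"
    proof (rule nn_integral_mono)
      fix g :: "nat \<Rightarrow> real"
      have e: "s * (\<Sum>k\<in>J. (\<Sum>j\<in>J. b k j * g j)\<^sup>2) = (\<Sum>k\<in>J. (\<beta> k / F) * y k g)"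
        unfolding sum_distrib_left
      proof (rule sum.cong [OF refl])
        fix k assume "k \<in> J"
        show "s * (\<Sum>j\<in>J. b k j * g j)\<^sup>2 = \<beta> k / F * y k g"
          using F zero [of k] by (cases "\<beta> k = 0") (simp_all add: y_def)
      qed
      have "exp (\<Sum>k\<in>J. (\<beta> k / F) *\<^sub>R y k g) \<le> (\<Sum>k\<in>J. (\<beta> k / F) * exp (y k g))"
      proof (rule convex_on_sum [OF J])
        show "J \<noteq> {}" using F by (auto simp: F_def)
        show "convex_on UNIV (exp :: real \<Rightarrow> real)" by (rule exp_convex)
        show "(\<Sum>k\<in>J. \<beta> k / F) = 1" using F by (simp add: sum_divide_distrib [symmetric] F_def [symmetric])
        show "\<And>k. k \<in> J \<Longrightarrow> 0 \<le> \<beta> k / F" using \<beta> F by simp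
      qed auto
      then show "ennreal (exp (s * (\<Sum>k\<in>J. (\<Sum>j\<in>J. b k j * g j)\<^sup>2)))
          \<le> (\<Sum>k\<in>J. ennreal (\<beta> k / F) * ennreal (exp (y k g)))"
        using \<beta> F unfolding e by (simp add: ennreal_mult [symmetric] sum_ennreal ennreal_leI)
    qed
    also have "\<dots> = (\<Sum>k\<in>J. ennreal (\<beta> k / F) * (\<integral>\<^sup>+g. ennreal (exp (y k g)) \<partial>gauss J))"
      unfolding y_def by (simp add: nn_integral_sum nn_integral_cmult)
    also have "\<dots> \<le> (\<Sum>k\<in>J. ennreal (\<beta> k / F) * ennreal (exp (2 * s * F)))"
    proof (intro sum_mono mult_left_mono)
      fix k assume "k \<in> J"
      show "(\<integral>\<^sup>+g. ennreal (exp (y k g)) \<partial>gauss J) \<le> ennreal (exp (2 * s * F))"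
      proof (cases "\<beta> k = 0")
        case True
        then show ?thesis using s F by (simp add: y_def G.emeasure_space_1)
      next
        case False
        then have b: "\<beta> k > 0" using \<beta> [of k] by simp
        have "(\<integral>\<^sup>+g. ennreal (exp (s * F / \<beta> k * (\<Sum>j\<in>J. b k j * g j)\<^sup>2)) \<partial>gauss J)
            \<le> ennreal (exp (2 * (s * F / \<beta> k) * (\<Sum>j\<in>J. (b k j)\<^sup>2)))"
          by (rule gauss_linear_square_mgf [OF J])
             (use b F s in \<open>auto simp: \<beta>_def [symmetric] F_def [symmetric]\<close>)
        then show ?thesis using b by (simp add: y_def \<beta>_def [symmetric] mult.assoc)
      qed
    qed simp
    also have "\<dots> = (\<Sum>k\<in>J. ennreal (\<beta> k / F)) * ennreal (exp (2 * s * F))"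
      by (simp add: sum_distrib_right)
    also have "(\<Sum>k\<in>J. ennreal (\<beta> k / F)) = ennreal (\<Sum>k\<in>J. \<beta> k / F)"
      using \<beta> F by (intro sum_ennreal) simp
    also have "(\<Sum>k\<in>J. \<beta> k / F) = 1" using F by (simp add: sum_divide_distrib [symmetric] F_def [symmetric])
    finally show ?thesis by (simp add: F_def \<beta>_def)
  qed
qed

text \<open>The squares cancel in the difference, and what remains is bilinear.\<close>

lemma quad_form_polarize:
  assumes "\<And>i j. i \<in> J \<Longrightarrow> j \<in> J \<Longrightarrow> B i j = B j i" "finite J"
  shows "quad_form J B (\<lambda>i. (g i + h i) / sqrt 2) - quad_form J B (\<lambda>i. (g i - h i) / sqrt 2)
       = 2 * (\<Sum>i\<in>J. (\<Sum>j\<in>J. B i j * h j) * g i)"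
proof -
  have "quad_form J B (\<lambda>i. (g i + h i) / sqrt 2) - quad_form J B (\<lambda>i. (g i - h i) / sqrt 2)
      = (\<Sum>i\<in>J. \<Sum>j\<in>J. B i j * g i * h j + B i j * h i * g j)"
    unfolding quad_form_def sum_subtractf [symmetric] by (intro sum.cong refl) (simp add: field_simps)
  also have "\<dots> = (\<Sum>i\<in>J. \<Sum>j\<in>J. B i j * g i * h j) + (\<Sum>i\<in>J. \<Sum>j\<in>J. B i j * h i * g j)"
    by (simp add: sum.distrib)
  also have "(\<Sum>i\<in>J. \<Sum>j\<in>J. B i j * h i * g j) = (\<Sum>j\<in>J. \<Sum>i\<in>J. B i j * h i * g j)"
    by (rule sum.swap)
  also have "\<dots> = (\<Sum>i\<in>J. \<Sum>j\<in>J. B i j * g i * h j)"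
    using assms(1) by (intro sum.cong refl) (simp add: mult_ac)
  finally show ?thesis by (simp add: sum_distrib_left sum_distrib_right mult_ac)
qed

text \<open>Decoupling. Multiplying by \<open>E exp (- t * (Q h - tr B)) \<ge> 1\<close> for an independent copy \<open>h\<close> gives an upper bound in which
  \<open>tr B\<close> has disappeared. The pair \<open>(g, h)\<close> may be replaced by its rotation by 45 degrees, for which the
  difference of the two forms is \<open>2 * (\<Sum>i. (B h) i * g i)\<close>. Integrating over \<open>g\<close> leaves \<open>exp (2 t\<^sup>2 \<bar>B h\<bar>\<^sup>2)\<close>, a sum of squares.\<close>

theorem gauss_chaos_mgf:
  assumes J: "finite J" and sym: "\<And>i j. i \<in> J \<Longrightarrow> j \<in> J \<Longrightarrow> B i j = B j i"
    and t: "8 * t\<^sup>2 * (\<Sum>i\<in>J. \<Sum>j\<in>J. (B i j)\<^sup>2) \<le> 1"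
  shows "(\<integral>\<^sup>+g. ennreal (exp (t * (quad_form J B g - (\<Sum>i\<in>J. B i i)))) \<partial>gauss J)
          \<le> ennreal (exp (4 * t\<^sup>2 * (\<Sum>i\<in>J. \<Sum>j\<in>J. (B i j)\<^sup>2)))"
proof -
  let ?tr = "\<Sum>i\<in>J. B i i"
  let ?Q = "quad_form J B"
  interpret G: prob_space "gauss J" by (rule prob_space_gauss)
  interpret GG: pair_sigma_finite "gauss J" "gauss J" ..
  have one: "1 \<le> (\<integral>\<^sup>+h. ennreal (exp (- t * (?Q h - ?tr))) \<partial>gauss J)"
  proof -
    have i: "integrable (gauss J) (\<lambda>h. - t * (?Q h - ?tr))"
      using gauss_quad_form_mean(1) [OF J, of B] by simp
    have "(\<integral>h. ?Q h - ?tr \<partial>gauss J) = (\<integral>h. ?Q h \<partial>gauss J) - (\<integral>h. ?tr \<partial>gauss J)"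
      by (rule Bochner_Integration.integral_diff [OF gauss_quad_form_mean(1) [OF J]]) simp
    then have E0: "(\<integral>h. - t * (?Q h - ?tr) \<partial>gauss J) = 0"
      using gauss_quad_form_mean(2) [OF J, of B] by (simp add: G.prob_space)
    show ?thesis using exp_mean_le_nn_integral_exp [OF G.prob_space_axioms i] unfolding E0 by simp
  qed
  have "(\<integral>\<^sup>+g. ennreal (exp (t * (?Q g - ?tr))) \<partial>gauss J)
      \<le> (\<integral>\<^sup>+g. ennreal (exp (t * (?Q g - ?tr))) * (\<integral>\<^sup>+h. ennreal (exp (- t * (?Q h - ?tr))) \<partial>gauss J) \<partial>gauss J)"
    using mult_left_mono [OF one] by (intro nn_integral_mono) simp
  also have "\<dots> = (\<integral>\<^sup>+g. \<integral>\<^sup>+h. ennreal (exp (t * (?Q g - ?Q h))) \<partial>gauss J \<partial>gauss J)"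
    by (intro nn_integral_cong, subst nn_integral_cmult [symmetric], measurable)
       (simp add: ennreal_mult [symmetric] exp_add [symmetric] algebra_simps)
  also have "\<dots> = (\<integral>\<^sup>+g. \<integral>\<^sup>+h. (\<lambda>z. ennreal (exp (t * (quad_form J B (\<lambda>i. fst (z i)) - quad_form J B (\<lambda>i. snd (z i))))))
        (\<lambda>i\<in>J. (g i, h i)) \<partial>gauss J \<partial>gauss J)"
    by (simp add: quad_form_def)
  also have "\<dots> = (\<integral>\<^sup>+g. \<integral>\<^sup>+h. (\<lambda>z. ennreal (exp (t * (quad_form J B (\<lambda>i. fst (z i)) - quad_form J B (\<lambda>i. snd (z i))))))
        (\<lambda>i\<in>J. ((g i + h i) / sqrt 2, (g i - h i) / sqrt 2)) \<partial>gauss J \<partial>gauss J)"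
    by (rule gauss_pair_rotate [OF J]) (simp only: quad_form_def, measurable)
  also have "\<dots> = (\<integral>\<^sup>+g. \<integral>\<^sup>+h. ennreal (exp (t * (quad_form J B (\<lambda>i. (g i + h i) / sqrt 2)
        - quad_form J B (\<lambda>i. (g i - h i) / sqrt 2)))) \<partial>gauss J \<partial>gauss J)"
    by (simp add: quad_form_def)
  also have "\<dots> = (\<integral>\<^sup>+g. \<integral>\<^sup>+h. ennreal (exp (\<Sum>i\<in>J. (2 * t * (\<Sum>j\<in>J. B i j * h j)) * g i)) \<partial>gauss J \<partial>gauss J)"
  proof (intro nn_integral_cong arg_cong [where f = ennreal] arg_cong [where f = exp])
    fix g h :: "nat \<Rightarrow> real"
    have "quad_form J B (\<lambda>i. (g i + h i) / sqrt 2) - quad_form J B (\<lambda>i. (g i - h i) / sqrt 2)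
       = 2 * (\<Sum>i\<in>J. (\<Sum>j\<in>J. B i j * h j) * g i)"
      by (rule quad_form_polarize [OF sym J])
    then show "t * (quad_form J B (\<lambda>i. (g i + h i) / sqrt 2) - quad_form J B (\<lambda>i. (g i - h i) / sqrt 2))
        = (\<Sum>i\<in>J. (2 * t * (\<Sum>j\<in>J. B i j * h j)) * g i)"
      by (simp only:) (simp add: sum_distrib_left mult_ac)
  qed
  also have "\<dots> = (\<integral>\<^sup>+h. \<integral>\<^sup>+g. ennreal (exp (\<Sum>i\<in>J. (2 * t * (\<Sum>j\<in>J. B i j * h j)) * g i)) \<partial>gauss J \<partial>gauss J)"
    by (rule GG.Fubini' [symmetric]) measurable
  also have "\<dots> = (\<integral>\<^sup>+h. ennreal (exp (2 * t\<^sup>2 * (\<Sum>i\<in>J. (\<Sum>j\<in>J. B i j * h j)\<^sup>2))) \<partial>gauss J)"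
    by (subst gauss_exp_linear [OF J])
       (simp only: power_mult_distrib sum_distrib_left [symmetric], simp add: mult.assoc)
  also have "\<dots> \<le> ennreal (exp (2 * (2 * t\<^sup>2) * (\<Sum>i\<in>J. \<Sum>j\<in>J. (B i j)\<^sup>2)))"
    by (rule gauss_sum_squares_mgf [OF J]) (use t in auto)
  finally show ?thesis by simp
qed

section \<open>Quadratic forms on the sphere\<close>

text \<open>A change of variables in one coordinate acts on the product measure coordinatewise. It is used twice: for a
  translation and for a dilation of the Gaussian vector.\<close>

lemma gauss_change_of_coordinates:
  assumes J: "finite J"
    and w[measurable]: "\<And>i. w i \<in> borel_measurable borel"
    and T[measurable]: "\<And>i. T i \<in> borel_measurable borel"
    and wT: "\<And>i. density std_gauss (w i) = distr std_gauss borel (T i)"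
    and F: "F \<in> borel_measurable (PiM J (\<lambda>_. borel))"
  shows "(\<integral>\<^sup>+p. (\<Prod>i\<in>J. w i (p i)) * F p \<partial>gauss J) = (\<integral>\<^sup>+g. F (\<lambda>i\<in>J. T i (g i)) \<partial>gauss J)"
proof -
  define D where "D i = density std_gauss (w i)" for i
  have Ps: "prob_space (D i)" for i
    unfolding D_def wT
    by (rule prob_space.prob_space_distr [OF prob_space_std_gauss])
       (unfold measurable_cong_sets [OF sets_std_gauss refl], rule T)
  have sD: "sets (D i) = sets borel" for i by (simp add: D_def)
  interpret D: product_prob_space D by (intro product_prob_spaceI Ps)
  interpret P: product_prob_space "\<lambda>_::nat. std_gauss" by (rule product_prob_std_gauss)
  have sPD: "sets (PiM J D) = sets (gauss J)"
    unfolding gauss_def by (intro sets_PiM_cong) (simp_all add: sD)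
  have Wm[measurable]: "(\<lambda>p. \<Prod>i\<in>J. w i (p i)) \<in> borel_measurable (gauss J)" by measurable
  have Tm[measurable]: "(\<lambda>g. \<lambda>i\<in>J. T i (g i)) \<in> gauss J \<rightarrow>\<^sub>M gauss J"
    unfolding gauss_def by measurable
  have Fm[measurable]: "F \<in> borel_measurable (gauss J)"
    using F by (simp add: measurable_cong_sets [OF sets_gauss refl])
  have 1: "density (gauss J) (\<lambda>p. \<Prod>i\<in>J. w i (p i)) = PiM J D"
  proof (rule D.PiM_eqI [OF J])
    show "sets (density (gauss J) (\<lambda>p. \<Prod>i\<in>J. w i (p i))) = sets (PiM J D)" by (simp add: sPD)
    fix A assume A: "\<And>i. i \<in> J \<Longrightarrow> A i \<in> sets (D i)"
    then have A': "\<And>i. i \<in> J \<Longrightarrow> A i \<in> sets borel" by (simp add: sD)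
    have [measurable]: "PiE J A \<in> sets (gauss J)"
      unfolding gauss_def using J A' by (intro sets_PiM_I_finite) auto
    have "emeasure (density (gauss J) (\<lambda>p. \<Prod>i\<in>J. w i (p i))) (PiE J A)
        = (\<integral>\<^sup>+p. (\<Prod>i\<in>J. w i (p i)) * indicator (PiE J A) p \<partial>gauss J)"
      by (subst emeasure_density) auto
    also have "\<dots> = (\<integral>\<^sup>+p. (\<Prod>i\<in>J. w i (p i) * indicator (A i) (p i)) \<partial>gauss J)"
    proof (rule nn_integral_cong)
      fix p assume "p \<in> space (gauss J)"
      then have "indicator (PiE J A) p = (\<Prod>i\<in>J. indicator (A i) (p i) :: ennreal)"
        using J by (auto simp: indicator_def PiE_iff space_gauss prod_zero_iff)
      then show "(\<Prod>i\<in>J. w i (p i)) * indicator (PiE J A) p = (\<Prod>i\<in>J. w i (p i) * indicator (A i) (p i))"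
        by (simp add: prod.distrib)
    qed
    also have "\<dots> = (\<Prod>i\<in>J. \<integral>\<^sup>+x. w i x * indicator (A i) x \<partial>std_gauss)"
      unfolding gauss_def
    proof (rule P.product_nn_integral_prod [OF J])
      fix i assume i: "i \<in> J"
      note A' [OF i, measurable]
      show "(\<lambda>x. w i x * indicator (A i) x) \<in> borel_measurable std_gauss" by measurable
    qed
    also have "\<dots> = (\<Prod>i\<in>J. emeasure (D i) (A i))"
      using A' unfolding D_def by (intro prod.cong refl emeasure_density [symmetric]) auto
    finally show "emeasure (density (gauss J) (\<lambda>p. \<Prod>i\<in>J. w i (p i))) (PiE J A) = (\<Prod>i\<in>J. emeasure (D i) (A i))" .
  qed
  have 2: "distr (gauss J) (gauss J) (\<lambda>g. \<lambda>i\<in>J. T i (g i)) = PiM J D"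
  proof (rule D.PiM_eqI [OF J])
    show "sets (distr (gauss J) (gauss J) (\<lambda>g. \<lambda>i\<in>J. T i (g i))) = sets (PiM J D)" by (simp add: sPD)
    fix A assume A: "\<And>i. i \<in> J \<Longrightarrow> A i \<in> sets (D i)"
    then have A': "\<And>i. i \<in> J \<Longrightarrow> A i \<in> sets borel" by (simp add: sD)
    have A2: "T i -` A i \<in> sets borel" if "i \<in> J" for i
      using measurable_sets [OF T A' [OF that]] by simp
    have [measurable]: "PiE J A \<in> sets (gauss J)"
      unfolding gauss_def using J A' by (intro sets_PiM_I_finite) auto
    have pre: "(\<lambda>g. \<lambda>i\<in>J. T i (g i)) -` PiE J A \<inter> space (gauss J) = PiE J (\<lambda>i. T i -` A i)"
      by (auto simp: space_gauss PiE_iff)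
    have "emeasure (distr (gauss J) (gauss J) (\<lambda>g. \<lambda>i\<in>J. T i (g i))) (PiE J A)
        = emeasure (gauss J) ((\<lambda>g. \<lambda>i\<in>J. T i (g i)) -` PiE J A \<inter> space (gauss J))"
      by (rule emeasure_distr) measurable
    also have "\<dots> = emeasure (PiM J (\<lambda>_. std_gauss)) (PiE J (\<lambda>i. T i -` A i))"
      by (subst pre) (simp add: gauss_def)
    also have "\<dots> = (\<Prod>i\<in>J. emeasure std_gauss (T i -` A i))"
      using A2 by (intro P.emeasure_PiM J) auto
    also have "\<dots> = (\<Prod>i\<in>J. emeasure (D i) (A i))"
      unfolding D_def wT using A' by (intro prod.cong refl) (simp add: emeasure_distr)
    finally show "emeasure (distr (gauss J) (gauss J) (\<lambda>g. \<lambda>i\<in>J. T i (g i))) (PiE J A) = (\<Prod>i\<in>J. emeasure (D i) (A i))" .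
  qed
  have "(\<integral>\<^sup>+p. (\<Prod>i\<in>J. w i (p i)) * F p \<partial>gauss J) = (\<integral>\<^sup>+p. F p \<partial>density (gauss J) (\<lambda>p. \<Prod>i\<in>J. w i (p i)))"
    by (subst nn_integral_density) auto
  also have "\<dots> = (\<integral>\<^sup>+p. F p \<partial>distr (gauss J) (gauss J) (\<lambda>g. \<lambda>i\<in>J. T i (g i)))"
    unfolding 1 2 ..
  also have "\<dots> = (\<integral>\<^sup>+g. F (\<lambda>i\<in>J. T i (g i)) \<partial>gauss J)"
    by (rule nn_integral_distr) auto
  finally show ?thesis .
qed

lemma distr_std_gauss_affine:
  fixes a r :: real
  assumes r: "r > 0"
  shows "distr std_gauss borel (\<lambda>x. a + r * x) = density lborel (normal_density a r)"
proof -
  interpret S: prob_space std_gauss by (rule prob_space_std_gauss)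
  have d: "distributed std_gauss lborel (\<lambda>x. x) std_normal_density"
    unfolding distributed_def std_gauss_def by (auto simp: distr_id2)
  have "distributed std_gauss lborel (\<lambda>x. a + r * x) (normal_density (a + r * 0) (\<bar>r\<bar> * 1))"
    by (rule S.normal_density_affine [OF d]) (use r in auto)
  then show ?thesis
    using r unfolding distributed_def by (simp add: distr_cong [of _ _ borel lborel])
qed

lemma std_gauss_affine:
  fixes a r :: real
  assumes r: "r > 0"
  shows "density std_gauss (\<lambda>x. ennreal (normal_density a r x / std_normal_density x))
       = distr std_gauss borel (\<lambda>x. a + r * x)"
proof -
  have "density std_gauss (\<lambda>x. ennreal (normal_density a r x / std_normal_density x)) =
      density lborel (\<lambda>x. ennreal (std_normal_density x) * ennreal (normal_density a r x / std_normal_density x))"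
    unfolding std_gauss_def by (rule density_density_eq) auto
  also have "\<dots> = density lborel (normal_density a r)"
    by (intro density_cong) (auto simp: ennreal_mult [symmetric] normal_density_pos less_imp_neq [OF normal_density_pos, symmetric])
  finally show ?thesis using distr_std_gauss_affine [OF r] by simp
qed

text \<open>The Cameron-Martin formula in finite dimension.\<close>

lemma gauss_translate:
  fixes a :: "nat \<Rightarrow> real"
  assumes J: "finite J" and F: "F \<in> borel_measurable (PiM J (\<lambda>_. borel))"
  shows "(\<integral>\<^sup>+h. F (\<lambda>i\<in>J. a i + h i) \<partial>gauss J)
       = (\<integral>\<^sup>+p. ennreal (exp ((\<Sum>i\<in>J. a i * p i) - (\<Sum>i\<in>J. (a i)\<^sup>2) / 2)) * F p \<partial>gauss J)"
proof -
  define w where "w i x = ennreal (normal_density (a i) 1 x / std_normal_density x)" for i x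
  have w: "w i x = ennreal (exp (a i * x - (a i)\<^sup>2 / 2))" for i x
  proof -
    have e: "- (x - a i)\<^sup>2 / 2 = - x\<^sup>2 / 2 + (a i * x - (a i)\<^sup>2 / 2)"
      by (simp add: power2_eq_square field_simps)
    have "normal_density (a i) 1 x = std_normal_density x * exp (a i * x - (a i)\<^sup>2 / 2)"
      unfolding normal_density_def using e by (simp add: exp_add [symmetric])
    moreover have "std_normal_density x \<noteq> 0" using normal_density_pos [of 1 0 x] by simp
    ultimately show ?thesis by (simp add: w_def)
  qed
  have "(\<integral>\<^sup>+h. F (\<lambda>i\<in>J. a i + 1 * h i) \<partial>gauss J) = (\<integral>\<^sup>+p. (\<Prod>i\<in>J. w i (p i)) * F p \<partial>gauss J)"
  proof (rule gauss_change_of_coordinates [OF J _ _ _ F, symmetric])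
    show "w i \<in> borel_measurable borel" for i unfolding w_def [abs_def] by measurable
    show "(\<lambda>x. a i + 1 * x) \<in> borel_measurable borel" for i by measurable
    show "density std_gauss (w i) = distr std_gauss borel (\<lambda>x. a i + 1 * x)" for i
      unfolding w_def [abs_def] by (rule std_gauss_affine) simp
  qed
  also have "\<dots> = (\<integral>\<^sup>+p. ennreal (exp ((\<Sum>i\<in>J. a i * p i) - (\<Sum>i\<in>J. (a i)\<^sup>2) / 2)) * F p \<partial>gauss J)"
    by (simp add: w prod_ennreal exp_sum [OF J, symmetric] sum_subtractf sum_divide_distrib)
  finally show ?thesis by simp
qed

text \<open>The factor is the density of \<open>sqrt 2 * g\<close> relative to the law of \<open>g\<close>.\<close>

lemma gauss_scale_sqrt2:
  assumes J: "finite J" and F: "F \<in> borel_measurable (PiM J (\<lambda>_. borel))"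
  shows "(\<integral>\<^sup>+g. F (\<lambda>i\<in>J. sqrt 2 * g i) \<partial>gauss J)
       = (\<integral>\<^sup>+p. ennreal ((1 / sqrt 2) ^ card J * exp ((\<Sum>i\<in>J. (p i)\<^sup>2) / 4)) * F p \<partial>gauss J)"
proof -
  define w where "w x = ennreal (normal_density 0 (sqrt 2) x / std_normal_density x)" for x
  have w: "w x = ennreal (1 / sqrt 2 * exp (x\<^sup>2 / 4))" for x
  proof -
    have e: "- x\<^sup>2 / 4 = - x\<^sup>2 / 2 + x\<^sup>2 / 4" by simp
    have "exp (- x\<^sup>2 / 4) = exp (- x\<^sup>2 / 2) * exp (x\<^sup>2 / 4)" unfolding e exp_add ..
    then have "normal_density 0 (sqrt 2) x = std_normal_density x * (1 / sqrt 2 * exp (x\<^sup>2 / 4))"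
      unfolding normal_density_def by (simp add: real_sqrt_mult)
    moreover have "std_normal_density x \<noteq> 0" using normal_density_pos [of 1 0 x] by simp
    ultimately show ?thesis by (simp add: w_def)
  qed
  have "(\<integral>\<^sup>+h. F (\<lambda>i\<in>J. 0 + sqrt 2 * h i) \<partial>gauss J) = (\<integral>\<^sup>+p. (\<Prod>i\<in>J. w (p i)) * F p \<partial>gauss J)"
  proof (rule gauss_change_of_coordinates [OF J _ _ _ F, symmetric])
    show "w \<in> borel_measurable borel" unfolding w_def [abs_def] by measurable
    show "(\<lambda>x. 0 + sqrt 2 * x) \<in> borel_measurable borel" by measurable
    show "density std_gauss w = distr std_gauss borel (\<lambda>x. 0 + sqrt 2 * x)"
      unfolding w_def [abs_def] by (rule std_gauss_affine) simp
  qed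
  also have "(\<lambda>p. (\<Prod>i\<in>J. w (p i))) = (\<lambda>p. ennreal ((1 / sqrt 2) ^ card J * exp ((\<Sum>i\<in>J. (p i)\<^sup>2) / 4)))"
    unfolding w by (simp only: prod_ennreal prod.distrib prod_constant exp_sum [OF J, symmetric]
      sum_divide_distrib mult_nonneg_nonneg exp_ge_zero real_sqrt_ge_zero zero_le_divide_1_iff zero_le_numeral)
  finally show ?thesis by (simp only: add_0)
qed

text \<open>Let \<open>g\<close>, \<open>h\<close> be independent Gaussian vectors, \<open>n = card J\<close> and \<open>r = \<bar>g\<bar>\<close>. The conditional mean of
  \<open>Q (r u + h)\<close> given \<open>u\<close> is \<open>n * Q u + tr B\<close>, so by Jensen's inequality, applied first to \<open>h\<close> and then to \<open>g\<close>, it is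
  enough to bound \<open>E exp (t * Q (r u + h))\<close>. By Cameron and Martin this is the integral of \<open>exp (t * Q p)\<close>
  against \<open>exp (\<bar>g\<bar> u \<cdot> p - \<bar>g\<bar>\<^sup>2 / 2)\<close>. Once averaged over \<open>u\<close>, the kernel \<open>exp (\<bar>g\<bar> u \<cdot> p)\<close> depends on \<open>\<bar>g\<bar> \<bar>p\<bar>\<close> only, so
  \<open>g\<close> and \<open>p\<close> may exchange their roles in it; then the integral over \<open>g\<close> is Gaussian and produces exactly the density
  of \<open>sqrt 2\<close> times a Gaussian vector. Rotation invariance is assumed
  through the Laplace transform (\<open>kernel\<close>), a form that the real sphere and the complex sphere, seen as a real one, share.\<close>

theorem sphere_chaos_mgf:
  fixes u :: "'a \<Rightarrow> nat \<Rightarrow> real"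
  assumes \<nu>: "prob_space \<nu>" and J: "finite J"
    and u[measurable]: "\<And>i. i \<in> J \<Longrightarrow> (\<lambda>\<omega>. u \<omega> i) \<in> borel_measurable \<nu>"
    and unit: "AE \<omega> in \<nu>. (\<Sum>i\<in>J. (u \<omega> i)\<^sup>2) = 1"
    and kernel: "\<And>p q :: nat \<Rightarrow> real. (\<Sum>i\<in>J. (p i)\<^sup>2) = (\<Sum>i\<in>J. (q i)\<^sup>2) \<Longrightarrow>
        (\<integral>\<^sup>+\<omega>. ennreal (exp (\<Sum>i\<in>J. p i * u \<omega> i)) \<partial>\<nu>) = (\<integral>\<^sup>+\<omega>. ennreal (exp (\<Sum>i\<in>J. q i * u \<omega> i)) \<partial>\<nu>)"
    and sym: "\<And>i j. i \<in> J \<Longrightarrow> j \<in> J \<Longrightarrow> B i j = B j i"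
    and t: "32 * t\<^sup>2 * (\<Sum>i\<in>J. \<Sum>j\<in>J. (B i j)\<^sup>2) \<le> 1"
  shows "(\<integral>\<^sup>+\<omega>. ennreal (exp (t * (real (card J) * quad_form J B (u \<omega>) - (\<Sum>i\<in>J. B i i)))) \<partial>\<nu>)
          \<le> ennreal (exp (16 * t\<^sup>2 * (\<Sum>i\<in>J. \<Sum>j\<in>J. (B i j)\<^sup>2)))"
proof -
  let ?tr = "\<Sum>i\<in>J. B i i"
  let ?Q = "quad_form J B"
  let ?n = "real (card J)"
  define r where "r g = sqrt (\<Sum>i\<in>J. (g i)\<^sup>2)" for g :: "nat \<Rightarrow> real"
  have r0: "r g \<ge> 0" and r2: "(r g)\<^sup>2 = (\<Sum>i\<in>J. (g i)\<^sup>2)" for g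
    by (simp_all add: r_def sum_nonneg)
  interpret nu: prob_space \<nu> by fact
  interpret G: prob_space "gauss J" by (rule prob_space_gauss)
  interpret GG: pair_sigma_finite "gauss J" "gauss J" ..
  interpret GN: pair_sigma_finite "gauss J" \<nu> ..
  have rm[measurable]: "r \<in> borel_measurable (gauss J)" unfolding r_def [abs_def] by measurable
  define K where "K p g \<omega> = ennreal (exp (t * ?Q p)) * ennreal (exp (r g * (\<Sum>i\<in>J. u \<omega> i * p i) - (r g)\<^sup>2 / 2))" for p g \<omega>
  have Qm[measurable]: "?Q \<in> borel_measurable (PiM J (\<lambda>_. borel))"
    unfolding quad_form_def [abs_def] by measurable

  \<comment> \<open>Both uses of Jensen's inequality, for a fixed point of the sphere.\<close>
  have fixed_u: "ennreal (exp (t * (?n * ?Q (u \<omega>) + ?tr))) \<le> (\<integral>\<^sup>+g. \<integral>\<^sup>+p. K p g \<omega> \<partial>gauss J \<partial>gauss J)"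
    if un: "(\<Sum>i\<in>J. (u \<omega> i)\<^sup>2) = 1" for \<omega>
  proof -
    have inner: "ennreal (exp (t * ((r g)\<^sup>2 * ?Q (u \<omega>) + ?tr))) \<le> (\<integral>\<^sup>+p. K p g \<omega> \<partial>gauss J)" for g
    proof -
      define a where "a i = r g * u \<omega> i" for i
      define X where "X h = t * ((r g)\<^sup>2 * ?Q (u \<omega>) + (\<Sum>i\<in>J. (\<Sum>j\<in>J. (B i j + B j i) * a j) * h i) + ?Q h)" for h
      have X: "t * ?Q (\<lambda>i\<in>J. a i + h i) = X h" for h
      proof -
        have "?Q (\<lambda>i\<in>J. a i + h i) = (\<Sum>i\<in>J. \<Sum>j\<in>J. B i j * a i * a j + (B i j * h i * a j + B i j * a i * h j) + B i j * h i * h j)"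
          unfolding quad_form_def by (intro sum.cong refl) (simp add: algebra_simps)
        also have "\<dots> = (\<Sum>i\<in>J. \<Sum>j\<in>J. B i j * a i * a j) + ((\<Sum>i\<in>J. \<Sum>j\<in>J. B i j * h i * a j) + (\<Sum>i\<in>J. \<Sum>j\<in>J. B i j * a i * h j)) + ?Q h"
          unfolding quad_form_def by (simp add: sum.distrib)
        also have "(\<Sum>i\<in>J. \<Sum>j\<in>J. B i j * a i * h j) = (\<Sum>i\<in>J. \<Sum>j\<in>J. B j i * a j * h i)"
          by (rule sum.swap)
        also have "(\<Sum>i\<in>J. \<Sum>j\<in>J. B i j * a i * a j) = (r g)\<^sup>2 * ?Q (u \<omega>)"
          unfolding quad_form_def a_def sum_distrib_left by (intro sum.cong refl) (simp add: power2_eq_square)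
        also have "(\<Sum>i\<in>J. \<Sum>j\<in>J. B i j * h i * a j) + (\<Sum>i\<in>J. \<Sum>j\<in>J. B j i * a j * h i)
            = (\<Sum>i\<in>J. (\<Sum>j\<in>J. (B i j + B j i) * a j) * h i)"
          unfolding sum.distrib [symmetric] sum_distrib_right by (intro sum.cong refl) (simp add: algebra_simps)
        finally show ?thesis by (simp only: X_def)
      qed
      have i1: "integrable (gauss J) (\<lambda>h. \<Sum>i\<in>J. (\<Sum>j\<in>J. (B i j + B j i) * a j) * h i)"
        by (intro Bochner_Integration.integrable_sum integrable_mult_right gauss_first_moment(1) J) auto
      have v1: "(\<integral>h. (\<Sum>i\<in>J. (\<Sum>j\<in>J. (B i j + B j i) * a j) * h i) \<partial>gauss J) = 0"
        by (subst Bochner_Integration.integral_sum)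
           (auto intro!: sum.neutral integrable_mult_right gauss_first_moment J simp: gauss_first_moment(2) [OF J])
      have iX: "integrable (gauss J) X"
        unfolding X_def using i1 gauss_quad_form_mean(1) [OF J, of B]
        by (intro integrable_mult_right Bochner_Integration.integrable_add) auto
      have "(\<integral>h. X h \<partial>gauss J) = t * ((r g)\<^sup>2 * ?Q (u \<omega>) + ?tr)"
        unfolding X_def using i1 v1 gauss_quad_form_mean [OF J, of B]
        by (simp add: Bochner_Integration.integral_add G.prob_space)
      then have "ennreal (exp (t * ((r g)\<^sup>2 * ?Q (u \<omega>) + ?tr))) \<le> (\<integral>\<^sup>+h. ennreal (exp (X h)) \<partial>gauss J)"
        using exp_mean_le_nn_integral_exp [OF G.prob_space_axioms iX] by simp
      also have "\<dots> = (\<integral>\<^sup>+h. ennreal (exp (t * ?Q (\<lambda>i\<in>J. a i + h i))) \<partial>gauss J)"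
        unfolding X ..
      also have "\<dots> = (\<integral>\<^sup>+p. ennreal (exp ((\<Sum>i\<in>J. a i * p i) - (\<Sum>i\<in>J. (a i)\<^sup>2) / 2)) * ennreal (exp (t * ?Q p)) \<partial>gauss J)"
        by (rule gauss_translate [OF J]) measurable
      also have "\<dots> = (\<integral>\<^sup>+p. K p g \<omega> \<partial>gauss J)"
      proof -
        have "(\<Sum>i\<in>J. (a i)\<^sup>2) = (r g)\<^sup>2"
          using un by (simp add: a_def power_mult_distrib sum_distrib_left [symmetric])
        moreover have "(\<Sum>i\<in>J. a i * p i) = r g * (\<Sum>i\<in>J. u \<omega> i * p i)" for p
          by (simp add: a_def sum_distrib_left mult.assoc)
        ultimately show ?thesis by (simp add: K_def mult.commute)
      qed
      finally show ?thesis .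
    qed
    define Y where "Y g = t * ((\<Sum>i\<in>J. g i * g i) * ?Q (u \<omega>) + ?tr)" for g
    have Yr: "t * ((r g)\<^sup>2 * ?Q (u \<omega>) + ?tr) = Y g" for g
      unfolding Y_def r2 by (simp only: power2_eq_square)
    have isq: "integrable (gauss J) (\<lambda>g. \<Sum>i\<in>J. g i * g i)"
      by (intro Bochner_Integration.integrable_sum gauss_second_moment(1) J)
    have vs: "(\<integral>g. (\<Sum>i\<in>J. g i * g i) \<partial>gauss J) = ?n"
      by (subst Bochner_Integration.integral_sum)
         (auto intro!: gauss_second_moment(1) J simp: gauss_second_moment(2) [OF J])
    have iY: "integrable (gauss J) Y"
      unfolding Y_def using isq by (intro integrable_mult_right integrable_mult_left Bochner_Integration.integrable_add) auto
    have "(\<integral>g. Y g \<partial>gauss J) = t * (?n * ?Q (u \<omega>) + ?tr)"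
      unfolding Y_def using isq vs by (simp add: Bochner_Integration.integral_add G.prob_space)
    then have "ennreal (exp (t * (?n * ?Q (u \<omega>) + ?tr))) \<le> (\<integral>\<^sup>+g. ennreal (exp (Y g)) \<partial>gauss J)"
      using exp_mean_le_nn_integral_exp [OF G.prob_space_axioms iY] by simp
    also have "\<dots> \<le> (\<integral>\<^sup>+g. \<integral>\<^sup>+p. K p g \<omega> \<partial>gauss J \<partial>gauss J)"
      using inner by (intro nn_integral_mono) (simp add: Yr)
    finally show ?thesis .
  qed

  \<comment> \<open>The exchange of \<open>g\<close> and \<open>p\<close> in the averaged kernel.\<close>
  have swap_kernel: "(\<integral>\<^sup>+\<omega>. ennreal (exp (r g * (\<Sum>i\<in>J. u \<omega> i * p i))) \<partial>\<nu>)
      = (\<integral>\<^sup>+\<omega>. ennreal (exp (r p * (\<Sum>i\<in>J. u \<omega> i * g i))) \<partial>\<nu>)" for p g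
  proof -
    have "(\<Sum>i\<in>J. (r g * p i)\<^sup>2) = (\<Sum>i\<in>J. (r p * g i)\<^sup>2)"
      by (simp add: power_mult_distrib sum_distrib_left [symmetric] r2)
    from kernel [OF this] show ?thesis
      by (simp add: sum_distrib_left mult_ac)
  qed
  have K3: "(\<lambda>x. K (fst x) (fst (snd x)) (snd (snd x))) \<in> borel_measurable (gauss J \<Otimes>\<^sub>M (gauss J \<Otimes>\<^sub>M \<nu>))"
    unfolding K_def by measurable
  have Km [measurable (raw)]: "(\<lambda>x. K (f x) (g x) (h x)) \<in> borel_measurable M"
    if "f \<in> M \<rightarrow>\<^sub>M gauss J" "g \<in> M \<rightarrow>\<^sub>M gauss J" "h \<in> M \<rightarrow>\<^sub>M \<nu>" for f g h and M :: "'b measure"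
    using measurable_compose [OF measurable_Pair [OF that(1) measurable_Pair [OF that(2,3)]] K3] by simp
  \<comment> \<open>Fubini puts the integral over \<open>g\<close> innermost, where it is Gaussian.\<close>
  have sum_K: "(\<integral>\<^sup>+g. \<integral>\<^sup>+\<omega>. K p g \<omega> \<partial>\<nu> \<partial>gauss J)
      = ennreal ((1 / sqrt 2) ^ card J * exp ((\<Sum>i\<in>J. (p i)\<^sup>2) / 4)) * ennreal (exp (t * ?Q p))" for p
  proof -
    have "(\<integral>\<^sup>+g. \<integral>\<^sup>+\<omega>. K p g \<omega> \<partial>\<nu> \<partial>gauss J)
        = (\<integral>\<^sup>+g. ennreal (exp (t * ?Q p)) * (ennreal (exp (- (r g)\<^sup>2 / 2)) *
            (\<integral>\<^sup>+\<omega>. ennreal (exp (r g * (\<Sum>i\<in>J. u \<omega> i * p i))) \<partial>\<nu>)) \<partial>gauss J)"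
      unfolding K_def
      by (intro nn_integral_cong)
         (simp add: nn_integral_cmult [symmetric] ennreal_mult [symmetric] exp_add [symmetric] algebra_simps)
    also have "\<dots> = (\<integral>\<^sup>+g. ennreal (exp (t * ?Q p)) *
            (\<integral>\<^sup>+\<omega>. ennreal (exp (\<Sum>i\<in>J. (r p * u \<omega> i) * g i + (-1/2) * (g i)\<^sup>2)) \<partial>\<nu>) \<partial>gauss J)"
    proof (intro nn_integral_cong arg_cong2 [where f = "(*)"] refl)
      fix g :: "nat \<Rightarrow> real"
      show "ennreal (exp (- (r g)\<^sup>2 / 2)) * (\<integral>\<^sup>+\<omega>. ennreal (exp (r g * (\<Sum>i\<in>J. u \<omega> i * p i))) \<partial>\<nu>)
          = (\<integral>\<^sup>+\<omega>. ennreal (exp (\<Sum>i\<in>J. (r p * u \<omega> i) * g i + (-1/2) * (g i)\<^sup>2)) \<partial>\<nu>)"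
        by (subst swap_kernel, unfold r2)
           (simp add: nn_integral_cmult [symmetric] ennreal_mult [symmetric] exp_add [symmetric] sum.distrib
             sum_distrib_left sum_divide_distrib sum_negf sum_subtractf mult_ac)
    qed
    also have "\<dots> = ennreal (exp (t * ?Q p)) *
        (\<integral>\<^sup>+g. \<integral>\<^sup>+\<omega>. ennreal (exp (\<Sum>i\<in>J. (r p * u \<omega> i) * g i + (-1/2) * (g i)\<^sup>2)) \<partial>\<nu> \<partial>gauss J)"
      by (rule nn_integral_cmult) measurable
    also have "(\<integral>\<^sup>+g. \<integral>\<^sup>+\<omega>. ennreal (exp (\<Sum>i\<in>J. (r p * u \<omega> i) * g i + (-1/2) * (g i)\<^sup>2)) \<partial>\<nu> \<partial>gauss J)
        = (\<integral>\<^sup>+\<omega>. \<integral>\<^sup>+g. ennreal (exp (\<Sum>i\<in>J. (r p * u \<omega> i) * g i + (-1/2) * (g i)\<^sup>2)) \<partial>gauss J \<partial>\<nu>)"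
      by (rule GN.Fubini' [symmetric]) measurable
    also have "\<dots> = (\<integral>\<^sup>+\<omega>. ennreal ((1 / sqrt 2) ^ card J * exp ((\<Sum>i\<in>J. (p i)\<^sup>2) / 4)) \<partial>\<nu>)"
    proof (rule nn_integral_cong_AE, use unit in eventually_elim)
      fix \<omega> assume un: "(\<Sum>i\<in>J. (u \<omega> i)\<^sup>2) = 1"
      have "(\<integral>\<^sup>+g. ennreal (exp (\<Sum>i\<in>J. (r p * u \<omega> i) * g i + (-1/2) * (g i)\<^sup>2)) \<partial>gauss J)
          = ennreal (\<Prod>i\<in>J. 1 / sqrt 2 * exp ((r p * u \<omega> i)\<^sup>2 / 4))"
        using gauss_exp_quad [OF J, of "\<lambda>_. -1/2" "\<lambda>i. r p * u \<omega> i"] by simp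
      also have "(\<Prod>i\<in>J. 1 / sqrt 2 * exp ((r p * u \<omega> i)\<^sup>2 / 4))
          = (1 / sqrt 2) ^ card J * exp (\<Sum>i\<in>J. (r p * u \<omega> i)\<^sup>2 / 4)"
        by (simp only: prod.distrib prod_constant exp_sum [OF J])
      also have "(\<Sum>i\<in>J. (r p * u \<omega> i)\<^sup>2 / 4) = (\<Sum>i\<in>J. (p i)\<^sup>2) / 4"
        using un by (simp add: power_mult_distrib sum_divide_distrib [symmetric] sum_distrib_left [symmetric] r2)
      finally show "(\<integral>\<^sup>+g. ennreal (exp (\<Sum>i\<in>J. (r p * u \<omega> i) * g i + (-1/2) * (g i)\<^sup>2)) \<partial>gauss J)
          = ennreal ((1 / sqrt 2) ^ card J * exp ((\<Sum>i\<in>J. (p i)\<^sup>2) / 4))" .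
    qed
    also have "\<dots> = ennreal ((1 / sqrt 2) ^ card J * exp ((\<Sum>i\<in>J. (p i)\<^sup>2) / 4))"
      by (simp add: nu.emeasure_space_1)
    finally show ?thesis by (simp only: mult.commute)
  qed
  have "(\<integral>\<^sup>+\<omega>. ennreal (exp (t * (?n * ?Q (u \<omega>) + ?tr))) \<partial>\<nu>)
      \<le> (\<integral>\<^sup>+\<omega>. \<integral>\<^sup>+g. \<integral>\<^sup>+p. K p g \<omega> \<partial>gauss J \<partial>gauss J \<partial>\<nu>)"
    by (rule nn_integral_mono_AE, use unit in eventually_elim) (rule fixed_u)
  also have "\<dots> = (\<integral>\<^sup>+g. \<integral>\<^sup>+\<omega>. \<integral>\<^sup>+p. K p g \<omega> \<partial>gauss J \<partial>\<nu> \<partial>gauss J)"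
    by (rule GN.Fubini') measurable
  also have "\<dots> = (\<integral>\<^sup>+g. \<integral>\<^sup>+p. \<integral>\<^sup>+\<omega>. K p g \<omega> \<partial>\<nu> \<partial>gauss J \<partial>gauss J)"
    by (intro nn_integral_cong GN.Fubini') measurable
  also have "\<dots> = (\<integral>\<^sup>+p. \<integral>\<^sup>+g. \<integral>\<^sup>+\<omega>. K p g \<omega> \<partial>\<nu> \<partial>gauss J \<partial>gauss J)"
    by (rule GG.Fubini') measurable
  also have "\<dots> = (\<integral>\<^sup>+g. ennreal (exp (t * ?Q (\<lambda>i\<in>J. sqrt 2 * g i))) \<partial>gauss J)"
    unfolding sum_K by (rule gauss_scale_sqrt2 [OF J, symmetric]) measurable
  also have "\<dots> = (\<integral>\<^sup>+g. ennreal (exp (2 * t * ?tr)) * ennreal (exp (2 * t * (?Q g - ?tr))) \<partial>gauss J)"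
  proof (rule nn_integral_cong)
    fix g
    have "?Q (\<lambda>i\<in>J. sqrt 2 * g i) = 2 * ?Q g"
      unfolding quad_form_def sum_distrib_left by (intro sum.cong refl) simp
    then show "ennreal (exp (t * ?Q (\<lambda>i\<in>J. sqrt 2 * g i))) = ennreal (exp (2 * t * ?tr)) * ennreal (exp (2 * t * (?Q g - ?tr)))"
      by (simp add: ennreal_mult [symmetric] exp_add [symmetric] algebra_simps)
  qed
  also have "\<dots> = ennreal (exp (2 * t * ?tr)) * (\<integral>\<^sup>+g. ennreal (exp (2 * t * (?Q g - ?tr))) \<partial>gauss J)"
    by (rule nn_integral_cmult) measurable
  also have "\<dots> \<le> ennreal (exp (2 * t * ?tr)) * ennreal (exp (4 * (2 * t)\<^sup>2 * (\<Sum>i\<in>J. \<Sum>j\<in>J. (B i j)\<^sup>2)))"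
    by (intro mult_left_mono gauss_chaos_mgf J sym) (use t in \<open>auto simp: power_mult_distrib\<close>)
  finally have main: "(\<integral>\<^sup>+\<omega>. ennreal (exp (t * (?n * ?Q (u \<omega>) + ?tr))) \<partial>\<nu>)
      \<le> ennreal (exp (2 * t * ?tr)) * ennreal (exp (16 * t\<^sup>2 * (\<Sum>i\<in>J. \<Sum>j\<in>J. (B i j)\<^sup>2)))"
    by (simp add: power_mult_distrib)
  have Qu[measurable]: "(\<lambda>\<omega>. ?Q (u \<omega>)) \<in> borel_measurable \<nu>"
    unfolding quad_form_def by measurable
  have "(\<integral>\<^sup>+\<omega>. ennreal (exp (t * (?n * ?Q (u \<omega>) - ?tr))) \<partial>\<nu>)
      = (\<integral>\<^sup>+\<omega>. ennreal (exp (- (2 * t * ?tr))) * ennreal (exp (t * (?n * ?Q (u \<omega>) + ?tr))) \<partial>\<nu>)"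
    by (simp add: ennreal_mult [symmetric] exp_add [symmetric] algebra_simps)
  also have "\<dots> = ennreal (exp (- (2 * t * ?tr))) * (\<integral>\<^sup>+\<omega>. ennreal (exp (t * (?n * ?Q (u \<omega>) + ?tr))) \<partial>\<nu>)"
    by (rule nn_integral_cmult) measurable
  also have "\<dots> \<le> ennreal (exp (- (2 * t * ?tr))) *
      (ennreal (exp (2 * t * ?tr)) * ennreal (exp (16 * t\<^sup>2 * (\<Sum>i\<in>J. \<Sum>j\<in>J. (B i j)\<^sup>2))))"
    by (rule mult_left_mono [OF main]) simp
  also have "\<dots> = ennreal (exp (16 * t\<^sup>2 * (\<Sum>i\<in>J. \<Sum>j\<in>J. (B i j)\<^sup>2)))"
    by (simp add: ennreal_mult [symmetric] exp_add [symmetric])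
  finally show ?thesis .
qed

section \<open>Hermitian forms of a random row\<close>

lemma index_mat_adjoint:
  "i < dim_col A \<Longrightarrow> j < dim_row A \<Longrightarrow> mat_adjoint A $$ (i, j) = cnj (A $$ (j, i))"
  unfolding mat_adjoint_def by (simp add: mat_of_rows_index)

lemma dim_mat_adjoint [simp]:
  "dim_row (mat_adjoint A) = dim_col A" "dim_col (mat_adjoint A) = dim_row A"
  unfolding mat_adjoint_def by simp_all

lemma sum_lessThan_add:
  fixes f :: "nat \<Rightarrow> 'a::comm_monoid_add"
  shows "(\<Sum>i<m + n. f i) = (\<Sum>i<m. f i) + (\<Sum>i<n. f (m + i))"
  by (induction n) (simp_all add: add.assoc)

text \<open>The matrix \<open>I - v v\<^sup>* / s\<close> with \<open>v = p - q\<close> and \<open>s = v\<^sup>* p\<close> sends \<open>p\<close> to \<open>q\<close>. It is unitary because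
  \<open>\<bar>p\<bar> = \<bar>q\<bar>\<close> gives \<open>s + cnj s = \<bar>v\<bar>\<^sup>2\<close>, and it is real whenever \<open>p\<close> and \<open>q\<close> are.\<close>

lemma unitary_transitive:
  fixes p q :: "nat \<Rightarrow> complex"
  assumes norm: "(\<Sum>i<M. (cmod (p i))\<^sup>2) = (\<Sum>i<M. (cmod (q i))\<^sup>2)"
    and F: "F = \<real> \<or> F = UNIV" and pF: "\<And>i. i < M \<Longrightarrow> p i \<in> F" and qF: "\<And>i. i < M \<Longrightarrow> q i \<in> F"
  obtains U where "U \<in> carrier_mat M M" "\<And>i j. i < M \<Longrightarrow> j < M \<Longrightarrow> U $$ (i, j) \<in> F"
    "mat_adjoint U * U = 1\<^sub>m M" "\<And>i. i < M \<Longrightarrow> (\<Sum>j<M. U $$ (i, j) * p j) = q i"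
proof (cases "\<forall>i<M. p i = q i")
  case True
  have adj: "mat_adjoint (1\<^sub>m M) = (1\<^sub>m M :: complex mat)"
    by (rule eq_matI) (auto simp: index_mat_adjoint)
  show ?thesis
  proof (rule that [of "1\<^sub>m M"])
    show "(\<Sum>j<M. 1\<^sub>m M $$ (i, j) * p j) = q i" if "i < M" for i
    proof -
      have "(\<Sum>j<M. 1\<^sub>m M $$ (i, j) * p j) = (\<Sum>j<M. if i = j then p j else 0)"
        using that by (intro sum.cong refl) auto
      then show ?thesis using that True by simp
    qed
  qed (use F adj in \<open>auto\<close>)
next
  case False
  define v where "v i = p i - q i" for i
  define s where "s = (\<Sum>j<M. cnj (v j) * p j)"
  define V where "V = (\<Sum>i<M. (cmod (v i))\<^sup>2)"
  have V: "V > 0"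
  proof -
    obtain i where i: "i < M" "v i \<noteq> 0" using False by (auto simp: v_def)
    have "0 < (cmod (v i))\<^sup>2" using i by simp
    also have "\<dots> \<le> V" unfolding V_def using i by (intro member_le_sum) auto
    finally show ?thesis .
  qed
  have cV: "complex_of_real V = (\<Sum>k<M. cnj (v k) * v k)"
    unfolding V_def of_real_sum by (intro sum.cong refl) (simp only: complex_norm_square mult.commute)
  have sV: "s + cnj s = of_real V"
  proof -
    have "s + cnj s - (\<Sum>k<M. cnj (v k) * v k) = (\<Sum>k<M. cnj (v k) * p k + v k * cnj (p k) - cnj (v k) * v k)"
      by (simp add: s_def sum.distrib sum_subtractf)
    also have "\<dots> = (\<Sum>k<M. p k * cnj (p k) - q k * cnj (q k))"
      by (intro sum.cong refl) (simp add: v_def algebra_simps)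
    also have "\<dots> = of_real ((\<Sum>k<M. (cmod (p k))\<^sup>2) - (\<Sum>k<M. (cmod (q k))\<^sup>2))"
      by (simp only: sum_subtractf of_real_diff of_real_sum complex_norm_square)
    finally show ?thesis using norm cV by simp
  qed
  have s0: "s \<noteq> 0" using sV V by auto
  define U where "U = mat M M (\<lambda>(i, j). (if i = j then 1 else 0) - v i * cnj (v j) / s)"
  have Uc: "U \<in> carrier_mat M M" by (simp add: U_def)
  have Uij: "U $$ (i, j) = (if i = j then 1 else 0) - v i * cnj (v j) / s" if "i < M" "j < M" for i j
    using that by (simp add: U_def)
  show ?thesis
  proof (rule that [OF Uc])
    show "U $$ (i, j) \<in> F" if ij: "i < M" "j < M" for i j
    proof (cases "F = UNIV")
      case False
      then have FR: "F = \<real>" using F by simp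
      have vr: "v k \<in> \<real>" "cnj (v k) \<in> \<real>" if "k < M" for k
        using pF [OF that] qF [OF that] unfolding v_def FR by (auto simp: Reals_cnj_iff Reals_diff)
      have "s \<in> \<real>" unfolding s_def using vr pF FR by (intro sum_in_Reals Reals_mult) auto
      then show ?thesis unfolding Uij [OF ij] FR using vr ij
        by (intro Reals_diff Reals_divide Reals_mult) auto
    qed simp
    show "(\<Sum>j<M. U $$ (i, j) * p j) = q i" if i: "i < M" for i
    proof -
      have "(\<Sum>j<M. U $$ (i, j) * p j) = (\<Sum>j<M. (if i = j then p j else 0) - v i / s * (cnj (v j) * p j))"
        using i by (intro sum.cong refl) (simp add: Uij algebra_simps)
      also have "\<dots> = p i - v i / s * s"
        using i by (simp add: sum_subtractf s_def sum_distrib_left)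
      finally show ?thesis using s0 by (simp add: v_def)
    qed
    show "mat_adjoint U * U = 1\<^sub>m M"
    proof (rule eq_matI)
      fix i j assume "i < dim_row (1\<^sub>m M :: complex mat)" "j < dim_col (1\<^sub>m M :: complex mat)"
      then have ij: "i < M" "j < M" by auto
      have "(mat_adjoint U * U) $$ (i, j) = (\<Sum>k<M. mat_adjoint U $$ (i, k) * U $$ (k, j))"
        using ij Uc by (simp add: scalar_prod_def atLeast0LessThan)
      also have "\<dots> = (\<Sum>k<M. cnj ((if k = i then 1 else 0) - v k * cnj (v i) / s) * ((if k = j then 1 else 0) - v k * cnj (v j) / s))"
        using ij Uc by (intro sum.cong refl) (simp add: index_mat_adjoint Uij)
      also have "\<dots> = (\<Sum>k<M. (if k = i then (if i = j then 1 else 0) - v i * cnj (v j) / s else 0)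
            - (if k = j then cnj (v j) * v i / cnj s else 0) + v i * cnj (v j) / (s * cnj s) * (cnj (v k) * v k))"
        by (intro sum.cong refl) (auto simp: algebra_simps)
      also have "\<dots> = ((if i = j then 1 else 0) - v i * cnj (v j) / s) - cnj (v j) * v i / cnj s
          + v i * cnj (v j) / (s * cnj s) * of_real V"
        using ij by (simp add: sum.distrib sum_subtractf sum_distrib_left cV)
      also have "\<dots> = (if i = j then 1 else 0)"
        unfolding sV [symmetric] using s0 by (simp add: field_simps)
      finally show "(mat_adjoint U * U) $$ (i, j) = (1\<^sub>m M :: complex mat) $$ (i, j)" using ij by simp
    qed (use Uc in auto)
  qed
qed

text \<open>The Laplace transform of the uniform law is radial: a matrix of the group that sends \<open>p\<close> to \<open>q\<close> preserves the law.\<close>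

lemma haar_kernel:
  fixes p q :: "nat \<Rightarrow> complex"
  assumes h: "haar_sphere F M \<nu>"
    and norm: "(\<Sum>i<M. (cmod (p i))\<^sup>2) = (\<Sum>i<M. (cmod (q i))\<^sup>2)"
    and F: "F = \<real> \<or> F = UNIV" and pF: "\<And>i. i < M \<Longrightarrow> p i \<in> F" and qF: "\<And>i. i < M \<Longrightarrow> q i \<in> F"
  shows "(\<integral>\<^sup>+u. ennreal (exp (Re (\<Sum>i<M. cnj (p i) * u i))) \<partial>\<nu>) = (\<integral>\<^sup>+u. ennreal (exp (Re (\<Sum>i<M. cnj (q i) * u i))) \<partial>\<nu>)"
proof -
  obtain U where U: "U \<in> carrier_mat M M" "\<And>i j. i < M \<Longrightarrow> j < M \<Longrightarrow> U $$ (i, j) \<in> F"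
    "mat_adjoint U * U = 1\<^sub>m M" "\<And>i. i < M \<Longrightarrow> (\<Sum>j<M. U $$ (i, j) * p j) = q i"
    using unitary_transitive [OF norm F pF qF] by blast
  have sets[measurable_cong]: "sets \<nu> = sets (row_space M)" using h by (simp add: haar_sphere_def)
  define T where "T u = (\<lambda>i\<in>{..<M}. \<Sum>j<M. U $$ (i, j) * u j)" for u :: "nat \<Rightarrow> complex"
  have inv: "distr \<nu> (row_space M) T = \<nu>"
    using h U(1-3) unfolding T_def [abs_def] haar_sphere_def by auto
  have [measurable]: "T \<in> \<nu> \<rightarrow>\<^sub>M row_space M" unfolding T_def by measurable
  have orth: "(\<Sum>i<M. cnj (U $$ (i, k)) * U $$ (i, j)) = (if k = j then 1 else 0)" if "k < M" "j < M" for j k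
  proof -
    have "(\<Sum>i<M. cnj (U $$ (i, k)) * U $$ (i, j)) = (\<Sum>i<M. mat_adjoint U $$ (k, i) * U $$ (i, j))"
      using that U(1) by (intro sum.cong refl) (simp add: index_mat_adjoint)
    also have "\<dots> = (mat_adjoint U * U) $$ (k, j)"
      using that U(1) by (simp add: scalar_prod_def atLeast0LessThan)
    finally show ?thesis using U(3) that by simp
  qed
  have eq: "(\<Sum>i<M. cnj (q i) * T u i) = (\<Sum>i<M. cnj (p i) * u i)" for u
  proof -
    have "(\<Sum>i<M. cnj (q i) * T u i) = (\<Sum>i<M. \<Sum>k<M. \<Sum>j<M. cnj (p k) * u j * (cnj (U $$ (i, k)) * U $$ (i, j)))"
    proof (rule sum.cong [OF refl])
      fix i assume "i \<in> {..<M}"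
      then have "cnj (q i) * T u i = (\<Sum>k<M. cnj (U $$ (i, k)) * cnj (p k)) * (\<Sum>j<M. U $$ (i, j) * u j)"
        by (simp add: T_def U(4) [symmetric])
      also have "\<dots> = (\<Sum>k<M. \<Sum>j<M. cnj (p k) * u j * (cnj (U $$ (i, k)) * U $$ (i, j)))"
        unfolding sum_product by (intro sum.cong refl) (simp only: mult_ac)
      finally show "cnj (q i) * T u i = (\<Sum>k<M. \<Sum>j<M. cnj (p k) * u j * (cnj (U $$ (i, k)) * U $$ (i, j)))" .
    qed
    also have "\<dots> = (\<Sum>k<M. \<Sum>j<M. \<Sum>i<M. cnj (p k) * u j * (cnj (U $$ (i, k)) * U $$ (i, j)))"
      by (subst sum.swap, rule sum.cong [OF refl], rule sum.swap)
    also have "\<dots> = (\<Sum>k<M. \<Sum>j<M. if k = j then cnj (p k) * u j else 0)"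
      by (intro sum.cong refl) (simp add: sum_distrib_left [symmetric] orth)
    finally show ?thesis by simp
  qed
  have "(\<integral>\<^sup>+u. ennreal (exp (Re (\<Sum>i<M. cnj (q i) * u i))) \<partial>\<nu>)
      = (\<integral>\<^sup>+u. ennreal (exp (Re (\<Sum>i<M. cnj (q i) * u i))) \<partial>distr \<nu> (row_space M) T)"
    unfolding inv ..
  also have "\<dots> = (\<integral>\<^sup>+u. ennreal (exp (Re (\<Sum>i<M. cnj (q i) * T u i))) \<partial>\<nu>)"
    by (rule nn_integral_distr) measurable
  finally show ?thesis by (simp only: eq)
qed

definition herm_form :: "nat \<Rightarrow> (nat \<Rightarrow> nat \<Rightarrow> complex) \<Rightarrow> (nat \<Rightarrow> complex) \<Rightarrow> real" where
  "herm_form M A z = Re (\<Sum>a<M. \<Sum>b<M. cnj (z a) * A a b * z b)"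

text \<open>The real symmetric matrix, of size \<open>2 M\<close>, of half the Hermitian form of \<open>A\<close> in the real and imaginary parts of the
  argument. The factor one half matches the variance \<open>1/2\<close> of the two parts of a complex normal coordinate.\<close>

definition realify :: "nat \<Rightarrow> (nat \<Rightarrow> nat \<Rightarrow> complex) \<Rightarrow> nat \<Rightarrow> nat \<Rightarrow> real" where
  "realify M A i j = (if i < M then if j < M then Re (A i j) else - Im (A i (j - M))
     else if j < M then Im (A (i - M) j) else Re (A (i - M) (j - M))) / 2"

lemma quad_form_realify:
  "quad_form {..<M + M} (realify M A) g = herm_form M A (\<lambda>i. Complex (g i) (g (M + i))) / 2"
proof -
  have "quad_form {..<M + M} (realify M A) g = (\<Sum>i<M. \<Sum>j<M.
      (Re (A i j) * g i * g j + - Im (A i j) * g i * g (M + j)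
      + (Im (A i j) * g (M + i) * g j + Re (A i j) * g (M + i) * g (M + j))) / 2)"
    unfolding quad_form_def sum_lessThan_add realify_def sum.distrib [symmetric]
    by (intro sum.cong refl) (simp add: field_simps)
  also have "\<dots> = herm_form M A (\<lambda>i. Complex (g i) (g (M + i))) / 2"
    unfolding herm_form_def Re_sum sum_divide_distrib
    by (intro sum.cong refl arg_cong2 [where f = "(/)"]) (simp add: algebra_simps)
  finally show ?thesis .
qed

lemma realify_facts:
  assumes herm: "\<And>a b. a < M \<Longrightarrow> b < M \<Longrightarrow> A b a = cnj (A a b)"
  shows "i < M + M \<Longrightarrow> j < M + M \<Longrightarrow> realify M A i j = realify M A j i"
    and "(\<Sum>i<M + M. \<Sum>j<M + M. (realify M A i j)\<^sup>2) = (\<Sum>a<M. \<Sum>b<M. (cmod (A a b))\<^sup>2) / 2"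
    and "(\<Sum>i<M + M. realify M A i i) = (\<Sum>a<M. Re (A a a))"
proof -
  show "realify M A i j = realify M A j i" if "i < M + M" "j < M + M"
    using that herm [of i j] herm [of "i - M" j] herm [of i "j - M"] herm [of "i - M" "j - M"]
    by (auto simp: realify_def not_less)
  show "(\<Sum>i<M + M. \<Sum>j<M + M. (realify M A i j)\<^sup>2) = (\<Sum>a<M. \<Sum>b<M. (cmod (A a b))\<^sup>2) / 2"
    unfolding sum_lessThan_add realify_def sum_divide_distrib sum.distrib [symmetric]
    by (intro sum.cong refl) (simp add: cmod_power2 power_divide field_simps)
  show "(\<Sum>i<M + M. realify M A i i) = (\<Sum>a<M. Re (A a a))"
    unfolding sum_lessThan_add realify_def by (simp add: sum.distrib [symmetric])
qed

lemma measurable_cnj [measurable]: "cnj \<in> borel_measurable borel"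
  by (intro borel_measurable_continuous_onI continuous_on_cnj continuous_on_id)

lemma measurable_Complex [measurable (raw)]:
  assumes [measurable]: "f \<in> borel_measurable M" "g \<in> borel_measurable M"
  shows "(\<lambda>x. Complex (f x) (g x)) \<in> borel_measurable M"
  unfolding Complex_eq by measurable

lemma measurable_herm_form [measurable]: "herm_form M A \<in> borel_measurable (row_space M)"
  unfolding herm_form_def [abs_def] by measurable

lemma herm_form_scale:
  "herm_form M A (\<lambda>j\<in>{..<M}. complex_of_real r * u j) = r\<^sup>2 * herm_form M A u"
proof -
  have "(\<Sum>a<M. \<Sum>b<M. cnj ((\<lambda>j\<in>{..<M}. complex_of_real r * u j) a) * A a b * (\<lambda>j\<in>{..<M}. complex_of_real r * u j) b)
      = complex_of_real (r\<^sup>2) * (\<Sum>a<M. \<Sum>b<M. cnj (u a) * A a b * u b)"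
    unfolding sum_distrib_left by (intro sum.cong refl) (simp add: power2_eq_square)
  then show ?thesis unfolding herm_form_def by simp
qed

text \<open>A real argument only sees the real part of \<open>A\<close>, a symmetric matrix whose Frobenius norm is not larger.\<close>

lemma real_normal_chaos_mgf:
  assumes herm: "\<And>a b. a < M \<Longrightarrow> b < M \<Longrightarrow> A b a = cnj (A a b)"
    and t: "8 * t\<^sup>2 * (\<Sum>a<M. \<Sum>b<M. (cmod (A a b))\<^sup>2) \<le> 1"
  shows "(\<integral>\<^sup>+z. ennreal (exp (t * (herm_form M A z - (\<Sum>a<M. Re (A a a))))) \<partial>PiM {..<M} (\<lambda>_. real_std_normal))
          \<le> ennreal (exp (4 * t\<^sup>2 * (\<Sum>a<M. \<Sum>b<M. (cmod (A a b))\<^sup>2)))"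
proof -
  let ?I = "{..<M}"
  define D where "D = distr std_gauss borel complex_of_real"
  have D: "real_std_normal = D" by (simp add: D_def real_std_normal_def std_gauss_def)
  have Dp: "prob_space D" unfolding D_def by (rule prob_space.prob_space_distr [OF prob_space_std_gauss]) measurable
  have sD [measurable_cong]: "sets D = sets borel" by (simp add: D_def)
  have "distr (gauss ?I) (PiM ?I (\<lambda>_. D)) (compose ?I complex_of_real) = PiM ?I (\<lambda>_. distr std_gauss D complex_of_real)"
    unfolding gauss_def by (rule distr_PiM_finite_prob_space') (auto simp: Dp prob_space_std_gauss)
  also have "distr std_gauss D complex_of_real = D" unfolding D_def by (rule distr_cong) auto
  finally have PD: "PiM ?I (\<lambda>_. D) = distr (gauss ?I) (PiM ?I (\<lambda>_. D)) (compose ?I complex_of_real)" ..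
  have cm: "compose ?I complex_of_real \<in> gauss ?I \<rightarrow>\<^sub>M PiM ?I (\<lambda>_. D)"
    unfolding compose_def [abs_def] gauss_def by measurable
  have hm: "herm_form M A \<in> borel_measurable (PiM ?I (\<lambda>_. D))"
    unfolding herm_form_def [abs_def] by measurable
  have le: "(\<Sum>a<M. \<Sum>b<M. (Re (A a b))\<^sup>2) \<le> (\<Sum>a<M. \<Sum>b<M. (cmod (A a b))\<^sup>2)"
    by (intro sum_mono) (simp add: cmod_power2)
  have "(\<integral>\<^sup>+z. ennreal (exp (t * (herm_form M A z - (\<Sum>a<M. Re (A a a))))) \<partial>PiM ?I (\<lambda>_. D))
     = (\<integral>\<^sup>+g. ennreal (exp (t * (herm_form M A (compose ?I complex_of_real g) - (\<Sum>a<M. Re (A a a))))) \<partial>gauss ?I)"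
    by (subst PD, rule nn_integral_distr [OF cm]) (use hm in measurable)
  also have "\<dots> = (\<integral>\<^sup>+g. ennreal (exp (t * (quad_form ?I (\<lambda>a b. Re (A a b)) g - (\<Sum>a<M. Re (A a a))))) \<partial>gauss ?I)"
    by (simp add: herm_form_def quad_form_def compose_def mult_ac)
  also have "\<dots> \<le> ennreal (exp (4 * t\<^sup>2 * (\<Sum>a<M. \<Sum>b<M. (Re (A a b))\<^sup>2)))"
  proof (rule gauss_chaos_mgf)
    show "Re (A i j) = Re (A j i)" if "i \<in> ?I" "j \<in> ?I" for i j using herm [of j i] that by simp
    have "8 * t\<^sup>2 * (\<Sum>a<M. \<Sum>b<M. (Re (A a b))\<^sup>2) \<le> 8 * t\<^sup>2 * (\<Sum>a<M. \<Sum>b<M. (cmod (A a b))\<^sup>2)"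
      using le by (intro mult_left_mono) auto
    then show "8 * t\<^sup>2 * (\<Sum>a<M. \<Sum>b<M. (Re (A a b))\<^sup>2) \<le> 1" using t by linarith
  qed simp
  also have "\<dots> \<le> ennreal (exp (4 * t\<^sup>2 * (\<Sum>a<M. \<Sum>b<M. (cmod (A a b))\<^sup>2)))"
    using le by (intro ennreal_leI) (simp add: mult_left_mono)
  finally show ?thesis by (simp only: D)
qed

text \<open>Joins the vectors of real and of imaginary parts into one Gaussian vector of twice the length.\<close>

lemma gauss_double:
  assumes F: "F \<in> borel_measurable (gauss {..<M + M})"
  shows "(\<integral>\<^sup>+g. F g \<partial>gauss {..<M + M})
     = (\<integral>\<^sup>+g. \<integral>\<^sup>+h. F (\<lambda>i\<in>{..<M + M}. if i < M then g i else h (i - M)) \<partial>gauss {..<M} \<partial>gauss {..<M})"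
proof -
  interpret P: product_prob_space "\<lambda>_::nat. std_gauss" by (rule product_prob_std_gauss)
  let ?J = "{M..<M + M}"
  have IJ: "{..<M} \<inter> ?J = {}" "{..<M + M} = {..<M} \<union> ?J" by auto
  define sh where "sh h = (\<lambda>n\<in>?J. h (n - M))" for h :: "nat \<Rightarrow> real"
  have sh: "distr (gauss {..<M}) (gauss ?J) sh = gauss ?J"
    unfolding gauss_def sh_def by (rule distr_PiM_reindex) (auto simp: prob_space_std_gauss inj_on_def)
  have shm: "sh \<in> gauss {..<M} \<rightarrow>\<^sub>M gauss ?J"
    unfolding sh_def gauss_def by (rule measurable_restrict) auto
  have F': "F \<in> borel_measurable (PiM ({..<M} \<union> ?J) (\<lambda>_. std_gauss))"
    using F unfolding gauss_def IJ(2) .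
  have "(\<integral>\<^sup>+g. F g \<partial>gauss {..<M + M})
      = (\<integral>\<^sup>+g. \<integral>\<^sup>+h. F (merge {..<M} ?J (g, h)) \<partial>gauss ?J \<partial>gauss {..<M})"
    unfolding gauss_def IJ(2) by (rule P.product_nn_integral_fold [OF IJ(1) _ _ F']) auto
  also have "\<dots> = (\<integral>\<^sup>+g. \<integral>\<^sup>+h. F (merge {..<M} ?J (g, sh h)) \<partial>gauss {..<M} \<partial>gauss {..<M})"
  proof (rule nn_integral_cong)
    fix g assume g: "g \<in> space (gauss {..<M})"
    have m: "(\<lambda>h. F (merge {..<M} ?J (g, h))) \<in> borel_measurable (gauss ?J)"
      using measurable_compose [OF measurable_compose [OF measurable_Pair1' [OF g] measurable_merge [of "{..<M}" ?J "\<lambda>_. std_gauss", folded gauss_def]] F' [folded gauss_def]]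
      by simp
    show "(\<integral>\<^sup>+h. F (merge {..<M} ?J (g, h)) \<partial>gauss ?J) = (\<integral>\<^sup>+h. F (merge {..<M} ?J (g, sh h)) \<partial>gauss {..<M})"
      by (subst sh [symmetric], rule nn_integral_distr [OF shm]) (simp add: m)
  qed
  also have "\<dots> = (\<integral>\<^sup>+g. \<integral>\<^sup>+h. F (\<lambda>i\<in>{..<M + M}. if i < M then g i else h (i - M)) \<partial>gauss {..<M} \<partial>gauss {..<M})"
    by (intro nn_integral_cong arg_cong [where f = F]) (auto simp: merge_def sh_def fun_eq_iff)
  finally show ?thesis .
qed

text \<open>The real and imaginary parts, scaled by \<open>sqrt 2\<close>, form a Gaussian vector of length \<open>2 M\<close>, so the real case applies
  to \<open>realify\<close>.\<close>

lemma complex_normal_chaos_mgf: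
  assumes herm: "\<And>a b. a < M \<Longrightarrow> b < M \<Longrightarrow> A b a = cnj (A a b)"
    and t: "8 * t\<^sup>2 * (\<Sum>a<M. \<Sum>b<M. (cmod (A a b))\<^sup>2) \<le> 1"
  shows "(\<integral>\<^sup>+z. ennreal (exp (t * (herm_form M A z - (\<Sum>a<M. Re (A a a))))) \<partial>PiM {..<M} (\<lambda>_. complex_std_normal))
          \<le> ennreal (exp (4 * t\<^sup>2 * (\<Sum>a<M. \<Sum>b<M. (cmod (A a b))\<^sup>2)))"
proof -
  let ?I = "{..<M}"
  let ?P = "std_gauss \<Otimes>\<^sub>M std_gauss"
  let ?F = "\<Sum>a<M. \<Sum>b<M. (cmod (A a b))\<^sup>2"
  have F0: "?F \<ge> 0" by (intro sum_nonneg) auto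
  have R2: "(\<Sum>i<M + M. \<Sum>j<M + M. (realify M A i j)\<^sup>2) = ?F / 2"
    by (rule realify_facts(2) [OF herm])
  have R3: "(\<Sum>i<M + M. realify M A i i) = (\<Sum>a<M. Re (A a a))"
    by (rule realify_facts(3) [OF herm])
  define f where "f = (\<lambda>(x, y). Complex (x / sqrt 2) (y / sqrt 2))"
  have fm [measurable]: "f \<in> borel_measurable ?P" unfolding f_def by measurable
  define D where "D = distr ?P borel f"
  interpret S: prob_space std_gauss by (rule prob_space_std_gauss)
  interpret G: prob_space "gauss ?I" by (rule prob_space_gauss)
  have D: "complex_std_normal = D"
  proof -
    define \<nu> where "\<nu> = density lborel (\<lambda>x. ennreal (normal_density 0 (1 / sqrt 2) x))"
    have \<nu>: "\<nu> = distr std_gauss borel (\<lambda>x. 0 + 1 / sqrt 2 * x)"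
      unfolding \<nu>_def by (rule distr_std_gauss_affine [symmetric]) simp
    have p: "prob_space (distr std_gauss borel (\<lambda>x. 0 + 1 / sqrt 2 * x))"
      by (rule S.prob_space_distr) measurable
    have "\<nu> \<Otimes>\<^sub>M \<nu> = distr ?P (borel \<Otimes>\<^sub>M borel) (\<lambda>(x, y). (0 + 1 / sqrt 2 * x, 0 + 1 / sqrt 2 * y))"
      unfolding \<nu> by (rule pair_measure_distr [OF _ _ prob_space_imp_sigma_finite [OF p]]) measurable
    then have "complex_std_normal = distr (distr ?P (borel \<Otimes>\<^sub>M borel) (\<lambda>(x, y). (0 + 1 / sqrt 2 * x, 0 + 1 / sqrt 2 * y))) borel (\<lambda>(x, y). Complex x y)"
      unfolding complex_std_normal_def Let_def \<nu>_def [symmetric] by simp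
    also have "\<dots> = distr ?P borel ((\<lambda>(x, y). Complex x y) \<circ> (\<lambda>(x, y). (0 + 1 / sqrt 2 * x, 0 + 1 / sqrt 2 * y)))"
      by (rule distr_distr) measurable
    also have "\<dots> = D" unfolding D_def f_def by (intro distr_cong refl) auto
    finally show ?thesis .
  qed
  have Pp: "prob_space ?P" by (intro prob_space_pair prob_space_std_gauss)
  have Dp: "prob_space D" unfolding D_def by (rule prob_space.prob_space_distr [OF Pp]) measurable
  have sD [measurable_cong]: "sets D = sets borel" by (simp add: D_def)
  have "distr (PiM ?I (\<lambda>_. ?P)) (PiM ?I (\<lambda>_. D)) (compose ?I f) = PiM ?I (\<lambda>_. distr ?P D f)"
    by (rule distr_PiM_finite_prob_space') (auto simp: Dp Pp)
  also have "distr ?P D f = D" unfolding D_def by (rule distr_cong) auto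
  finally have PD: "PiM ?I (\<lambda>_. D) = distr (PiM ?I (\<lambda>_. ?P)) (PiM ?I (\<lambda>_. D)) (compose ?I f)" ..
  have cm: "compose ?I f \<in> PiM ?I (\<lambda>_. ?P) \<rightarrow>\<^sub>M PiM ?I (\<lambda>_. D)"
    unfolding compose_def [abs_def] by measurable
  have hm [measurable]: "herm_form M A \<in> borel_measurable (PiM ?I (\<lambda>_. D))"
    unfolding herm_form_def [abs_def] by measurable
  have z: "(\<lambda>(g, h). \<lambda>i\<in>?I. (g i, h i)) \<in> gauss ?I \<Otimes>\<^sub>M gauss ?I \<rightarrow>\<^sub>M PiM ?I (\<lambda>_. ?P)"
    unfolding gauss_def by measurable
  define \<Phi> where "\<Phi> z = ennreal (exp (t * (herm_form M A z - (\<Sum>a<M. Re (A a a)))))" for z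
  have \<Phi>m [measurable]: "\<Phi> \<in> borel_measurable (PiM ?I (\<lambda>_. D))" unfolding \<Phi>_def by measurable
  have \<Phi>c: "(\<lambda>z. \<Phi> (compose ?I f z)) \<in> borel_measurable (PiM ?I (\<lambda>_. ?P))"
    by (rule measurable_compose [OF cm \<Phi>m])
  have "(\<integral>\<^sup>+z. \<Phi> z \<partial>PiM ?I (\<lambda>_. D)) = (\<integral>\<^sup>+z. \<Phi> z \<partial>distr (PiM ?I (\<lambda>_. ?P)) (PiM ?I (\<lambda>_. D)) (compose ?I f))"
    by (rule arg_cong [where f = "\<lambda>m. \<integral>\<^sup>+z. \<Phi> z \<partial>m", OF PD])
  also have "\<dots> = (\<integral>\<^sup>+z. \<Phi> (compose ?I f z) \<partial>PiM ?I (\<lambda>_. ?P))"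
    by (rule nn_integral_distr [OF cm]) (simp add: \<Phi>m)
  also have "\<dots> = (\<integral>\<^sup>+z. \<Phi> (compose ?I f z) \<partial>distr (gauss ?I \<Otimes>\<^sub>M gauss ?I) (PiM ?I (\<lambda>_. ?P)) (\<lambda>(g, h). \<lambda>i\<in>?I. (g i, h i)))"
    unfolding gauss_def PiM_pair_eq_distr [OF prob_space_std_gauss finite_lessThan, symmetric] ..
  also have "\<dots> = (\<integral>\<^sup>+gh. \<Phi> (compose ?I f (case gh of (g, h) \<Rightarrow> \<lambda>i\<in>?I. (g i, h i))) \<partial>(gauss ?I \<Otimes>\<^sub>M gauss ?I))"
    by (rule nn_integral_distr [OF z]) (simp add: \<Phi>c)
  also have "\<dots> = (\<integral>\<^sup>+g. \<integral>\<^sup>+h. \<Phi> (compose ?I f (\<lambda>i\<in>?I. (g i, h i))) \<partial>gauss ?I \<partial>gauss ?I)"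
    using G.nn_integral_fst [OF measurable_compose [OF z \<Phi>c], symmetric] by simp
  also have "\<dots> = (\<integral>\<^sup>+g. \<integral>\<^sup>+h. (\<lambda>g. ennreal (exp (t * (quad_form {..<M + M} (realify M A) g - (\<Sum>i<M + M. realify M A i i)))))
      (\<lambda>i\<in>{..<M + M}. if i < M then g i else h (i - M)) \<partial>gauss ?I \<partial>gauss ?I)"
  proof (intro nn_integral_cong)
    fix g h :: "nat \<Rightarrow> real"
    have cx: "Complex (a / sqrt 2) (b / sqrt 2) = complex_of_real (1 / sqrt 2) * Complex a b" for a b :: real
      by (simp add: complex_eq_iff)
    have "herm_form M A (compose ?I f (\<lambda>i\<in>?I. (g i, h i)))
        = herm_form M A (\<lambda>i\<in>?I. complex_of_real (1 / sqrt 2) * Complex (g i) (h i))"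
      unfolding herm_form_def
      by (intro arg_cong [where f = Re] sum.cong refl) (simp add: compose_def f_def cx)
    also have "\<dots> = herm_form M A (\<lambda>i. Complex (g i) (h i)) / 2"
      unfolding herm_form_scale by (simp add: power_divide)
    also have "\<dots> = quad_form {..<M + M} (realify M A) (\<lambda>i\<in>{..<M + M}. if i < M then g i else h (i - M))"
      unfolding quad_form_realify herm_form_def by simp
    finally show "\<Phi> (compose ?I f (\<lambda>i\<in>?I. (g i, h i))) = (\<lambda>g. ennreal (exp (t * (quad_form {..<M + M} (realify M A) g
        - (\<Sum>i<M + M. realify M A i i))))) (\<lambda>i\<in>{..<M + M}. if i < M then g i else h (i - M))"
      by (simp only: \<Phi>_def R3)
  qed
  also have "\<dots> = (\<integral>\<^sup>+g. ennreal (exp (t * (quad_form {..<M + M} (realify M A) g - (\<Sum>i<M + M. realify M A i i)))) \<partial>gauss {..<M + M})"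
    by (rule gauss_double [symmetric]) measurable
  also have "\<dots> \<le> ennreal (exp (4 * t\<^sup>2 * (\<Sum>i<M + M. \<Sum>j<M + M. (realify M A i j)\<^sup>2)))"
  proof (rule gauss_chaos_mgf)
    show "realify M A i j = realify M A j i" if "i \<in> {..<M + M}" "j \<in> {..<M + M}" for i j
      using realify_facts(1) [OF herm] that by simp
    have "8 * t\<^sup>2 * (?F / 2) \<le> 8 * t\<^sup>2 * ?F" using F0 by (intro mult_left_mono) auto
    then show "8 * t\<^sup>2 * (\<Sum>i<M + M. \<Sum>j<M + M. (realify M A i j)\<^sup>2) \<le> 1"
      unfolding R2 using t by linarith
  qed simp
  also have "\<dots> \<le> ennreal (exp (4 * t\<^sup>2 * ?F))"
    unfolding R2 using F0 by (intro ennreal_leI) (simp add: mult_left_mono)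
  finally show ?thesis by (simp only: D \<Phi>_def)
qed

text \<open>The complex unit sphere of dimension \<open>M\<close> is the real one of dimension \<open>2 M\<close>; for a real scalar product with it,
  \<open>haar_kernel\<close> provides the radial Laplace transform.\<close>

lemma sphere_chaos_mgf_herm:
  assumes h: "haar_sphere F M \<nu>" and F: "F = \<real> \<or> F = UNIV"
    and herm: "\<And>a b. a < M \<Longrightarrow> b < M \<Longrightarrow> A b a = cnj (A a b)"
    and t: "32 * t\<^sup>2 * (\<Sum>a<M. \<Sum>b<M. (cmod (A a b))\<^sup>2) \<le> 1"
  shows "(\<integral>\<^sup>+u. ennreal (exp (t * (real M * herm_form M A u - (\<Sum>a<M. Re (A a a))))) \<partial>\<nu>)
          \<le> ennreal (exp (16 * t\<^sup>2 * (\<Sum>a<M. \<Sum>b<M. (cmod (A a b))\<^sup>2)))"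
proof -
  let ?F = "\<Sum>a<M. \<Sum>b<M. (cmod (A a b))\<^sup>2"
  have F0: "?F \<ge> 0" by (intro sum_nonneg) auto
  have pr: "prob_space \<nu>" and sets [measurable_cong]: "sets \<nu> = sets (row_space M)"
    and uF: "AE u in \<nu>. (\<forall>j<M. u j \<in> F) \<and> (\<Sum>j<M. (cmod (u j))\<^sup>2) = 1"
    using h by (auto simp: haar_sphere_def)
  show ?thesis
  proof (cases "F = UNIV")
    case True
    let ?J = "{..<M + M}"
    define x where "x u i = (if i < M then Re (u i) else Im (u (i - M)))" for u :: "nat \<Rightarrow> complex" and i
    have xu: "(\<lambda>i. Complex (x u i) (x u (M + i))) = (\<lambda>i. if i < M then u i else Complex (Im (u (i - M))) (Im (u i)))" for u
      by (auto simp: x_def fun_eq_iff)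
    have pu: "(\<Sum>i\<in>?J. p i * x u i) = Re (\<Sum>i<M. cnj (Complex (p i) (p (M + i))) * u i)" for p u
      by (simp add: sum_lessThan_add x_def Re_sum sum.distrib)
    have R2: "(\<Sum>i\<in>?J. \<Sum>j\<in>?J. (realify M A i j)\<^sup>2) = ?F / 2"
      by (rule realify_facts(2) [OF herm])
    have R3: "(\<Sum>i\<in>?J. realify M A i i) = (\<Sum>a<M. Re (A a a))"
      by (rule realify_facts(3) [OF herm])
    have "(\<integral>\<^sup>+u. ennreal (exp (t * (real (card ?J) * quad_form ?J (realify M A) (x u) - (\<Sum>i\<in>?J. realify M A i i)))) \<partial>\<nu>)
        \<le> ennreal (exp (16 * t\<^sup>2 * (\<Sum>i\<in>?J. \<Sum>j\<in>?J. (realify M A i j)\<^sup>2)))"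
    proof (rule sphere_chaos_mgf [OF pr])
      show "(\<lambda>u. x u i) \<in> borel_measurable \<nu>" if "i \<in> ?J" for i
      proof (cases "i < M")
        case True
        then have "i \<in> {..<M}" by simp
        then have "(\<lambda>u. Re (u i)) \<in> borel_measurable \<nu>" by measurable
        then show ?thesis using True by (simp add: x_def)
      next
        case False
        then have "i - M \<in> {..<M}" using that by auto
        then have "(\<lambda>u. Im (u (i - M))) \<in> borel_measurable \<nu>" by measurable
        then show ?thesis using False by (simp add: x_def)
      qed
      show "AE u in \<nu>. (\<Sum>i\<in>?J. (x u i)\<^sup>2) = 1"
        using uF by eventually_elim (simp add: sum_lessThan_add x_def cmod_power2 sum.distrib)
      show "realify M A i j = realify M A j i" if "i \<in> ?J" "j \<in> ?J" for i j
        using realify_facts(1) [OF herm] that by simp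
      show "(\<integral>\<^sup>+u. ennreal (exp (\<Sum>i\<in>?J. p i * x u i)) \<partial>\<nu>) = (\<integral>\<^sup>+u. ennreal (exp (\<Sum>i\<in>?J. q i * x u i)) \<partial>\<nu>)"
        if "(\<Sum>i\<in>?J. (p i)\<^sup>2) = (\<Sum>i\<in>?J. (q i)\<^sup>2)" for p q :: "nat \<Rightarrow> real"
        unfolding pu
        by (rule haar_kernel [OF h _ F]) (use that True in \<open>auto simp: sum_lessThan_add cmod_power2 sum.distrib\<close>)
      have "32 * t\<^sup>2 * (?F / 2) \<le> 32 * t\<^sup>2 * ?F" using F0 by (intro mult_left_mono) auto
      then have "32 * t\<^sup>2 * (?F / 2) \<le> 1" using t by linarith
      then show "32 * t\<^sup>2 * (\<Sum>i\<in>?J. \<Sum>j\<in>?J. (realify M A i j)\<^sup>2) \<le> 1" by (simp only: R2)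
    qed simp
    also have "\<dots> \<le> ennreal (exp (16 * t\<^sup>2 * ?F))"
      unfolding R2 using F0 by (intro ennreal_leI) (simp add: mult_left_mono)
    finally show ?thesis
      unfolding quad_form_realify R3 xu by (simp add: herm_form_def)
  next
    case False
    then have FR: "F = \<real>" using F by simp
    let ?J = "{..<M}"
    have le: "(\<Sum>a<M. \<Sum>b<M. (Re (A a b))\<^sup>2) \<le> ?F"
      by (intro sum_mono) (simp add: cmod_power2)
    have re: "u i = complex_of_real (Re (u i))" if "\<forall>j<M. u j \<in> F" "i < M" for u :: "nat \<Rightarrow> complex" and i
      using that FR by (simp add: complex_is_Real_iff complex_eq_iff)
    have "(\<integral>\<^sup>+u. ennreal (exp (t * (real M * herm_form M A u - (\<Sum>a<M. Re (A a a))))) \<partial>\<nu>)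
       = (\<integral>\<^sup>+u. ennreal (exp (t * (real (card ?J) * quad_form ?J (\<lambda>a b. Re (A a b)) (\<lambda>i. Re (u i)) - (\<Sum>a<M. Re (A a a))))) \<partial>\<nu>)"
    proof (rule nn_integral_cong_AE, use uF in eventually_elim)
      fix u assume u: "(\<forall>j<M. u j \<in> F) \<and> (\<Sum>j<M. (cmod (u j))\<^sup>2) = 1"
      have "herm_form M A u = herm_form M A (\<lambda>i. complex_of_real (Re (u i)))"
        unfolding herm_form_def using u re [of u] by (intro arg_cong [where f = Re] sum.cong refl) simp
      also have "\<dots> = quad_form ?J (\<lambda>a b. Re (A a b)) (\<lambda>i. Re (u i))"
        by (simp add: herm_form_def quad_form_def mult_ac)
      finally show "ennreal (exp (t * (real M * herm_form M A u - (\<Sum>a<M. Re (A a a)))))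
        = ennreal (exp (t * (real (card ?J) * quad_form ?J (\<lambda>a b. Re (A a b)) (\<lambda>i. Re (u i)) - (\<Sum>a<M. Re (A a a)))))"
        by simp
    qed
    also have "\<dots> \<le> ennreal (exp (16 * t\<^sup>2 * (\<Sum>a<M. \<Sum>b<M. (Re (A a b))\<^sup>2)))"
    proof (rule sphere_chaos_mgf [OF pr])
      show "(\<lambda>u. Re (u i)) \<in> borel_measurable \<nu>" if "i \<in> ?J" for i using that by measurable
      show "AE u in \<nu>. (\<Sum>i\<in>?J. (Re (u i))\<^sup>2) = 1"
        using uF
      proof eventually_elim
        fix u assume u: "(\<forall>j<M. u j \<in> F) \<and> (\<Sum>j<M. (cmod (u j))\<^sup>2) = 1"
        have "(Re (u j))\<^sup>2 = (cmod (u j))\<^sup>2" if "j < M" for j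
          using u that FR by (simp add: cmod_power2 complex_is_Real_iff)
        then show "(\<Sum>i\<in>?J. (Re (u i))\<^sup>2) = 1" using u by simp
      qed
      show "Re (A i j) = Re (A j i)" if "i \<in> ?J" "j \<in> ?J" for i j using herm [of j i] that by simp
      show "(\<integral>\<^sup>+u. ennreal (exp (\<Sum>i\<in>?J. p i * Re (u i))) \<partial>\<nu>) = (\<integral>\<^sup>+u. ennreal (exp (\<Sum>i\<in>?J. q i * Re (u i))) \<partial>\<nu>)"
        if "(\<Sum>i\<in>?J. (p i)\<^sup>2) = (\<Sum>i\<in>?J. (q i)\<^sup>2)" for p q :: "nat \<Rightarrow> real"
        using haar_kernel [OF h _ F, of "\<lambda>i. complex_of_real (p i)" "\<lambda>i. complex_of_real (q i)"] that FR
        by (simp add: Re_sum)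
      have "32 * t\<^sup>2 * (\<Sum>a<M. \<Sum>b<M. (Re (A a b))\<^sup>2) \<le> 32 * t\<^sup>2 * ?F"
        using le by (intro mult_left_mono) auto
      then show "32 * t\<^sup>2 * (\<Sum>a<M. \<Sum>b<M. (Re (A a b))\<^sup>2) \<le> 1" using t by linarith
    qed simp
    also have "\<dots> \<le> ennreal (exp (16 * t\<^sup>2 * ?F))"
      using le by (intro ennreal_leI) (simp add: mult_left_mono)
    finally show ?thesis .
  qed
qed

text \<open>One bound, with the constants of the sphere, for the four admissible laws of a row.\<close>

theorem row_law_chaos_mgf:
  assumes law: "row_law E M \<mu>"
    and herm: "\<And>a b. a < M \<Longrightarrow> b < M \<Longrightarrow> A b a = cnj (A a b)"
    and t: "32 * t\<^sup>2 * (\<Sum>a<M. \<Sum>b<M. (cmod (A a b))\<^sup>2) \<le> 1"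
  shows "(\<integral>\<^sup>+z. ennreal (exp (t * (herm_form M A z - (\<Sum>a<M. Re (A a a))))) \<partial>\<mu>)
          \<le> ennreal (exp (16 * t\<^sup>2 * (\<Sum>a<M. \<Sum>b<M. (cmod (A a b))\<^sup>2)))"
proof -
  let ?F = "\<Sum>a<M. \<Sum>b<M. (cmod (A a b))\<^sup>2"
  have F0: "?F \<ge> 0" by (intro sum_nonneg) auto
  have t8: "8 * t\<^sup>2 * ?F \<le> 1"
  proof -
    have "8 * t\<^sup>2 * ?F \<le> 32 * t\<^sup>2 * ?F" using F0 by (intro mult_right_mono) auto
    then show ?thesis using t by linarith
  qed
  have weaken: "ennreal (exp (4 * t\<^sup>2 * ?F)) \<le> ennreal (exp (16 * t\<^sup>2 * ?F))"
    using F0 by (intro ennreal_leI) (simp add: mult_right_mono)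
  have sphere: "(\<integral>\<^sup>+z. ennreal (exp (t * (herm_form M A z - (\<Sum>a<M. Re (A a a))))) \<partial>\<mu>) \<le> ennreal (exp (16 * t\<^sup>2 * ?F))"
    if "scaled_haar_sphere F M \<mu>" and F: "F = \<real> \<or> F = UNIV" for F
  proof -
    obtain \<nu> where h: "haar_sphere F M \<nu>"
      and \<mu>: "\<mu> = distr \<nu> (row_space M) (\<lambda>u. \<lambda>j\<in>{..<M}. complex_of_real (sqrt (real M)) * u j)"
      using \<open>scaled_haar_sphere F M \<mu>\<close> by (auto simp: scaled_haar_sphere_def)
    have sets [measurable_cong]: "sets \<nu> = sets (row_space M)" using h by (auto simp: haar_sphere_def)
    have "(\<integral>\<^sup>+z. ennreal (exp (t * (herm_form M A z - (\<Sum>a<M. Re (A a a))))) \<partial>\<mu>)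
        = (\<integral>\<^sup>+u. ennreal (exp (t * (herm_form M A (\<lambda>j\<in>{..<M}. complex_of_real (sqrt (real M)) * u j) - (\<Sum>a<M. Re (A a a))))) \<partial>\<nu>)"
      unfolding \<mu> by (rule nn_integral_distr) measurable
    also have "\<dots> = (\<integral>\<^sup>+u. ennreal (exp (t * (real M * herm_form M A u - (\<Sum>a<M. Re (A a a))))) \<partial>\<nu>)"
      unfolding herm_form_scale by simp
    also have "\<dots> \<le> ennreal (exp (16 * t\<^sup>2 * ?F))"
      by (rule sphere_chaos_mgf_herm [OF h F herm t])
    finally show ?thesis .
  qed
  show ?thesis
  proof (cases E)
    case Real_Normal
    then show ?thesis using law order_trans [OF real_normal_chaos_mgf [OF herm t8] weaken] by simp
  next
    case Complex_Normal
    then show ?thesis using law order_trans [OF complex_normal_chaos_mgf [OF herm t8] weaken] by simp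
  next
    case Real_Sphere
    then show ?thesis using law sphere [of \<real>] by simp
  next
    case Complex_Sphere
    then show ?thesis using law sphere [of UNIV] by simp
  qed
qed

section \<open>Concentration over independent rows\<close>

lemma iid_rows_measurable:
  assumes "prob_space P" "iid_rows E M N P Z" "n < N"
  shows "(\<lambda>\<omega>. mat_row_fun M (Z \<omega>) n) \<in> P \<rightarrow>\<^sub>M row_space M"
  using assms prob_space.indep_vars_def2 [OF assms(1), of "\<lambda>_. row_space M" "\<lambda>i \<omega>. mat_row_fun M (Z \<omega>) i" "{..<N}"]
  by (auto simp: iid_rows_def)

text \<open>The Chernoff bound: independence makes the exponential moment of the sum a product.\<close>

lemma rows_upper_tail:
  fixes w :: "nat \<Rightarrow> real"
  assumes P: "prob_space P" and rows: "iid_rows E M N P Z"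
    and herm: "\<And>a b. a < M \<Longrightarrow> b < M \<Longrightarrow> A b a = cnj (A a b)"
    and F: "(\<Sum>a<M. \<Sum>b<M. (cmod (A a b))\<^sup>2) \<le> F"
    and w: "\<And>n. n < N \<Longrightarrow> 32 * (l * w n)\<^sup>2 * F \<le> 1"
    and l: "l > 0"
  shows "measure P {\<omega> \<in> space P. y < (\<Sum>n<N. w n * (herm_form M A (mat_row_fun M (Z \<omega>) n) - (\<Sum>a<M. Re (A a a))))}
       \<le> exp (- l * y + 16 * l\<^sup>2 * F * (\<Sum>n<N. (w n)\<^sup>2))"
proof -
  interpret prob_space P by fact
  define Y where "Y n \<omega> = herm_form M A (mat_row_fun M (Z \<omega>) n) - (\<Sum>a<M. Re (A a a))" for n \<omega>
  define S where "S \<omega> = (\<Sum>n<N. w n * Y n \<omega>)" for \<omega>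
  let ?F = "\<Sum>a<M. \<Sum>b<M. (cmod (A a b))\<^sup>2"
  note rm = iid_rows_measurable [OF P rows]
  have Ym: "Y n \<in> borel_measurable P" if "n < N" for n
    unfolding Y_def using measurable_compose [OF rm [OF that] measurable_herm_form] by measurable
  have Sm [measurable]: "S \<in> borel_measurable P"
    unfolding S_def using Ym by (intro borel_measurable_sum borel_measurable_times) auto
  obtain \<mu> where law: "row_law E M \<mu>"
    and dist: "\<And>n. n < N \<Longrightarrow> distr P (row_space M) (\<lambda>\<omega>. mat_row_fun M (Z \<omega>) n) = \<mu>"
    using rows by (auto simp: iid_rows_def)
  have one: "(\<integral>\<^sup>+\<omega>. ennreal (exp (l * w n * Y n \<omega>)) \<partial>P) \<le> ennreal (exp (16 * (l * w n)\<^sup>2 * F))" if n: "n < N" for n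
  proof -
    have "(\<integral>\<^sup>+\<omega>. ennreal (exp (l * w n * Y n \<omega>)) \<partial>P)
       = (\<integral>\<^sup>+z. ennreal (exp (l * w n * (herm_form M A z - (\<Sum>a<M. Re (A a a))))) \<partial>\<mu>)"
      unfolding Y_def dist [OF n, symmetric] by (rule nn_integral_distr [symmetric, OF rm [OF n]]) measurable
    also have "\<dots> \<le> ennreal (exp (16 * (l * w n)\<^sup>2 * ?F))"
    proof (rule row_law_chaos_mgf [OF law herm])
      have "32 * (l * w n)\<^sup>2 * ?F \<le> 32 * (l * w n)\<^sup>2 * F" using F by (intro mult_left_mono) auto
      then show "32 * (l * w n)\<^sup>2 * ?F \<le> 1" using w [OF n] by linarith
    qed
    also have "\<dots> \<le> ennreal (exp (16 * (l * w n)\<^sup>2 * F))"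
      using F by (intro ennreal_leI) (simp add: mult_left_mono)
    finally show ?thesis .
  qed
  have indep: "indep_vars (\<lambda>_. borel) (\<lambda>n \<omega>. ennreal (exp (l * w n * Y n \<omega>))) {..<N}"
  proof -
    have "indep_vars (\<lambda>_. row_space M) (\<lambda>i \<omega>. mat_row_fun M (Z \<omega>) i) {..<N}"
      using rows by (simp add: iid_rows_def)
    from indep_vars_compose2 [OF this, of "\<lambda>n z. ennreal (exp (l * w n * (herm_form M A z - (\<Sum>a<M. Re (A a a)))))" "\<lambda>_. borel"]
    show ?thesis unfolding Y_def by measurable
  qed
  have "(\<integral>\<^sup>+\<omega>. ennreal (exp (l * S \<omega>)) \<partial>P) = (\<integral>\<^sup>+\<omega>. (\<Prod>n<N. ennreal (exp (l * w n * Y n \<omega>))) \<partial>P)"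
    by (simp add: S_def sum_distrib_left exp_sum prod_ennreal mult.assoc)
  also have "\<dots> = (\<Prod>n<N. \<integral>\<^sup>+\<omega>. ennreal (exp (l * w n * Y n \<omega>)) \<partial>P)"
    by (rule indep_vars_nn_integral [OF _ indep]) auto
  also have "\<dots> \<le> (\<Prod>n<N. ennreal (exp (16 * (l * w n)\<^sup>2 * F)))"
    by (rule prod_mono_ennreal) (use one in auto)
  also have "\<dots> = ennreal (exp (16 * l\<^sup>2 * F * (\<Sum>n<N. (w n)\<^sup>2)))"
    by (simp add: prod_ennreal exp_sum [symmetric] sum_distrib_left power_mult_distrib mult_ac)
  finally have mgf: "(\<integral>\<^sup>+\<omega>. ennreal (exp (l * S \<omega>)) \<partial>P) \<le> ennreal (exp (16 * l\<^sup>2 * F * (\<Sum>n<N. (w n)\<^sup>2)))" .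
  have "emeasure P {\<omega> \<in> space P. y < S \<omega>} = (\<integral>\<^sup>+\<omega>. indicator {\<omega> \<in> space P. y < S \<omega>} \<omega> \<partial>P)"
    by simp
  also have "\<dots> \<le> (\<integral>\<^sup>+\<omega>. ennreal (exp (- l * y)) * ennreal (exp (l * S \<omega>)) \<partial>P)"
  proof (rule nn_integral_mono)
    fix \<omega>
    show "indicator {\<omega> \<in> space P. y < S \<omega>} \<omega> \<le> ennreal (exp (- l * y)) * ennreal (exp (l * S \<omega>))"
    proof (cases "y < S \<omega>")
      case True
      then have "1 \<le> exp (- l * y + l * S \<omega>)" using l by simp
      then have "ennreal 1 \<le> ennreal (exp (- l * y + l * S \<omega>))" by (rule ennreal_leI)
      then show ?thesis by (simp add: indicator_def ennreal_mult [symmetric] exp_add [symmetric])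
    qed (simp add: indicator_def)
  qed
  also have "\<dots> = ennreal (exp (- l * y)) * (\<integral>\<^sup>+\<omega>. ennreal (exp (l * S \<omega>)) \<partial>P)"
    by (rule nn_integral_cmult) measurable
  also have "\<dots> \<le> ennreal (exp (- l * y)) * ennreal (exp (16 * l\<^sup>2 * F * (\<Sum>n<N. (w n)\<^sup>2)))"
    by (intro mult_left_mono mgf) simp
  also have "\<dots> = ennreal (exp (- l * y + 16 * l\<^sup>2 * F * (\<Sum>n<N. (w n)\<^sup>2)))"
    by (simp add: ennreal_mult [symmetric] exp_add [symmetric])
  finally show ?thesis
    unfolding S_def Y_def by (simp add: emeasure_eq_measure)
qed

theorem rows_concentration:
  fixes w :: "nat \<Rightarrow> real"
  assumes P: "prob_space P" and rows: "iid_rows E M N P Z"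
    and herm: "\<And>a b. a < M \<Longrightarrow> b < M \<Longrightarrow> A b a = cnj (A a b)"
    and F: "(\<Sum>a<M. \<Sum>b<M. (cmod (A a b))\<^sup>2) \<le> F"
    and w: "\<And>n. n < N \<Longrightarrow> 32 * (l * w n)\<^sup>2 * F \<le> 1"
    and l: "l > 0"
  defines "S \<equiv> \<lambda>\<omega>. \<Sum>n<N. w n * (herm_form M A (mat_row_fun M (Z \<omega>) n) - (\<Sum>a<M. Re (A a a)))"
  shows "{\<omega> \<in> space P. y < \<bar>S \<omega>\<bar>} \<in> sets P"
    and "measure P {\<omega> \<in> space P. y < \<bar>S \<omega>\<bar>} \<le> 2 * exp (- l * y + 16 * l\<^sup>2 * F * (\<Sum>n<N. (w n)\<^sup>2))"
proof -
  interpret prob_space P by fact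
  have m: "(\<lambda>\<omega>. herm_form M A (mat_row_fun M (Z \<omega>) n)) \<in> borel_measurable P" if "n < N" for n
    using measurable_compose [OF iid_rows_measurable [OF P rows that] measurable_herm_form] .
  have Sm [measurable]: "S \<in> borel_measurable P"
    unfolding S_def using m by (intro borel_measurable_sum borel_measurable_times borel_measurable_diff) auto
  show "{\<omega> \<in> space P. y < \<bar>S \<omega>\<bar>} \<in> sets P" by measurable
  have "{\<omega> \<in> space P. y < \<bar>S \<omega>\<bar>} = {\<omega> \<in> space P. y < S \<omega>} \<union> {\<omega> \<in> space P. y < - S \<omega>}"
    by auto
  then have "measure P {\<omega> \<in> space P. y < \<bar>S \<omega>\<bar>} \<le> measure P {\<omega> \<in> space P. y < S \<omega>} + measure P {\<omega> \<in> space P. y < - S \<omega>}"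
    by (simp add: measure_subadditive)
  moreover have "measure P {\<omega> \<in> space P. y < S \<omega>} \<le> exp (- l * y + 16 * l\<^sup>2 * F * (\<Sum>n<N. (w n)\<^sup>2))"
    unfolding S_def by (rule rows_upper_tail [OF P rows herm F w l])
  moreover have "measure P {\<omega> \<in> space P. y < - S \<omega>} \<le> exp (- l * y + 16 * l\<^sup>2 * F * (\<Sum>n<N. (w n)\<^sup>2))"
    using rows_upper_tail [OF P rows herm F, of l "\<lambda>n. - w n" y] w l
    unfolding S_def by (simp add: sum_negf)
  ultimately show "measure P {\<omega> \<in> space P. y < \<bar>S \<omega>\<bar>} \<le> 2 * exp (- l * y + 16 * l\<^sup>2 * F * (\<Sum>n<N. (w n)\<^sup>2))"
    by linarith
qed

section \<open>Hermitian forms and positive semidefinite roots\<close>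

text \<open>Vectors and square matrices are treated here as functions of their indices, read only below the dimension \<open>n\<close>; matrices enter
  through \<open>entries\<close>.\<close>

definition sq_norm :: "nat \<Rightarrow> (nat \<Rightarrow> complex) \<Rightarrow> real" where
  "sq_norm n v = (\<Sum>i<n. (cmod (v i))\<^sup>2)"

definition app :: "nat \<Rightarrow> (nat \<Rightarrow> nat \<Rightarrow> complex) \<Rightarrow> (nat \<Rightarrow> complex) \<Rightarrow> nat \<Rightarrow> complex" where
  "app n A v i = (\<Sum>j<n. A i j * v j)"

definition sesq :: "nat \<Rightarrow> (nat \<Rightarrow> nat \<Rightarrow> complex) \<Rightarrow> (nat \<Rightarrow> complex) \<Rightarrow> (nat \<Rightarrow> complex) \<Rightarrow> complex" where
  "sesq n A v w = (\<Sum>i<n. cnj (w i) * app n A v i)"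

definition hermitian :: "nat \<Rightarrow> (nat \<Rightarrow> nat \<Rightarrow> complex) \<Rightarrow> bool" where
  "hermitian n A \<longleftrightarrow> (\<forall>i<n. \<forall>j<n. cnj (A i j) = A j i)"

lemma hermitianI: "(\<And>i j. i < n \<Longrightarrow> j < n \<Longrightarrow> cnj (A i j) = A j i) \<Longrightarrow> hermitian n A"
  by (simp add: hermitian_def)

lemma hermitianD: "hermitian n A \<Longrightarrow> i < n \<Longrightarrow> j < n \<Longrightarrow> cnj (A i j) = A j i"
  by (simp add: hermitian_def)

lemma sq_norm_nonneg [simp]: "0 \<le> sq_norm n v"
  by (simp add: sq_norm_def sum_nonneg)

lemma sq_norm_eq_0: "sq_norm n v = 0 \<longleftrightarrow> (\<forall>i<n. v i = 0)"
  by (auto simp: sq_norm_def sum_nonneg_eq_0_iff)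

lemma sq_norm_cong: "(\<And>i. i < n \<Longrightarrow> v i = w i) \<Longrightarrow> sq_norm n v = sq_norm n w"
  by (simp add: sq_norm_def)

lemma sq_norm_scale: "sq_norm n (\<lambda>i. c * v i) = (cmod c)\<^sup>2 * sq_norm n v"
  by (simp add: sq_norm_def norm_mult power_mult_distrib sum_distrib_left)

lemma sq_norm_complex: "complex_of_real (sq_norm n v) = (\<Sum>i<n. cnj (v i) * v i)"
  unfolding sq_norm_def of_real_sum by (intro sum.cong refl) (simp only: complex_norm_square mult.commute)

lemma sesq_double_sum: "sesq n A v w = (\<Sum>i<n. \<Sum>j<n. cnj (w i) * A i j * v j)"
  by (simp add: sesq_def app_def sum_distrib_left mult.assoc)

lemma sesq_add: "sesq n A (\<lambda>i. u i + v i) (\<lambda>i. u i + v i)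
    = sesq n A u u + sesq n A u v + sesq n A v u + sesq n A v v"
  unfolding sesq_double_sum sum.distrib [symmetric] by (intro sum.cong refl) (simp add: algebra_simps)

lemma sesq_diff: "sesq n A (\<lambda>i. u i - v i) (\<lambda>i. u i - v i)
    = sesq n A u u - sesq n A u v - sesq n A v u + sesq n A v v"
  unfolding sesq_double_sum sum.distrib [symmetric] sum_subtractf [symmetric]
  by (intro sum.cong refl) (simp add: algebra_simps)

lemma sesq_scale: "sesq n A (\<lambda>i. c * v i) (\<lambda>i. d * w i) = c * cnj d * sesq n A v w"
  unfolding sesq_double_sum sum_distrib_left by (intro sum.cong refl) (simp add: mult_ac)

lemma sesq_swap:
  assumes "hermitian n A"
  shows "sesq n A v u = cnj (sesq n A u v)"
proof -
  have "cnj (sesq n A u v) = (\<Sum>i<n. \<Sum>j<n. v i * cnj (A i j) * cnj (u j))"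
    by (simp add: sesq_double_sum)
  also have "\<dots> = (\<Sum>j<n. \<Sum>i<n. v i * cnj (A i j) * cnj (u j))" by (rule sum.swap)
  also have "\<dots> = sesq n A v u"
    unfolding sesq_double_sum by (intro sum.cong refl) (simp add: hermitianD [OF assms] mult_ac)
  finally show ?thesis ..
qed

lemma sq_norm_parallelogram:
  "sq_norm n (\<lambda>i. u i + v i) + sq_norm n (\<lambda>i. u i - v i) = 2 * sq_norm n u + 2 * sq_norm n v"
  unfolding sq_norm_def sum_distrib_left sum.distrib [symmetric]
  by (intro sum.cong refl) (simp only: cmod_power2, simp add: power2_eq_square algebra_simps)

text \<open>For a Hermitian matrix the numerical radius bounds the norm: polarization bounds \<open>Re (sesq n H u w)\<close>, which is
  then used with \<open>w\<close> proportional to \<open>H u\<close>.\<close>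

lemma hermitian_norm_bound:
  assumes H: "hermitian n H" and y: "0 \<le> y"
    and form: "\<And>v. \<bar>Re (sesq n H v v)\<bar> \<le> y * sq_norm n v"
  shows "sq_norm n (app n H v) \<le> y\<^sup>2 * sq_norm n v"
proof -
  have polar: "Re (sesq n H u w) \<le> y / 2 * (sq_norm n u + sq_norm n w)" for u w
  proof -
    have "4 * Re (sesq n H u w) = Re (sesq n H (\<lambda>i. u i + w i) (\<lambda>i. u i + w i)) - Re (sesq n H (\<lambda>i. u i - w i) (\<lambda>i. u i - w i))"
      unfolding sesq_add sesq_diff sesq_swap [OF H, of w u] by simp
    also have "\<dots> \<le> y * sq_norm n (\<lambda>i. u i + w i) + y * sq_norm n (\<lambda>i. u i - w i)"
      using form [of "\<lambda>i. u i + w i"] form [of "\<lambda>i. u i - w i"] by linarith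
    also have "\<dots> = y * (2 * sq_norm n u + 2 * sq_norm n w)"
      unfolding sq_norm_parallelogram [symmetric] by (simp add: algebra_simps)
    finally show ?thesis by (simp add: algebra_simps)
  qed
  define h where "h = sq_norm n (app n H v)"
  have s: "s * h \<le> y / 2 * (sq_norm n v + s\<^sup>2 * h)" for s :: real
  proof -
    have "sesq n H v (\<lambda>i. complex_of_real s * app n H v i) = complex_of_real (s * h)"
      unfolding h_def sesq_def of_real_mult sq_norm_complex sum_distrib_left by (intro sum.cong refl) simp
    then show ?thesis
      using polar [of v "\<lambda>i. complex_of_real s * app n H v i"] by (simp add: sq_norm_scale h_def)
  qed
  have h0: "h \<ge> 0" by (simp add: h_def)
  show ?thesis
  proof (cases "y = 0")
    case True
    then show ?thesis using s [of 1] h0 by (simp add: h_def)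
  next
    case False
    then have y: "y > 0" using y by simp
    have "h / y \<le> y * sq_norm n v / 2 + h / y / 2"
      using s [of "1 / y"] y by (simp add: field_simps power2_eq_square)
    then have "h / y \<le> y * sq_norm n v" by simp
    then show ?thesis using y by (simp add: h_def field_simps power2_eq_square)
  qed
qed

text \<open>A zero of a nonnegative form is a minimum; the first variation there, in the direction \<open>H w\<close>, must vanish.\<close>

lemma psd_kernel:
  assumes H: "hermitian n H" and psd: "\<And>v. 0 \<le> Re (sesq n H v v)"
    and zero: "Re (sesq n H w w) = 0" and i: "i < n"
  shows "app n H w i = 0"
proof -
  define u where "u = app n H w"
  define h where "h = sq_norm n u"
  define q where "q = Re (sesq n H u u)"
  have q: "q \<ge> 0" using psd by (simp add: q_def)
  have wu: "sesq n H w u = complex_of_real h"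
    unfolding h_def sesq_def sq_norm_complex by (simp add: u_def)
  have "0 \<le> - 2 * t * h + t\<^sup>2 * q" for t :: real
  proof -
    have "0 \<le> Re (sesq n H (\<lambda>i. w i - complex_of_real t * u i) (\<lambda>i. w i - complex_of_real t * u i))" by (rule psd)
    also have "\<dots> = Re (sesq n H w w - complex_of_real t * sesq n H w u - complex_of_real t * sesq n H u w
        + complex_of_real (t\<^sup>2) * sesq n H u u)"
      unfolding sesq_diff
      using sesq_scale [of n H 1 w "complex_of_real t" u] sesq_scale [of n H "complex_of_real t" u 1 w]
        sesq_scale [of n H "complex_of_real t" u "complex_of_real t" u] by (simp add: power2_eq_square)
    also have "\<dots> = - 2 * t * h + t\<^sup>2 * q"
      using zero wu sesq_swap [OF H, of u w] by (simp add: q_def)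
    finally show ?thesis .
  qed
  \<comment> \<open>The step of size \<open>h / q\<close> is optimal; \<open>q + 1\<close> avoids a case distinction on \<open>q = 0\<close>.\<close>
  from this [of "h / (q + 1)"] have "0 \<le> h / (q + 1) * (- 2 * h + h / (q + 1) * q)"
    by (simp add: algebra_simps power2_eq_square)
  moreover have "h / (q + 1) * q \<le> h" using q by (simp add: h_def field_simps)
  moreover have "0 \<le> h" by (simp add: h_def)
  ultimately have "h = 0"
  proof (cases "h = 0")
    case False
    then have "h > 0" using \<open>0 \<le> h\<close> by simp
    then have "h / (q + 1) > 0" using q by simp
    then have "0 \<le> - 2 * h + h / (q + 1) * q"
      using \<open>0 \<le> h / (q + 1) * (- 2 * h + h / (q + 1) * q)\<close> by (simp only: zero_le_mult_iff) linarith
    then show ?thesis using \<open>h / (q + 1) * q \<le> h\<close> \<open>h > 0\<close> by linarith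
  qed
  then show ?thesis using i by (simp add: h_def sq_norm_eq_0 u_def)
qed

text \<open>With \<open>D = B - B'\<close> and \<open>S = B + B'\<close>, equality of the squares says \<open>S D + D S = 0\<close>. Hence \<open>tr (D S D) = 0\<close>, a sum of
  values of the form of \<open>S\<close> at the columns of \<open>D\<close>. All of them vanish, so by \<open>psd_kernel\<close> the matrices \<open>B\<close> and \<open>B'\<close>
  annihilate these columns. Then \<open>D D = 0\<close>, which forces \<open>D = 0\<close>.\<close>

lemma psd_sqrt_unique:
  assumes B: "hermitian n B" "\<And>v. 0 \<le> Re (sesq n B v v)"
    and B': "hermitian n B'" "\<And>v. 0 \<le> Re (sesq n B' v v)"
    and eq: "\<And>i j. i < n \<Longrightarrow> j < n \<Longrightarrow> (\<Sum>k<n. B i k * B k j) = (\<Sum>k<n. B' i k * B' k j)"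
    and ij: "i < n" "j < n"
  shows "B i j = B' i j"
proof -
  define D where "D i j = B i j - B' i j" for i j
  define S where "S i j = B i j + B' i j" for i j
  have D: "hermitian n D"
    by (rule hermitianI) (simp add: D_def hermitianD [OF B(1)] hermitianD [OF B'(1)])
  have SD: "(\<Sum>k<n. S i k * D k j) + (\<Sum>k<n. D i k * S k j) = 0" if "i < n" "j < n" for i j
  proof -
    have "(\<Sum>k<n. S i k * D k j) + (\<Sum>k<n. D i k * S k j) = 2 * (\<Sum>k<n. B i k * B k j) - 2 * (\<Sum>k<n. B' i k * B' k j)"
      unfolding sum_distrib_left sum.distrib [symmetric] sum_subtractf [symmetric]
      by (intro sum.cong refl) (simp add: S_def D_def algebra_simps)
    then show ?thesis using eq [OF that] by simp
  qed
  have form: "sesq n S v v = sesq n B v v + sesq n B' v v" for v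
    unfolding sesq_double_sum sum.distrib [symmetric] by (intro sum.cong refl) (simp add: S_def algebra_simps)
  define c where "c l = (\<lambda>i. D i l)" for l
  have tr: "(\<Sum>l<n. sesq n S (c l) (c l)) = (\<Sum>l<n. \<Sum>i<n. D l i * (\<Sum>k<n. S i k * D k l))"
    unfolding sesq_def app_def c_def by (intro sum.cong refl) (simp add: hermitianD [OF D])
  also have "\<dots> = (\<Sum>l<n. \<Sum>i<n. D l i * - (\<Sum>k<n. D i k * S k l))"
  proof (intro sum.cong refl arg_cong2 [where f = "(*)"])
    fix l i assume "l \<in> {..<n}" "i \<in> {..<n}"
    then show "(\<Sum>k<n. S i k * D k l) = - (\<Sum>k<n. D i k * S k l)"
      using SD [of i l] by (simp add: eq_neg_iff_add_eq_0)
  qed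
  also have "\<dots> = - (\<Sum>l<n. \<Sum>i<n. \<Sum>k<n. D l i * D i k * S k l)"
    by (simp add: sum_negf sum_distrib_left mult.assoc)
  also have "(\<Sum>l<n. \<Sum>i<n. \<Sum>k<n. D l i * D i k * S k l) = (\<Sum>i<n. \<Sum>k<n. \<Sum>l<n. D l i * D i k * S k l)"
    by (subst sum.swap, rule sum.cong [OF refl], rule sum.swap)
  also have "\<dots> = (\<Sum>l<n. \<Sum>i<n. D l i * (\<Sum>k<n. S i k * D k l))"
    by (simp add: sum_distrib_left mult_ac)
  finally have "(\<Sum>l<n. sesq n S (c l) (c l)) = 0" unfolding tr by simp
  then have "(\<Sum>l<n. Re (sesq n S (c l) (c l))) = 0" by (simp only: Re_sum [symmetric] zero_complex.sel)
  then have z: "Re (sesq n S (c l) (c l)) = 0" if "l < n" for l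
    using that B(2) B'(2) by (subst (asm) sum_nonneg_eq_0_iff) (auto simp: form intro: add_nonneg_nonneg)
  have "app n B (c l) i = 0 \<and> app n B' (c l) i = 0" if "l < n" "i < n" for l i
  proof -
    have "Re (sesq n B (c l) (c l)) = 0" "Re (sesq n B' (c l) (c l)) = 0"
      using z [OF that(1)] B(2) [of "c l"] B'(2) [of "c l"] unfolding form by auto
    then show ?thesis using psd_kernel [OF B _ that(2)] psd_kernel [OF B' _ that(2)] by blast
  qed
  then have DD: "app n D (c l) i = 0" if "l < n" "i < n" for l i
    using that by (simp add: app_def D_def sum_subtractf left_diff_distrib)
  have "complex_of_real (sq_norm n (c j)) = app n D (c j) j"
    unfolding sq_norm_complex app_def c_def using ij by (intro sum.cong refl) (simp add: hermitianD [OF D])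
  then have "sq_norm n (c j) = 0" using DD ij by simp
  then show ?thesis using ij by (simp add: sq_norm_eq_0 c_def D_def)
qed

fun mpow :: "nat \<Rightarrow> (nat \<Rightarrow> nat \<Rightarrow> complex) \<Rightarrow> nat \<Rightarrow> nat \<Rightarrow> nat \<Rightarrow> complex" where
  "mpow n X 0 i j = (if i = j then 1 else 0)"
| "mpow n X (Suc k) i j = (\<Sum>l<n. X i l * mpow n X k l j)"

lemma mpow_add:
  "i < n \<Longrightarrow> (\<Sum>l<n. mpow n X k i l * mpow n X m l j) = mpow n X (k + m) i j"
proof (induction k arbitrary: i)
  case 0
  then have "(\<Sum>l<n. mpow n X 0 i l * mpow n X m l j) = (\<Sum>l<n. if i = l then mpow n X m l j else 0)"
    by (intro sum.cong refl) simp
  then show ?case using 0 by simp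
next
  case (Suc k)
  have "(\<Sum>l<n. mpow n X (Suc k) i l * mpow n X m l j) = (\<Sum>l<n. \<Sum>p<n. X i p * (mpow n X k p l * mpow n X m l j))"
    by (simp add: sum_distrib_right mult.assoc)
  also have "\<dots> = (\<Sum>p<n. X i p * (\<Sum>l<n. mpow n X k p l * mpow n X m l j))"
    by (subst sum.swap) (simp add: sum_distrib_left)
  also have "\<dots> = mpow n X (Suc k + m) i j" using Suc.IH by simp
  finally show ?case .
qed

lemma mpow_hermitian:
  assumes X: "hermitian n X"
  shows "hermitian n (mpow n X k)"
proof (induction k)
  case 0
  show ?case by (simp add: hermitian_def)
next
  case (Suc k)
  have "cnj (mpow n X (Suc k) i j) = mpow n X (Suc k) j i" if "i < n" "j < n" for i j
  proof -
    have "cnj (mpow n X (Suc k) i j) = (\<Sum>l<n. cnj (X i l) * cnj (mpow n X k l j))" by simp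
    also have "\<dots> = (\<Sum>l<n. mpow n X k j l * X l i)"
      using that by (intro sum.cong refl) (simp add: hermitianD [OF X] hermitianD [OF Suc] mult.commute)
    also have "\<dots> = (\<Sum>l<n. mpow n X k j l * mpow n X 1 l i)"
    proof (intro sum.cong refl arg_cong2 [where f = "(*)"])
      fix l assume "l \<in> {..<n}"
      have "mpow n X 1 l i = (\<Sum>p<n. if p = i then X l p else 0)" unfolding One_nat_def mpow.simps by (intro sum.cong refl) simp
      then show "X l i = mpow n X 1 l i" using that by simp
    qed
    also have "\<dots> = mpow n X (Suc k) j i" using mpow_add [OF that(2), of X k 1 i] by simp
    finally show ?thesis .
  qed
  then show ?case by (rule hermitianI)
qed

lemma mpow_contraction:
  assumes X: "\<And>v. sq_norm n (app n X v) \<le> r\<^sup>2 * sq_norm n v"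
  shows "sq_norm n (app n (mpow n X k) v) \<le> (r ^ k)\<^sup>2 * sq_norm n v"
proof (induction k)
  case 0
  have "app n (mpow n X 0) v i = v i" if "i < n" for i
  proof -
    have "app n (mpow n X 0) v i = (\<Sum>j<n. if i = j then v j else 0)" unfolding app_def by (intro sum.cong refl) simp
    then show ?thesis using that by simp
  qed
  then have "sq_norm n (app n (mpow n X 0) v) = sq_norm n v" by (rule sq_norm_cong)
  then show ?case by (simp del: mpow.simps)
next
  case (Suc k)
  have "app n (mpow n X (Suc k)) v i = app n X (app n (mpow n X k) v) i" for i
    by (simp add: app_def sum_distrib_left sum_distrib_right mult.assoc) (rule sum.swap)
  then have "sq_norm n (app n (mpow n X (Suc k)) v) = sq_norm n (app n X (app n (mpow n X k) v))"
    by (intro sq_norm_cong) simp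
  also have "\<dots> \<le> r\<^sup>2 * sq_norm n (app n (mpow n X k) v)" by (rule X)
  also have "\<dots> \<le> r\<^sup>2 * ((r ^ k)\<^sup>2 * sq_norm n v)" by (intro mult_left_mono Suc) simp
  finally show ?case by (simp add: power_mult_distrib mult_ac del: mpow.simps)
qed

lemma cauchy_schwarz_sq_norm:
  "cmod (\<Sum>i<n. cnj (w i) * v i) \<le> sqrt (sq_norm n w) * sqrt (sq_norm n v)"
proof -
  have "cmod (\<Sum>i<n. cnj (w i) * v i) \<le> (\<Sum>i<n. \<bar>cmod (w i)\<bar> * \<bar>cmod (v i)\<bar>)"
    by (rule order_trans [OF norm_sum]) (simp add: norm_mult)
  also have "\<dots> \<le> L2_set (\<lambda>i. cmod (w i)) {..<n} * L2_set (\<lambda>i. cmod (v i)) {..<n}"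
    by (rule L2_set_mult_ineq)
  finally show ?thesis by (simp add: L2_set_def sq_norm_def)
qed

lemma mpow_bounds:
  assumes X: "\<And>v. sq_norm n (app n X v) \<le> r\<^sup>2 * sq_norm n v" and r: "0 \<le> r"
  shows "cmod (sesq n (mpow n X k) v v) \<le> r ^ k * sq_norm n v"
    and "i < n \<Longrightarrow> j < n \<Longrightarrow> cmod (mpow n X k i j) \<le> r ^ k"
proof -
  have root: "sqrt (sq_norm n (app n (mpow n X k) v)) \<le> r ^ k * sqrt (sq_norm n v)" for v
  proof -
    have "sqrt (sq_norm n (app n (mpow n X k) v)) \<le> sqrt ((r ^ k)\<^sup>2 * sq_norm n v)"
      using mpow_contraction [OF X] by (intro real_sqrt_le_mono) simp
    then show ?thesis using r by (simp add: real_sqrt_mult)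
  qed
  have "cmod (sesq n (mpow n X k) v v) \<le> sqrt (sq_norm n v) * sqrt (sq_norm n (app n (mpow n X k) v))"
    unfolding sesq_def by (rule cauchy_schwarz_sq_norm)
  also have "\<dots> \<le> sqrt (sq_norm n v) * (r ^ k * sqrt (sq_norm n v))"
    by (intro mult_left_mono root) simp
  finally show "cmod (sesq n (mpow n X k) v v) \<le> r ^ k * sq_norm n v"
    by (simp add: mult_ac flip: power2_eq_square)
  show "cmod (mpow n X k i j) \<le> r ^ k" if ij: "i < n" "j < n"
  proof -
    define e where "e l = (if l = j then 1 else 0 :: complex)" for l
    have a: "app n (mpow n X k) e i = mpow n X k i j" for i
      using ij by (simp add: app_def e_def if_distrib [of "\<lambda>x. _ * x"] cong: if_cong)
    have e: "sq_norm n e = 1"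
      using ij by (simp add: sq_norm_def e_def if_distrib [of "\<lambda>x. (cmod x)\<^sup>2"] cong: if_cong)
    have "(cmod (mpow n X k i j))\<^sup>2 \<le> sq_norm n (app n (mpow n X k) e)"
      unfolding sq_norm_def a using ij by (intro member_le_sum) auto
    then have "cmod (mpow n X k i j) \<le> sqrt (sq_norm n (app n (mpow n X k) e))"
      by (rule real_le_rsqrt)
    then show ?thesis using root [of e] e by simp
  qed
qed

text \<open>The Taylor coefficients of \<open>sqrt (1 - x)\<close> at 0.\<close>

definition sqrt_coeff :: "nat \<Rightarrow> real" where
  "sqrt_coeff k = (1/2 gchoose k) * (-1) ^ k"

text \<open>This sign is what makes the matrix square root nonnegative: replacing \<open>X\<close> by its norm can only decrease the series.\<close>

lemma sqrt_coeff_nonpos: "k \<ge> 1 \<Longrightarrow> sqrt_coeff k \<le> 0"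
proof (induction k rule: nat_induct_at_least)
  case base
  show ?case by (simp add: sqrt_coeff_def)
next
  case (Suc k)
  have "sqrt_coeff (Suc k) = sqrt_coeff k * ((real k - 1/2) / (real k + 1))"
    unfolding sqrt_coeff_def gbinomial_rec [of "1/2" k, simplified] 
    by (simp add: gbinomial_prod_rev field_simps)
  moreover have "0 \<le> (real k - 1/2) / (real k + 1)" using Suc by simp
  ultimately show ?case using Suc by (simp only: mult_nonpos_nonneg)
qed

lemma sqrt_coeff_sums:
  assumes "0 \<le> x" "x < 1"
  shows "(\<lambda>k. sqrt_coeff k * x ^ k) sums sqrt (1 - x)"
  using gen_binomial_real [of "- x" "1/2"] assms
  by (simp add: sqrt_coeff_def powr_half_sqrt power_minus [of x] mult.assoc)

lemma sqrt_coeff_abs_summable: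
  assumes "0 \<le> x" "x < 1"
  shows "summable (\<lambda>k. \<bar>sqrt_coeff k\<bar> * x ^ k)"
proof -
  have "summable (\<lambda>k. norm (sqrt_coeff k * x ^ k))"
    by (rule powser_insidea [of sqrt_coeff "(1 + x) / 2"])
       (use assms sqrt_coeff_sums [of "(1 + x) / 2"] in \<open>auto simp: sums_iff\<close>)
  then show ?thesis using assms by (simp add: abs_mult)
qed

text \<open>The Cauchy square of the series of \<open>sqrt (1 - x)\<close> is \<open>1 - x\<close>; on coefficients, this is Vandermonde's identity.\<close>

lemma sqrt_coeff_convolution:
  "(\<Sum>k\<le>m. sqrt_coeff k * sqrt_coeff (m - k)) = (if m = 0 then 1 else if m = 1 then -1 else 0)"
proof -
  have "(\<Sum>k\<le>m. sqrt_coeff k * sqrt_coeff (m - k)) = (\<Sum>k\<le>m. (1/2 gchoose k) * (1/2 gchoose (m - k)) * (-1) ^ m)"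
  proof (rule sum.cong [OF refl])
    fix k assume "k \<in> {..m}"
    then have "(-1::real) ^ k * (-1) ^ (m - k) = (-1) ^ m" by (simp flip: power_add)
    then show "sqrt_coeff k * sqrt_coeff (m - k) = (1/2 gchoose k) * (1/2 gchoose (m - k)) * (-1) ^ m"
      by (simp add: sqrt_coeff_def mult_ac)
  qed
  also have "\<dots> = ((1/2 + 1/2) gchoose m) * (-1) ^ m"
    by (simp only: sum_distrib_right [symmetric] gbinomial_Vandermonde atMost_atLeast0)
  also have "\<dots> = (real 1 gchoose m) * (-1) ^ m" by simp
  also have "\<dots> = (if m = 0 then 1 else if m = 1 then -1 else 0)"
    by (simp only: binomial_gbinomial [symmetric]) (auto simp: binomial_eq_0)
  finally show ?thesis .
qed

text \<open>After division by an upper bound \<open>b\<close> of the form, \<open>R / b = I - X\<close> with \<open>X\<close> Hermitian and of norm at most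
  \<open>r = 1 - d / b < 1\<close>, so the binomial series of \<open>sqrt (1 - x)\<close> converges at \<open>X\<close>.\<close>

lemma psd_sqrt_exists:
  assumes R: "hermitian n R" and d: "d > 0" and coercive: "\<And>v. d * sq_norm n v \<le> Re (sesq n R v v)"
  obtains S where "hermitian n S" "\<And>v. 0 \<le> Re (sesq n S v v)"
    "\<And>i j. i < n \<Longrightarrow> j < n \<Longrightarrow> (\<Sum>k<n. S i k * S k j) = R i j"
proof -
  define b where "b = d + (\<Sum>i<n. \<Sum>j<n. cmod (R i j))"
  have b: "b \<ge> d" "b > 0" using d by (simp_all add: b_def sum_nonneg add_pos_nonneg)
  have upper: "Re (sesq n R v v) \<le> b * sq_norm n v" for v
  proof -
    have sq: "cmod (v i) * cmod (v j) \<le> sq_norm n v" if "i < n" "j < n" for i j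
    proof -
      have m: "(cmod (v i))\<^sup>2 \<le> sq_norm n v" if "i < n" for i
        unfolding sq_norm_def using that by (intro member_le_sum) auto
      have "2 * (cmod (v i) * cmod (v j)) \<le> (cmod (v i))\<^sup>2 + (cmod (v j))\<^sup>2"
        using sum_squares_bound [of "cmod (v i)" "cmod (v j)"] by simp
      then show ?thesis using m [OF that(1)] m [OF that(2)] by linarith
    qed
    have "Re (sesq n R v v) \<le> cmod (sesq n R v v)" by (rule complex_Re_le_cmod)
    also have "\<dots> \<le> (\<Sum>i<n. \<Sum>j<n. cmod (R i j) * (cmod (v i) * cmod (v j)))"
      unfolding sesq_double_sum
      by (rule order_trans [OF norm_sum], rule sum_mono, rule order_trans [OF norm_sum], rule sum_mono)
         (simp add: norm_mult mult_ac)
    also have "\<dots> \<le> (\<Sum>i<n. \<Sum>j<n. cmod (R i j) * sq_norm n v)"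
      using sq by (intro sum_mono mult_left_mono) auto
    also have "\<dots> = (\<Sum>i<n. \<Sum>j<n. cmod (R i j)) * sq_norm n v" by (simp add: sum_distrib_right)
    also have "\<dots> \<le> b * sq_norm n v" using d by (intro mult_right_mono) (auto simp: b_def)
    finally show ?thesis .
  qed
  define X where "X i j = (if i = j then 1 else 0) - R i j / of_real b" for i j
  define r where "r = 1 - d / b"
  have r: "0 \<le> r" "r < 1" using b d by (auto simp: r_def)
  have Xh: "hermitian n X" by (rule hermitianI) (simp add: X_def hermitianD [OF R])
  have Xform: "sesq n X v v = of_real (sq_norm n v) - sesq n R v v / of_real b" for v
  proof -
    have "sesq n X v v = (\<Sum>i<n. \<Sum>j<n. (if i = j then cnj (v i) * v j else 0) - cnj (v i) * R i j * v j / of_real b)"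
      unfolding sesq_double_sum X_def by (intro sum.cong refl) (simp add: algebra_simps)
    also have "\<dots> = (\<Sum>i<n. cnj (v i) * v i) - sesq n R v v / of_real b"
      by (simp add: sum_subtractf sesq_double_sum sum_divide_distrib)
    finally show ?thesis by (simp add: sq_norm_complex)
  qed
  have Xc: "sq_norm n (app n X v) \<le> r\<^sup>2 * sq_norm n v" for v
  proof (rule hermitian_norm_bound [OF Xh r(1)])
    fix v
    have e: "Re (sesq n X v v) = sq_norm n v - Re (sesq n R v v) / b" by (simp add: Xform)
    have "0 \<le> Re (sesq n X v v)" unfolding e using upper [of v] b by (simp add: field_simps)
    moreover have "Re (sesq n X v v) \<le> r * sq_norm n v"
      unfolding e r_def using coercive [of v] b by (simp add: field_simps)
    ultimately show "\<bar>Re (sesq n X v v)\<bar> \<le> r * sq_norm n v" by simp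
  qed
  define a where "a k = complex_of_real (sqrt_coeff k)" for k
  have abs_sum: "summable (\<lambda>k. norm (a k * mpow n X k i j))" if "i < n" "j < n" for i j
  proof (rule summable_comparison_test' [OF sqrt_coeff_abs_summable [OF r], of 0])
    fix k
    show "norm (norm (a k * mpow n X k i j)) \<le> \<bar>sqrt_coeff k\<bar> * r ^ k"
      using mpow_bounds(2) [OF Xc r(1) that, of k] by (simp add: a_def norm_mult mult_left_mono)
  qed
  define S0 where "S0 i j = (\<Sum>k. a k * mpow n X k i j)" for i j
  have S0: "(\<lambda>k. a k * mpow n X k i j) sums S0 i j" if "i < n" "j < n" for i j
    unfolding S0_def using summable_norm_cancel [OF abs_sum [OF that]] by (rule summable_sums)
  have S0h: "hermitian n S0"
  proof (rule hermitianI)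
    fix i j assume ij: "i < n" "j < n"
    have "(\<lambda>k. cnj (a k * mpow n X k i j)) sums cnj (S0 i j)" using S0 [OF ij] by (simp only: sums_cnj)
    moreover have "cnj (a k * mpow n X k i j) = a k * mpow n X k j i" for k
      using ij by (simp add: hermitianD [OF mpow_hermitian [OF Xh]] a_def)
    ultimately have "(\<lambda>k. a k * mpow n X k j i) sums cnj (S0 i j)" by simp
    then show "cnj (S0 i j) = S0 j i" using S0 [OF ij(2,1)] sums_unique2 by blast
  qed
  have S0form: "(\<lambda>k. a k * sesq n (mpow n X k) v v) sums sesq n S0 v v" for v
  proof -
    have "(\<lambda>k. \<Sum>i<n. \<Sum>j<n. cnj (v i) * (a k * mpow n X k i j) * v j) sums sesq n S0 v v"
      unfolding sesq_double_sum by (intro sums_sum sums_mult2 sums_mult S0) auto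
    moreover have "(\<Sum>i<n. \<Sum>j<n. cnj (v i) * (a k * mpow n X k i j) * v j) = a k * sesq n (mpow n X k) v v" for k
      unfolding sesq_double_sum sum_distrib_left by (intro sum.cong refl) (simp add: mult_ac)
    ultimately show ?thesis by simp
  qed
  have S0pos: "0 \<le> Re (sesq n S0 v v)" for v
  proof -
    have 1: "(\<lambda>k. Re (a k * sesq n (mpow n X k) v v)) sums Re (sesq n S0 v v)"
      by (rule sums_Re [OF S0form])
    have 2: "(\<lambda>k. (sqrt_coeff k * r ^ k) * sq_norm n v) sums (sqrt (1 - r) * sq_norm n v)"
      by (intro sums_mult2 sqrt_coeff_sums r)
    have "sqrt_coeff k * r ^ k * sq_norm n v \<le> Re (a k * sesq n (mpow n X k) v v)" for k
    proof (cases "k = 0")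
      case True
      have "sesq n (mpow n X 0) v v = (\<Sum>i<n. \<Sum>j<n. if i = j then cnj (v i) * v j else 0)"
        unfolding sesq_double_sum by (intro sum.cong refl) simp
      then have "sesq n (mpow n X 0) v v = of_real (sq_norm n v)" by (simp add: sq_norm_complex)
      then show ?thesis using True by (simp add: a_def sqrt_coeff_def del: mpow.simps)
    next
      case False
      have "Re (sesq n (mpow n X k) v v) \<le> r ^ k * sq_norm n v"
        using mpow_bounds(1) [OF Xc r(1), of k v] complex_Re_le_cmod order_trans by blast
      then have "sqrt_coeff k * (r ^ k * sq_norm n v) \<le> sqrt_coeff k * Re (sesq n (mpow n X k) v v)"
        using sqrt_coeff_nonpos [of k] False by (intro mult_left_mono_neg) auto
      then show ?thesis by (simp add: a_def mult.assoc)
    qed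
    then have "sqrt (1 - r) * sq_norm n v \<le> Re (sesq n S0 v v)"
      by (rule sums_le [OF _ 2 1])
    moreover have "0 \<le> sqrt (1 - r) * sq_norm n v" using r by simp
    ultimately show ?thesis by linarith
  qed
  have S0sq: "(\<Sum>l<n. S0 i l * S0 l j) = R i j / of_real b" if ij: "i < n" "j < n" for i j
  proof -
    have c: "(\<lambda>m. \<Sum>k\<le>m. (a k * mpow n X k i l) * (a (m - k) * mpow n X (m - k) l j)) sums (S0 i l * S0 l j)" if "l < n" for l
      unfolding S0_def using ij that by (intro Cauchy_product_sums abs_sum) auto
    have "(\<lambda>m. \<Sum>l<n. \<Sum>k\<le>m. (a k * mpow n X k i l) * (a (m - k) * mpow n X (m - k) l j)) sums (\<Sum>l<n. S0 i l * S0 l j)"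
      using c by (intro sums_sum) auto
    moreover have "(\<Sum>l<n. \<Sum>k\<le>m. (a k * mpow n X k i l) * (a (m - k) * mpow n X (m - k) l j))
        = (if m \<in> {0, 1} then (if m = 0 then 1 else -1) * mpow n X m i j else 0)" for m
    proof -
      have "(\<Sum>l<n. \<Sum>k\<le>m. (a k * mpow n X k i l) * (a (m - k) * mpow n X (m - k) l j))
          = (\<Sum>k\<le>m. \<Sum>l<n. (a k * a (m - k)) * (mpow n X k i l * mpow n X (m - k) l j))"
        by (subst sum.swap) (intro sum.cong refl, simp add: mult_ac)
      also have "\<dots> = (\<Sum>k\<le>m. a k * a (m - k) * mpow n X m i j)"
        by (intro sum.cong refl) (simp add: sum_distrib_left [symmetric] mpow_add [OF ij(1)])
      also have "\<dots> = of_real (\<Sum>k\<le>m. sqrt_coeff k * sqrt_coeff (m - k)) * mpow n X m i j"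
        by (simp add: a_def sum_distrib_right)
      finally show ?thesis by (simp add: sqrt_coeff_convolution)
    qed
    ultimately have "(\<lambda>m. if m \<in> {0, 1} then (if m = 0 then 1 else -1) * mpow n X m i j else 0) sums (\<Sum>l<n. S0 i l * S0 l j)"
      by simp
    moreover have "(\<lambda>m. if m \<in> {0, 1} then (if m = 0 then 1 else -1) * mpow n X m i j else 0) sums
        (\<Sum>m\<in>{0, 1}. (if m = 0 then 1 else -1) * mpow n X m i j)"
      by (rule sums_If_finite_set) simp
    ultimately have "(\<Sum>l<n. S0 i l * S0 l j) = (\<Sum>m\<in>{0, 1::nat}. (if m = 0 then 1 else -1) * mpow n X m i j)"
      by (rule sums_unique2)
    moreover have "mpow n X 1 i j = X i j"
    proof -
      have "mpow n X 1 i j = (\<Sum>p<n. if p = j then X i p else 0)" unfolding One_nat_def mpow.simps by (intro sum.cong refl) simp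
      then show ?thesis using ij by simp
    qed
    ultimately show ?thesis using ij by (simp add: X_def del: mpow.simps(2))
  qed
  show ?thesis
  proof (rule that [of "\<lambda>i j. of_real (sqrt b) * S0 i j"])
    show "hermitian n (\<lambda>i j. of_real (sqrt b) * S0 i j)" by (rule hermitianI) (simp add: hermitianD [OF S0h])
    have "sesq n (\<lambda>i j. of_real (sqrt b) * S0 i j) v v = of_real (sqrt b) * sesq n S0 v v" for v
      unfolding sesq_double_sum sum_distrib_left by (intro sum.cong refl) (simp add: mult_ac)
    then show "0 \<le> Re (sesq n (\<lambda>i j. of_real (sqrt b) * S0 i j) v v)" for v using S0pos b by simp
    show "(\<Sum>k<n. of_real (sqrt b) * S0 i k * (of_real (sqrt b) * S0 k j)) = R i j" if "i < n" "j < n" for i j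
    proof -
      have rb: "complex_of_real (sqrt b) * complex_of_real (sqrt b) = complex_of_real b"
        using b by (simp flip: of_real_mult)
      have "(\<Sum>k<n. of_real (sqrt b) * S0 i k * (of_real (sqrt b) * S0 k j))
          = (complex_of_real (sqrt b) * complex_of_real (sqrt b)) * (\<Sum>k<n. S0 i k * S0 k j)"
        unfolding sum_distrib_left by (intro sum.cong refl) (simp only: mult_ac)
      then show ?thesis using S0sq [OF that] b unfolding rb by simp
    qed
  qed
qed

section \<open>Square roots and spectral norms of matrices\<close>

definition entries :: "complex mat \<Rightarrow> nat \<Rightarrow> nat \<Rightarrow> complex" where
  "entries A i j = A $$ (i, j)"

lemma mult_mat_index:
  assumes "A \<in> carrier_mat n m" "B \<in> carrier_mat m p" "i < n" "j < p"
  shows "(A * B) $$ (i, j) = (\<Sum>k<m. A $$ (i, k) * B $$ (k, j))"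
  using assms by (simp add: scalar_prod_def atLeast0LessThan)

lemma mult_mat_vec_index:
  assumes "A \<in> carrier_mat n n" "v \<in> carrier_vec n" "i < n"
  shows "(A *\<^sub>v v) $ i = app n (entries A) (\<lambda>j. v $ j) i"
  using assms by (simp add: scalar_prod_def atLeast0LessThan app_def entries_def)

lemma form_mat:
  assumes A: "A \<in> carrier_mat n n" and v: "v \<in> carrier_vec n"
  shows "(A *\<^sub>v v) \<bullet>c v = sesq n (entries A) (\<lambda>i. v $ i) (\<lambda>i. v $ i)"
proof -
  have "(A *\<^sub>v v) \<bullet>c v = (\<Sum>i<n. (A *\<^sub>v v) $ i * cnj (v $ i))"
    using v unfolding scalar_prod_def atLeast0LessThan by (intro sum.cong) auto
  also have "\<dots> = sesq n (entries A) (\<lambda>i. v $ i) (\<lambda>i. v $ i)"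
    unfolding sesq_def using mult_mat_vec_index [OF A v] by (intro sum.cong refl) (simp add: mult.commute)
  finally show ?thesis .
qed

lemma sesq_cong:
  "(\<And>i. i < n \<Longrightarrow> v i = v' i) \<Longrightarrow> (\<And>i j. i < n \<Longrightarrow> j < n \<Longrightarrow> A i j = A' i j) \<Longrightarrow> sesq n A v v = sesq n A' v' v'"
  unfolding sesq_double_sum by (intro sum.cong refl) simp

lemma pos_semidef_iff:
  assumes A: "A \<in> carrier_mat n n"
  shows "pos_semidef n A \<longleftrightarrow> hermitian n (entries A) \<and> (\<forall>v. 0 \<le> Re (sesq n (entries A) v v))"
proof -
  have 1: "mat_adjoint A = A \<longleftrightarrow> hermitian n (entries A)"
  proof
    assume eq: "mat_adjoint A = A"
    show "hermitian n (entries A)"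
    proof (rule hermitianI)
      fix i j assume ij: "i < n" "j < n"
      have "mat_adjoint A $$ (j, i) = cnj (A $$ (i, j))"
        using ij A by (simp add: index_mat_adjoint)
      then show "cnj (entries A i j) = entries A j i" unfolding eq entries_def by simp
    qed
  next
    assume h: "hermitian n (entries A)"
    show "mat_adjoint A = A"
      using A by (intro eq_matI) (auto simp: index_mat_adjoint hermitianD [OF h, unfolded entries_def])
  qed
  have 2: "(\<forall>v \<in> carrier_vec n. 0 \<le> Re ((A *\<^sub>v v) \<bullet>c v)) \<longleftrightarrow> (\<forall>v. 0 \<le> Re (sesq n (entries A) v v))"
  proof
    assume h: "\<forall>v \<in> carrier_vec n. 0 \<le> Re ((A *\<^sub>v v) \<bullet>c v)"
    show "\<forall>v. 0 \<le> Re (sesq n (entries A) v v)"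
    proof
      fix v :: "nat \<Rightarrow> complex"
      have "0 \<le> Re ((A *\<^sub>v vec n v) \<bullet>c vec n v)" using h by simp
      also have "(A *\<^sub>v vec n v) \<bullet>c vec n v = sesq n (entries A) v v"
        by (subst form_mat [OF A]) (auto intro: sesq_cong)
      finally show "0 \<le> Re (sesq n (entries A) v v)" .
    qed
  next
    assume h: "\<forall>v. 0 \<le> Re (sesq n (entries A) v v)"
    then show "\<forall>v \<in> carrier_vec n. 0 \<le> Re ((A *\<^sub>v v) \<bullet>c v)"
      by (auto simp: form_mat [OF A])
  qed
  show ?thesis unfolding pos_semidef_def using A 1 2 by blast
qed

text \<open>Uniqueness of the root turns the definite description into an equation.\<close>

lemma mat_sqrt_eqI:
  assumes B: "pos_semidef n B" and BB: "B * B = A" and A: "A \<in> carrier_mat n n"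
  shows "mat_sqrt A = B"
  unfolding mat_sqrt_def
proof (rule the_equality)
  have n: "dim_row A = n" using A by simp
  show "pos_semidef (dim_row A) B \<and> B * B = A" using B BB n by simp
  fix B' assume B': "pos_semidef (dim_row A) B' \<and> B' * B' = A"
  have c: "B \<in> carrier_mat n n" "B' \<in> carrier_mat n n" using B B' n by (auto simp: pos_semidef_def)
  show "B' = B"
  proof (rule eq_matI)
    fix i j assume "i < dim_row B" "j < dim_col B"
    then have ij: "i < n" "j < n" using c by auto
    have "entries B' i j = entries B i j"
    proof (rule psd_sqrt_unique [OF _ _ _ _ _ ij])
      fix i j assume ij: "i < n" "j < n"
      have "(B' * B') $$ (i, j) = (B * B) $$ (i, j)" using B' BB by simp
      then show "(\<Sum>k<n. entries B' i k * entries B' k j) = (\<Sum>k<n. entries B i k * entries B k j)"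
        using mult_mat_index [OF c(1,1) ij] mult_mat_index [OF c(2,2) ij] by (simp add: entries_def)
    qed (use B B' n pos_semidef_iff [OF c(1)] pos_semidef_iff [OF c(2)] in auto)
    then show "B' $$ (i, j) = B $$ (i, j)" by (simp add: entries_def)
  qed (use c in auto)
qed

lemma mat_sqrt_diag:
  assumes c: "\<And>i. i < n \<Longrightarrow> 0 \<le> c i"
  shows "mat_sqrt (mat_diag n (\<lambda>i. complex_of_real (c i))) = mat_diag n (\<lambda>i. complex_of_real (sqrt (c i)))"
proof (rule mat_sqrt_eqI)
  let ?B = "mat_diag n (\<lambda>i. complex_of_real (sqrt (c i)))"
  have cB: "?B \<in> carrier_mat n n" by simp
  have e: "entries ?B i j = (if i = j then complex_of_real (sqrt (c i)) else 0)" if "i < n" "j < n" for i j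
    using that by (auto simp: entries_def mat_diag_def)
  have "0 \<le> Re (sesq n (entries ?B) v v)" for v
  proof -
    have "sesq n (entries ?B) v v = (\<Sum>i<n. \<Sum>j<n. if i = j then complex_of_real (sqrt (c i) * (cmod (v i))\<^sup>2) else 0)"
      unfolding sesq_double_sum
      by (intro sum.cong refl) (auto simp: e complex_norm_square [symmetric] mult_ac simp del: of_real_power)
    also have "\<dots> = complex_of_real (\<Sum>i<n. sqrt (c i) * (cmod (v i))\<^sup>2)" by simp
    finally show ?thesis using c by (auto intro!: sum_nonneg mult_nonneg_nonneg simp del: of_real_sum)
  qed
  then show "pos_semidef n ?B"
    unfolding pos_semidef_iff [OF cB] by (auto intro!: hermitianI simp: e)
  show "?B * ?B = mat_diag n (\<lambda>i. complex_of_real (c i))"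
    unfolding mat_diag_diag
    by (rule eq_matI) (auto simp: mat_diag_def c simp flip: of_real_mult)
qed simp

lemma mat_sqrt_coercive:
  assumes A: "A \<in> carrier_mat n n" and h: "hermitian n (entries A)"
    and d: "d > 0" and coercive: "\<And>v. d * sq_norm n v \<le> Re (sesq n (entries A) v v)"
  shows "mat_sqrt A \<in> carrier_mat n n" "hermitian n (entries (mat_sqrt A))" "mat_sqrt A * mat_sqrt A = A"
proof -
  obtain S where S: "hermitian n S" "\<And>v. 0 \<le> Re (sesq n S v v)"
    "\<And>i j. i < n \<Longrightarrow> j < n \<Longrightarrow> (\<Sum>k<n. S i k * S k j) = entries A i j"
    using psd_sqrt_exists [OF h d coercive] by blast
  define B where "B = mat n n (\<lambda>(i, j). S i j)"
  have B: "B \<in> carrier_mat n n" by (simp add: B_def)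
  have e: "entries B i j = S i j" if "i < n" "j < n" for i j using that by (simp add: entries_def B_def)
  have psd: "pos_semidef n B"
    unfolding pos_semidef_iff [OF B]
  proof (intro conjI allI)
    show "hermitian n (entries B)" by (rule hermitianI) (simp add: e hermitianD [OF S(1)])
    have "sesq n (entries B) v v = sesq n S v v" for v by (rule sesq_cong) (simp_all add: e)
    then show "0 \<le> Re (sesq n (entries B) v v)" for v using S(2) by simp
  qed
  have BB: "B * B = A"
  proof (rule eq_matI)
    fix i j assume "i < dim_row A" "j < dim_col A"
    then have ij: "i < n" "j < n" using A by auto
    have "(B * B) $$ (i, j) = (\<Sum>k<n. S i k * S k j)"
      unfolding mult_mat_index [OF B B ij] using ij by (intro sum.cong refl) (simp add: e [unfolded entries_def])
    then show "(B * B) $$ (i, j) = A $$ (i, j)" using S(3) [OF ij] by (simp add: entries_def)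
  qed (use A B in auto)
  have "mat_sqrt A = B" by (rule mat_sqrt_eqI [OF psd BB A])
  then show "mat_sqrt A \<in> carrier_mat n n" "hermitian n (entries (mat_sqrt A))" "mat_sqrt A * mat_sqrt A = A"
    using B BB psd pos_semidef_iff [OF B] by auto
qed

text \<open>A coercive matrix is injective, so its determinant, which is the square of that of the root, does not vanish.\<close>

lemma mat_inv_sqrt_coercive:
  assumes A: "A \<in> carrier_mat n n" and h: "hermitian n (entries A)"
    and d: "d > 0" and coercive: "\<And>v. d * sq_norm n v \<le> Re (sesq n (entries A) v v)"
  shows "mat_inv_sqrt A \<in> carrier_mat n n" "hermitian n (entries (mat_inv_sqrt A))"
    "mat_inv_sqrt A * A * mat_inv_sqrt A = 1\<^sub>m n"
proof -
  let ?Q = "mat_sqrt A"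
  let ?W = "mat_inv_sqrt A"
  note Q = mat_sqrt_coercive [OF A h d coercive]
  have "det A \<noteq> 0"
  proof
    assume "det A = 0"
    then obtain v where v: "v \<in> carrier_vec n" "v \<noteq> 0\<^sub>v n" "A *\<^sub>v v = 0\<^sub>v n"
      using det_0_iff_vec_prod_zero [OF A] by auto
    have "sesq n (entries A) (\<lambda>i. v $ i) (\<lambda>i. v $ i) = 0"
      unfolding form_mat [OF A v(1), symmetric] v(3) using v(1) by simp
    then have "sq_norm n (\<lambda>i. v $ i) = 0"
      using coercive [of "\<lambda>i. v $ i"] d sq_norm_nonneg [of n "\<lambda>i. v $ i"]
      by (simp add: mult_le_0_iff order_antisym)
    then have "v = 0\<^sub>v n" using v(1) by (intro eq_vecI) (auto simp: sq_norm_eq_0)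
    then show False using v(2) by simp
  qed
  moreover have "det A = det ?Q * det ?Q" using det_mult [OF Q(1,1)] Q(3) by simp
  ultimately have "det ?Q \<noteq> 0" by auto
  then have "?Q \<in> Units (ring_mat TYPE(complex) n undefined)" by (rule det_non_zero_imp_unit [OF Q(1)])
  then have "mat_inverse ?Q \<noteq> None" using mat_inverse(1) [OF Q(1), of undefined] by auto
  then have "mat_inverse ?Q = Some ?W" by (simp add: mat_inv_sqrt_def)
  from mat_inverse(2) [OF Q(1) this] have W: "?Q * ?W = 1\<^sub>m n" "?W * ?Q = 1\<^sub>m n" "?W \<in> carrier_mat n n" by auto
  show "?W \<in> carrier_mat n n" by (rule W(3))
  show "hermitian n (entries ?W)"
  proof (rule hermitianI)
    fix i j assume ij: "i < n" "j < n"
    define V where "V = mat n n (\<lambda>(i, j). cnj (?W $$ (j, i)))"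
    have V: "V \<in> carrier_mat n n" by (simp add: V_def)
    have "V * ?Q = 1\<^sub>m n"
    proof (rule eq_matI)
      fix i j assume "i < dim_row (1\<^sub>m n :: complex mat)" "j < dim_col (1\<^sub>m n :: complex mat)"
      then have ij: "i < n" "j < n" by auto
      have "(V * ?Q) $$ (i, j) = (\<Sum>k<n. cnj (?Q $$ (j, k) * ?W $$ (k, i)))"
        unfolding mult_mat_index [OF V Q(1) ij]
        using ij by (intro sum.cong refl) (simp add: V_def hermitianD [OF Q(2), unfolded entries_def] mult.commute)
      also have "\<dots> = cnj ((?Q * ?W) $$ (j, i))"
        unfolding mult_mat_index [OF Q(1) W(3) ij(2,1)] by simp
      finally show "(V * ?Q) $$ (i, j) = (1\<^sub>m n :: complex mat) $$ (i, j)" using ij by (auto simp: W(1))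
    qed (use V Q in auto)
    have "V = V * (?Q * ?W)" using V W by simp
    also have "\<dots> = (V * ?Q) * ?W" using V Q(1) W(3) by (simp add: assoc_mult_mat)
    also have "\<dots> = ?W" using \<open>V * ?Q = 1\<^sub>m n\<close> W(3) by simp
    finally have "V = ?W" .
    then have "?W $$ (j, i) = V $$ (j, i)" by simp
    then show "cnj (entries ?W i j) = entries ?W j i" using ij by (simp add: V_def entries_def)
  qed
  have "?W * A * ?W = ?W * (?Q * ?Q) * ?W" by (simp add: Q(3))
  also have "\<dots> = (?W * ?Q) * (?Q * ?W)" using Q(1) W(3) by (simp add: assoc_mult_mat [of _ n n _ n _ n])
  finally show "?W * A * ?W = 1\<^sub>m n" by (simp add: W(1,2))
qed

lemma l2_norm_sq_norm: "v \<in> carrier_vec n \<Longrightarrow> l2_norm v = sqrt (sq_norm n (\<lambda>i. v $ i))"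
  by (simp add: l2_norm_def L2_set_def sq_norm_def)

lemma op_norm_le:
  assumes A: "A \<in> carrier_mat n n" and h: "hermitian n (entries A)" and y: "0 \<le> y"
    and form: "\<And>v. \<bar>Re (sesq n (entries A) v v)\<bar> \<le> y * sq_norm n v"
  shows "op_norm A \<le> y"
  unfolding op_norm_def
proof (rule cSUP_least)
  have "0\<^sub>v n \<in> {v \<in> carrier_vec (dim_col A). l2_norm v \<le> 1}"
    using A by (simp add: l2_norm_sq_norm [of _ n] sq_norm_def)
  then show "{v \<in> carrier_vec (dim_col A). l2_norm v \<le> 1} \<noteq> {}" by blast
  fix v assume "v \<in> {v \<in> carrier_vec (dim_col A). l2_norm v \<le> 1}"
  then have v: "v \<in> carrier_vec n" "l2_norm v \<le> 1" using A by auto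
  have Av: "A *\<^sub>v v \<in> carrier_vec n" using A v by simp
  have "sq_norm n (\<lambda>i. (A *\<^sub>v v) $ i) = sq_norm n (app n (entries A) (\<lambda>i. v $ i))"
    using mult_mat_vec_index [OF A v(1)] by (intro sq_norm_cong)
  also have "\<dots> \<le> y\<^sup>2 * sq_norm n (\<lambda>i. v $ i)" by (rule hermitian_norm_bound [OF h y form])
  finally have "l2_norm (A *\<^sub>v v) \<le> sqrt (y\<^sup>2 * sq_norm n (\<lambda>i. v $ i))"
    unfolding l2_norm_sq_norm [OF Av] by simp
  also have "\<dots> = y * l2_norm v" using y by (simp add: l2_norm_sq_norm [OF v(1)] real_sqrt_mult)
  also have "\<dots> \<le> y" using y v(2) mult_left_mono [of "l2_norm v" 1 y] by simp
  finally show "l2_norm (A *\<^sub>v v) \<le> y" .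
qed

lemma op_norm_diag_ge:
  assumes i: "i < n" and c: "\<And>j. j < n \<Longrightarrow> 0 \<le> c j"
  shows "c i \<le> op_norm (mat_diag n (\<lambda>j. complex_of_real (c j)))"
proof -
  let ?A = "mat_diag n (\<lambda>j. complex_of_real (c j))"
  have A: "?A \<in> carrier_mat n n" by simp
  define m where "m = (\<Sum>j<n. c j)"
  have m: "c j \<le> m" if "j < n" for j unfolding m_def using that c by (intro member_le_sum) auto
  have m0: "m \<ge> 0" unfolding m_def using c by (intro sum_nonneg) auto
  have entry: "(?A *\<^sub>v v) $ j = complex_of_real (c j) * v $ j" if "v \<in> carrier_vec n" "j < n" for v j
  proof -
    have "(?A *\<^sub>v v) $ j = (\<Sum>k<n. if j = k then complex_of_real (c j) * v $ j else 0)"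
      unfolding mult_mat_vec_index [OF A that] app_def entries_def
      using that by (intro sum.cong refl) (auto simp: mat_diag_def)
    then show ?thesis using that by simp
  qed
  have norm: "l2_norm (?A *\<^sub>v v) = sqrt (\<Sum>j<n. (c j)\<^sup>2 * (cmod (v $ j))\<^sup>2)" if v: "v \<in> carrier_vec n" for v
  proof -
    have "?A *\<^sub>v v \<in> carrier_vec n" by (rule mult_mat_vec_carrier [OF A v])
    then show ?thesis
      unfolding l2_norm_sq_norm [of _ n] sq_norm_def
      by (simp add: l2_norm_sq_norm [of _ n] sq_norm_def entry [OF v] norm_mult power_mult_distrib)
  qed
  define e where "e = vec n (\<lambda>j. if j = i then 1 else 0 :: complex)"
  have e: "e \<in> carrier_vec n" by (simp add: e_def)
  have "c i = sqrt (\<Sum>j<n. if j = i then (c j)\<^sup>2 else 0)" using i c by simp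
  also have "\<dots> = l2_norm (?A *\<^sub>v e)"
    unfolding norm [OF e] by (intro arg_cong [where f = sqrt] sum.cong refl) (simp add: e_def)
  also have "\<dots> \<le> op_norm ?A"
    unfolding op_norm_def
  proof (rule cSUP_upper)
    have "sq_norm n (\<lambda>j. e $ j) = (\<Sum>j<n. if j = i then 1 else 0)"
      unfolding sq_norm_def by (intro sum.cong refl) (simp add: e_def)
    then show "e \<in> {v \<in> carrier_vec (dim_col ?A). l2_norm v \<le> 1}"
      using e i by (simp add: l2_norm_sq_norm [OF e] mat_diag_def)
    show "bdd_above ((\<lambda>v. l2_norm (?A *\<^sub>v v)) ` {v \<in> carrier_vec (dim_col ?A). l2_norm v \<le> 1})"
    proof (rule bdd_aboveI2)
      fix v assume "v \<in> {v \<in> carrier_vec (dim_col ?A). l2_norm v \<le> 1}"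
      then have v: "v \<in> carrier_vec n" "l2_norm v \<le> 1" by (auto simp: mat_diag_def)
      have "(\<Sum>j<n. (c j)\<^sup>2 * (cmod (v $ j))\<^sup>2) \<le> (\<Sum>j<n. m\<^sup>2 * (cmod (v $ j))\<^sup>2)"
        using m c by (intro sum_mono mult_right_mono power_mono) auto
      then have "l2_norm (?A *\<^sub>v v) \<le> sqrt (m\<^sup>2 * sq_norm n (\<lambda>j. v $ j))"
        unfolding norm [OF v(1)] sq_norm_def sum_distrib_left by simp
      also have "\<dots> = m * l2_norm v" using m0 by (simp add: l2_norm_sq_norm [OF v(1)] real_sqrt_mult)
      also have "\<dots> \<le> m" using m0 v(2) mult_left_mono [of "l2_norm v" 1 m] by simp
      finally show "l2_norm (?A *\<^sub>v v) \<le> m" .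
    qed
  qed
  finally show ?thesis .
qed

section \<open>Slow variation and the singularity of the spectral density\<close>

text \<open>Pointwise convergence of \<open>L (v * y m) / L (y m)\<close> to 1 makes the sets of good \<open>v\<close> increase to the whole interval.\<close>

lemma slow_close_sets:
  fixes L :: "real \<Rightarrow> real" and y :: "nat \<Rightarrow> real"
  assumes L: "slowly_varying_on A L" and A: "A > 0" and y: "\<And>m. A \<le> y m" "filterlim y at_top sequentially" and c: "1 \<le> c"
  defines "E \<equiv> \<lambda>n. {v \<in> {1..c}. \<forall>m\<ge>n. \<bar>ln (L (v * y m)) - ln (L (y m))\<bar> \<le> 1/2}"
  shows "E n \<in> sets lebesgue" and "(\<lambda>n. measure lebesgue (E n)) \<longlonglongrightarrow> c - 1"
proof -
  define L' where "L' x = (if x \<in> {A..} then L x else 0)" for x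
  have L'm: "L' \<in> borel_measurable lebesgue"
    unfolding L'_def using L by (subst borel_measurable_if) (auto simp: slowly_varying_on_def)
  have scale: "(\<lambda>v. L' (y m * v)) \<in> borel_measurable lebesgue" for m
    using measurable_compose [OF lebesgue_measurable_scaling [of "y m"] L'm] by simp
  have vy: "A \<le> v * y m" if "1 \<le> v" for v m
  proof -
    have "A * 1 \<le> y m * v" using that y(1) [of m] A by (intro mult_mono) auto
    then show ?thesis by (simp add: mult.commute)
  qed
  have E_eq: "E n = {v \<in> space lebesgue. v \<in> {1..c} \<and> (\<forall>m. n \<le> m \<longrightarrow> \<bar>ln (L' (y m * v)) - ln (L (y m))\<bar> \<le> 1/2)}" for n
    unfolding E_def using vy by (auto simp: L'_def mult.commute)
  show sE: "E n \<in> sets lebesgue" for n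
  proof -
    have "(\<lambda>v. \<bar>ln (L' (y m * v)) - ln (L (y m))\<bar>) \<in> borel_measurable lebesgue" for m
      by (intro borel_measurable_abs borel_measurable_diff borel_measurable_ln scale borel_measurable_const)
    then have s: "{v \<in> space lebesgue. \<bar>ln (L' (y m * v)) - ln (L (y m))\<bar> \<le> 1/2} \<in> sets lebesgue" for m
      by (rule borel_measurable_le) simp
    have "{v \<in> space lebesgue. n \<le> m \<longrightarrow> \<bar>ln (L' (y m * v)) - ln (L (y m))\<bar> \<le> 1/2} \<in> sets lebesgue" for m
      using s [of m] by (cases "n \<le> m") auto
    then have "{v \<in> space lebesgue. \<forall>m. n \<le> m \<longrightarrow> \<bar>ln (L' (y m * v)) - ln (L (y m))\<bar> \<le> 1/2} \<in> sets lebesgue"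
      by (rule sets.sets_Collect_countable_All)
    then have "{1..c} \<inter> {v \<in> space lebesgue. \<forall>m. n \<le> m \<longrightarrow> \<bar>ln (L' (y m * v)) - ln (L (y m))\<bar> \<le> 1/2} \<in> sets lebesgue"
      by (rule sets.Int [rotated]) simp
    also have "{1..c} \<inter> {v \<in> space lebesgue. \<forall>m. n \<le> m \<longrightarrow> \<bar>ln (L' (y m * v)) - ln (L (y m))\<bar> \<le> 1/2} = E n"
      by (rule trans [OF _ E_eq [symmetric]]) blast
    finally show ?thesis .
  qed
  have inc: "incseq E" unfolding E_def by (intro monoI) auto
  have un: "(\<Union>n. E n) = {1..c}"
  proof
    show "(\<Union>n. E n) \<subseteq> {1..c}" by (auto simp: E_def)
    show "{1..c} \<subseteq> (\<Union>n. E n)"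
    proof
      fix v assume v: "v \<in> {1..c}"
      have "((\<lambda>x. L (v * x) / L x) \<longlongrightarrow> 1) at_top" using L v by (auto simp: slowly_varying_on_def)
      then have "(\<lambda>m. L (v * y m) / L (y m)) \<longlonglongrightarrow> 1" using y(2) by (rule filterlim_compose)
      then have "(\<lambda>m. ln (L (v * y m) / L (y m))) \<longlonglongrightarrow> ln 1" by (intro tendsto_ln) auto
      moreover have "ln (L (v * y m) / L (y m)) = ln (L (v * y m)) - ln (L (y m))" for m
      proof -
        have "0 < L (v * y m)" "0 < L (y m)" using L vy [of v m] v y(1) [of m] by (auto simp: slowly_varying_on_def)
        then show ?thesis by (simp add: ln_div)
      qed
      ultimately have "(\<lambda>m. ln (L (v * y m)) - ln (L (y m))) \<longlonglongrightarrow> 0" by simp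
      then have "\<forall>\<^sub>F m in sequentially. \<bar>ln (L (v * y m)) - ln (L (y m))\<bar> < 1/2"
        by (auto dest!: tendstoD [where e = "1/2"] simp: dist_real_def)
      then obtain n where "\<forall>m\<ge>n. \<bar>ln (L (v * y m)) - ln (L (y m))\<bar> < 1/2"
        by (auto simp: eventually_sequentially)
      then have "v \<in> E n" using v by (auto simp: E_def intro: less_imp_le)
      then show "v \<in> (\<Union>n. E n)" by blast
    qed
  qed
  have "(\<lambda>n. measure lebesgue (E n)) \<longlonglongrightarrow> measure lebesgue (\<Union>n. E n)"
  proof (rule Lim_measure_incseq [OF _ inc])
    show "range E \<subseteq> sets lebesgue" using sE by auto
    show "emeasure lebesgue (\<Union> (range E)) \<noteq> \<infinity>" unfolding un using c by simp
  qed
  then show "(\<lambda>n. measure lebesgue (E n)) \<longlonglongrightarrow> c - 1" unfolding un using c by simp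
qed

text \<open>A bound that is uniform over \<open>t\<close>, from convergence for each \<open>t\<close>. If it failed along \<open>x n\<close>, \<open>t n\<close>, then for large
  \<open>n\<close> the set \<open>V n\<close> of the \<open>v\<close> for which \<open>L (v * x n)\<close> is close to \<open>L (x n)\<close>, and the dilation by \<open>t n\<close> of the set \<open>W n\<close>
  of the \<open>w\<close> for which \<open>L (w * t n * x n)\<close> is close to \<open>L (t n * x n)\<close>, would be two subsets of \<open>{1..5}\<close> of
  measure above \<open>7/2\<close> and above 1. They meet, and a common point contradicts the choice of \<open>x n\<close> and \<open>t n\<close>.\<close>

theorem slow_uniform:
  fixes L :: "real \<Rightarrow> real"
  assumes L: "slowly_varying_on A L" and A: "A > 0"
  shows "\<exists>X\<ge>A. \<forall>x\<ge>X. \<forall>t\<in>{1..2}. \<bar>ln (L (t * x)) - ln (L x)\<bar> \<le> 1"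
proof (rule ccontr)
  assume neg: "\<not> ?thesis"
  have "\<exists>x t. A + real n \<le> x \<and> t \<in> {1..2} \<and> \<bar>ln (L (t * x)) - ln (L x)\<bar> > 1" for n
  proof -
    have "A \<le> A + real n" by simp
    then show ?thesis using neg not_le by blast
  qed
  then obtain x t where xt: "\<And>n. A + real n \<le> x n" "\<And>n. t n \<in> {1..2}" "\<And>n. \<bar>ln (L (t n * x n)) - ln (L (x n))\<bar> > 1"
    by metis
  have xA: "A \<le> x n" for n using xt(1) [of n] by simp
  have tx: "x n \<le> t n * x n" for n using xt(2) [of n] xA [of n] A mult_right_mono [of 1 "t n" "x n"] by simp
  have lin: "filterlim (\<lambda>n. A + real n) at_top sequentially"
    by (intro filterlim_tendsto_add_at_top [OF tendsto_const] filterlim_real_sequentially)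
  have xlim: "filterlim x at_top sequentially"
    by (rule filterlim_at_top_mono [OF lin]) (simp add: xt(1))
  have txlim: "filterlim (\<lambda>n. t n * x n) at_top sequentially"
    by (rule filterlim_at_top_mono [OF xlim]) (simp add: tx)
  have txA: "A \<le> t n * x n" for n using xA tx order_trans by blast
  define V where "V n = {v \<in> {1..5}. \<forall>m\<ge>n. \<bar>ln (L (v * x m)) - ln (L (x m))\<bar> \<le> 1/2}" for n
  define W where "W n = {v \<in> {1..5/2}. \<forall>m\<ge>n. \<bar>ln (L (v * (t m * x m))) - ln (L (t m * x m))\<bar> \<le> 1/2}" for n
  have V: "V n \<in> sets lebesgue" "(\<lambda>n. measure lebesgue (V n)) \<longlonglongrightarrow> 5 - 1" for n
    unfolding V_def by (rule slow_close_sets [OF L A xA xlim]; simp)+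
  have W: "W n \<in> sets lebesgue" "(\<lambda>n. measure lebesgue (W n)) \<longlonglongrightarrow> 5/2 - 1" for n
    unfolding W_def by (rule slow_close_sets [OF L A txA txlim]; simp)+
  have "\<forall>\<^sub>F n in sequentially. 7/2 < measure lebesgue (V n)" using order_tendstoD(1) [OF V(2), of "7/2"] by simp
  moreover have "\<forall>\<^sub>F n in sequentially. 1 < measure lebesgue (W n)" using order_tendstoD(1) [OF W(2), of 1] by simp
  ultimately obtain n where n: "7/2 < measure lebesgue (V n)" "1 < measure lebesgue (W n)"
    using eventually_happens [OF eventually_conj] by (metis (no_types, lifting) trivial_limit_sequentially)
  define W' where "W' = (\<lambda>w. t n *\<^sub>R w + 0) ` W n"
  have W's: "W' \<in> sets lebesgue"
  proof -
    have t0: "t n \<noteq> 0" using xt(2) [of n] by auto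
    have "W' = (*\<^sub>R) (1 / t n) -` W n \<inter> space lebesgue"
      unfolding W'_def using t0 by (auto simp: image_iff intro!: bexI [of _ "_ / t n"])
    then show ?thesis using measurable_sets [OF lebesgue_measurable_scaling [of "1 / t n"] W(1)] by simp
  qed
  have V5: "V n \<subseteq> {1..5}" by (auto simp: V_def)
  have W'5: "W' \<subseteq> {1..5}"
  proof
    fix z assume "z \<in> W'"
    then obtain w where w: "w \<in> {1..5/2}" "z = t n * w" by (auto simp: W'_def W_def)
    have t: "1 \<le> t n" "t n \<le> 2" using xt(2) [of n] by auto
    have "1 * 1 \<le> t n * w" "t n * w \<le> 2 * (5/2)" using w t by (intro mult_mono; simp)+
    then show "z \<in> {1..5}" using w by simp
  qed
  have fin: "S \<in> lmeasurable" if "S \<in> sets lebesgue" "S \<subseteq> {1..5::real}" for S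
    using that by (intro bounded_set_imp_lmeasurable) (auto intro: bounded_subset [OF bounded_closed_interval])
  have "measure lebesgue W' = \<bar>t n\<bar> * measure lebesgue (W n)"
    using measure_lebesgue_affine [of "t n" 0 "W n"] by (simp add: W'_def)
  also have "\<dots> \<ge> 1 * measure lebesgue (W n)" using xt(2) [of n] by (intro mult_right_mono) auto
  finally have W'm: "1 < measure lebesgue W'" using n by simp
  have "V n \<inter> W' \<noteq> {}"
  proof
    assume disj: "V n \<inter> W' = {}"
    have "measure lebesgue (V n \<union> W') = measure lebesgue (V n) + measure lebesgue W'"
      using fmeasurableD2 [OF fin [OF V(1) V5]] fmeasurableD2 [OF fin [OF W's W'5]] V(1) W's disj
      by (intro measure_Union) auto
    moreover have "measure lebesgue (V n \<union> W') \<le> measure lebesgue {1..5::real}"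
      using V5 W'5 V(1) W's by (intro measure_mono_fmeasurable) auto
    ultimately show False using n W'm by simp
  qed
  then obtain w where w: "w \<in> W n" "t n * w \<in> V n" by (auto simp: W'_def)
  have "\<bar>ln (L (t n * w * x n)) - ln (L (x n))\<bar> \<le> 1/2" using w(2) by (simp add: V_def)
  moreover have "\<bar>ln (L (t n * w * x n)) - ln (L (t n * x n))\<bar> \<le> 1/2" using w(1) by (simp add: W_def mult_ac)
  ultimately show False using xt(3) [of n] by linarith
qed

text \<open>The ratio \<open>y / x\<close> is a power of 2 times a number in \<open>{1..2}\<close>. Each doubling costs at most \<open>e * ln 2\<close> in the
  logarithm of \<open>L\<close>, and the remaining factor at most 1 by \<open>slow_uniform\<close>.\<close>

theorem potter_bounds:
  fixes L :: "real \<Rightarrow> real"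
  assumes L: "slowly_varying_on A L" and A: "A > 0" and e: "e > 0"
  obtains X where "X \<ge> A" "\<And>x y. X \<le> x \<Longrightarrow> x \<le> y \<Longrightarrow> L y \<le> exp 1 * (y / x) powr e * L x"
    "\<And>x y. X \<le> x \<Longrightarrow> x \<le> y \<Longrightarrow> L x \<le> exp 1 * (y / x) powr e * L y"
proof -
  have pos: "0 < L x" if "A \<le> x" for x using L that by (auto simp: slowly_varying_on_def)
  obtain X1 where X1: "X1 \<ge> A" "\<And>x t. X1 \<le> x \<Longrightarrow> t \<in> {1..2} \<Longrightarrow> \<bar>ln (L (t * x)) - ln (L x)\<bar> \<le> 1"
    using slow_uniform [OF L A] by blast
  have "((\<lambda>x. L (2 * x) / L x) \<longlongrightarrow> 1) at_top" using L by (auto simp: slowly_varying_on_def)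
  then have "((\<lambda>x. ln (L (2 * x) / L x)) \<longlongrightarrow> ln 1) at_top" by (intro tendsto_ln) auto
  then have "\<forall>\<^sub>F x in at_top. \<bar>ln (L (2 * x) / L x)\<bar> < e * ln 2"
    using e by (auto dest!: tendstoD [where e = "e * ln 2"] simp: dist_real_def)
  then obtain X2 where X2: "\<And>x. X2 \<le> x \<Longrightarrow> \<bar>ln (L (2 * x) / L x)\<bar> < e * ln 2"
    by (auto simp: eventually_at_top_linorder)
  define X where "X = max X1 X2"
  have XA: "A \<le> X" using X1 by (simp add: X_def)
  have double: "\<bar>ln (L (2 ^ k * x)) - ln (L x)\<bar> \<le> real k * (e * ln 2)" if x: "X \<le> x" for k x
  proof (induction k)
    case (Suc k)
    have x0: "0 < x" "A \<le> x" using x XA A by auto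
    have "1 * x \<le> 2 ^ k * x" using x0 by (intro mult_right_mono) auto
    then have kx: "X \<le> 2 ^ k * x" using x by simp
    have "A \<le> 2 * (2 ^ k * x)" using kx XA A by simp
    then have "0 < L (2 * (2 ^ k * x))" "0 < L (2 ^ k * x)" using kx XA by (auto intro!: pos)
    then have "ln (L (2 * (2 ^ k * x)) / L (2 ^ k * x)) = ln (L (2 * (2 ^ k * x))) - ln (L (2 ^ k * x))"
      by (simp add: ln_div)
    then have "\<bar>ln (L (2 * (2 ^ k * x))) - ln (L (2 ^ k * x))\<bar> \<le> e * ln 2"
      using X2 [of "2 ^ k * x"] kx by (simp add: X_def)
    then have "\<bar>ln (L (2 ^ Suc k * x)) - ln (L x)\<bar> \<le> e * ln 2 + real k * (e * ln 2)"
      using Suc by (simp add: mult.assoc)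
    then show ?case by (simp add: algebra_simps)
  qed simp
  have main: "\<bar>ln (L y) - ln (L x)\<bar> \<le> 1 + e * ln (y / x)" if xy: "X \<le> x" "x \<le> y" for x y
  proof -
    have x0: "0 < x" "A \<le> x" "0 < y" using xy XA A by auto
    have yx: "1 \<le> y / x" using xy x0 by simp
    obtain k :: nat where k: "2 ^ k \<le> y / x" "y / x < 2 ^ (k + 1)"
    proof -
      define n where "n = (LEAST n. y / x < 2 ^ n)"
      have ex: "\<exists>n. y / x < 2 ^ n" by (rule real_arch_pow) simp
      have n: "y / x < 2 ^ n" unfolding n_def by (rule LeastI_ex [OF ex])
      have "n \<noteq> 0" using n yx by (intro notI) simp
      then obtain k where k: "n = Suc k" using not0_implies_Suc by blast
      have "\<not> y / x < 2 ^ k" by (rule not_less_Least) (simp add: n_def [symmetric] k)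
      then show ?thesis using n k by (intro that [of k]) auto
    qed
    define t where "t = y / (2 ^ k * x)"
    have kx0: "0 < 2 ^ k * x" using x0 by simp
    have t: "t \<in> {1..2}" using k x0 by (auto simp: t_def field_simps)
    have y: "y = t * (2 ^ k * x)" using kx0 x0 by (simp add: t_def)
    have "1 * x \<le> 2 ^ k * x" using x0 by (intro mult_right_mono) auto
    then have "X1 \<le> 2 ^ k * x" using xy by (simp add: X_def)
    then have "\<bar>ln (L y) - ln (L (2 ^ k * x))\<bar> \<le> 1" unfolding y by (rule X1(2)) (rule t)
    then have "\<bar>ln (L y) - ln (L x)\<bar> \<le> 1 + real k * (e * ln 2)"
      using double [OF xy(1), of k] by linarith
    moreover have "ln (2 ^ k) \<le> ln (y / x)" using k(1) yx by (subst ln_le_cancel_iff) auto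
    then have "real k * ln 2 \<le> ln (y / x)" by (simp add: ln_realpow)
    then have "e * (real k * ln 2) \<le> e * ln (y / x)" using e by (intro mult_left_mono) auto
    ultimately show ?thesis by (simp add: mult_ac)
  qed
  have conv: "u \<le> exp 1 * r powr e * w" if "ln u \<le> 1 + e * ln r + ln w" "0 < u" "0 < w" "0 < r" for u w r :: real
  proof -
    have "u = exp (ln u)" using that by simp
    also have "\<dots> \<le> exp (1 + e * ln r + ln w)" by (simp only: exp_le_cancel_iff that(1))
    also have "\<dots> = exp 1 * r powr e * w" using that by (simp add: exp_add powr_def)
    finally show ?thesis .
  qed
  show ?thesis
  proof (rule that [OF XA])
    fix x y assume xy: "X \<le> x" "x \<le> y"
    then have p: "0 < L x" "0 < L y" "0 < y / x" using XA A by (auto intro: pos)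
    show "L y \<le> exp 1 * (y / x) powr e * L x" using main [OF xy] p by (intro conv) linarith+
    show "L x \<le> exp 1 * (y / x) powr e * L y" using main [OF xy] p by (intro conv) linarith+
  qed
qed

text \<open>All that the proof uses about the spectral density. The profile \<open>\<phi> t\<close> is the supremum of \<open>f\<close> over the frequencies of
  modulus at least \<open>t\<close>, but at least \<open>c\<close>. Below a threshold \<open>\<delta>\<close> the Potter bounds say that \<open>f\<close> is, up to constants,
  decreasing and growing at most like the power \<open>b = a + e\<close>; above \<open>\<delta>\<close> it is bounded and can be compared with
  its lower bound \<open>c\<close>. Of the conclusions, \<open>\<phi> t \<le> C * f s\<close> for \<open>\<bar>s\<bar> \<le> t\<close> transfers estimates relative to \<open>\<phi>\<close> to estimates
  relative to \<open>f\<close> (it is conditional on \<open>c \<le> f s\<close>, since this bound holds only almost everywhere); the next two bound \<open>f\<close> by \<open>\<phi>\<close> on both sides of \<open>t\<close>, with an integrable singularity since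
  \<open>b < 1\<close>; the last one bounds the growth of \<open>\<phi>\<close> at 0, where \<open>b < a + \<gamma>\<close> matters.\<close>

theorem spectral_profile:
  fixes f L :: "real \<Rightarrow> real"
  assumes f_bounded: "\<And>\<delta>. \<delta> > 0 \<Longrightarrow> bounded (f ` ({-pi..pi} - {-\<delta><..<\<delta>}))"
    and f_essinf: "essinf (lebesgue_on {-pi<..<pi}) f > 0"
    and a: "0 < a" "a < 1"
    and L: "slowly_varying_on (1 / pi) L"
    and f_L: "\<And>t. t \<in> {-pi..pi} - {0} \<Longrightarrow> f t = L (inverse \<bar>t\<bar>) / \<bar>t\<bar> powr a"
    and \<gamma>: "\<gamma> > 0"
  obtains \<phi> :: "real \<Rightarrow> real" and C c b :: real
  where "0 < c" "0 < C" "0 < b" "b < 1" "b < a + \<gamma>"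
    "AE s in lebesgue_on {-pi<..<pi}. c \<le> f s"
    "\<And>s t. 0 < s \<Longrightarrow> s \<le> t \<Longrightarrow> t \<le> pi \<Longrightarrow> \<phi> t \<le> \<phi> s"
    "\<And>t. 0 < t \<Longrightarrow> t \<le> pi \<Longrightarrow> c \<le> \<phi> t"
    "\<And>s t. c \<le> f s \<Longrightarrow> 0 < \<bar>s\<bar> \<Longrightarrow> \<bar>s\<bar> \<le> t \<Longrightarrow> t \<le> pi \<Longrightarrow> \<phi> t \<le> C * f s"
    "\<And>s t. 0 < \<bar>s\<bar> \<Longrightarrow> \<bar>s\<bar> \<le> t \<Longrightarrow> t \<le> pi \<Longrightarrow> f s \<le> C * (t / \<bar>s\<bar>) powr b * \<phi> t"
    "\<And>s t. 0 < t \<Longrightarrow> t \<le> \<bar>s\<bar> \<Longrightarrow> \<bar>s\<bar> \<le> pi \<Longrightarrow> f s \<le> \<phi> t"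
    "\<And>t. 0 < t \<Longrightarrow> t \<le> pi \<Longrightarrow> \<phi> t \<le> C * (pi / t) powr b * \<phi> pi"
proof -
  \<comment> \<open>Small enough for \<open>a + e\<close> to stay below 1 and below \<open>a + \<gamma>\<close>; \<open>e \<le> a\<close> makes \<open>L x * x powr a\<close> almost increasing.\<close>
  define e where "e = min a (min ((1 - a) / 2) (\<gamma> / 2))"
  have e: "0 < e" "e \<le> a" "a + e < 1" "a + e < a + \<gamma>" using a \<gamma> by (auto simp: e_def min_def field_simps)
  obtain X where X: "X \<ge> 1 / pi" "\<And>x y. X \<le> x \<Longrightarrow> x \<le> y \<Longrightarrow> L y \<le> exp 1 * (y / x) powr e * L x"
    "\<And>x y. X \<le> x \<Longrightarrow> x \<le> y \<Longrightarrow> L x \<le> exp 1 * (y / x) powr e * L y"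
    using potter_bounds [OF L _ e(1)] by auto
  have X0: "X > 0" using X(1) less_le_trans [of 0 "1 / pi" X] by simp
  define \<delta> where "\<delta> = 1 / X"
  have \<delta>: "0 < \<delta>" "\<delta> \<le> pi" using X0 X(1) by (auto simp: \<delta>_def field_simps)
  have Lpos: "0 < L x" if "1 / pi \<le> x" for x using L that by (auto simp: slowly_varying_on_def)
  obtain c where c: "0 < c" "ereal c < essinf (lebesgue_on {-pi<..<pi}) f"
    using ereal_dense2 [OF f_essinf] by auto
  have AEc: "AE s in lebesgue_on {-pi<..<pi}. c \<le> f s"
  proof -
    have "AE s in lebesgue_on {-pi<..<pi}. ereal (- f s) \<le> esssup (lebesgue_on {-pi<..<pi}) (\<lambda>x. ereal (- f x))"
      by (rule esssup_AE)
    then show ?thesis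
    proof eventually_elim
      fix s assume "ereal (- f s) \<le> esssup (lebesgue_on {-pi<..<pi}) (\<lambda>x. ereal (- f x))"
      then have "essinf (lebesgue_on {-pi<..<pi}) f \<le> ereal (f s)"
        unfolding essinf_def by (simp add: ereal_uminus_le_reorder)
      then have "ereal c < ereal (f s)" using c(2) by (rule less_le_trans [rotated])
      then show "c \<le> f s" by simp
    qed
  qed
  define S where "S t = {s. t \<le> \<bar>s\<bar> \<and> \<bar>s\<bar> \<le> pi}" for t :: real
  have bdd: "bdd_above (f ` S t)" if "0 < t" for t
  proof -
    have "S t \<subseteq> {-pi..pi} - {-t<..<t}" by (auto simp: S_def)
    then show ?thesis
      by (intro bounded_imp_bdd_above bounded_subset [OF f_bounded [OF that]] image_mono)
  qed
  define \<phi> where "\<phi> t = max c (Sup (f ` S t))" for t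
  have piS: "pi \<in> S t" if "t \<le> pi" for t using that by (simp add: S_def)
  have P3: "f s \<le> \<phi> t" if "0 < t" "t \<le> \<bar>s\<bar>" "\<bar>s\<bar> \<le> pi" for s t
    unfolding \<phi>_def using cSup_upper [OF _ bdd [OF that(1)], of "f s"] that by (simp add: S_def le_max_iff_disj)
  have \<phi>c: "c \<le> \<phi> t" for t by (simp add: \<phi>_def)
  have \<phi>le: "\<phi> t \<le> u" if "c \<le> u" "\<And>s. s \<in> S t \<Longrightarrow> f s \<le> u" "t \<le> pi" for t u
    unfolding \<phi>_def using that piS [of t] by (auto intro!: cSup_least)
  have anti: "\<phi> t \<le> \<phi> s" if "0 < s" "s \<le> t" "t \<le> pi" for s t
    by (rule \<phi>le) (use that \<phi>c P3 in \<open>auto simp: S_def\<close>)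
  define D where "D = \<phi> \<delta>"
  have D: "c \<le> D" "D > 0" using \<phi>c [of \<delta>] c(1) by (auto simp: D_def)
  define C where "C = exp 1 * (1 + D / c)"
  have C1: "exp 1 \<le> C" using D c(1) by (simp add: C_def)
  have e1: "1 \<le> exp (1::real)" by simp
  have C2: "exp 1 * D \<le> C * c" using D c(1) by (simp add: C_def field_simps)
  have "1 * D \<le> exp 1 * D" using e1 D by (intro mult_right_mono) auto
  then have C3: "D \<le> C * c" using C2 by linarith
  have C0: "C \<ge> 1" "C > 0" using C1 e1 by linarith+
  have fx: "f s = L (1 / \<bar>s\<bar>) * (1 / \<bar>s\<bar>) powr a" if "0 < \<bar>s\<bar>" "\<bar>s\<bar> \<le> pi" for s
  proof -
    have "s \<in> {-pi..pi} - {0}" using that by auto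
    from f_L [OF this] show ?thesis using that by (simp add: powr_divide inverse_eq_divide)
  qed
  have small_lower: "f s' \<le> exp 1 * f s" if s: "0 < \<bar>s\<bar>" "\<bar>s\<bar> \<le> \<bar>s'\<bar>" "\<bar>s'\<bar> \<le> \<delta>" for s s'
  proof -
    define x y where "x = 1 / \<bar>s'\<bar>" and "y = 1 / \<bar>s\<bar>"
    have x: "X \<le> x" using s X0 by (simp add: x_def \<delta>_def field_simps)
    have xy: "x \<le> y" using s by (simp add: x_def y_def frac_le)
    have x0: "0 < x" "0 < y" using x xy X0 by auto
    have "(y / x) powr e * x powr a \<le> (y / x) powr a * x powr a"
      using xy x0 e by (intro mult_right_mono powr_mono) auto
    also have "\<dots> = y powr a" using x0 by (simp add: powr_divide)
    finally have p: "(y / x) powr e * x powr a \<le> y powr a" .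
    have Ly: "0 < L y" using x xy X(1) by (intro Lpos) linarith
    have "f s' = L x * x powr a" using s \<delta> by (subst fx) (auto simp: x_def)
    also have "\<dots> \<le> exp 1 * (y / x) powr e * L y * x powr a" using X(3) [OF x xy] by (intro mult_right_mono) auto
    also have "\<dots> = exp 1 * L y * ((y / x) powr e * x powr a)" by simp
    also have "\<dots> \<le> exp 1 * L y * y powr a" using Ly by (intro mult_left_mono p) auto
    also have "\<dots> = exp 1 * (L y * y powr a)" by simp
    also have "L y * y powr a = f s" using s \<delta> by (subst fx) (auto simp: y_def)
    finally show ?thesis .
  qed
  have small_upper: "f s \<le> exp 1 * (t / \<bar>s\<bar>) powr (a + e) * f t" if s: "0 < \<bar>s\<bar>" "\<bar>s\<bar> \<le> t" "t \<le> \<delta>" for s t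
  proof -
    define x y where "x = 1 / t" and "y = 1 / \<bar>s\<bar>"
    have t0: "0 < t" using s by linarith
    have x: "X \<le> x" using s t0 X0 by (simp add: x_def \<delta>_def field_simps)
    have xy: "x \<le> y" using s by (simp add: x_def y_def frac_le)
    have x0: "0 < x" "0 < y" using x xy X0 by auto
    have r: "y / x = t / \<bar>s\<bar>" using s t0 by (simp add: x_def y_def)
    have "f s = L y * y powr a" using s \<delta> by (subst fx) (auto simp: y_def)
    also have "\<dots> \<le> exp 1 * (y / x) powr e * L x * y powr a" using X(2) [OF x xy] by (intro mult_right_mono) auto
    also have "y powr a = (y / x) powr a * x powr a" using x0 by (simp add: powr_divide)
    also have "exp 1 * (y / x) powr e * L x * ((y / x) powr a * x powr a) = exp 1 * (y / x) powr (a + e) * (L x * x powr a)"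
      by (simp add: powr_add)
    also have "L x * x powr a = f t" using s t0 \<delta> by (subst fx) (auto simp: x_def)
    finally show ?thesis by (simp add: r)
  qed
  have P1: "\<phi> t \<le> C * f s" if s: "c \<le> f s" "0 < \<bar>s\<bar>" "\<bar>s\<bar> \<le> t" "t \<le> pi" for s t
  proof (rule \<phi>le)
    have fs: "0 < f s" using s c(1) by linarith
    have "1 * f s \<le> C * f s" using C0 fs by (intro mult_right_mono) auto
    then show "c \<le> C * f s" using s by linarith
    fix s' assume s': "s' \<in> S t"
    show "f s' \<le> C * f s"
    proof (cases "\<bar>s'\<bar> \<le> \<delta>")
      case True
      have "f s' \<le> exp 1 * f s" using s s' True by (intro small_lower) (auto simp: S_def)
      also have "\<dots> \<le> C * f s" using C1 fs by (intro mult_right_mono) auto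
      finally show ?thesis .
    next
      case False
      have "f s' \<le> D" unfolding D_def using False s' \<delta> by (intro P3) (auto simp: S_def)
      also have "D \<le> C * c" by (rule C3)
      also have "\<dots> \<le> C * f s" using s C0 by (intro mult_left_mono) auto
      finally show ?thesis .
    qed
  qed (use that in simp)
  have P2: "f s \<le> C * (t / \<bar>s\<bar>) powr (a + e) * \<phi> t" if s: "0 < \<bar>s\<bar>" "\<bar>s\<bar> \<le> t" "t \<le> pi" for s t
  proof -
    have ts: "1 \<le> t / \<bar>s\<bar>" using s by simp
    have p1: "1 \<le> (t / \<bar>s\<bar>) powr (a + e)" using ts a e by (intro ge_one_powr_ge_zero) auto
    have \<phi>0: "0 < \<phi> t" using \<phi>c [of t] c(1) by linarith
    show ?thesis
    proof (cases "\<bar>s\<bar> \<le> \<delta>")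
      case True
      show ?thesis
      proof (cases "t \<le> \<delta>")
        case t: True
        have "f s \<le> exp 1 * (t / \<bar>s\<bar>) powr (a + e) * f t" by (rule small_upper) (use s t in auto)
        also have "\<dots> \<le> exp 1 * (t / \<bar>s\<bar>) powr (a + e) * \<phi> t" using s by (intro mult_left_mono P3) auto
        also have "\<dots> \<le> C * (t / \<bar>s\<bar>) powr (a + e) * \<phi> t" using C1 \<phi>0 by (intro mult_right_mono) auto
        finally show ?thesis .
      next
        case t: False
        have "f s \<le> exp 1 * (\<delta> / \<bar>s\<bar>) powr (a + e) * f \<delta>" by (rule small_upper) (use s True in auto)
        also have "\<dots> \<le> exp 1 * (\<delta> / \<bar>s\<bar>) powr (a + e) * D" unfolding D_def using \<delta> by (intro mult_left_mono P3) auto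
        also have "\<dots> \<le> exp 1 * (t / \<bar>s\<bar>) powr (a + e) * D"
          using t s \<delta> D a e by (intro mult_right_mono mult_left_mono powr_mono2 divide_right_mono) auto
        also have "\<dots> = exp 1 * D * (t / \<bar>s\<bar>) powr (a + e)" by simp
        also have "\<dots> \<le> (C * c) * (t / \<bar>s\<bar>) powr (a + e)" using C2 by (intro mult_right_mono) auto
        also have "\<dots> \<le> (C * \<phi> t) * (t / \<bar>s\<bar>) powr (a + e)" using C0 \<phi>c by (intro mult_right_mono mult_left_mono) auto
        finally show ?thesis by (simp add: mult_ac)
      qed
    next
      case False
      have "f s \<le> D" unfolding D_def using False s \<delta> by (intro P3) auto
      also have "D \<le> C * c" by (rule C3)
      also have "\<dots> \<le> C * \<phi> t" using C0 \<phi>c by (intro mult_left_mono) auto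
      also have "\<dots> \<le> C * \<phi> t * (t / \<bar>s\<bar>) powr (a + e)"
        using p1 C0 \<phi>0 mult_left_mono [OF p1, of "C * \<phi> t"] by simp
      finally show ?thesis by (simp add: mult_ac)
    qed
  qed
  have P4: "\<phi> t \<le> C * (pi / t) powr (a + e) * \<phi> pi" if t: "0 < t" "t \<le> pi" for t
  proof (rule \<phi>le)
    have \<phi>0: "0 < \<phi> pi" using \<phi>c [of pi] c(1) by linarith
    have "1 \<le> (pi / t) powr (a + e)" using t a e by (intro ge_one_powr_ge_zero) auto
    then have "1 * 1 \<le> C * (pi / t) powr (a + e)" using C0 by (intro mult_mono) auto
    then have "1 * \<phi> pi \<le> C * (pi / t) powr (a + e) * \<phi> pi" using \<phi>0 by (intro mult_right_mono) auto
    then show "c \<le> C * (pi / t) powr (a + e) * \<phi> pi" using \<phi>c [of pi] by linarith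
    fix s assume "s \<in> S t"
    then have s: "t \<le> \<bar>s\<bar>" "\<bar>s\<bar> \<le> pi" "0 < \<bar>s\<bar>" using t by (auto simp: S_def)
    have "f s \<le> C * (pi / \<bar>s\<bar>) powr (a + e) * \<phi> pi" by (rule P2) (use s in auto)
    also have "\<dots> \<le> C * (pi / t) powr (a + e) * \<phi> pi"
      using s t C0 \<phi>0 a e by (intro mult_right_mono mult_left_mono powr_mono2 divide_left_mono) auto
    finally show "f s \<le> C * (pi / t) powr (a + e) * \<phi> pi" .
  qed (use t in auto)
  show ?thesis
    by (rule that [of c C "a + e" \<phi>]) (use c(1) C0 a e AEc anti \<phi>c P1 P2 P3 P4 in auto)
qed

section \<open>Toeplitz forms and symbols\<close>

abbreviation circ :: "real measure" where "circ \<equiv> lebesgue_on {-pi..pi}"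

definition trig :: "nat \<Rightarrow> (nat \<Rightarrow> complex) \<Rightarrow> real \<Rightarrow> complex" where
  "trig M v t = (\<Sum>q<M. v q * cis (real q * t))"

lemma finite_measure_circ: "finite_measure circ"
  by (intro finite_measureI) (simp add: emeasure_restrict_space space_restrict_space)

lemma measure_circ: "measure circ (space circ) = 2 * pi"
  by (simp add: measure_restrict_space space_restrict_space)

lemma integrable_circ_continuous:
  fixes g :: "real \<Rightarrow> 'b::euclidean_space"
  shows "continuous_on {-pi..pi} g \<Longrightarrow> integrable circ g"
  by (rule continuous_imp_integrable_real)

lemma measurable_circ_continuous:
  fixes g :: "real \<Rightarrow> 'b::euclidean_space"
  shows "continuous_on {-pi..pi} g \<Longrightarrow> g \<in> borel_measurable circ"
  by (rule borel_measurable_integrable [OF integrable_circ_continuous])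

lemma integrable_circ_mult:
  fixes f :: "real \<Rightarrow> real" and g :: "real \<Rightarrow> real"
  assumes f: "integrable circ f" and g: "continuous_on {-pi..pi} g"
  shows "integrable circ (\<lambda>t. f t * g t)"
proof -
  have "bounded (g ` {-pi..pi})" by (intro compact_imp_bounded compact_continuous_image g compact_Icc)
  then obtain B where B: "\<And>t. t \<in> {-pi..pi} \<Longrightarrow> \<bar>g t\<bar> \<le> B"
    unfolding bounded_iff by (metis imageI real_norm_def)
  show ?thesis
  proof (rule Bochner_Integration.integrable_bound)
    show "integrable circ (\<lambda>t. B * f t)" using f by simp
    show "(\<lambda>t. f t * g t) \<in> borel_measurable circ"
      using borel_measurable_integrable [OF f] measurable_circ_continuous [OF g] by measurable
    show "AE t in circ. norm (f t * g t) \<le> norm (B * f t)"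
    proof (rule AE_I2)
      fix t assume "t \<in> space circ"
      then have "\<bar>g t\<bar> \<le> B" using B by (simp add: space_restrict_space)
      then show "norm (f t * g t) \<le> norm (B * f t)"
        using mult_left_mono [of "\<bar>g t\<bar>" "\<bar>B\<bar>" "\<bar>f t\<bar>"] by (simp add: abs_mult mult.commute)
    qed
  qed
qed

lemma integrable_circ_mult_cis:
  assumes "integrable circ f"
  shows "integrable circ (\<lambda>t. complex_of_real (f t) * cis (r * t))"
proof -
  have 1: "integrable circ (\<lambda>t. f t * cos (r * t))" "integrable circ (\<lambda>t. f t * sin (r * t))"
    by (intro integrable_circ_mult assms continuous_intros)+
  have "integrable circ (\<lambda>t. complex_of_real (f t * cos (r * t)) + \<i> * complex_of_real (f t * sin (r * t)))"
    using 1 by (intro Bochner_Integration.integrable_add integrable_mult_right integrable_of_real)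
  also have "(\<lambda>t. complex_of_real (f t * cos (r * t)) + \<i> * complex_of_real (f t * sin (r * t)))
      = (\<lambda>t. complex_of_real (f t) * cis (r * t))"
    by (auto simp: complex_eq_iff)
  finally show ?thesis .
qed

lemma autocov_circ:
  "autocov f k = complex_of_real (1 / (2 * pi)) * (LINT t|circ. complex_of_real (f t) * cis (- real_of_int k * t))"
proof -
  have e: "exp (- \<i> * of_int k * complex_of_real t) = cis (- real_of_int k * t)" for t
    by (simp add: cis_conv_exp mult_ac)
  have "(LINT t|circ. complex_of_real (f t) * cis (- real_of_int k * t))
      = (LINT t|lebesgue. indicator {-pi..pi} t *\<^sub>R (complex_of_real (f t) * cis (- real_of_int k * t)))"
    by (rule integral_restrict_space) simp
  then show ?thesis unfolding autocov_def set_lebesgue_integral_def e by simp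
qed

lemma cis_int_integral:
  "(LINT t|circ. cis (real_of_int k * t)) = (if k = 0 then complex_of_real (2 * pi) else 0)"
proof (cases "k = 0")
  case True
  then show ?thesis by (simp add: measure_circ [simplified] scaleR_conv_of_real)
next
  case False
  define F where "F t = Complex (sin (real_of_int k * t) / real_of_int k) (- cos (real_of_int k * t) / real_of_int k)" for t
  have d: "(F has_vector_derivative cis (real_of_int k * t)) (at t within {-pi..pi})" for t
  proof -
    have 1: "((\<lambda>t. complex_of_real (sin (real_of_int k * t) / real_of_int k)) has_vector_derivative complex_of_real (cos (real_of_int k * t))) (at t within {-pi..pi})"
      by (rule has_vector_derivative_of_real)
         (use False in \<open>auto intro!: derivative_eq_intros simp: has_real_derivative_iff_has_vector_derivative [symmetric]\<close>)
    have 2: "((\<lambda>t. complex_of_real (- cos (real_of_int k * t) / real_of_int k)) has_vector_derivative complex_of_real (sin (real_of_int k * t))) (at t within {-pi..pi})"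
      by (rule has_vector_derivative_of_real)
         (use False in \<open>auto intro!: derivative_eq_intros simp: has_real_derivative_iff_has_vector_derivative [symmetric]\<close>)
    have "((\<lambda>t. complex_of_real (sin (real_of_int k * t) / real_of_int k) + \<i> * complex_of_real (- cos (real_of_int k * t) / real_of_int k))
        has_vector_derivative complex_of_real (cos (real_of_int k * t)) + \<i> * complex_of_real (sin (real_of_int k * t))) (at t within {-pi..pi})"
      by (intro has_vector_derivative_add has_vector_derivative_mult_right 1 2)
    moreover have "complex_of_real (cos (real_of_int k * t)) + \<i> * complex_of_real (sin (real_of_int k * t)) = cis (real_of_int k * t)"
      by (simp add: complex_eq_iff)
    moreover have "(\<lambda>t. complex_of_real (sin (real_of_int k * t) / real_of_int k) + \<i> * complex_of_real (- cos (real_of_int k * t) / real_of_int k)) = F"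
      by (auto simp: F_def complex_eq_iff)
    ultimately show ?thesis by simp
  qed
  have "((\<lambda>t. cis (real_of_int k * t)) has_integral (F pi - F (- pi))) {-pi..pi}"
    by (rule fundamental_theorem_of_calculus) (use d in auto)
  moreover have "F pi - F (- pi) = 0"
    using sin_int_times_real [of k] by (simp add: F_def complex_eq_iff sin_integer_2pi sin_npi_int mult.commute)
  ultimately have "integral {-pi..pi} (\<lambda>t. cis (real_of_int k * t)) = 0" by (simp add: integral_unique)
  moreover have "(LINT t|circ. cis (real_of_int k * t)) = integral {-pi..pi} (\<lambda>t. cis (real_of_int k * t))"
    by (intro lebesgue_integral_eq_integral integrable_circ_continuous continuous_intros) auto
  ultimately show ?thesis using False by simp
qed

lemma continuous_on_trig [continuous_intros]: "continuous_on S (trig M v)"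
  unfolding trig_def by (intro continuous_intros)

text \<open>Under the integral, the sum over the entries is the product of the trigonometric polynomial of \<open>v\<close> and its conjugate.\<close>

theorem toeplitz_form:
  assumes f: "integrable circ f"
  shows "(\<Sum>p<M. \<Sum>q<M. cnj (v p) * autocov f (int p - int q) * v q)
       = complex_of_real (1 / (2 * pi) * (LINT t|circ. f t * (cmod (trig M v t))\<^sup>2))"
proof -
  have sq: "complex_of_real (f t * (cmod (trig M v t))\<^sup>2)
      = (\<Sum>p<M. \<Sum>q<M. cnj (v p) * v q * (complex_of_real (f t) * cis (- real_of_int (int p - int q) * t)))" for t
  proof -
    have "complex_of_real ((cmod (trig M v t))\<^sup>2) = cnj (trig M v t) * trig M v t"
      by (simp only: complex_norm_square mult.commute)
    also have "\<dots> = (\<Sum>p<M. \<Sum>q<M. (cnj (v p) * cis (- (real p * t))) * (v q * cis (real q * t)))"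
      unfolding trig_def cnj_sum sum_product by (simp add: cis_cnj)
    also have "\<dots> = (\<Sum>p<M. \<Sum>q<M. cnj (v p) * v q * cis (- real_of_int (int p - int q) * t))"
    proof (intro sum.cong refl)
      fix p q
      have "cis (- (real p * t)) * cis (real q * t) = cis (- real_of_int (int p - int q) * t)"
        unfolding cis_mult by (simp add: algebra_simps)
      then show "(cnj (v p) * cis (- (real p * t))) * (v q * cis (real q * t)) = cnj (v p) * v q * cis (- real_of_int (int p - int q) * t)"
        by (metis (no_types, lifting) mult.assoc mult.left_commute)
    qed
    finally have e: "complex_of_real ((cmod (trig M v t))\<^sup>2) = (\<Sum>p<M. \<Sum>q<M. cnj (v p) * v q * cis (- real_of_int (int p - int q) * t))" .
    show ?thesis unfolding of_real_mult e sum_distrib_left by (intro sum.cong refl) (simp only: mult_ac)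
  qed
  have "complex_of_real (LINT t|circ. f t * (cmod (trig M v t))\<^sup>2)
      = (LINT t|circ. (\<Sum>p<M. \<Sum>q<M. cnj (v p) * v q * (complex_of_real (f t) * cis (- real_of_int (int p - int q) * t))))"
    by (simp only: integral_complex_of_real [symmetric] sq)
  also have "\<dots> = (\<Sum>p<M. \<Sum>q<M. cnj (v p) * v q * (LINT t|circ. complex_of_real (f t) * cis (- real_of_int (int p - int q) * t)))"
  proof -
    have i: "integrable circ (\<lambda>t. cnj (v p) * v q * (complex_of_real (f t) * cis (- real_of_int (int p - int q) * t)))" for p q
      by (intro integrable_mult_right integrable_circ_mult_cis f)
    have "(LINT t|circ. (\<Sum>p<M. \<Sum>q<M. cnj (v p) * v q * (complex_of_real (f t) * cis (- real_of_int (int p - int q) * t))))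
      = (\<Sum>p<M. \<Sum>q<M. (LINT t|circ. cnj (v p) * v q * (complex_of_real (f t) * cis (- real_of_int (int p - int q) * t))))"
      by (subst Bochner_Integration.integral_sum, intro Bochner_Integration.integrable_sum i)
         (intro sum.cong refl Bochner_Integration.integral_sum i)
    then show ?thesis by (simp only: integral_mult_right_zero)
  qed
  finally have "complex_of_real (LINT t|circ. f t * (cmod (trig M v t))\<^sup>2)
      = (\<Sum>p<M. \<Sum>q<M. cnj (v p) * v q * (LINT t|circ. complex_of_real (f t) * cis (- real_of_int (int p - int q) * t)))" .
  then show ?thesis
    unfolding autocov_circ of_real_mult by (simp only: sum_distrib_left mult_ac)
qed

lemma autocov_one: "autocov (\<lambda>_. 1) k = (if k = 0 then 1 else 0)"
  unfolding autocov_circ using cis_int_integral [of "- k"] by auto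

lemma parseval: "1 / (2 * pi) * (LINT t|circ. (cmod (trig M v t))\<^sup>2) = sq_norm M v"
proof -
  interpret finite_measure circ by (rule finite_measure_circ)
  have "complex_of_real (1 / (2 * pi) * (LINT t|circ. 1 * (cmod (trig M v t))\<^sup>2))
     = (\<Sum>p<M. \<Sum>q<M. cnj (v p) * autocov (\<lambda>_. 1) (int p - int q) * v q)"
    by (rule toeplitz_form [symmetric]) simp
  also have "\<dots> = (\<Sum>p<M. \<Sum>q<M. if p = q then cnj (v p) * v q else 0)"
    by (intro sum.cong refl) (simp add: autocov_one)
  also have "\<dots> = complex_of_real (sq_norm M v)" by (simp add: sq_norm_complex)
  finally show ?thesis by (simp only: of_real_eq_iff mult_1_left)
qed

text \<open>Both forms are integrals against the same nonnegative weight, the squared modulus of \<open>trig M v\<close>.\<close>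

lemma toeplitz_form_mono:
  assumes f: "integrable circ f" and g: "integrable circ g" and le: "AE t in circ. \<bar>g t\<bar> \<le> B * f t"
  shows "\<bar>Re (sesq M (\<lambda>p q. autocov g (int p - int q)) v v)\<bar> \<le> B * Re (sesq M (\<lambda>p q. autocov f (int p - int q)) v v)"
proof -
  have c: "continuous_on {-pi..pi} (\<lambda>t. (cmod (trig M v t))\<^sup>2)" by (intro continuous_intros)
  have "\<bar>LINT t|circ. g t * (cmod (trig M v t))\<^sup>2\<bar> \<le> (LINT t|circ. \<bar>g t * (cmod (trig M v t))\<^sup>2\<bar>)"
    by (rule integral_abs_bound)
  also have "\<dots> \<le> (LINT t|circ. B * (f t * (cmod (trig M v t))\<^sup>2))"
  proof (rule integral_mono_AE)
    show "integrable circ (\<lambda>t. \<bar>g t * (cmod (trig M v t))\<^sup>2\<bar>)" by (intro integrable_abs integrable_circ_mult g c)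
    show "integrable circ (\<lambda>t. B * (f t * (cmod (trig M v t))\<^sup>2))" by (intro integrable_mult_right integrable_circ_mult f c)
    show "AE t in circ. \<bar>g t * (cmod (trig M v t))\<^sup>2\<bar> \<le> B * (f t * (cmod (trig M v t))\<^sup>2)"
      using le by eventually_elim (simp add: abs_mult mult_right_mono flip: mult.assoc)
  qed
  also have "\<dots> = B * (LINT t|circ. f t * (cmod (trig M v t))\<^sup>2)" by simp
  finally have "1 / (2 * pi) * \<bar>LINT t|circ. g t * (cmod (trig M v t))\<^sup>2\<bar> \<le> 1 / (2 * pi) * (B * (LINT t|circ. f t * (cmod (trig M v t))\<^sup>2))"
    by (intro mult_left_mono) auto
  then show ?thesis
    unfolding sesq_double_sum toeplitz_form [OF f] toeplitz_form [OF g] by (simp add: abs_mult)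
qed

text \<open>Sums over all entries of a square matrix, rearranged along the diagonals that the estimator averages.\<close>

lemma diag_sum:
  fixes h :: "nat \<Rightarrow> nat \<Rightarrow> 'a::comm_monoid_add"
  shows "(\<Sum>p<M. \<Sum>q<M. h p q) = (\<Sum>k\<in>{- int M<..<int M}.
     \<Sum>i\<in>{i. 0 \<le> i \<and> i < int M \<and> 0 \<le> i + k \<and> i + k < int M}. h (nat (i + k)) (nat i))"
proof -
  have fin: "finite {i. 0 \<le> i \<and> i < int M \<and> 0 \<le> i + k \<and> i + k < int M}" for k
    by (rule finite_subset [of _ "{0..int M}"]) auto
  have "(\<Sum>p<M. \<Sum>q<M. h p q) = (\<Sum>(p, q)\<in>{..<M} \<times> {..<M}. h p q)"
    by (simp add: sum.cartesian_product)
  also have "\<dots> = (\<Sum>(k, i)\<in>(SIGMA k:{- int M<..<int M}. {i. 0 \<le> i \<and> i < int M \<and> 0 \<le> i + k \<and> i + k < int M}). h (nat (i + k)) (nat i))"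
    by (rule sum.reindex_bij_witness [where i = "\<lambda>(k, i). (nat (i + k), nat i)" and j = "\<lambda>(p, q). (int p - int q, int q)"]) auto
  also have "\<dots> = (\<Sum>k\<in>{- int M<..<int M}. \<Sum>i\<in>{i. 0 \<le> i \<and> i < int M \<and> 0 \<le> i + k \<and> i + k < int M}. h (nat (i + k)) (nat i))"
    using fin by (intro sum.Sigma [symmetric]) auto
  finally show ?thesis .
qed

lemma card_diag:
  assumes "k \<in> {- int M<..<int M}"
  shows "real (card {i. 0 \<le> i \<and> i < int M \<and> 0 \<le> i + k \<and> i + k < int M}) = real M - \<bar>real_of_int k\<bar>"
proof -
  have "{i. 0 \<le> i \<and> i < int M \<and> 0 \<le> i + k \<and> i + k < int M} = {max 0 (- k)..<min (int M) (int M - k)}"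
    by auto
  then show ?thesis using assms by (auto simp: min_def max_def)
qed

text \<open>The trigonometric polynomial with coefficients \<open>T\<close>: the spectral function of least degree of the Toeplitz matrix
  with these coefficients.\<close>

definition symbol :: "nat \<Rightarrow> (int \<Rightarrow> complex) \<Rightarrow> real \<Rightarrow> complex" where
  "symbol M T t = (\<Sum>k\<in>{- int M<..<int M}. T k * cis (real_of_int k * t))"

lemma symbol_double_sum:
  "symbol M T t = (\<Sum>p<M. \<Sum>q<M. T (int p - int q) * cis (real_of_int (int p - int q) * t)
      / complex_of_real (real M - \<bar>real_of_int (int p - int q)\<bar>))"
proof -
  let ?I = "\<lambda>k. {i. 0 \<le> i \<and> i < int M \<and> 0 \<le> i + k \<and> i + k < int M}"
  let ?h = "\<lambda>k. T k * cis (real_of_int k * t) / complex_of_real (real M - \<bar>real_of_int k\<bar>)"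
  have "(\<Sum>p<M. \<Sum>q<M. ?h (int p - int q)) = (\<Sum>k\<in>{- int M<..<int M}. \<Sum>i\<in>?I k. ?h (int (nat (i + k)) - int (nat i)))"
    by (rule diag_sum)
  also have "\<dots> = (\<Sum>k\<in>{- int M<..<int M}. \<Sum>i\<in>?I k. ?h k)" by (intro sum.cong refl) auto
  also have "\<dots> = symbol M T t"
    unfolding symbol_def
  proof (intro sum.cong refl)
    fix k assume k: "k \<in> {- int M<..<int M}"
    then have nz: "real M - \<bar>real_of_int k\<bar> \<noteq> 0" by auto
    have cancel: "complex_of_real r * (z / complex_of_real r) = z" if "r \<noteq> 0" for r z
      using that by simp
    have "(\<Sum>i\<in>?I k. ?h k) = complex_of_real (real (card (?I k))) * ?h k" by simp
    then show "(\<Sum>i\<in>?I k. ?h k) = T k * cis (real_of_int k * t)"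
      by (simp only: card_diag [OF k] cancel [OF nz])
  qed
  finally show ?thesis by simp
qed

lemma continuous_on_symbol [continuous_intros]: "continuous_on S (symbol M T)"
  unfolding symbol_def by (intro continuous_intros)

lemma symbol_real:
  assumes T: "\<And>k. T (- k) = cnj (T k)"
  shows "symbol M T t = complex_of_real (Re (symbol M T t))"
proof -
  have "cnj (symbol M T t) = (\<Sum>k\<in>{- int M<..<int M}. T (- k) * cis (real_of_int (- k) * t))"
    unfolding symbol_def cnj_sum by (intro sum.cong refl) (simp add: T cis_cnj)
  also have "\<dots> = symbol M T t"
    unfolding symbol_def
    by (rule sum.reindex_bij_witness [where i = uminus and j = uminus]) auto
  finally show ?thesis by (metis Reals_cnj_iff complex_is_Real_iff complex_eq_iff Re_complex_of_real Im_complex_of_real)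
qed

text \<open>Orthogonality of the exponentials: the Toeplitz matrix with coefficients \<open>T\<close> has the symbol as a spectral function.\<close>

lemma autocov_symbol:
  assumes T: "\<And>k. T (- k) = cnj (T k)" and k: "k \<in> {- int M<..<int M}"
  shows "autocov (\<lambda>t. Re (symbol M T t)) k = T k"
proof -
  have i: "integrable circ (\<lambda>t. T j * cis (real_of_int (j - k) * t))" for j
    by (intro integrable_mult_right integrable_circ_continuous continuous_intros)
  have "(LINT t|circ. complex_of_real (Re (symbol M T t)) * cis (- real_of_int k * t))
      = (LINT t|circ. (\<Sum>j\<in>{- int M<..<int M}. T j * cis (real_of_int (j - k) * t)))"
  proof (rule Bochner_Integration.integral_cong [OF refl])
    fix t
    have "complex_of_real (Re (symbol M T t)) * cis (- real_of_int k * t) = symbol M T t * cis (- real_of_int k * t)"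
      using symbol_real [where T = T and M = M and t = t, OF T] by simp
    also have "\<dots> = (\<Sum>j\<in>{- int M<..<int M}. T j * cis (real_of_int (j - k) * t))"
      unfolding symbol_def sum_distrib_right
      by (intro sum.cong refl) (simp add: mult.assoc cis_mult algebra_simps)
    finally show "complex_of_real (Re (symbol M T t)) * cis (- real_of_int k * t)
      = (\<Sum>j\<in>{- int M<..<int M}. T j * cis (real_of_int (j - k) * t))" .
  qed
  also have "\<dots> = (\<Sum>j\<in>{- int M<..<int M}. T j * (LINT t|circ. cis (real_of_int (j - k) * t)))"
    by (subst Bochner_Integration.integral_sum, rule i) (simp only: integral_mult_right_zero)
  also have "\<dots> = (\<Sum>j\<in>{- int M<..<int M}. if j = k then T k * complex_of_real (2 * pi) else 0)"
    unfolding cis_int_integral by (intro sum.cong refl) auto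
  also have "\<dots> = T k * complex_of_real (2 * pi)" using k by simp
  finally show ?thesis unfolding autocov_circ by simp
qed

lemma norm_cis_diff_le: "cmod (cis a - cis b) \<le> \<bar>a - b\<bar>"
proof -
  have "cis a - cis b = cis b * (exp (\<i> * complex_of_real (a - b)) - 1)"
    by (simp only: cis_conv_exp [symmetric] right_diff_distrib mult_1_right cis_mult) simp
  then have "cmod (cis a - cis b) = 2 * \<bar>sin ((a - b) / 2)\<bar>"
    by (simp only: norm_mult norm_cis mult_1_left dist_exp_i_1)
  also have "\<dots> \<le> 2 * \<bar>(a - b) / 2\<bar>" by (intro mult_left_mono abs_sin_x_le_abs_x) simp
  finally show ?thesis by simp
qed

text \<open>Each coefficient is at most the supremum \<open>G\<close> of the modulus of the symbol, and there are fewer than \<open>2 M\<close> of them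
  with frequencies below \<open>M\<close>, so the symbol is Lipschitz with constant \<open>2 M\<^sup>2 G\<close>. Applied at a point where \<open>G\<close> is attained,
  this shows \<open>G \<le> 2 y \<Psi>\<close> when the grid is fine enough, and this bound on \<open>G\<close> turns the Lipschitz estimate into the
  claim. The predicate \<open>P\<close> records
  how the grid point lies relative to \<open>t\<close>.\<close>

theorem symbol_grid:
  fixes \<psi> :: "real \<Rightarrow> real" and \<Theta> :: "real set"
  assumes T: "\<And>k. T (- k) = cnj (T k)" and M: "M \<ge> 1"
    and grid: "\<And>t. t \<in> {-pi..pi} \<Longrightarrow> \<exists>u\<in>\<Theta>. \<bar>t - u\<bar> \<le> h \<and> P t u" and \<Theta>: "\<Theta> \<subseteq> {-pi..pi}"
    and h: "0 \<le> h" "4 * (real M)\<^sup>2 * h \<le> 1"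
    and small: "\<And>u. u \<in> \<Theta> \<Longrightarrow> \<bar>Re (symbol M T u)\<bar> \<le> y * \<psi> u"
    and \<psi>: "\<And>u. u \<in> \<Theta> \<Longrightarrow> \<psi> u \<le> \<Psi>" and y: "y \<ge> 0" and t: "t \<in> {-pi..pi}"
  shows "\<exists>u\<in>\<Theta>. \<bar>t - u\<bar> \<le> h \<and> P t u \<and> \<bar>Re (symbol M T t)\<bar> \<le> y * \<psi> u + 4 * (real M)\<^sup>2 * h * y * \<Psi>"
proof -
  define g where "g t = Re (symbol M T t)" for t
  have cg: "continuous_on {-pi..pi} (\<lambda>t. \<bar>g t\<bar>)" unfolding g_def by (intro continuous_intros)
  obtain t0 where t0: "t0 \<in> {-pi..pi}" "\<And>t. t \<in> {-pi..pi} \<Longrightarrow> \<bar>g t\<bar> \<le> \<bar>g t0\<bar>"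
    using continuous_attains_sup [OF compact_Icc _ cg] by (auto simp: less_imp_le)
  define G where "G = \<bar>g t0\<bar>"
  have coef: "cmod (T k) \<le> G" if k: "k \<in> {- int M<..<int M}" for k
  proof -
    have "T k = complex_of_real (1 / (2 * pi)) * (LINT t|circ. complex_of_real (g t) * cis (- real_of_int k * t))"
      using autocov_symbol [where T = T, OF T k] unfolding autocov_circ g_def by simp
    then have "cmod (T k) = 1 / (2 * pi) * cmod (LINT t|circ. complex_of_real (g t) * cis (- real_of_int k * t))"
      by (simp add: norm_mult norm_divide)
    also have "\<dots> \<le> 1 / (2 * pi) * (LINT t|circ. cmod (complex_of_real (g t) * cis (- real_of_int k * t)))"
      by (intro mult_left_mono integral_norm_bound) simp
    also have "\<dots> \<le> 1 / (2 * pi) * (LINT t|circ. G)"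
    proof (intro mult_left_mono integral_mono)
      show "integrable circ (\<lambda>t. cmod (complex_of_real (g t) * cis (- real_of_int k * t)))"
        unfolding g_def by (intro integrable_circ_continuous continuous_intros)
      show "integrable circ (\<lambda>t. G)" by (intro integrable_circ_continuous continuous_intros)
      fix t assume "t \<in> space circ"
      then show "cmod (complex_of_real (g t) * cis (- real_of_int k * t)) \<le> G"
        using t0(2) [of t] by (simp add: norm_mult G_def space_restrict_space)
    qed simp
    also have "\<dots> = G" using measure_circ by simp
    finally show ?thesis .
  qed
  have G0: "G \<ge> 0" by (simp add: G_def)
  have lip: "\<bar>g s - g t\<bar> \<le> 2 * (real M)\<^sup>2 * G * \<bar>s - t\<bar>" for s t
  proof -
    have "\<bar>g s - g t\<bar> \<le> cmod (symbol M T s - symbol M T t)"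
      unfolding g_def minus_complex.sel(1) [symmetric] by (rule abs_Re_le_cmod)
    also have "symbol M T s - symbol M T t = (\<Sum>k\<in>{- int M<..<int M}. T k * (cis (real_of_int k * s) - cis (real_of_int k * t)))"
      unfolding symbol_def sum_subtractf [symmetric] right_diff_distrib ..
    also have "cmod \<dots> \<le> (\<Sum>k\<in>{- int M<..<int M}. G * (real M * \<bar>s - t\<bar>))"
    proof (rule order_trans [OF norm_sum], rule sum_mono)
      fix k assume k: "k \<in> {- int M<..<int M}"
      have "cmod (cis (real_of_int k * s) - cis (real_of_int k * t)) \<le> \<bar>real_of_int k * s - real_of_int k * t\<bar>"
        by (rule norm_cis_diff_le)
      also have "\<dots> = \<bar>real_of_int k\<bar> * \<bar>s - t\<bar>" by (simp add: abs_mult [symmetric] algebra_simps)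
      also have "\<dots> \<le> real M * \<bar>s - t\<bar>" using k by (intro mult_right_mono) auto
      finally show "cmod (T k * (cis (real_of_int k * s) - cis (real_of_int k * t))) \<le> G * (real M * \<bar>s - t\<bar>)"
        unfolding norm_mult using coef [OF k] G0 by (intro mult_mono) auto
    qed
    also have "\<dots> = real (card {- int M<..<int M}) * (G * (real M * \<bar>s - t\<bar>))" by simp
    also have "\<dots> \<le> (2 * real M) * (G * (real M * \<bar>s - t\<bar>))"
      using G0 by (intro mult_right_mono) auto
    finally show ?thesis by (simp add: power2_eq_square mult_ac)
  qed
  have near: "\<exists>u\<in>\<Theta>. \<bar>t - u\<bar> \<le> h \<and> P t u \<and> \<bar>g t\<bar> \<le> y * \<psi> u + 2 * (real M)\<^sup>2 * h * G" if t: "t \<in> {-pi..pi}" for t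
  proof -
    obtain u where u: "u \<in> \<Theta>" "\<bar>t - u\<bar> \<le> h" "P t u" using grid [OF t] by blast
    have "2 * (real M)\<^sup>2 * G * \<bar>t - u\<bar> \<le> 2 * (real M)\<^sup>2 * G * h" using u G0 by (intro mult_left_mono) auto
    then have "\<bar>g t\<bar> \<le> y * \<psi> u + 2 * (real M)\<^sup>2 * h * G"
      using lip [of t u] small [OF u(1)] by (simp add: g_def mult_ac)
    then show ?thesis using u by blast
  qed
  have GG: "G \<le> 2 * y * \<Psi>"
  proof -
    obtain u where u: "u \<in> \<Theta>" "\<bar>g t0\<bar> \<le> y * \<psi> u + 2 * (real M)\<^sup>2 * h * G" using near [OF t0(1)] by blast
    have "y * \<psi> u \<le> y * \<Psi>" using \<psi> [OF u(1)] y by (intro mult_left_mono)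
    moreover have "4 * (real M)\<^sup>2 * h * G \<le> 1 * G" using h G0 by (intro mult_right_mono) auto
    ultimately show ?thesis using u(2) unfolding G_def [symmetric] by linarith
  qed
  obtain u where u: "u \<in> \<Theta>" "\<bar>t - u\<bar> \<le> h" "P t u" "\<bar>g t\<bar> \<le> y * \<psi> u + 2 * (real M)\<^sup>2 * h * G" using near [OF t] by blast
  have "2 * (real M)\<^sup>2 * h * G \<le> 2 * (real M)\<^sup>2 * h * (2 * y * \<Psi>)" using GG h by (intro mult_left_mono) auto
  then have "\<bar>g t\<bar> \<le> y * \<psi> u + 4 * (real M)\<^sup>2 * h * y * \<Psi>" using u(4) by (simp add: mult_ac)
  then show ?thesis using u unfolding g_def by blast
qed

section \<open>The matrix of the symbol at a frequency\<close>

text \<open>The inverse of the number of entries on the diagonal through \<open>(j, k)\<close>.\<close>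

definition wt :: "nat \<Rightarrow> nat \<Rightarrow> nat \<Rightarrow> real" where
  "wt M j k = 1 / (real M - \<bar>real j - real k\<bar>)"

lemma wt_pos: "j < M \<Longrightarrow> k < M \<Longrightarrow> 0 < wt M j k"
  by (auto simp: wt_def abs_if)

lemma wt_sym: "wt M j k = wt M k j"
  by (simp add: wt_def abs_minus_commute)

lemma sum_inverse_harm: "(\<Sum>j<M. 1 / (real j + 1)) = harm M"
  by (induction M) (simp_all add: harm_Suc harm_def inverse_eq_divide add.commute)

lemma sum_inverse_rev: "(\<Sum>j<M. 1 / (real M - real j)) = harm M"
proof -
  have "(\<Sum>j<M. 1 / (real M - real j)) = (\<Sum>j<M. 1 / (real (M - Suc j) + 1))"
    by (intro sum.cong refl) (simp add: of_nat_diff)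
  also have "\<dots> = (\<Sum>j<M. 1 / (real j + 1))" by (rule sum.nat_diff_reindex)
  finally show ?thesis by (simp only: sum_inverse_harm)
qed

lemma wt_row_sum:
  assumes j: "j < M"
  shows "(\<Sum>k<M. wt M j k) \<le> 2 * harm M"
proof -
  have le: "wt M j k \<le> (if k \<le> j then 1 / (real M - real (j - k)) else 1 / (real M - real (k - j)))" for k
    by (auto simp: wt_def of_nat_diff)
  have "(\<Sum>k<M. wt M j k) = (\<Sum>k\<in>{..j} \<union> {j<..<M}. wt M j k)"
    using j by (intro sum.cong) auto
  also have "\<dots> = (\<Sum>k\<in>{..j}. wt M j k) + (\<Sum>k\<in>{j<..<M}. wt M j k)"
    by (rule sum.union_disjoint) auto
  also have "(\<Sum>k\<in>{..j}. wt M j k) = (\<Sum>i\<in>{..j}. 1 / (real M - real i))"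
    by (rule sum.reindex_bij_witness [where i = "\<lambda>i. j - i" and j = "\<lambda>i. j - i"]) (auto simp: wt_def of_nat_diff)
  also have "\<dots> \<le> (\<Sum>i<M. 1 / (real M - real i))"
    using j by (intro sum_mono2) auto
  also have "(\<Sum>k\<in>{j<..<M}. wt M j k) = (\<Sum>i\<in>{0<..<M - j}. 1 / (real M - real i))"
    by (rule sum.reindex_bij_witness [where i = "\<lambda>i. j + i" and j = "\<lambda>i. i - j"]) (auto simp: wt_def of_nat_diff)
  also have "\<dots> \<le> (\<Sum>i<M. 1 / (real M - real i))"
    by (intro sum_mono2) auto
  finally show ?thesis unfolding sum_inverse_rev by simp
qed

text \<open>Along each diagonal the squared weights add up to the weight itself.\<close>

lemma wt_square_sum: "(\<Sum>j<M. \<Sum>k<M. (wt M j k)\<^sup>2) \<le> 2 * harm M"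
proof -
  let ?I = "\<lambda>k. {i. 0 \<le> i \<and> i < int M \<and> 0 \<le> i + k \<and> i + k < int M}"
  have "(\<Sum>j<M. \<Sum>k<M. (wt M j k)\<^sup>2) = (\<Sum>k\<in>{- int M<..<int M}. \<Sum>i\<in>?I k. (wt M (nat (i + k)) (nat i))\<^sup>2)"
    by (rule diag_sum)
  also have "\<dots> = (\<Sum>k\<in>{- int M<..<int M}. 1 / (real M - \<bar>real_of_int k\<bar>))"
  proof (intro sum.cong refl)
    fix k assume k: "k \<in> {- int M<..<int M}"
    have nz: "real M - \<bar>real_of_int k\<bar> \<noteq> 0" using k by auto
    have "(\<Sum>i\<in>?I k. (wt M (nat (i + k)) (nat i))\<^sup>2) = (\<Sum>i\<in>?I k. (1 / (real M - \<bar>real_of_int k\<bar>))\<^sup>2)"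
      by (intro sum.cong refl) (auto simp: wt_def)
    also have "\<dots> = real (card (?I k)) * (1 / (real M - \<bar>real_of_int k\<bar>))\<^sup>2" by simp
    finally show "(\<Sum>i\<in>?I k. (wt M (nat (i + k)) (nat i))\<^sup>2) = 1 / (real M - \<bar>real_of_int k\<bar>)"
      unfolding card_diag [OF k] using nz by (simp add: power2_eq_square)
  qed
  also have "\<dots> = (\<Sum>k\<in>{- int M<..<0}. 1 / (real M - \<bar>real_of_int k\<bar>)) + (\<Sum>k\<in>{0..<int M}. 1 / (real M - \<bar>real_of_int k\<bar>))"
  proof -
    have e: "{- int M<..<int M} = {- int M<..<0} \<union> {0..<int M}" by auto
    show ?thesis unfolding e by (rule sum.union_disjoint) auto
  qed
  also have "(\<Sum>k\<in>{0..<int M}. 1 / (real M - \<bar>real_of_int k\<bar>)) = (\<Sum>j<M. 1 / (real M - real j))"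
    by (rule sum.reindex_bij_witness [where i = int and j = nat]) auto
  also have "(\<Sum>k\<in>{- int M<..<0}. 1 / (real M - \<bar>real_of_int k\<bar>)) = (\<Sum>j\<in>{0<..<M}. 1 / (real M - real j))"
    by (rule sum.reindex_bij_witness [where i = "\<lambda>j. - int j" and j = "\<lambda>k. nat (- k)"]) auto
  also have "\<dots> \<le> (\<Sum>j<M. 1 / (real M - real j))" by (intro sum_mono2) auto
  finally show ?thesis unfolding sum_inverse_rev by simp
qed

text \<open>Summation by parts: a geometric sum with weights of bounded variation decays like the inverse distance of \<open>z\<close> to 1.\<close>

lemma abel_bound:
  fixes w :: "nat \<Rightarrow> real" and z :: complex
  assumes z: "cmod z = 1" and M: "M \<ge> 1"
  shows "cmod ((1 - z) * (\<Sum>k<M. of_real (w k) * z ^ k)) \<le> \<bar>w 0\<bar> + \<bar>w (M - 1)\<bar> + (\<Sum>k<M - 1. \<bar>w (Suc k) - w k\<bar>)"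
proof -
  have "(1 - z) * (\<Sum>k<Suc m. of_real (w k) * z ^ k)
      = of_real (w 0) - of_real (w m) * z ^ Suc m + (\<Sum>k<m. of_real (w (Suc k) - w k) * z ^ Suc k)" for m
  proof (induction m)
    case 0
    show ?case by (simp add: algebra_simps)
  next
    case (Suc m)
    have eq: "(1 - z) * (\<Sum>k<Suc (Suc m). of_real (w k) * z ^ k)
        = (1 - z) * (\<Sum>k<Suc m. of_real (w k) * z ^ k) + (1 - z) * (of_real (w (Suc m)) * z ^ Suc m)"
      by (simp only: sum.lessThan_Suc [of _ "Suc m"] distrib_left)
    have alg: "(of_real (w 0) - of_real (w m) * z ^ Suc m + B) + (1 - z) * (of_real (w (Suc m)) * z ^ Suc m)
        = of_real (w 0) - of_real (w (Suc m)) * z ^ Suc (Suc m) + (B + of_real (w (Suc m) - w m) * z ^ Suc m)" for B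
      by (simp add: algebra_simps)
    show ?case unfolding eq Suc.IH by (simp only: sum.lessThan_Suc [of _ m] alg)
  qed
  from this [of "M - 1"] have e: "(1 - z) * (\<Sum>k<M. of_real (w k) * z ^ k)
      = of_real (w 0) - of_real (w (M - 1)) * z ^ M + (\<Sum>k<M - 1. of_real (w (Suc k) - w k) * z ^ Suc k)"
    using M by simp
  have "cmod ((1 - z) * (\<Sum>k<M. of_real (w k) * z ^ k)) \<le> cmod (of_real (w 0)) + cmod (of_real (w (M - 1)) * z ^ M)
      + cmod (\<Sum>k<M - 1. of_real (w (Suc k) - w k) * z ^ Suc k)"
    unfolding e by (intro order_trans [OF norm_triangle_ineq] add_mono norm_triangle_ineq4) auto
  also have "cmod (\<Sum>k<M - 1. of_real (w (Suc k) - w k) * z ^ Suc k) \<le> (\<Sum>k<M - 1. \<bar>w (Suc k) - w k\<bar>)"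
    by (rule order_trans [OF norm_sum]) (simp only: norm_mult norm_power z norm_of_real power_one mult_1_right order_refl)
  finally show ?thesis using z by (simp add: norm_mult norm_power)
qed

text \<open>The weights of a row decrease up to the main diagonal and increase after it, so their variation telescopes.\<close>

lemma wt_variation:
  assumes j: "j < M"
  shows "(\<Sum>k<M - 1. \<bar>wt M j (Suc k) - wt M j k\<bar>) \<le> wt M j 0 + wt M j (M - 1)"
proof -
  have down: "\<bar>wt M j (Suc k) - wt M j k\<bar> = wt M j k - wt M j (Suc k)" if "k < j" for k
  proof -
    have "wt M j (Suc k) \<le> wt M j k" using that j by (auto simp: wt_def frac_le)
    then show ?thesis by simp
  qed
  have up: "\<bar>wt M j (Suc k) - wt M j k\<bar> = wt M j (Suc k) - wt M j k" if "j \<le> k" "k < M - 1" for k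
  proof -
    have "wt M j k \<le> wt M j (Suc k)" using that j by (auto simp: wt_def frac_le)
    then show ?thesis by simp
  qed
  have p: "0 < wt M j j" using wt_pos [of j M j] j by simp
  have "(\<Sum>k<M - 1. \<bar>wt M j (Suc k) - wt M j k\<bar>) = (\<Sum>k\<in>{..<j} \<union> {j..<M - 1}. \<bar>wt M j (Suc k) - wt M j k\<bar>)"
    using j by (intro sum.cong) auto
  also have "\<dots> = (\<Sum>k<j. \<bar>wt M j (Suc k) - wt M j k\<bar>) + (\<Sum>k\<in>{j..<M - 1}. \<bar>wt M j (Suc k) - wt M j k\<bar>)"
    by (rule sum.union_disjoint) auto
  also have "(\<Sum>k<j. \<bar>wt M j (Suc k) - wt M j k\<bar>) = (\<Sum>k<j. wt M j k - wt M j (Suc k))"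
    by (intro sum.cong refl down) simp
  also have "\<dots> = wt M j 0 - wt M j j" by (rule sum_lessThan_telescope')
  also have "(\<Sum>k\<in>{j..<M - 1}. \<bar>wt M j (Suc k) - wt M j k\<bar>) = (\<Sum>k\<in>{j..<M - 1}. wt M j (Suc k) - wt M j k)"
    by (intro sum.cong refl up) auto
  also have "\<dots> = wt M j (M - 1) - wt M j j" using j by (intro sum_Suc_diff') auto
  finally show ?thesis using p by linarith
qed

lemma wt_trig_bound:
  assumes j: "j < M" and u: "cis (- u) \<noteq> 1"
  shows "cmod (\<Sum>k<M. complex_of_real (wt M j k) * cis (- (real k * u)))
      \<le> 2 * (1 / (real M - real j) + 1 / (real j + 1)) / cmod (1 - cis (- u))"
proof -
  have M: "M \<ge> 1" using j by simp
  have z: "cis (- (real k * u)) = cis (- u) ^ k" for k :: nat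
    by (subst Complex.DeMoivre) simp
  have w: "wt M j 0 = 1 / (real M - real j)" "wt M j (M - 1) = 1 / (real j + 1)"
    using j by (auto simp: wt_def of_nat_diff abs_if)
  have "cmod ((1 - cis (- u)) * (\<Sum>k<M. complex_of_real (wt M j k) * cis (- u) ^ k))
      \<le> \<bar>wt M j 0\<bar> + \<bar>wt M j (M - 1)\<bar> + (\<Sum>k<M - 1. \<bar>wt M j (Suc k) - wt M j k\<bar>)"
    by (rule abel_bound) (use M in auto)
  also have "\<dots> \<le> 2 * (wt M j 0 + wt M j (M - 1))"
    using wt_variation [OF j] wt_pos [OF j, of 0] wt_pos [OF j, of "M - 1"] M by simp
  finally have "cmod (1 - cis (- u)) * cmod (\<Sum>k<M. complex_of_real (wt M j k) * cis (- u) ^ k) \<le> 2 * (wt M j 0 + wt M j (M - 1))"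
    by (simp only: norm_mult)
  moreover have "cmod (1 - cis (- u)) > 0" using u by simp
  ultimately show ?thesis unfolding z w by (simp only: pos_le_divide_eq mult.commute)
qed

text \<open>The chord is \<open>2 * \<bar>sin (u / 2)\<bar>\<close>. The Taylor expansion gives \<open>sin x \<ge> x / 3\<close> up to \<open>pi / 2\<close>, and the reflection at
  \<open>pi / 2\<close> extends this with the constant 9 to \<open>3 * pi / 4\<close>. The range is what is needed for \<open>u = s - \<theta>\<close> with \<open>\<bar>\<theta>\<bar> \<le> pi\<close> and
  \<open>\<bar>s\<bar> \<le> \<bar>\<theta>\<bar> / 2\<close>.\<close>

lemma chord_lower:
  assumes u: "\<bar>u\<bar> \<le> 3 * pi / 2"
  shows "\<bar>u\<bar> / 9 \<le> cmod (1 - cis (- u))"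
proof -
  have half: "x / 3 \<le> sin x" if x: "0 \<le> x" "x \<le> pi / 2" for x :: real
  proof -
    have "\<bar>sin x - (\<Sum>m<3. sin_coeff m * x ^ m)\<bar> \<le> inverse (fact 3) * \<bar>x\<bar> ^ 3" by (rule Maclaurin_sin_bound)
    moreover have "(\<Sum>m<3. sin_coeff m * x ^ m) = x" by (simp add: sin_coeff_def eval_nat_numeral)
    moreover have "inverse (fact 3) * \<bar>x\<bar> ^ 3 = x ^ 3 / 6" using x by (simp add: eval_nat_numeral)
    ultimately have "x - x ^ 3 / 6 \<le> sin x" by linarith
    moreover have "x ^ 3 / 6 \<le> 2 * x / 3"
    proof -
      have "x \<le> 2" using x pi_half_less_two by linarith
      then have "x * x \<le> 2 * 2" using x by (intro mult_mono) auto
      then have "x * (x * x) \<le> x * 4" using x by (intro mult_left_mono) auto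
      then show ?thesis by (simp add: eval_nat_numeral)
    qed
    ultimately show ?thesis by linarith
  qed
  define x where "x = \<bar>u\<bar> / 2"
  have x: "0 \<le> x" "x \<le> 3 * pi / 4" using u by (auto simp: x_def)
  have s: "x / 9 \<le> sin x"
  proof (cases "x \<le> pi / 2")
    case True
    then show ?thesis using half [OF x(1)] x by linarith
  next
    case False
    have "(pi - x) / 3 \<le> sin (pi - x)" using False x by (intro half) auto
    then have "(pi - x) / 3 \<le> sin x" by simp
    moreover have "x / 9 \<le> (pi - x) / 3" using x by (simp add: field_simps)
    ultimately show ?thesis by (rule order_trans [rotated])
  qed
  have "cmod (1 - cis (- u)) = cmod (exp (\<i> * complex_of_real (- u)) - 1)"
    by (simp only: cis_conv_exp norm_minus_commute)
  also have "\<dots> = 2 * \<bar>sin (- u / 2)\<bar>" by (rule dist_exp_i_1)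
  also have "\<dots> = 2 * \<bar>sin x\<bar>" by (cases "u \<ge> 0") (auto simp: x_def)
  finally show ?thesis using s unfolding x_def by linarith
qed

text \<open>The matrix that represents the evaluation of the symbol at \<open>\<theta>\<close>: pairing it with a matrix averages the diagonals and
  sums the averages with phases.\<close>

definition dmat :: "nat \<Rightarrow> real \<Rightarrow> nat \<Rightarrow> nat \<Rightarrow> complex" where
  "dmat M \<theta> j k = complex_of_real (wt M j k) * cis (- ((real j - real k) * \<theta>))"

definition wave :: "real \<Rightarrow> nat \<Rightarrow> complex" where
  "wave s a = cis (- (real a * s))"

text \<open>The transform of a pure wave. It is large near \<open>s = \<theta>\<close> only.\<close>

definition dvec :: "nat \<Rightarrow> real \<Rightarrow> real \<Rightarrow> nat \<Rightarrow> complex" where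
  "dvec M \<theta> s = app M (dmat M \<theta>) (wave s)"

lemma hermitian_dmat: "hermitian M (dmat M \<theta>)"
proof (rule hermitianI)
  fix i j
  have "- (- ((real i - real j) * \<theta>)) = - ((real j - real i) * \<theta>)" by (simp add: algebra_simps)
  then show "cnj (dmat M \<theta> i j) = dmat M \<theta> j i"
    unfolding dmat_def complex_cnj_mult cis_cnj complex_cnj_complex_of_real wt_sym [of M j i] by simp
qed

lemma norm_dvec:
  "cmod (dvec M \<theta> s j) = cmod (\<Sum>k<M. complex_of_real (wt M j k) * cis (- (real k * (s - \<theta>))))"
proof -
  have "dvec M \<theta> s j = cis (- (real j * \<theta>)) * (\<Sum>k<M. complex_of_real (wt M j k) * cis (- (real k * (s - \<theta>))))"
    unfolding dvec_def app_def dmat_def wave_def sum_distrib_left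
  proof (intro sum.cong refl)
    fix k
    have "- ((real j - real k) * \<theta>) + - (real k * s) = - (real j * \<theta>) + - (real k * (s - \<theta>))"
      by (simp add: algebra_simps)
    then have "cis (- ((real j - real k) * \<theta>)) * cis (- (real k * s)) = cis (- (real j * \<theta>)) * cis (- (real k * (s - \<theta>)))"
      unfolding cis_mult by simp
    then show "complex_of_real (wt M j k) * cis (- ((real j - real k) * \<theta>)) * cis (- (real k * s))
        = cis (- (real j * \<theta>)) * (complex_of_real (wt M j k) * cis (- (real k * (s - \<theta>))))"
      by (metis (no_types, lifting) mult.assoc mult.left_commute)
  qed
  then show ?thesis by (simp add: norm_mult)
qed

lemma dvec_entry_le:
  assumes "j < M"
  shows "cmod (dvec M \<theta> s j) \<le> 2 * harm M"
proof -
  have "cmod (dvec M \<theta> s j) \<le> (\<Sum>k<M. cmod (complex_of_real (wt M j k) * cis (- (real k * (s - \<theta>)))))"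
    unfolding norm_dvec by (rule norm_sum)
  also have "\<dots> = (\<Sum>k<M. wt M j k)"
  proof (intro sum.cong refl)
    fix k assume "k \<in> {..<M}"
    then have "0 < wt M j k" using wt_pos [OF assms] by simp
    then show "cmod (complex_of_real (wt M j k) * cis (- (real k * (s - \<theta>)))) = wt M j k" by (simp add: norm_mult)
  qed
  also have "\<dots> \<le> 2 * harm M" by (rule wt_row_sum [OF assms])
  finally show ?thesis .
qed

lemma harm_ge_1: "M \<ge> 1 \<Longrightarrow> (1::real) \<le> harm M"
  using harm_mono [of 1 M] by (simp add: harm_expand)

text \<open>If \<open>\<bar>\<theta>\<bar> \<ge> 1 / M\<close>, the frequency \<open>s - \<theta>\<close> is at least \<open>\<bar>\<theta>\<bar> / 2\<close> in modulus and \<open>wt_trig_bound\<close> applies to each row; the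
  two edge weights of the rows add up to \<open>2 * harm M\<close>, and \<open>36\<close> is half of \<open>4 * 18\<close>, the factor 18 coming from the chord.
  Otherwise the trivial bound on each entry suffices.\<close>

lemma dvec_sum_le:
  assumes M: "M \<ge> 1" and \<theta>: "\<bar>\<theta>\<bar> \<le> pi" and s: "\<bar>s\<bar> < max \<bar>\<theta>\<bar> (1 / real M) / 2"
  shows "(\<Sum>j<M. cmod (dvec M \<theta> s j)) \<le> 36 * (2 * harm M) / max \<bar>\<theta>\<bar> (1 / real M)"
proof (cases "1 / real M \<le> \<bar>\<theta>\<bar>")
  case True
  then have \<tau>: "max \<bar>\<theta>\<bar> (1 / real M) = \<bar>\<theta>\<bar>" by simp
  have \<theta>0: "0 < \<bar>\<theta>\<bar>" using s abs_ge_zero [of s] unfolding \<tau> by linarith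
  define u where "u = s - \<theta>"
  have s2: "\<bar>s\<bar> < \<bar>\<theta>\<bar> / 2" using s unfolding \<tau> .
  have "\<bar>\<theta>\<bar> \<le> \<bar>s\<bar> + \<bar>u\<bar>" "\<bar>u\<bar> \<le> \<bar>s\<bar> + \<bar>\<theta>\<bar>" unfolding u_def by arith+
  then have u: "\<bar>\<theta>\<bar> / 2 \<le> \<bar>u\<bar>" "\<bar>u\<bar> \<le> 3 * pi / 2" using s2 \<theta> by linarith+
  have low: "\<bar>\<theta>\<bar> / 18 \<le> cmod (1 - cis (- u))" using chord_lower [OF u(2)] u(1) by linarith
  then have c: "cis (- u) \<noteq> 1" using \<theta>0 by auto
  have h: "(harm M :: real) \<ge> 1" by (rule harm_ge_1 [OF M])
  have "(\<Sum>j<M. cmod (dvec M \<theta> s j)) \<le> (\<Sum>j<M. 2 * (1 / (real M - real j) + 1 / (real j + 1)) / cmod (1 - cis (- u)))"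
    unfolding norm_dvec u_def [symmetric] by (intro sum_mono wt_trig_bound c) auto
  also have "\<dots> = 2 * ((\<Sum>j<M. 1 / (real M - real j)) + (\<Sum>j<M. 1 / (real j + 1))) / cmod (1 - cis (- u))"
    by (simp only: sum_divide_distrib [symmetric] sum_distrib_left [symmetric] sum.distrib)
  also have "\<dots> = 4 * harm M / cmod (1 - cis (- u))"
    unfolding sum_inverse_rev sum_inverse_harm by simp
  also have "\<dots> \<le> 4 * harm M / (\<bar>\<theta>\<bar> / 18)"
  proof (intro divide_left_mono mult_pos_pos)
    show "0 < cmod (1 - cis (- u))" using low \<theta>0 by linarith
  qed (use low \<theta>0 h in auto)
  finally show ?thesis unfolding \<tau> by simp
next
  case False
  then have \<tau>: "max \<bar>\<theta>\<bar> (1 / real M) = 1 / real M" by simp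
  have h: "(harm M :: real) \<ge> 1" by (rule harm_ge_1 [OF M])
  have "(\<Sum>j<M. cmod (dvec M \<theta> s j)) \<le> (\<Sum>j<M. 2 * harm M)" by (intro sum_mono dvec_entry_le) auto
  also have "\<dots> = real M * (2 * harm M)" by simp
  also have "\<dots> \<le> 36 * (real M * (2 * harm M))" using h by simp
  finally show ?thesis unfolding \<tau> by (simp add: mult_ac)
qed

lemma dvec_sq_norm_le:
  assumes M: "M \<ge> 1" and \<theta>: "\<bar>\<theta>\<bar> \<le> pi" and s: "\<bar>s\<bar> < max \<bar>\<theta>\<bar> (1 / real M) / 2"
  shows "sq_norm M (dvec M \<theta> s) \<le> 36 * (2 * harm M)\<^sup>2 / max \<bar>\<theta>\<bar> (1 / real M)"
proof -
  have h: "(harm M :: real) \<ge> 1" by (rule harm_ge_1 [OF M])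
  have "sq_norm M (dvec M \<theta> s) \<le> (\<Sum>j<M. 2 * harm M * cmod (dvec M \<theta> s j))"
    unfolding sq_norm_def power2_eq_square by (intro sum_mono mult_right_mono dvec_entry_le) auto
  also have "\<dots> = 2 * harm M * (\<Sum>j<M. cmod (dvec M \<theta> s j))" by (simp add: sum_distrib_left)
  also have "\<dots> \<le> 2 * harm M * (36 * (2 * harm M) / max \<bar>\<theta>\<bar> (1 / real M))"
    using h by (intro mult_left_mono dvec_sum_le M \<theta> s) auto
  finally show ?thesis by (simp add: power2_eq_square mult_ac)
qed

lemma dvec_trig_le:
  assumes M: "M \<ge> 1" and \<theta>: "\<bar>\<theta>\<bar> \<le> pi" and s: "\<bar>s\<bar> < max \<bar>\<theta>\<bar> (1 / real M) / 2"
  shows "cmod (trig M (dvec M \<theta> s) t) \<le> 36 * (2 * harm M) / max \<bar>\<theta>\<bar> (1 / real M)"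
proof -
  have "cmod (trig M (dvec M \<theta> s) t) \<le> (\<Sum>j<M. cmod (dvec M \<theta> s j))"
    unfolding trig_def by (rule order_trans [OF norm_sum]) (simp add: norm_mult)
  then show ?thesis using dvec_sum_le [OF M \<theta> s] by linarith
qed

lemma continuous_on_dvec [continuous_intros]: "continuous_on S (\<lambda>s. dvec M \<theta> s j)"
  unfolding dvec_def app_def wave_def by (intro continuous_intros)

lemma continuous_on_sq_norm_dvec [continuous_intros]: "continuous_on S (\<lambda>s. sq_norm M (dvec M \<theta> s))"
  unfolding sq_norm_def by (intro continuous_intros)

text \<open>By Parseval, the mean over \<open>s\<close> is the squared Frobenius norm of \<open>dmat\<close>.\<close>

lemma dvec_mean_square: "1 / (2 * pi) * (LINT s|circ. sq_norm M (dvec M \<theta> s)) \<le> 2 * harm M"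
proof -
  have e: "cmod (dvec M \<theta> s j) = cmod (trig M (\<lambda>k. cnj (dmat M \<theta> j k)) s)" for s j
  proof -
    have "cnj (dvec M \<theta> s j) = trig M (\<lambda>k. cnj (dmat M \<theta> j k)) s"
      unfolding dvec_def app_def trig_def wave_def cnj_sum by (simp add: cis_cnj)
    then show ?thesis by (metis complex_mod_cnj)
  qed
  have "1 / (2 * pi) * (LINT s|circ. sq_norm M (dvec M \<theta> s))
      = (\<Sum>j<M. 1 / (2 * pi) * (LINT s|circ. (cmod (trig M (\<lambda>k. cnj (dmat M \<theta> j k)) s))\<^sup>2))"
  proof -
    have "(LINT s|circ. sq_norm M (dvec M \<theta> s)) = (\<Sum>j<M. (LINT s|circ. (cmod (trig M (\<lambda>k. cnj (dmat M \<theta> j k)) s))\<^sup>2))"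
      unfolding sq_norm_def e
      by (rule Bochner_Integration.integral_sum) (intro integrable_circ_continuous continuous_intros)
    then show ?thesis by (simp only: sum_distrib_left)
  qed
  also have "\<dots> = (\<Sum>j<M. sq_norm M (\<lambda>k. cnj (dmat M \<theta> j k)))" by (simp only: parseval)
  also have "\<dots> = (\<Sum>j<M. \<Sum>k<M. (wt M j k)\<^sup>2)"
    by (simp add: sq_norm_def dmat_def norm_mult power_mult_distrib)
  also have "\<dots> \<le> 2 * harm M" by (rule wt_square_sum)
  finally show ?thesis .
qed

section \<open>Frobenius norms as spectral integrals\<close>

definition tmat :: "(real \<Rightarrow> real) \<Rightarrow> nat \<Rightarrow> nat \<Rightarrow> complex" where
  "tmat f p q = autocov f (int p - int q)"

text \<open>The trace of \<open>G D F D\<close>, grouped so that the spectral representation of \<open>G\<close> can be inserted.\<close>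

definition trace4 :: "nat \<Rightarrow> (nat \<Rightarrow> nat \<Rightarrow> complex) \<Rightarrow> (nat \<Rightarrow> nat \<Rightarrow> complex) \<Rightarrow> (nat \<Rightarrow> nat \<Rightarrow> complex) \<Rightarrow> complex" where
  "trace4 M D F G = (\<Sum>a<M. \<Sum>b<M. G a b * (\<Sum>c<M. \<Sum>d<M. D b c * F c d * D d a))"

lemma trace4_expand: "trace4 M D F G = (\<Sum>a<M. \<Sum>b<M. \<Sum>c<M. \<Sum>d<M. G a b * D b c * F c d * D d a)"
  unfolding trace4_def by (simp add: sum_distrib_left mult.assoc)

text \<open>Cyclicity of the trace.\<close>

lemma trace4_swap: "trace4 M D F G = trace4 M D G F"
proof -
  have "trace4 M D F G = (\<Sum>a<M. \<Sum>b<M. \<Sum>c<M. \<Sum>d<M. G a b * D b c * F c d * D d a)"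
    by (rule trace4_expand)
  also have "\<dots> = (\<Sum>a<M. \<Sum>c<M. \<Sum>b<M. \<Sum>d<M. G a b * D b c * F c d * D d a)"
    by (intro sum.cong refl sum.swap)
  also have "\<dots> = (\<Sum>c<M. \<Sum>a<M. \<Sum>b<M. \<Sum>d<M. G a b * D b c * F c d * D d a)"
    by (rule sum.swap)
  also have "\<dots> = (\<Sum>c<M. \<Sum>a<M. \<Sum>d<M. \<Sum>b<M. G a b * D b c * F c d * D d a)"
    by (intro sum.cong refl sum.swap)
  also have "\<dots> = (\<Sum>c<M. \<Sum>d<M. \<Sum>a<M. \<Sum>b<M. G a b * D b c * F c d * D d a)"
    by (intro sum.cong refl sum.swap)
  also have "\<dots> = trace4 M D G F" unfolding trace4_expand by (intro sum.cong refl) (simp add: mult_ac)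
  finally show ?thesis .
qed

lemma trace4_add:
  "trace4 M D (\<lambda>i j. F i j + F' i j) G = trace4 M D F G + trace4 M D F' G"
  unfolding trace4_expand sum.distrib [symmetric] by (intro sum.cong refl) (simp add: algebra_simps)

text \<open>Inserting the Fourier integral for the entries of the Toeplitz matrix of \<open>g\<close> turns the trace into an average over
  \<open>s\<close> of the form of \<open>F\<close> at the transform by \<open>D\<close> of the wave of frequency \<open>s\<close>.\<close>

lemma trace4_integral:
  assumes g: "integrable circ g" and D: "hermitian M D"
  shows "trace4 M D F (tmat g)
    = complex_of_real (1 / (2 * pi)) * (LINT s|circ. complex_of_real (g s) * sesq M F (app M D (wave s)) (app M D (wave s)))"
proof -
  define X where "X b a = (\<Sum>c<M. \<Sum>d<M. D b c * F c d * D d a)" for b a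
  have form: "sesq M F (app M D (wave s)) (app M D (wave s))
      = (\<Sum>a<M. \<Sum>b<M. X b a * cis (- real_of_int (int a - int b) * s))" for s
  proof -
    have "sesq M F (app M D (wave s)) (app M D (wave s))
        = (\<Sum>c<M. \<Sum>d<M. (\<Sum>b<M. cnj (D c b) * cnj (wave s b)) * F c d * (\<Sum>a<M. D d a * wave s a))"
      by (simp add: sesq_double_sum app_def)
    also have "\<dots> = (\<Sum>c<M. \<Sum>d<M. \<Sum>b<M. \<Sum>a<M. D b c * F c d * D d a * (cnj (wave s b) * wave s a))"
    proof (intro sum.cong refl)
      fix c d assume c: "c \<in> {..<M}"
      have "(\<Sum>b<M. cnj (D c b) * cnj (wave s b)) * F c d * (\<Sum>a<M. D d a * wave s a)
          = (\<Sum>b<M. \<Sum>a<M. (cnj (D c b) * cnj (wave s b) * F c d) * (D d a * wave s a))"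
        unfolding sum_distrib_right [of _ _ "F c d"] sum_product ..
      also have "\<dots> = (\<Sum>b<M. \<Sum>a<M. D b c * F c d * D d a * (cnj (wave s b) * wave s a))"
        using c by (intro sum.cong refl) (simp add: hermitianD [OF D] mult_ac)
      finally show "(\<Sum>b<M. cnj (D c b) * cnj (wave s b)) * F c d * (\<Sum>a<M. D d a * wave s a)
          = (\<Sum>b<M. \<Sum>a<M. D b c * F c d * D d a * (cnj (wave s b) * wave s a))" .
    qed
    also have "\<dots> = (\<Sum>c<M. \<Sum>b<M. \<Sum>d<M. \<Sum>a<M. D b c * F c d * D d a * (cnj (wave s b) * wave s a))"
      by (intro sum.cong refl sum.swap)
    also have "\<dots> = (\<Sum>b<M. \<Sum>c<M. \<Sum>d<M. \<Sum>a<M. D b c * F c d * D d a * (cnj (wave s b) * wave s a))"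
      by (rule sum.swap)
    also have "\<dots> = (\<Sum>b<M. \<Sum>c<M. \<Sum>a<M. \<Sum>d<M. D b c * F c d * D d a * (cnj (wave s b) * wave s a))"
      by (intro sum.cong refl sum.swap)
    also have "\<dots> = (\<Sum>b<M. \<Sum>a<M. \<Sum>c<M. \<Sum>d<M. D b c * F c d * D d a * (cnj (wave s b) * wave s a))"
      by (intro sum.cong refl sum.swap)
    also have "\<dots> = (\<Sum>a<M. \<Sum>b<M. \<Sum>c<M. \<Sum>d<M. D b c * F c d * D d a * (cnj (wave s b) * wave s a))"
      by (rule sum.swap)
    also have "\<dots> = (\<Sum>a<M. \<Sum>b<M. X b a * (cnj (wave s b) * wave s a))"
      by (simp add: X_def sum_distrib_right)
    also have "\<dots> = (\<Sum>a<M. \<Sum>b<M. X b a * cis (- real_of_int (int a - int b) * s))"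
    proof (intro sum.cong refl arg_cong2 [where f = "(*)"])
      fix a b
      have "cnj (wave s b) * wave s a = cis (real b * s + - (real a * s))"
        by (simp add: wave_def cis_cnj cis_mult)
      also have "real b * s + - (real a * s) = - real_of_int (int a - int b) * s" by (simp add: algebra_simps)
      finally show "cnj (wave s b) * wave s a = cis (- real_of_int (int a - int b) * s)" .
    qed
    finally show ?thesis .
  qed
  have i: "integrable circ (\<lambda>s. X b a * (complex_of_real (g s) * cis (- real_of_int (int a - int b) * s)))" for a b
    by (intro integrable_mult_right integrable_circ_mult_cis g)
  have "(LINT s|circ. complex_of_real (g s) * sesq M F (app M D (wave s)) (app M D (wave s)))
      = (LINT s|circ. (\<Sum>a<M. \<Sum>b<M. X b a * (complex_of_real (g s) * cis (- real_of_int (int a - int b) * s))))"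
    unfolding form sum_distrib_left by (simp only: mult.left_commute)
  also have "\<dots> = (\<Sum>a<M. \<Sum>b<M. X b a * (LINT s|circ. complex_of_real (g s) * cis (- real_of_int (int a - int b) * s)))"
  proof -
    have "(LINT s|circ. (\<Sum>a<M. \<Sum>b<M. X b a * (complex_of_real (g s) * cis (- real_of_int (int a - int b) * s))))
      = (\<Sum>a<M. \<Sum>b<M. (LINT s|circ. X b a * (complex_of_real (g s) * cis (- real_of_int (int a - int b) * s))))"
      by (subst Bochner_Integration.integral_sum, intro Bochner_Integration.integrable_sum i)
         (intro sum.cong refl Bochner_Integration.integral_sum i)
    then show ?thesis by (simp only: integral_mult_right_zero)
  qed
  finally show ?thesis
    unfolding trace4_def X_def [symmetric] tmat_def autocov_circ
    by (simp only: sum_distrib_left) (simp only: mult_ac)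
qed

lemma integral_abs_powr:
  fixes \<tau> b :: real
  assumes \<tau>: "0 < \<tau>" "\<tau> \<le> pi" and b: "0 < b" "b < 1"
  shows "integrable circ (\<lambda>s. indicat_real {-\<tau>..\<tau>} s * \<bar>s\<bar> powr - b)"
    and "(LINT s|circ. indicat_real {-\<tau>..\<tau>} s * \<bar>s\<bar> powr - b) = 2 * \<tau> powr (1 - b) / (1 - b)"
proof -
  define h where "h s = \<bar>s\<bar> powr - b" for s :: real
  define I where "I = \<tau> powr (1 - b) / (1 - b)"
  have "((\<lambda>x. x powr - b) has_integral I) {0..\<tau>}"
    using has_integral_powr_from_0 [of "- b" \<tau>] b \<tau> by (simp add: I_def add.commute)
  then have 1: "(h has_integral I) {0..\<tau>}"
    by (rule has_integral_eq [rotated]) (simp add: h_def)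
  have "((\<lambda>x. h (- x)) has_integral I) {- \<tau>..- 0}"
    using 1 unfolding has_integral_reflect_real .
  then have 2: "(h has_integral I) {- \<tau>..0}" by (simp add: h_def [abs_def])
  have 3: "(h has_integral (I + I)) {- \<tau>..\<tau>}"
    by (rule has_integral_combine [OF _ _ 2 1]) (use \<tau> in auto)
  have abs: "set_integrable lebesgue {- \<tau>..\<tau>} h"
    by (rule nonnegative_absolutely_integrable_1) (use 3 in \<open>auto simp: h_def\<close>)
  have val: "(LINT s:{- \<tau>..\<tau>}|lebesgue. h s) = I + I"
    using set_lebesgue_integral_eq_integral(2) [OF abs] 3 by (simp add: integral_unique)
  have e: "indicat_real {-pi..pi} s *\<^sub>R (indicat_real {-\<tau>..\<tau>} s * \<bar>s\<bar> powr - b) = indicat_real {-\<tau>..\<tau>} s *\<^sub>R h s" for s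
    using \<tau> by (auto simp: indicator_def h_def)
  show "integrable circ (\<lambda>s. indicat_real {-\<tau>..\<tau>} s * \<bar>s\<bar> powr - b)"
    using abs unfolding set_integrable_def by (subst integrable_restrict_space) (simp_all only: e, simp)
  have "(LINT s|circ. indicat_real {-\<tau>..\<tau>} s * \<bar>s\<bar> powr - b)
      = (LINT s|lebesgue. indicat_real {-pi..pi} s *\<^sub>R (indicat_real {-\<tau>..\<tau>} s * \<bar>s\<bar> powr - b))"
    by (rule integral_restrict_space) simp
  also have "\<dots> = I + I" using val unfolding e set_lebesgue_integral_def .
  finally show "(LINT s|circ. indicat_real {-\<tau>..\<tau>} s * \<bar>s\<bar> powr - b) = 2 * \<tau> powr (1 - b) / (1 - b)"
    by (simp add: I_def)
qed

text \<open>The Toeplitz form of \<open>f\<close> at the transform by \<open>dmat\<close> of the wave of frequency \<open>s\<close>, as a spectral integral.\<close>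

definition energy :: "nat \<Rightarrow> real \<Rightarrow> (real \<Rightarrow> real) \<Rightarrow> real \<Rightarrow> real" where
  "energy M \<theta> f s = 1 / (2 * pi) * (LINT t|circ. f t * (cmod (trig M (dvec M \<theta> s) t))\<^sup>2)"

lemma sesq_energy:
  assumes "integrable circ f"
  shows "sesq M (tmat f) (dvec M \<theta> s) (dvec M \<theta> s) = complex_of_real (energy M \<theta> f s)"
  unfolding sesq_double_sum tmat_def energy_def by (rule toeplitz_form [OF assms])

lemma continuous_on_energy:
  assumes "integrable circ f"
  shows "continuous_on S (energy M \<theta> f)"
proof -
  have "energy M \<theta> f = (\<lambda>s. Re (sesq M (tmat f) (dvec M \<theta> s) (dvec M \<theta> s)))"
    by (auto simp: sesq_energy [OF assms])
  then show ?thesis unfolding sesq_double_sum by (simp only:) (intro continuous_intros)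
qed

lemma trace4_tmat:
  assumes f: "integrable circ f" and g: "integrable circ g"
  shows "trace4 M (dmat M \<theta>) (tmat f) (tmat g) = complex_of_real (1 / (2 * pi) * (LINT s|circ. g s * energy M \<theta> f s))"
proof -
  have "trace4 M (dmat M \<theta>) (tmat f) (tmat g)
      = complex_of_real (1 / (2 * pi)) * (LINT s|circ. complex_of_real (g s) * complex_of_real (energy M \<theta> f s))"
    unfolding trace4_integral [OF g hermitian_dmat] dvec_def [symmetric] sesq_energy [OF f] ..
  also have "\<dots> = complex_of_real (1 / (2 * pi) * (LINT s|circ. g s * energy M \<theta> f s))"
    by (simp only: of_real_mult [symmetric] integral_complex_of_real)
  finally show ?thesis .
qed

lemma energy_le_bounded:
  assumes f: "integrable circ f" and le: "AE t in circ. f t \<le> K"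
  shows "energy M \<theta> f s \<le> K * sq_norm M (dvec M \<theta> s)"
proof -
  have c: "continuous_on {-pi..pi} (\<lambda>t. (cmod (trig M (dvec M \<theta> s) t))\<^sup>2)" by (intro continuous_intros)
  have "(LINT t|circ. f t * (cmod (trig M (dvec M \<theta> s) t))\<^sup>2) \<le> (LINT t|circ. K * (cmod (trig M (dvec M \<theta> s) t))\<^sup>2)"
  proof (rule integral_mono_AE)
    show "integrable circ (\<lambda>t. f t * (cmod (trig M (dvec M \<theta> s) t))\<^sup>2)" by (rule integrable_circ_mult [OF f c])
    show "integrable circ (\<lambda>t. K * (cmod (trig M (dvec M \<theta> s) t))\<^sup>2)" by (intro integrable_mult_right integrable_circ_continuous c)
    show "AE t in circ. f t * (cmod (trig M (dvec M \<theta> s) t))\<^sup>2 \<le> K * (cmod (trig M (dvec M \<theta> s) t))\<^sup>2"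
      using le by eventually_elim (simp add: mult_right_mono)
  qed
  then have "energy M \<theta> f s \<le> 1 / (2 * pi) * (LINT t|circ. K * (cmod (trig M (dvec M \<theta> s) t))\<^sup>2)"
    unfolding energy_def by (intro mult_left_mono) auto
  also have "\<dots> = K * (1 / (2 * pi) * (LINT t|circ. (cmod (trig M (dvec M \<theta> s) t))\<^sup>2))" by simp
  finally show ?thesis unfolding parseval .
qed

lemma energy_nonneg:
  assumes "AE t in circ. 0 \<le> f t"
  shows "0 \<le> energy M \<theta> f s"
  unfolding energy_def
  by (intro mult_nonneg_nonneg integral_nonneg_AE) (use assms in \<open>auto elim!: eventually_mono\<close>)

lemma energy_le_mass:
  assumes f: "integrable circ f" and nn: "AE t in circ. 0 \<le> f t" and B: "\<And>t. cmod (trig M (dvec M \<theta> s) t) \<le> B"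
  shows "energy M \<theta> f s \<le> 1 / (2 * pi) * (B\<^sup>2 * (LINT t|circ. f t))"
proof -
  have c: "continuous_on {-pi..pi} (\<lambda>t. (cmod (trig M (dvec M \<theta> s) t))\<^sup>2)" by (intro continuous_intros)
  have "(LINT t|circ. f t * (cmod (trig M (dvec M \<theta> s) t))\<^sup>2) \<le> (LINT t|circ. B\<^sup>2 * f t)"
  proof (rule integral_mono_AE)
    show "integrable circ (\<lambda>t. f t * (cmod (trig M (dvec M \<theta> s) t))\<^sup>2)" by (rule integrable_circ_mult [OF f c])
    show "integrable circ (\<lambda>t. B\<^sup>2 * f t)" using f by simp
    show "AE t in circ. f t * (cmod (trig M (dvec M \<theta> s) t))\<^sup>2 \<le> B\<^sup>2 * f t"
      using nn
    proof eventually_elim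
      fix t assume "0 \<le> f t"
      moreover have "(cmod (trig M (dvec M \<theta> s) t))\<^sup>2 \<le> B\<^sup>2" using B by (intro power_mono) auto
      ultimately show "f t * (cmod (trig M (dvec M \<theta> s) t))\<^sup>2 \<le> B\<^sup>2 * f t"
        by (metis mult.commute mult_left_mono)
    qed
  qed
  then show ?thesis unfolding energy_def by (simp add: divide_right_mono)
qed

text \<open>Write \<open>f = f1 + f2\<close>, where \<open>f2\<close> is the restriction of \<open>f\<close> to \<open>\<bar>s\<bar> < \<tau> / 2\<close>, and expand the trace into three
  terms. The part \<open>f1\<close> is at most \<open>K1 * m\<close>, where \<open>m = \<phi> \<tau>\<close>, so the term of \<open>f1\<close> with itself is controlled by the mean square
  of the transforms. The part \<open>f2\<close> has mass at most \<open>K2 * \<tau> * m\<close>, and lives at frequencies \<open>s\<close> where the transform of a wave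
  is \<open>O(l / \<tau>)\<close> in the sum of the moduli of its entries, hence also as a trigonometric polynomial, and \<open>O(l\<^sup>2 / \<tau>)\<close> in
  squared norm because no entry exceeds \<open>l\<close>. In the two terms that contain \<open>f2\<close>, the powers of \<open>\<tau>\<close> cancel. The sum of the three bounds is a perfect square.\<close>

theorem frobenius_profile:
  fixes f \<phi> :: "real \<Rightarrow> real" and c b C :: real
  assumes f: "integrable circ f" and nn: "AE s in circ. 0 \<le> f s"
    and c: "0 < c" and b: "0 < b" "b < 1" and C: "0 < C"
    and \<phi>c: "\<And>t. 0 < t \<Longrightarrow> t \<le> pi \<Longrightarrow> c \<le> \<phi> t"
    and P2: "\<And>s t. 0 < \<bar>s\<bar> \<Longrightarrow> \<bar>s\<bar> \<le> t \<Longrightarrow> t \<le> pi \<Longrightarrow> f s \<le> C * (t / \<bar>s\<bar>) powr b * \<phi> t"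
    and P3: "\<And>s t. 0 < t \<Longrightarrow> t \<le> \<bar>s\<bar> \<Longrightarrow> \<bar>s\<bar> \<le> pi \<Longrightarrow> f s \<le> \<phi> t"
    and M: "M \<ge> 1" and \<theta>: "\<bar>\<theta>\<bar> \<le> pi"
  shows "Re (trace4 M (dmat M \<theta>) (tmat f) (tmat f))
    \<le> ((2 * C + 1 + 36 * (2 * C / (1 - b))) * \<phi> (max \<bar>\<theta>\<bar> (1 / real M)) * (2 * harm M))\<^sup>2"
proof -
  define \<tau> where "\<tau> = max \<bar>\<theta>\<bar> (1 / real M)"
  define m where "m = \<phi> \<tau>"
  define l :: real where "l = 2 * harm M"
  define K1 where "K1 = 2 * C + 1"
  define K2 where "K2 = 2 * C / (1 - b)"
  have "1 / real M \<le> 1" using M by simp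
  then have M1: "1 / real M \<le> pi" using pi_gt3 by linarith
  have \<tau>: "0 < \<tau>" "\<tau> \<le> pi" using M M1 \<theta> by (auto simp: \<tau>_def less_max_iff_disj)
  have m: "0 < m" using \<phi>c [OF \<tau>] c by (simp add: m_def)
  have l: "2 \<le> l" using harm_ge_1 [OF M] by (simp add: l_def)
  have K: "0 < K1" "0 < K2" using C b by (auto simp: K1_def K2_def)
  define A where "A = {-(\<tau>/2)<..<\<tau>/2}"
  define f2 where "f2 s = indicat_real A s * f s" for s
  define f1 where "f1 s = f s - f2 s" for s
  have f2i: "integrable circ f2"
  proof -
    have "A \<inter> {-pi..pi} \<in> sets circ" by (subst sets_restrict_space_iff) (simp_all add: A_def)
    then have "integrable circ (\<lambda>s. indicat_real (A \<inter> {-pi..pi}) s *\<^sub>R f s)" by (rule integrable_mult_indicator [OF _ f])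
    moreover have "integrable circ f2 \<longleftrightarrow> integrable circ (\<lambda>s. indicat_real (A \<inter> {-pi..pi}) s *\<^sub>R f s)"
    proof (rule Bochner_Integration.integrable_cong [OF refl])
      fix s assume "s \<in> space circ"
      then have "s \<in> {-pi..pi}" by (simp add: space_restrict_space)
      then show "f2 s = indicat_real (A \<inter> {-pi..pi}) s *\<^sub>R f s" by (simp add: f2_def indicator_inter_arith)
    qed
    ultimately show ?thesis by blast
  qed
  have f1i: "integrable circ f1" unfolding f1_def using f f2i by simp
  have f1n: "AE s in circ. 0 \<le> f1 s" using nn by eventually_elim (simp add: f1_def f2_def indicator_def)
  have f2n: "AE s in circ. 0 \<le> f2 s" using nn by eventually_elim (simp add: f2_def indicator_def)
  have f1le: "AE s in circ. f1 s \<le> K1 * m"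
  proof (rule AE_I2)
    fix s assume "s \<in> space circ"
    then have s: "\<bar>s\<bar> \<le> pi" by (auto simp: space_restrict_space)
    show "f1 s \<le> K1 * m"
    proof (cases "s \<in> A")
      case True
      then show ?thesis using K m by (simp add: f1_def f2_def)
    next
      case False
      then have sA: "\<tau> / 2 \<le> \<bar>s\<bar>" by (auto simp: A_def)
      have "f s \<le> K1 * m"
      proof (cases "\<tau> \<le> \<bar>s\<bar>")
        case True
        have "f s \<le> 1 * m" unfolding m_def using P3 [OF \<tau>(1) True s] by simp
        also have "\<dots> \<le> K1 * m" using C m by (intro mult_right_mono) (auto simp: K1_def)
        finally show ?thesis .
      next
        case False
        have s0: "0 < \<bar>s\<bar>" using sA \<tau> by linarith
        have "f s \<le> C * (\<tau> / \<bar>s\<bar>) powr b * m" unfolding m_def using False s0 \<tau> by (intro P2) auto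
        also have "\<dots> \<le> C * 2 * m"
        proof (intro mult_right_mono mult_left_mono)
          have r: "1 \<le> \<tau> / \<bar>s\<bar>" "\<tau> / \<bar>s\<bar> \<le> 2" using False s0 sA by (auto simp: field_simps)
          have "(\<tau> / \<bar>s\<bar>) powr b \<le> (\<tau> / \<bar>s\<bar>) powr 1" using r b by (intro powr_mono) auto
          then show "(\<tau> / \<bar>s\<bar>) powr b \<le> 2" using r by simp
        qed (use C m in auto)
        also have "\<dots> \<le> K1 * m" using m by (intro mult_right_mono) (auto simp: K1_def)
        finally show ?thesis .
      qed
      then show ?thesis using False by (simp add: f1_def f2_def)
    qed
  qed
  have mass: "(LINT s|circ. f2 s) \<le> K2 * \<tau> * m"
  proof -
    define h where "h s = (C * \<tau> powr b * m) * (indicat_real {-\<tau>..\<tau>} s * \<bar>s\<bar> powr - b)" for s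
    have hi: "integrable circ h" unfolding h_def by (intro integrable_mult_right integral_abs_powr \<tau> b)
    have "AE s in circ. f2 s \<le> h s"
    proof -
      have "AE s in lebesgue. s \<noteq> 0" by (intro AE_completion AE_lborel_singleton)
      then have "AE s in circ. s \<noteq> 0" by (auto simp: AE_restrict_space_iff elim!: eventually_mono)
      then show ?thesis
      proof eventually_elim
        fix s :: real assume s: "s \<noteq> 0"
        show "f2 s \<le> h s"
        proof (cases "s \<in> A")
          case True
          then have s\<tau>: "\<bar>s\<bar> \<le> \<tau>" "s \<in> {-\<tau>..\<tau>}" using \<tau> by (auto simp: A_def)
          have "f2 s = f s" using True by (simp add: f2_def)
          also have "\<dots> \<le> C * (\<tau> / \<bar>s\<bar>) powr b * m" unfolding m_def using s s\<tau> \<tau> by (intro P2) auto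
          also have "\<dots> = h s" using s s\<tau> \<tau> by (simp add: h_def powr_divide powr_minus field_simps)
          finally show ?thesis .
        next
          case False
          then show ?thesis using C m by (simp add: f2_def h_def)
        qed
      qed
    qed
    then have "(LINT s|circ. f2 s) \<le> (LINT s|circ. h s)" by (rule integral_mono_AE [OF f2i hi])
    also have "\<dots> = (C * \<tau> powr b * m) * (2 * \<tau> powr (1 - b) / (1 - b))"
      unfolding h_def by (simp add: integral_abs_powr(2) [OF \<tau> b])
    also have "\<dots> = K2 * (\<tau> powr b * \<tau> powr (1 - b)) * m" by (simp add: K2_def)
    also have "\<tau> powr b * \<tau> powr (1 - b) = \<tau>" using \<tau> by (simp add: powr_add [symmetric])
    finally show ?thesis .
  qed
  have mass0: "0 \<le> (LINT s|circ. f2 s)" by (rule integral_nonneg_AE [OF f2n])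
  have inv2pi: "0 \<le> 1 / (2 * pi)" "1 / (2 * pi) \<le> 1" using pi_gt3 by auto

  have T11: "1 / (2 * pi) * (LINT s|circ. f1 s * energy M \<theta> f1 s) \<le> (K1 * m * l)\<^sup>2"
  proof -
    have "(LINT s|circ. f1 s * energy M \<theta> f1 s) \<le> (LINT s|circ. (K1 * m) * ((K1 * m) * sq_norm M (dvec M \<theta> s)))"
    proof (rule integral_mono_AE)
      show "integrable circ (\<lambda>s. f1 s * energy M \<theta> f1 s)" by (intro integrable_circ_mult f1i continuous_on_energy)
      show "integrable circ (\<lambda>s. (K1 * m) * ((K1 * m) * sq_norm M (dvec M \<theta> s)))"
        by (intro integrable_mult_right integrable_circ_continuous continuous_intros)
      show "AE s in circ. f1 s * energy M \<theta> f1 s \<le> (K1 * m) * ((K1 * m) * sq_norm M (dvec M \<theta> s))"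
        using f1le f1n
      proof eventually_elim
        fix s assume "f1 s \<le> K1 * m" "0 \<le> f1 s"
        then show "f1 s * energy M \<theta> f1 s \<le> (K1 * m) * ((K1 * m) * sq_norm M (dvec M \<theta> s))"
          using K m by (intro mult_mono energy_le_bounded f1i f1le energy_nonneg f1n) auto
      qed
    qed
    then have "1 / (2 * pi) * (LINT s|circ. f1 s * energy M \<theta> f1 s)
        \<le> 1 / (2 * pi) * (LINT s|circ. (K1 * m) * ((K1 * m) * sq_norm M (dvec M \<theta> s)))"
      by (intro mult_left_mono inv2pi)
    also have "\<dots> = (K1 * m)\<^sup>2 * (1 / (2 * pi) * (LINT s|circ. sq_norm M (dvec M \<theta> s)))"
      by (simp add: power2_eq_square)
    also have "\<dots> \<le> (K1 * m)\<^sup>2 * l"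
      unfolding l_def by (intro mult_left_mono dvec_mean_square) auto
    also have "\<dots> \<le> (K1 * m)\<^sup>2 * (l * l)" using l by (intro mult_left_mono) auto
    finally show ?thesis by (simp add: power2_eq_square mult_ac)
  qed
  have T12: "1 / (2 * pi) * (LINT s|circ. f2 s * energy M \<theta> f1 s) \<le> 36 * K1 * K2 * (m * l)\<^sup>2"
  proof -
    define B where "B = K1 * m * (36 * l\<^sup>2 / \<tau>)"
    have B: "0 \<le> B" using K m \<tau> by (simp add: B_def)
    have "(LINT s|circ. f2 s * energy M \<theta> f1 s) \<le> (LINT s|circ. f2 s * B)"
    proof (rule integral_mono_AE)
      show "integrable circ (\<lambda>s. f2 s * energy M \<theta> f1 s)" by (intro integrable_circ_mult f2i f1i continuous_on_energy)
      show "integrable circ (\<lambda>s. f2 s * B)" using f2i by simp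
      show "AE s in circ. f2 s * energy M \<theta> f1 s \<le> f2 s * B"
        using f2n
      proof eventually_elim
        fix s assume s: "0 \<le> f2 s"
        show "f2 s * energy M \<theta> f1 s \<le> f2 s * B"
        proof (cases "s \<in> A")
          case True
          then have "\<bar>s\<bar> < \<tau> / 2" by (auto simp: A_def)
          then have "sq_norm M (dvec M \<theta> s) \<le> 36 * l\<^sup>2 / \<tau>"
            unfolding l_def \<tau>_def by (rule dvec_sq_norm_le [OF M \<theta>])
          then have "K1 * m * sq_norm M (dvec M \<theta> s) \<le> B"
            unfolding B_def using K m by (intro mult_left_mono) auto
          then show ?thesis using s energy_le_bounded [OF f1i f1le, of M \<theta> s] by (intro mult_left_mono) auto
        next
          case False
          then show ?thesis by (simp add: f2_def)
        qed
      qed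
    qed
    also have "\<dots> = (LINT s|circ. f2 s) * B" by simp
    also have "\<dots> \<le> K2 * \<tau> * m * B" by (intro mult_right_mono mass B)
    also have "\<dots> = 36 * K1 * K2 * (m * l)\<^sup>2" using \<tau> by (simp add: B_def power2_eq_square)
    finally have le: "(LINT s|circ. f2 s * energy M \<theta> f1 s) \<le> 36 * K1 * K2 * (m * l)\<^sup>2" .
    have nonneg: "0 \<le> 36 * K1 * K2 * (m * l)\<^sup>2" using K by simp
    have "1 / (2 * pi) * (LINT s|circ. f2 s * energy M \<theta> f1 s) \<le> 1 / (2 * pi) * (36 * K1 * K2 * (m * l)\<^sup>2)"
      by (intro mult_left_mono le inv2pi)
    also have "\<dots> \<le> 1 * (36 * K1 * K2 * (m * l)\<^sup>2)" by (intro mult_right_mono nonneg inv2pi)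
    finally show ?thesis by simp
  qed
  have T22: "1 / (2 * pi) * (LINT s|circ. f2 s * energy M \<theta> f2 s) \<le> (36 * K2)\<^sup>2 * (m * l)\<^sup>2"
  proof -
    define B where "B = (36 * l / \<tau>)\<^sup>2 * (K2 * \<tau> * m)"
    have B: "0 \<le> B" using K m \<tau> by (simp add: B_def)
    have "(LINT s|circ. f2 s * energy M \<theta> f2 s) \<le> (LINT s|circ. f2 s * B)"
    proof (rule integral_mono_AE)
      show "integrable circ (\<lambda>s. f2 s * energy M \<theta> f2 s)" by (intro integrable_circ_mult f2i continuous_on_energy)
      show "integrable circ (\<lambda>s. f2 s * B)" using f2i by simp
      show "AE s in circ. f2 s * energy M \<theta> f2 s \<le> f2 s * B"
        using f2n
      proof eventually_elim
        fix s assume s: "0 \<le> f2 s"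
        show "f2 s * energy M \<theta> f2 s \<le> f2 s * B"
        proof (cases "s \<in> A")
          case True
          then have "\<bar>s\<bar> < \<tau> / 2" by (auto simp: A_def)
          then have tr: "cmod (trig M (dvec M \<theta> s) t) \<le> 36 * l / \<tau>" for t
            unfolding l_def \<tau>_def by (rule dvec_trig_le [OF M \<theta>])
          have "energy M \<theta> f2 s \<le> 1 / (2 * pi) * ((36 * l / \<tau>)\<^sup>2 * (LINT t|circ. f2 t))"
            by (rule energy_le_mass [OF f2i f2n tr])
          also have "\<dots> \<le> 1 * ((36 * l / \<tau>)\<^sup>2 * (LINT t|circ. f2 t))"
            using mass0 by (intro mult_right_mono inv2pi) auto
          also have "\<dots> \<le> B" unfolding B_def mult_1_left by (intro mult_left_mono mass) auto
          finally show ?thesis using s by (intro mult_left_mono) auto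
        next
          case False
          then show ?thesis by (simp add: f2_def)
        qed
      qed
    qed
    also have "\<dots> = (LINT s|circ. f2 s) * B" by simp
    also have "\<dots> \<le> K2 * \<tau> * m * B" by (intro mult_right_mono mass B)
    also have "\<dots> = (36 * K2)\<^sup>2 * (m * l)\<^sup>2" using \<tau> by (simp add: B_def power2_eq_square)
    finally have le: "(LINT s|circ. f2 s * energy M \<theta> f2 s) \<le> (36 * K2)\<^sup>2 * (m * l)\<^sup>2" .
    have "1 / (2 * pi) * (LINT s|circ. f2 s * energy M \<theta> f2 s) \<le> 1 / (2 * pi) * ((36 * K2)\<^sup>2 * (m * l)\<^sup>2)"
      by (intro mult_left_mono le inv2pi)
    also have "\<dots> \<le> 1 * ((36 * K2)\<^sup>2 * (m * l)\<^sup>2)" by (intro mult_right_mono inv2pi) auto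
    finally show ?thesis by simp
  qed
  have tsum: "tmat f = (\<lambda>i j. tmat f1 i j + tmat f2 i j)"
  proof (intro ext)
    fix i j
    have "(LINT t|circ. complex_of_real (f t) * cis (- real_of_int (int i - int j) * t))
      = (LINT t|circ. complex_of_real (f1 t) * cis (- real_of_int (int i - int j) * t)
          + complex_of_real (f2 t) * cis (- real_of_int (int i - int j) * t))"
      by (rule Bochner_Integration.integral_cong [OF refl]) (simp add: f1_def left_diff_distrib)
    also have "\<dots> = (LINT t|circ. complex_of_real (f1 t) * cis (- real_of_int (int i - int j) * t))
      + (LINT t|circ. complex_of_real (f2 t) * cis (- real_of_int (int i - int j) * t))"
      by (intro Bochner_Integration.integral_add integrable_circ_mult_cis f1i f2i)
    finally show "tmat f i j = tmat f1 i j + tmat f2 i j"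
      unfolding tmat_def autocov_circ by (simp only: distrib_left)
  qed
  let ?T = "trace4 M (dmat M \<theta>)"
  have "?T (tmat f) (tmat f) = ?T (tmat f1) (tmat f) + ?T (tmat f2) (tmat f)"
    by (subst (1) tsum) (rule trace4_add)
  also have "?T (tmat f1) (tmat f) = ?T (tmat f1) (tmat f1) + ?T (tmat f2) (tmat f1)"
    unfolding trace4_swap [of M _ "tmat f1" "tmat f"] by (subst tsum) (rule trace4_add)
  also have "?T (tmat f2) (tmat f) = ?T (tmat f1) (tmat f2) + ?T (tmat f2) (tmat f2)"
    unfolding trace4_swap [of M _ "tmat f2" "tmat f"] by (subst tsum) (rule trace4_add)
  also have "?T (tmat f2) (tmat f1) = ?T (tmat f1) (tmat f2)" by (rule trace4_swap)
  finally have "Re (?T (tmat f) (tmat f)) = Re (?T (tmat f1) (tmat f1)) + 2 * Re (?T (tmat f1) (tmat f2)) + Re (?T (tmat f2) (tmat f2))"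
    by simp
  also have "\<dots> \<le> (K1 * m * l)\<^sup>2 + 2 * (36 * K1 * K2 * (m * l)\<^sup>2) + (36 * K2)\<^sup>2 * (m * l)\<^sup>2"
    unfolding trace4_tmat [OF f1i f1i] trace4_tmat [OF f1i f2i] trace4_tmat [OF f2i f2i] Re_complex_of_real
    using T11 T12 T22 by linarith
  also have "\<dots> = ((K1 + 36 * K2) * m * l)\<^sup>2" by (simp add: power2_eq_square algebra_simps)
  finally show ?thesis unfolding K1_def K2_def m_def l_def \<tau>_def .
qed

section \<open>Whitening\<close>

definition mm :: "nat \<Rightarrow> (nat \<Rightarrow> nat \<Rightarrow> complex) \<Rightarrow> (nat \<Rightarrow> nat \<Rightarrow> complex) \<Rightarrow> nat \<Rightarrow> nat \<Rightarrow> complex" where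
  "mm n A B i j = (\<Sum>k<n. A i k * B k j)"

definition tr :: "nat \<Rightarrow> (nat \<Rightarrow> nat \<Rightarrow> complex) \<Rightarrow> complex" where
  "tr n A = (\<Sum>i<n. A i i)"

lemma mm_assoc: "mm n (mm n A B) C = mm n A (mm n B C)"
proof (intro ext)
  fix i j
  have "mm n (mm n A B) C i j = (\<Sum>k<n. \<Sum>l<n. A i l * (B l k * C k j))"
    by (simp add: mm_def sum_distrib_right mult.assoc)
  also have "\<dots> = (\<Sum>l<n. \<Sum>k<n. A i l * (B l k * C k j))" by (rule sum.swap)
  also have "\<dots> = mm n A (mm n B C) i j" by (simp add: mm_def sum_distrib_left)
  finally show "mm n (mm n A B) C i j = mm n A (mm n B C) i j" .
qed

lemma tr_mm_comm: "tr n (mm n A B) = tr n (mm n B A)"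
  unfolding tr_def mm_def by (subst sum.swap) (simp add: mult.commute)

lemma app_mm: "app n (mm n A B) v = app n A (app n B v)"
proof
  fix i
  have "app n (mm n A B) v i = (\<Sum>j<n. \<Sum>k<n. A i k * (B k j * v j))"
    by (simp add: app_def mm_def sum_distrib_right mult.assoc)
  also have "\<dots> = (\<Sum>k<n. \<Sum>j<n. A i k * (B k j * v j))" by (rule sum.swap)
  also have "\<dots> = app n A (app n B v) i" by (simp add: app_def sum_distrib_left)
  finally show "app n (mm n A B) v i = app n A (app n B v) i" .
qed

lemma hermitian_adjoint:
  assumes W: "hermitian n W"
  shows "(\<Sum>i<n. cnj (w i) * app n W u i) = (\<Sum>k<n. cnj (app n W w k) * u k)"
proof -
  have "(\<Sum>i<n. cnj (w i) * app n W u i) = (\<Sum>i<n. \<Sum>k<n. cnj (w i) * W i k * u k)"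
    by (simp add: app_def sum_distrib_left mult.assoc)
  also have "\<dots> = (\<Sum>k<n. \<Sum>i<n. cnj (w i) * W i k * u k)" by (rule sum.swap)
  also have "\<dots> = (\<Sum>k<n. cnj (app n W w k) * u k)"
    by (simp add: app_def sum_distrib_right sum_distrib_left hermitianD [OF W] mult_ac)
  finally show ?thesis .
qed

lemma sesq_congruence:
  assumes W: "hermitian n W"
  shows "sesq n (mm n W (mm n T W)) v v = sesq n T (app n W v) (app n W v)"
  unfolding sesq_def app_mm by (rule hermitian_adjoint [OF W])

lemma hermitian_congruence:
  assumes W: "hermitian n W" and T: "hermitian n T"
  shows "hermitian n (mm n W (mm n T W))"
proof (rule hermitianI)
  fix i j assume ij: "i < n" "j < n"
  have "cnj (mm n W (mm n T W) i j) = (\<Sum>k<n. \<Sum>l<n. W k i * (T l k * W j l))"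
    using ij by (simp add: mm_def hermitianD [OF W] hermitianD [OF T] sum_distrib_left)
  also have "\<dots> = (\<Sum>l<n. \<Sum>k<n. W k i * (T l k * W j l))" by (rule sum.swap)
  also have "\<dots> = mm n W (mm n T W) j i" by (simp add: mm_def sum_distrib_left mult_ac)
  finally show "cnj (mm n W (mm n T W) i j) = mm n W (mm n T W) j i" .
qed

lemma entries_mult:
  assumes "A \<in> carrier_mat n n" "B \<in> carrier_mat n n" "i < n" "j < n"
  shows "entries (A * B) i j = mm n (entries A) (entries B) i j"
  using mult_mat_index [OF assms] by (simp add: entries_def mm_def)

lemma entries_mult3:
  assumes W: "W \<in> carrier_mat n n" and T: "T \<in> carrier_mat n n" and ij: "i < n" "j < n"
  shows "entries (W * T * W) i j = mm n (entries W) (mm n (entries T) (entries W)) i j"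
proof -
  have "entries (W * T * W) i j = (\<Sum>k<n. entries (W * T) i k * entries W k j)"
    using mult_mat_index [of "W * T" n n W n] W T ij by (simp add: entries_def)
  also have "\<dots> = mm n (mm n (entries W) (entries T)) (entries W) i j"
    unfolding mm_def [of n "mm n (entries W) (entries T)"]
    by (intro sum.cong refl) (simp add: entries_mult [OF W T ij(1)])
  finally show ?thesis by (simp only: mm_assoc)
qed

text \<open>Substituting \<open>mat_inv_sqrt R\<close> applied to \<open>v\<close> turns the form of \<open>R\<close> into the squared norm of \<open>v\<close>.\<close>

theorem whitened_op_norm_le:
  assumes R: "R \<in> carrier_mat n n" and h: "hermitian n (entries R)"
    and d: "d > 0" and coercive: "\<And>v. d * sq_norm n v \<le> Re (sesq n (entries R) v v)"
    and T: "T \<in> carrier_mat n n" and Th: "hermitian n (entries T)"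
    and B: "0 \<le> B" and le: "\<And>v. \<bar>Re (sesq n (entries T) v v)\<bar> \<le> B * Re (sesq n (entries R) v v)"
  shows "op_norm (mat_inv_sqrt R * T * mat_inv_sqrt R) \<le> B"
proof -
  let ?W = "mat_inv_sqrt R"
  note W = mat_inv_sqrt_coercive [OF R h d coercive]
  have form: "sesq n (entries (?W * S * ?W)) v v = sesq n (entries S) (app n (entries ?W) v) (app n (entries ?W) v)"
    if S: "S \<in> carrier_mat n n" for S v
  proof -
    have "sesq n (entries (?W * S * ?W)) v v = sesq n (mm n (entries ?W) (mm n (entries S) (entries ?W))) v v"
      by (rule sesq_cong) (simp_all add: entries_mult3 [OF W(1) S])
    then show ?thesis by (simp only: sesq_congruence [OF W(2)])
  qed
  show ?thesis
  proof (rule op_norm_le [where n = n])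
    show "?W * T * ?W \<in> carrier_mat n n" using W(1) T by simp
    have hc: "hermitian n (mm n (entries ?W) (mm n (entries T) (entries ?W)))" by (rule hermitian_congruence [OF W(2) Th])
    show "hermitian n (entries (?W * T * ?W))"
      by (rule hermitianI) (simp add: entries_mult3 [OF W(1) T] hermitianD [OF hc])
    show "0 \<le> B" by (rule B)
    fix v
    have "sesq n (entries R) (app n (entries ?W) v) (app n (entries ?W) v) = sesq n (entries (1\<^sub>m n)) v v"
      unfolding form [OF R, symmetric] W(3) ..
    also have "\<dots> = (\<Sum>i<n. \<Sum>j<n. if i = j then cnj (v i) * v j else 0)"
      unfolding sesq_double_sum by (intro sum.cong refl) (auto simp: entries_def)
    also have "\<dots> = complex_of_real (sq_norm n v)" by (simp add: sq_norm_complex)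
    finally show "\<bar>Re (sesq n (entries (?W * T * ?W)) v v)\<bar> \<le> B * sq_norm n v"
      using le [of "app n (entries ?W) v"] unfolding form [OF T] by simp
  qed
qed

lemma autocov_uminus: "autocov f (- k) = cnj (autocov f k)"
proof -
  have "cnj (LINT t|circ. complex_of_real (f t) * cis (- real_of_int k * t))
      = (LINT t|circ. cnj (complex_of_real (f t) * cis (- real_of_int k * t)))"
    by (rule Bochner_Integration.integral_cnj [symmetric])
  then show ?thesis unfolding autocov_circ by (simp add: cis_cnj)
qed

lemma hermitian_tmat: "hermitian M (tmat f)"
  by (rule hermitianI) (simp add: tmat_def autocov_uminus [symmetric])

text \<open>The lower bound of the spectral function is inherited by the form, the constant function giving a multiple of the
  identity.\<close>

lemma tmat_coercive:
  assumes f: "integrable circ f" and c: "0 \<le> c" "AE t in circ. c \<le> f t"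
  shows "c * sq_norm M v \<le> Re (sesq M (tmat f) v v)"
proof -
  have "integrable circ (\<lambda>_. c)" by (intro integrable_circ_continuous continuous_intros)
  then have i: "integrable circ (\<lambda>_::real. c)" .
  have "sesq M (tmat (\<lambda>_. c)) v v = complex_of_real (1 / (2 * pi) * (LINT t|circ. c * (cmod (trig M v t))\<^sup>2))"
    unfolding sesq_double_sum tmat_def by (rule toeplitz_form [OF i])
  also have "1 / (2 * pi) * (LINT t|circ. c * (cmod (trig M v t))\<^sup>2) = c * (1 / (2 * pi) * (LINT t|circ. (cmod (trig M v t))\<^sup>2))" by simp
  also have "\<dots> = c * sq_norm M v" by (simp only: parseval)
  finally have e: "Re (sesq M (tmat (\<lambda>_. c)) v v) = c * sq_norm M v" by simp
  have "\<bar>Re (sesq M (tmat (\<lambda>_. c)) v v)\<bar> \<le> 1 * Re (sesq M (tmat f) v v)"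
    unfolding tmat_def by (rule toeplitz_form_mono [OF f i]) (use c in auto)
  then show ?thesis unfolding e by simp
qed

lemma integrable_circ_from_open:
  assumes "set_integrable lebesgue {-pi<..<pi} f"
  shows "integrable circ (f :: real \<Rightarrow> real)"
proof -
  have "integrable lebesgue (\<lambda>x. indicat_real {-pi<..<pi} x *\<^sub>R f x + (indicat_real {-pi} x * f (-pi) + indicat_real {pi} x * f pi))"
    using assms unfolding set_integrable_def
    by (intro Bochner_Integration.integrable_add integrable_mult_left) auto
  also have "(\<lambda>x. indicat_real {-pi<..<pi} x *\<^sub>R f x + (indicat_real {-pi} x * f (-pi) + indicat_real {pi} x * f pi))
      = (\<lambda>x. indicat_real {-pi..pi} x *\<^sub>R f x)"
    by (auto simp: indicator_def fun_eq_iff)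
  finally show ?thesis by (subst integrable_restrict_space) auto
qed

lemma AE_circ_from_open:
  assumes "AE s in lebesgue_on {-pi<..<pi}. Q s"
  shows "AE s in circ. Q s \<and> s \<noteq> 0"
proof -
  have "AE s in lebesgue. s \<in> {-pi<..<pi} \<longrightarrow> Q s" using assms by (subst (asm) AE_restrict_space_iff) auto
  moreover have "AE s in lebesgue. s \<noteq> 0" "AE s in lebesgue. s \<noteq> pi" "AE s in lebesgue. s \<noteq> - pi"
    by (intro AE_completion AE_lborel_singleton)+
  ultimately have "AE s in lebesgue. s \<in> {-pi..pi} \<longrightarrow> Q s \<and> s \<noteq> 0"
    by eventually_elim auto
  then show ?thesis by (subst AE_restrict_space_iff) auto
qed

section \<open>The symbol of the estimator as a quadratic form\<close>

text \<open>The matrix of the form in a row \<open>z\<close> of the data whose value is the contribution of \<open>z\<close> to the symbol of the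
  estimator; \<open>q\<close> is the square root of the Toeplitz matrix. The indices are exchanged because \<open>q\<close> acts on rows, from the
  right, whereas \<open>herm_form\<close> conjugates its left argument.\<close>

definition chaos_mat :: "nat \<Rightarrow> (nat \<Rightarrow> nat \<Rightarrow> complex) \<Rightarrow> real \<Rightarrow> nat \<Rightarrow> nat \<Rightarrow> complex" where
  "chaos_mat M q \<theta> a b = mm M q (mm M (dmat M \<theta>) q) b a"

lemma chaos_mat_hermitian:
  assumes q: "hermitian M q" and ab: "a < M" "b < M"
  shows "chaos_mat M q \<theta> b a = cnj (chaos_mat M q \<theta> a b)"
  using hermitianD [OF hermitian_congruence [OF q hermitian_dmat], of b a] ab by (simp add: chaos_mat_def)

lemma chaos_mat_trace:
  assumes qq: "\<And>i j. i < M \<Longrightarrow> j < M \<Longrightarrow> mm M q q i j = R i j"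
  shows "(\<Sum>a<M. chaos_mat M q \<theta> a a) = (\<Sum>p<M. \<Sum>s<M. R p s * dmat M \<theta> s p)"
proof -
  have "(\<Sum>a<M. chaos_mat M q \<theta> a a) = tr M (mm M q (mm M (dmat M \<theta>) q))"
    by (simp add: tr_def chaos_mat_def)
  also have "\<dots> = tr M (mm M (mm M (dmat M \<theta>) q) q)" by (rule tr_mm_comm)
  also have "\<dots> = tr M (mm M (dmat M \<theta>) (mm M q q))" by (simp only: mm_assoc)
  also have "\<dots> = tr M (mm M (mm M q q) (dmat M \<theta>))" by (rule tr_mm_comm)
  also have "\<dots> = (\<Sum>p<M. \<Sum>s<M. R p s * dmat M \<theta> s p)"
    unfolding tr_def mm_def [of M "mm M q q"] by (intro sum.cong refl) (simp add: qq)
  finally show ?thesis .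
qed

text \<open>The squared Frobenius norm of the Hermitian matrix \<open>q D q\<close> is \<open>tr (q D q q D q) = tr (R D R D)\<close>.\<close>

lemma chaos_mat_frobenius:
  assumes q: "hermitian M q" and qq: "\<And>i j. i < M \<Longrightarrow> j < M \<Longrightarrow> mm M q q i j = R i j"
  shows "(\<Sum>a<M. \<Sum>b<M. (cmod (chaos_mat M q \<theta> a b))\<^sup>2) = Re (trace4 M (dmat M \<theta>) R R)"
proof -
  let ?D = "dmat M \<theta>"
  let ?G = "mm M q (mm M ?D q)"
  have hG: "hermitian M ?G" by (rule hermitian_congruence [OF q hermitian_dmat])
  have "complex_of_real (\<Sum>a<M. \<Sum>b<M. (cmod (chaos_mat M q \<theta> a b))\<^sup>2) = (\<Sum>a<M. \<Sum>b<M. ?G a b * ?G b a)"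
    unfolding of_real_sum complex_norm_square chaos_mat_def
    by (intro sum.cong refl) (simp add: hermitianD [OF hG] mult.commute)
  also have "\<dots> = tr M (mm M ?G ?G)" by (simp add: tr_def mm_def [of M ?G])
  also have "\<dots> = tr M (mm M q (mm M ?D (mm M (mm M q q) (mm M ?D q))))" by (simp only: mm_assoc)
  also have "\<dots> = tr M (mm M (mm M ?D (mm M (mm M q q) (mm M ?D q))) q)" by (rule tr_mm_comm)
  also have "\<dots> = tr M (mm M (mm M ?D (mm M (mm M q q) ?D)) (mm M q q))" by (simp only: mm_assoc)
  also have "\<dots> = tr M (mm M (mm M q q) (mm M ?D (mm M (mm M q q) ?D)))" by (rule tr_mm_comm)
  also have "\<dots> = trace4 M ?D R R"
    unfolding tr_def trace4_def mm_def [of M "mm M q q" "mm M ?D _"]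
  proof (intro sum.cong refl)
    fix a b assume ab: "a \<in> {..<M}" "b \<in> {..<M}"
    have "mm M ?D (mm M (mm M q q) ?D) b a = (\<Sum>c<M. \<Sum>d<M. ?D b c * R c d * ?D d a)"
      unfolding mm_def [of M ?D] mm_def [of M "mm M q q"] sum_distrib_left
      by (intro sum.cong refl) (simp add: qq mult.assoc)
    then show "mm M q q a b * mm M ?D (mm M (mm M q q) ?D) b a = R a b * (\<Sum>c<M. \<Sum>d<M. ?D b c * R c d * ?D d a)"
      using ab by (simp add: qq)
  qed
  finally show ?thesis by (metis Re_complex_of_real)
qed

lemma chaos_mat_form:
  assumes q: "hermitian M q"
  shows "herm_form M (chaos_mat M q \<theta>) z
    = Re (\<Sum>p<M. \<Sum>s<M. cnj (\<Sum>a<M. z a * q a p) * (\<Sum>a<M. z a * q a s) * dmat M \<theta> s p)"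
proof -
  let ?D = "dmat M \<theta>"
  let ?G = "mm M q (mm M ?D q)"
  define w where "w a = cnj (z a)" for a
  have wq: "app M q w p = cnj (\<Sum>a<M. z a * q a p)" if "p < M" for p
    using that by (simp add: app_def w_def hermitianD [OF q] mult.commute)
  have "(\<Sum>a<M. \<Sum>b<M. cnj (z a) * chaos_mat M q \<theta> a b * z b) = (\<Sum>b<M. \<Sum>a<M. cnj (z a) * chaos_mat M q \<theta> a b * z b)"
    by (rule sum.swap)
  also have "\<dots> = sesq M ?G w w"
    unfolding sesq_double_sum by (intro sum.cong refl) (simp add: w_def chaos_mat_def mult_ac)
  also have "\<dots> = sesq M ?D (app M q w) (app M q w)" by (rule sesq_congruence [OF q])
  also have "\<dots> = (\<Sum>s<M. \<Sum>p<M. cnj (app M q w s) * ?D s p * app M q w p)" by (rule sesq_double_sum)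
  also have "\<dots> = (\<Sum>p<M. \<Sum>s<M. cnj (app M q w s) * ?D s p * app M q w p)" by (rule sum.swap)
  also have "\<dots> = (\<Sum>p<M. \<Sum>s<M. cnj (\<Sum>a<M. z a * q a p) * (\<Sum>a<M. z a * q a s) * ?D s p)"
    by (intro sum.cong refl) (simp add: wq mult_ac)
  finally show ?thesis unfolding herm_form_def by simp
qed

lemma symbol_dmat: "symbol M T \<theta> = (\<Sum>p<M. \<Sum>s<M. T (int p - int s) * dmat M \<theta> s p)"
  unfolding symbol_double_sum
proof (intro sum.cong refl)
  fix p s
  have "- ((real s - real p) * \<theta>) = real_of_int (int p - int s) * \<theta>" by (simp add: algebra_simps)
  moreover have "wt M s p = 1 / (real M - \<bar>real_of_int (int p - int s)\<bar>)" by (simp add: wt_def abs_minus_commute)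
  ultimately show "T (int p - int s) * cis (real_of_int (int p - int s) * \<theta>) / complex_of_real (real M - \<bar>real_of_int (int p - int s)\<bar>)
      = T (int p - int s) * dmat M \<theta> s p"
    unfolding dmat_def by (simp only: of_real_divide of_real_1) simp
qed

text \<open>The estimator averages the diagonals of \<open>S\<close>; the weights of \<open>dmat\<close> are the inverse lengths of these diagonals.\<close>

lemma symbol_autocov_est:
  assumes S: "S \<in> carrier_mat M M"
  shows "symbol M (autocov_est S) \<theta> = (\<Sum>p<M. \<Sum>s<M. S $$ (p, s) * dmat M \<theta> s p)"
proof -
  let ?I = "\<lambda>k. {i. 0 \<le> i \<and> i < int M \<and> 0 \<le> i + k \<and> i + k < int M}"
  have "(\<Sum>p<M. \<Sum>s<M. S $$ (p, s) * dmat M \<theta> s p)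
      = (\<Sum>k\<in>{- int M<..<int M}. \<Sum>i\<in>?I k. S $$ (nat (i + k), nat i) * dmat M \<theta> (nat i) (nat (i + k)))"
    by (rule diag_sum)
  also have "\<dots> = symbol M (autocov_est S) \<theta>"
    unfolding symbol_def
  proof (intro sum.cong refl)
    fix k assume k: "k \<in> {- int M<..<int M}"
    have "(\<Sum>i\<in>?I k. S $$ (nat (i + k), nat i) * dmat M \<theta> (nat i) (nat (i + k)))
        = (\<Sum>i\<in>?I k. S $$ (nat (i + k), nat i) * (complex_of_real (1 / (real M - \<bar>real_of_int k\<bar>)) * cis (real_of_int k * \<theta>)))"
    proof (intro sum.cong refl arg_cong2 [where f = "(*)"])
      fix i assume i: "i \<in> ?I k"
      have "real (nat i) - real (nat (i + k)) = - real_of_int k" using i by auto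
      then show "dmat M \<theta> (nat i) (nat (i + k)) = complex_of_real (1 / (real M - \<bar>real_of_int k\<bar>)) * cis (real_of_int k * \<theta>)"
        unfolding dmat_def wt_def by simp
    qed
    also have "\<dots> = (\<Sum>i\<in>?I k. S $$ (nat (i + k), nat i)) * (complex_of_real (1 / (real M - \<bar>real_of_int k\<bar>)) * cis (real_of_int k * \<theta>))"
      by (rule sum_distrib_right [symmetric])
    also have "\<dots> = autocov_est S k * cis (real_of_int k * \<theta>)"
      using S by (simp add: autocov_est_def)
    finally show "(\<Sum>i\<in>?I k. S $$ (nat (i + k), nat i) * dmat M \<theta> (nat i) (nat (i + k)))
        = autocov_est S k * cis (real_of_int k * \<theta>)" .
  qed
  finally show ?thesis ..
qed

lemma data_matrix_index:
  fixes c :: "nat \<Rightarrow> real"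
  assumes Z: "Z \<in> carrier_mat N M" and Q: "mat_sqrt R \<in> carrier_mat M M" and c: "\<And>n. n < N \<Longrightarrow> 0 \<le> c n"
  defines "X \<equiv> data_matrix (mat_diag N (\<lambda>n. complex_of_real (c n))) Z R"
  shows "X \<in> carrier_mat N M"
    and "n < N \<Longrightarrow> p < M \<Longrightarrow> X $$ (n, p) = complex_of_real (sqrt (c n)) * (\<Sum>a<M. Z $$ (n, a) * mat_sqrt R $$ (a, p))"
proof -
  have "mat_sqrt (mat_diag N (\<lambda>n. complex_of_real (c n))) = mat_diag N (\<lambda>n. complex_of_real (sqrt (c n)))"
    by (rule mat_sqrt_diag) (rule c)
  then have X: "X = mat N M (\<lambda>(n, a). complex_of_real (sqrt (c n)) * Z $$ (n, a)) * mat_sqrt R"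
    unfolding X_def data_matrix_def by (simp add: mat_diag_mult_left [OF Z])
  show "X \<in> carrier_mat N M" unfolding X by (rule mult_carrier_mat [OF _ Q]) simp
  assume np: "n < N" "p < M"
  have "X $$ (n, p) = (\<Sum>a<M. mat N M (\<lambda>(n, a). complex_of_real (sqrt (c n)) * Z $$ (n, a)) $$ (n, a) * mat_sqrt R $$ (a, p))"
    unfolding X by (rule mult_mat_index [OF _ Q np]) simp
  also have "\<dots> = complex_of_real (sqrt (c n)) * (\<Sum>a<M. Z $$ (n, a) * mat_sqrt R $$ (a, p))"
    using np unfolding sum_distrib_left by (intro sum.cong refl) simp
  finally show "X $$ (n, p) = complex_of_real (sqrt (c n)) * (\<Sum>a<M. Z $$ (n, a) * mat_sqrt R $$ (a, p))" .
qed

lemma sample_cov_index: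
  assumes X: "X \<in> carrier_mat N M"
  shows "sample_cov X \<in> carrier_mat M M"
    and "p < M \<Longrightarrow> s < M \<Longrightarrow> sample_cov X $$ (p, s) = complex_of_real (1 / real N) * (\<Sum>n<N. cnj (X $$ (n, p)) * X $$ (n, s))"
proof -
  have A: "mat_adjoint X \<in> carrier_mat M N" using X by (auto intro!: carrier_matI)
  show "sample_cov X \<in> carrier_mat M M" unfolding sample_cov_def using A X by simp
  assume ps: "p < M" "s < M"
  have "sample_cov X $$ (p, s) = complex_of_real (1 / real N) * (mat_adjoint X * X) $$ (p, s)"
    unfolding sample_cov_def using ps X by simp
  also have "(mat_adjoint X * X) $$ (p, s) = (\<Sum>n<N. mat_adjoint X $$ (p, n) * X $$ (n, s))"
    by (rule mult_mat_index [OF A X ps])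
  also have "\<dots> = (\<Sum>n<N. cnj (X $$ (n, p)) * X $$ (n, s))"
    using ps X by (intro sum.cong refl) (simp add: index_mat_adjoint)
  finally show "sample_cov X $$ (p, s) = complex_of_real (1 / real N) * (\<Sum>n<N. cnj (X $$ (n, p)) * X $$ (n, s))" .
qed

lemma hermitian_sample_cov:
  assumes X: "X \<in> carrier_mat N M"
  shows "hermitian M (entries (sample_cov X))"
  by (rule hermitianI) (simp add: entries_def sample_cov_index [OF X] mult.commute)

lemma autocov_est_uminus:
  assumes S: "S \<in> carrier_mat M M" and h: "hermitian M (entries S)"
  shows "autocov_est S (- k) = cnj (autocov_est S k)"
proof -
  have "(\<Sum>i\<in>{i. 0 \<le> i \<and> i < int M \<and> 0 \<le> i + - k \<and> i + - k < int M}. S $$ (nat (i + - k), nat i))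
      = (\<Sum>i\<in>{i. 0 \<le> i \<and> i < int M \<and> 0 \<le> i + k \<and> i + k < int M}. cnj (S $$ (nat (i + k), nat i)))"
  proof (rule sum.reindex_bij_witness [where i = "\<lambda>i. i + k" and j = "\<lambda>i. i - k"])
    fix i assume i: "i \<in> {i. 0 \<le> i \<and> i < int M \<and> 0 \<le> i + - k \<and> i + - k < int M}"
    then have "nat i < M" "nat (i - k) < M" by auto
    from hermitianD [OF h this] show "cnj (S $$ (nat (i - k + k), nat (i - k))) = S $$ (nat (i + - k), nat i)"
      by (simp add: entries_def)
  qed auto
  then show ?thesis using S by (simp add: autocov_est_def)
qed

text \<open>Both symbols are linear in their matrices: the symbol of the estimator is a weighted sum of forms over the rows, and
  that of the population matrix is the trace of the matrix of these forms.\<close>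

theorem symbol_deviation:
  fixes c :: "nat \<Rightarrow> real" and \<theta> :: real
  assumes Z: "Z \<in> carrier_mat N M" and N: "N \<ge> 1" and c: "\<And>n. n < N \<Longrightarrow> 0 \<le> c n"
    and Q: "mat_sqrt (toeplitz M (autocov f)) \<in> carrier_mat M M" "hermitian M (entries (mat_sqrt (toeplitz M (autocov f))))"
    and QQ: "mat_sqrt (toeplitz M (autocov f)) * mat_sqrt (toeplitz M (autocov f)) = toeplitz M (autocov f)"
  defines "X \<equiv> data_matrix (mat_diag N (\<lambda>n. complex_of_real (c n))) Z (toeplitz M (autocov f))"
    and "A \<equiv> chaos_mat M (entries (mat_sqrt (toeplitz M (autocov f)))) \<theta>"
    and "\<xi> \<equiv> (\<Sum>n<N. c n) / real N"
  shows "Re (symbol M (\<lambda>k. autocov_est (sample_cov X) k - complex_of_real \<xi> * autocov f k) \<theta>)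
    = (\<Sum>n<N. c n / real N * (herm_form M A (mat_row_fun M Z n) - (\<Sum>a<M. Re (A a a))))"
proof -
  let ?R = "toeplitz M (autocov f)"
  let ?q = "entries (mat_sqrt ?R)"
  let ?D = "dmat M \<theta>"
  define u where "u n p = (\<Sum>a<M. Z $$ (n, a) * mat_sqrt ?R $$ (a, p))" for n p
  have Xc: "X \<in> carrier_mat N M" unfolding X_def by (rule data_matrix_index(1) [OF Z Q(1) c])
  have Xi: "X $$ (n, p) = complex_of_real (sqrt (c n)) * u n p" if "n < N" "p < M" for n p
    unfolding X_def u_def by (rule data_matrix_index(2) [OF Z Q(1) c that])
  have S: "sample_cov X $$ (p, s) = (\<Sum>n<N. complex_of_real (c n / real N) * (cnj (u n p) * u n s))" if "p < M" "s < M" for p s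
    unfolding sample_cov_index(2) [OF Xc that] sum_distrib_left
  proof (intro sum.cong refl)
    fix n assume n: "n \<in> {..<N}"
    then have "complex_of_real (sqrt (c n)) * complex_of_real (sqrt (c n)) = complex_of_real (c n)"
      using c by (simp flip: of_real_mult)
    then have "cnj (X $$ (n, p)) * X $$ (n, s) = complex_of_real (c n) * (cnj (u n p) * u n s)"
      using n that by (simp add: Xi)
    then show "complex_of_real (1 / real N) * (cnj (X $$ (n, p)) * X $$ (n, s)) = complex_of_real (c n / real N) * (cnj (u n p) * u n s)"
      by simp
  qed
  have qq: "mm M ?q ?q i j = tmat f i j" if "i < M" "j < M" for i j
    using entries_mult [OF Q(1,1) that] that unfolding QQ by (simp add: entries_def toeplitz_def tmat_def)
  have form: "herm_form M A (mat_row_fun M Z n) = Re (\<Sum>p<M. \<Sum>s<M. cnj (u n p) * u n s * ?D s p)" for n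
    unfolding A_def chaos_mat_form [OF Q(2)] u_def entries_def mat_row_fun_def by simp
  have est: "symbol M (autocov_est (sample_cov X)) \<theta> = (\<Sum>n<N. complex_of_real (c n / real N) * (\<Sum>p<M. \<Sum>s<M. cnj (u n p) * u n s * ?D s p))"
  proof -
    have "symbol M (autocov_est (sample_cov X)) \<theta> = (\<Sum>p<M. \<Sum>s<M. sample_cov X $$ (p, s) * ?D s p)"
      by (rule symbol_autocov_est [OF sample_cov_index(1) [OF Xc]])
    also have "\<dots> = (\<Sum>p<M. \<Sum>s<M. \<Sum>n<N. complex_of_real (c n / real N) * (cnj (u n p) * u n s * ?D s p))"
      by (intro sum.cong refl) (simp add: S sum_distrib_right mult.assoc)
    also have "\<dots> = (\<Sum>p<M. \<Sum>n<N. \<Sum>s<M. complex_of_real (c n / real N) * (cnj (u n p) * u n s * ?D s p))"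
      by (intro sum.cong refl sum.swap)
    also have "\<dots> = (\<Sum>n<N. \<Sum>p<M. \<Sum>s<M. complex_of_real (c n / real N) * (cnj (u n p) * u n s * ?D s p))"
      by (rule sum.swap)
    finally show ?thesis by (simp only: sum_distrib_left)
  qed
  have pop: "symbol M (autocov f) \<theta> = (\<Sum>a<M. A a a)"
    using chaos_mat_trace [where R = "tmat f", OF qq, of \<theta>] unfolding A_def symbol_dmat tmat_def by simp
  have "symbol M (\<lambda>k. autocov_est (sample_cov X) k - complex_of_real \<xi> * autocov f k) \<theta>
      = symbol M (autocov_est (sample_cov X)) \<theta> - complex_of_real \<xi> * symbol M (autocov f) \<theta>"
    unfolding symbol_def sum_distrib_left sum_subtractf [symmetric] by (intro sum.cong refl) (simp add: algebra_simps)
  moreover have scale: "Re (complex_of_real r * z) = r * Re z" for r z by simp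
  ultimately have "Re (symbol M (\<lambda>k. autocov_est (sample_cov X) k - complex_of_real \<xi> * autocov f k) \<theta>)
      = (\<Sum>n<N. c n / real N * herm_form M A (mat_row_fun M Z n)) - \<xi> * (\<Sum>a<M. Re (A a a))"
    unfolding est pop form by (simp only: minus_complex.sel Re_sum scale)
  also have "\<dots> = (\<Sum>n<N. c n / real N * (herm_form M A (mat_row_fun M Z n) - (\<Sum>a<M. Re (A a a))))"
    unfolding \<xi>_def right_diff_distrib sum_subtractf sum_divide_distrib sum_distrib_right [symmetric] ..
  finally show ?thesis .
qed

section \<open>From a grid of frequencies to the spectral norm\<close>

text \<open>Rounding a frequency away from 0 to a multiple of \<open>h\<close>, cut off at \<open>pi\<close>, gives a nearby grid point that is not
  closer to the origin. This is the direction in which the profile at the grid point is bounded by \<open>f\<close> at the given frequency.\<close>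

definition outward_grid :: "real \<Rightarrow> real set" where
  "outward_grid h = (\<lambda>j. min pi (real j * h)) ` {..nat \<lceil>pi / h\<rceil>} \<union> (\<lambda>j. - min pi (real j * h)) ` {..nat \<lceil>pi / h\<rceil>}"

lemma outward_grid_facts:
  assumes h: "0 < h"
  shows "finite (outward_grid h)" "outward_grid h \<subseteq> {-pi..pi}"
    "real (card (outward_grid h)) \<le> 2 * (pi / h) + 4"
    "t \<in> {-pi..pi} \<Longrightarrow> \<exists>u\<in>outward_grid h. \<bar>t - u\<bar> \<le> h \<and> \<bar>t\<bar> \<le> \<bar>u\<bar>"
proof -
  let ?J = "nat \<lceil>pi / h\<rceil>"
  let ?g = "\<lambda>j. min pi (real j * h)"
  show "finite (outward_grid h)" by (simp add: outward_grid_def)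
  have g: "0 \<le> ?g j" "?g j \<le> pi" for j using h by auto
  show "outward_grid h \<subseteq> {-pi..pi}" using g order_trans [OF _ g(1)] by (auto simp: outward_grid_def)
  have "card (outward_grid h) \<le> card (?g ` {..?J}) + card ((\<lambda>j. - ?g j) ` {..?J})"
    unfolding outward_grid_def by (rule card_Un_le)
  also have "\<dots> \<le> Suc ?J + Suc ?J"
    by (intro add_mono) (metis card_atMost card_image_le finite_atMost)+
  finally have "real (card (outward_grid h)) \<le> 2 * real ?J + 2" by linarith
  also have "real ?J \<le> pi / h + 1"
  proof -
    have "0 \<le> pi / h" using h by simp
    then have "real ?J = of_int \<lceil>pi / h\<rceil>" by simp
    then show ?thesis using ceiling_correct [of "pi / h"] by linarith
  qed
  finally show "real (card (outward_grid h)) \<le> 2 * (pi / h) + 4" by simp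
  assume t: "t \<in> {-pi..pi}"
  define j where "j = nat \<lceil>\<bar>t\<bar> / h\<rceil>"
  have a: "0 \<le> \<bar>t\<bar> / h" "\<bar>t\<bar> / h \<le> pi / h" using h t by (auto intro: divide_right_mono)
  have jJ: "j \<le> ?J" unfolding j_def using a by (intro nat_mono ceiling_mono)
  have "real j = of_int \<lceil>\<bar>t\<bar> / h\<rceil>" using a by (simp add: j_def)
  then have "\<bar>t\<bar> / h \<le> real j" "real j \<le> \<bar>t\<bar> / h + 1" using ceiling_correct [of "\<bar>t\<bar> / h"] by linarith+
  then have jh: "\<bar>t\<bar> \<le> real j * h" "real j * h \<le> \<bar>t\<bar> + h" using h by (auto simp: field_simps)
  have gj: "\<bar>t\<bar> \<le> ?g j" "?g j \<le> \<bar>t\<bar> + h" using jh t by (auto simp: min_def)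
  show "\<exists>u\<in>outward_grid h. \<bar>t - u\<bar> \<le> h \<and> \<bar>t\<bar> \<le> \<bar>u\<bar>"
  proof (cases "0 \<le> t")
    case True
    have "?g j \<in> outward_grid h" using jJ by (auto simp: outward_grid_def)
    moreover have "\<bar>t - ?g j\<bar> \<le> h \<and> \<bar>t\<bar> \<le> \<bar>?g j\<bar>" using gj True by linarith
    ultimately show ?thesis by blast
  next
    case False
    have "- ?g j \<in> outward_grid h" using jJ by (auto simp: outward_grid_def)
    moreover have "\<bar>t - - ?g j\<bar> \<le> h \<and> \<bar>t\<bar> \<le> \<bar>- ?g j\<bar>" using gj False by linarith
    ultimately show ?thesis by blast
  qed
qed

text \<open>The symbol of the error is small on the grid, relative to the profile. By \<open>symbol_grid\<close> it is then small
  everywhere, up to a term that the choice of \<open>h\<close> keeps below \<open>y * c \<le> y * f t\<close>. Since the grid points are chosen away from 0, the profile there is at most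
  \<open>C * f t\<close>, so the symbol is at most \<open>y * (C + 1) * f\<close> almost everywhere, and the comparison of forms applies. The
  profile is evaluated at \<open>max \<bar>u\<bar> (1 / M)\<close> because \<open>frobenius_profile\<close> provides estimates there.\<close>

theorem op_norm_le_of_grid:
  fixes f \<phi> :: "real \<Rightarrow> real"
  assumes f: "integrable circ f" and fc: "AE t in circ. c \<le> f t \<and> t \<noteq> 0" and c: "0 < c" and C: "0 < C"
    and \<phi>c: "\<And>t. 0 < t \<Longrightarrow> t \<le> pi \<Longrightarrow> c \<le> \<phi> t"
    and anti: "\<And>s t. 0 < s \<Longrightarrow> s \<le> t \<Longrightarrow> t \<le> pi \<Longrightarrow> \<phi> t \<le> \<phi> s"
    and P1: "\<And>s t. c \<le> f s \<Longrightarrow> 0 < \<bar>s\<bar> \<Longrightarrow> \<bar>s\<bar> \<le> t \<Longrightarrow> t \<le> pi \<Longrightarrow> \<phi> t \<le> C * f s"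
    and M: "M \<ge> 1" and h: "0 < h" "4 * (real M)\<^sup>2 * h \<le> 1" "4 * (real M)\<^sup>2 * h * \<phi> (1 / real M) \<le> c"
    and S: "S \<in> carrier_mat M M" "hermitian M (entries S)" and y: "0 \<le> y"
    and small: "\<And>u. u \<in> outward_grid h \<Longrightarrow>
       \<bar>Re (symbol M (\<lambda>k. autocov_est S k - complex_of_real \<xi> * autocov f k) u)\<bar> \<le> y * \<phi> (max \<bar>u\<bar> (1 / real M))"
  shows "op_norm (mat_inv_sqrt (toeplitz M (autocov f)) * toeplitz M (autocov_est S) * mat_inv_sqrt (toeplitz M (autocov f))
      - complex_of_real \<xi> \<cdot>\<^sub>m 1\<^sub>m M) \<le> y * (C + 1)"
proof -
  let ?R = "toeplitz M (autocov f)"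
  let ?E = "toeplitz M (autocov_est S)"
  let ?W = "mat_inv_sqrt ?R"
  define T where "T k = autocov_est S k - complex_of_real \<xi> * autocov f k" for k
  define g where "g t = Re (symbol M T t)" for t
  have Tu: "T (- k) = cnj (T k)" for k
    by (simp add: T_def autocov_uminus autocov_est_uminus [OF S])
  have R: "?R \<in> carrier_mat M M" and E: "?E \<in> carrier_mat M M" by (simp_all add: toeplitz_def)
  have eR: "entries ?R i j = tmat f i j" if "i < M" "j < M" for i j using that by (simp add: entries_def toeplitz_def tmat_def)
  have hR: "hermitian M (entries ?R)" by (rule hermitianI) (simp add: eR hermitianD [OF hermitian_tmat])
  have sR: "sesq M (entries ?R) v v = sesq M (tmat f) v v" for v by (rule sesq_cong) (simp_all add: eR)
  have coercive: "c * sq_norm M v \<le> Re (sesq M (entries ?R) v v)" for v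
    unfolding sR by (rule tmat_coercive [OF f]) (use c fc in \<open>auto elim!: eventually_mono\<close>)
  note W = mat_inv_sqrt_coercive [OF R hR c coercive]
  let ?T = "?E - complex_of_real \<xi> \<cdot>\<^sub>m ?R"
  have Tc: "?T \<in> carrier_mat M M" by (rule carrier_matI) (simp_all add: toeplitz_def)
  have eT: "entries ?T i j = T (int i - int j)" if "i < M" "j < M" for i j
    using that by (simp add: entries_def toeplitz_def T_def)
  have hT: "hermitian M (entries ?T)" by (rule hermitianI) (simp add: eT Tu [symmetric])
  have M0: "0 < 1 / real M" and M1: "1 / real M \<le> pi"
  proof -
    show "0 < 1 / real M" using M by simp
    have "1 / real M \<le> 1" using M by simp
    then show "1 / real M \<le> pi" using pi_gt3 by linarith
  qed
  have \<tau>: "0 < max \<bar>u\<bar> (1 / real M)" "max \<bar>u\<bar> (1 / real M) \<le> pi" if "u \<in> {-pi..pi}" for u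
    using that M0 M1 by (auto simp: less_max_iff_disj)
  have grid_in: "u \<in> {-pi..pi}" if "u \<in> outward_grid h" for u using that outward_grid_facts(2) [OF h(1)] by auto
  have bound: "\<bar>g t\<bar> \<le> y * (C + 1) * f t" if t: "t \<in> {-pi..pi}" "c \<le> f t" "t \<noteq> 0" for t
  proof -
    have "\<exists>u\<in>outward_grid h. \<bar>t - u\<bar> \<le> h \<and> \<bar>t\<bar> \<le> \<bar>u\<bar> \<and>
        \<bar>Re (symbol M T t)\<bar> \<le> y * \<phi> (max \<bar>u\<bar> (1 / real M)) + 4 * (real M)\<^sup>2 * h * y * \<phi> (1 / real M)"
    proof (rule symbol_grid [where P = "\<lambda>t u. \<bar>t\<bar> \<le> \<bar>u\<bar>"])
      show "T (- k) = cnj (T k)" for k by (rule Tu)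
      show "\<exists>u\<in>outward_grid h. \<bar>t - u\<bar> \<le> h \<and> \<bar>t\<bar> \<le> \<bar>u\<bar>" if "t \<in> {-pi..pi}" for t
        by (rule outward_grid_facts(4) [OF h(1) that])
      show "outward_grid h \<subseteq> {-pi..pi}" by (rule outward_grid_facts(2) [OF h(1)])
      show "\<bar>Re (symbol M T u)\<bar> \<le> y * \<phi> (max \<bar>u\<bar> (1 / real M))" if "u \<in> outward_grid h" for u
        using small [OF that] unfolding T_def .
      show "\<phi> (max \<bar>u\<bar> (1 / real M)) \<le> \<phi> (1 / real M)" if "u \<in> outward_grid h" for u
        using M0 \<tau>(2) [OF grid_in [OF that]] by (intro anti) auto
    qed (use M h y t in auto)
    then obtain u where u: "u \<in> outward_grid h" "\<bar>t\<bar> \<le> \<bar>u\<bar>"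
      "\<bar>g t\<bar> \<le> y * \<phi> (max \<bar>u\<bar> (1 / real M)) + 4 * (real M)\<^sup>2 * h * y * \<phi> (1 / real M)" unfolding g_def by blast
    have "\<phi> (max \<bar>u\<bar> (1 / real M)) \<le> C * f t"
      using t u(2) \<tau>(2) [OF grid_in [OF u(1)]] by (intro P1) auto
    then have 1: "y * \<phi> (max \<bar>u\<bar> (1 / real M)) \<le> y * (C * f t)" using y by (intro mult_left_mono)
    have "y * (4 * (real M)\<^sup>2 * h * \<phi> (1 / real M)) \<le> y * f t" using h(3) t(2) y by (intro mult_left_mono) auto
    then have "\<bar>g t\<bar> \<le> y * (C * f t) + y * f t" using u(3) 1 by (simp add: mult_ac)
    then show ?thesis by (simp add: algebra_simps)
  qed
  have gi: "integrable circ g" unfolding g_def by (intro integrable_circ_continuous continuous_intros)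
  have gAE: "AE t in circ. \<bar>g t\<bar> \<le> y * (C + 1) * f t"
    using fc AE_space
  proof eventually_elim
    fix t assume "c \<le> f t \<and> t \<noteq> 0" "t \<in> space circ"
    then show "\<bar>g t\<bar> \<le> y * (C + 1) * f t" by (intro bound) (auto simp: space_restrict_space)
  qed
  have form: "\<bar>Re (sesq M (entries ?T) v v)\<bar> \<le> y * (C + 1) * Re (sesq M (entries ?R) v v)" for v
  proof -
    have "sesq M (entries ?T) v v = sesq M (\<lambda>p q. autocov g (int p - int q)) v v"
    proof (rule sesq_cong)
      fix i j assume ij: "i < M" "j < M"
      then have "int i - int j \<in> {- int M<..<int M}" by auto
      then have "autocov g (int i - int j) = T (int i - int j)"
        unfolding g_def [abs_def] by (rule autocov_symbol [where T = T, OF Tu])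
      then show "entries ?T i j = autocov g (int i - int j)" using ij by (simp add: eT)
    qed simp
    moreover have "sesq M (entries ?R) v v = sesq M (\<lambda>p q. autocov f (int p - int q)) v v"
      unfolding sR tmat_def [abs_def] ..
    ultimately show ?thesis using toeplitz_form_mono [OF f gi gAE, of M v] by simp
  qed
  have "?W * ?E * ?W - complex_of_real \<xi> \<cdot>\<^sub>m 1\<^sub>m M = ?W * ?T * ?W"
  proof -
    have "?W * ?T * ?W = (?W * ?E - ?W * (complex_of_real \<xi> \<cdot>\<^sub>m ?R)) * ?W"
      using W(1) R E by (subst mult_minus_distrib_mat [of _ M M]) auto
    also have "\<dots> = ?W * ?E * ?W - ?W * (complex_of_real \<xi> \<cdot>\<^sub>m ?R) * ?W"
      using W(1) R E by (subst minus_mult_distrib_mat [of _ M M]) auto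
    also have "?W * (complex_of_real \<xi> \<cdot>\<^sub>m ?R) * ?W = complex_of_real \<xi> \<cdot>\<^sub>m (?W * ?R * ?W)"
      using W(1) R by (simp add: mult_smult_distrib [of _ M M] mult_smult_assoc_mat [of _ M M])
    finally show ?thesis by (simp only: W(3))
  qed
  moreover have "op_norm (?W * ?T * ?W) \<le> y * (C + 1)"
    by (rule whitened_op_norm_le [OF R hR c coercive Tc hT _ form]) (use y C in auto)
  ultimately show ?thesis by simp
qed

section \<open>The deviation inequality\<close>

theorem theorem2p2:
  fixes E :: row_ensemble
    and P :: "nat \<Rightarrow> nat \<Rightarrow> 'w measure"
    and Z :: "nat \<Rightarrow> nat \<Rightarrow> 'w \<Rightarrow> complex mat"
    and c :: "nat \<Rightarrow> nat \<Rightarrow> real"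
    and C \<kappa> a \<gamma> :: real
    and f L :: "real \<Rightarrow> real"
    and x :: "nat \<Rightarrow> real"
  defines "CC \<equiv> \<lambda>N. mat_diag N (\<lambda>n. complex_of_real (c N n))"
    and "R \<equiv> \<lambda>M. toeplitz M (autocov f)"
    and "\<xi> \<equiv> \<lambda>N. mat_trace (mat_diag N (\<lambda>n. complex_of_real (c N n))) / of_nat N"
  assumes prob: "\<And>M N. M \<ge> 1 \<Longrightarrow> N \<ge> 1 \<Longrightarrow> prob_space (P M N)"
    and rows: "\<And>M N. M \<ge> 1 \<Longrightarrow> N \<ge> 1 \<Longrightarrow> iid_rows E M N (P M N) (Z M N)"
    and c_nonneg: "\<And>N n. N \<ge> 1 \<Longrightarrow> n < N \<Longrightarrow> 0 \<le> c N n"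
    and C_pos: "C > 0" and \<kappa>_pos: "\<kappa> > 0"
    and trace_bound: "\<And>N. N \<ge> 1 \<Longrightarrow> Re (mat_trace (CC N * CC N)) / real N \<le> C"
    and f_L1: "set_integrable lebesgue {-pi<..<pi} f"
    and f_pos: "\<And>t. t \<in> {-pi..pi} - {0} \<Longrightarrow> f t > 0"
    and f_bounded: "\<And>\<delta>. \<delta> > 0 \<Longrightarrow> bounded (f ` ({-pi..pi} - {-\<delta><..<\<delta>}))"
    and f_essinf: "essinf (lebesgue_on {-pi<..<pi}) f > 0"
    and f_even: "\<And>t. t \<in> {-pi..pi} \<Longrightarrow> f (- t) = f t"
    and a_range: "0 < a" "a < 1"
    and L_slow: "slowly_varying_on (1 / pi) L"
    and f_L: "\<And>t. t \<in> {-pi..pi} - {0} \<Longrightarrow> f t = L (inverse \<bar>t\<bar>) / \<bar>t\<bar> powr a"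
    and \<gamma>_pos: "\<gamma> > 0"
    and x_lower: "(\<lambda>M. real M powr - \<gamma>) \<lesssim> x"
    and x_upper: "x \<lesssim> (\<lambda>_. C / \<kappa>)"
  shows "\<exists>K>0. \<forall>\<beta>::int. real_of_int \<beta> > 2 + a + \<gamma> \<longrightarrow>
    (\<exists>M\<^sub>0\<ge>1. \<forall>M\<ge>M\<^sub>0. \<forall>N\<ge>1. op_norm (CC N) \<le> \<kappa> * ln (real M) \<longrightarrow>
      measure (P M N)
        {\<omega> \<in> space (P M N).
           op_norm (mat_inv_sqrt (R M) * toeplitz_est (data_matrix (CC N) (Z M N \<omega>) (R M))
                      * mat_inv_sqrt (R M) - \<xi> N \<cdot>\<^sub>m 1\<^sub>m M) > x M}
      \<le> 2 * exp (- (real N * (x M)\<^sup>2 / (C * K * (ln (real M))\<^sup>2)) + real_of_int \<beta> * ln (real M)))"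
proof -
  obtain \<phi> Cf cf b where cf: "0 < cf" and Cf: "0 < Cf" and b: "0 < b" "b < 1" "b < a + \<gamma>"
    and fAE: "AE s in lebesgue_on {-pi<..<pi}. cf \<le> f s"
    and anti: "\<And>s t. 0 < s \<Longrightarrow> s \<le> t \<Longrightarrow> t \<le> pi \<Longrightarrow> \<phi> t \<le> \<phi> s"
    and \<phi>c: "\<And>t. 0 < t \<Longrightarrow> t \<le> pi \<Longrightarrow> cf \<le> \<phi> t"
    and P1: "\<And>s t. cf \<le> f s \<Longrightarrow> 0 < \<bar>s\<bar> \<Longrightarrow> \<bar>s\<bar> \<le> t \<Longrightarrow> t \<le> pi \<Longrightarrow> \<phi> t \<le> Cf * f s"
    and P2: "\<And>s t. 0 < \<bar>s\<bar> \<Longrightarrow> \<bar>s\<bar> \<le> t \<Longrightarrow> t \<le> pi \<Longrightarrow> f s \<le> Cf * (t / \<bar>s\<bar>) powr b * \<phi> t"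
    and P3: "\<And>s t. 0 < t \<Longrightarrow> t \<le> \<bar>s\<bar> \<Longrightarrow> \<bar>s\<bar> \<le> pi \<Longrightarrow> f s \<le> \<phi> t"
    and P4: "\<And>t. 0 < t \<Longrightarrow> t \<le> pi \<Longrightarrow> \<phi> t \<le> Cf * (pi / t) powr b * \<phi> pi"
  proof (rule spectral_profile [OF f_bounded f_essinf a_range L_slow f_L \<gamma>_pos], goal_cases)
    case (3 \<phi> Cf cf b)
    show ?case by (rule 3(1) [OF 3(2-)])
  qed
  have fi: "integrable circ f" by (rule integrable_circ_from_open [OF f_L1])
  have fc: "AE t in circ. cf \<le> f t \<and> t \<noteq> 0" by (rule AE_circ_from_open [OF fAE])
  have fn: "AE t in circ. 0 \<le> f t" using fc by eventually_elim (use cf in auto)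
  obtain k1 where k1: "k1 > 0" "\<And>M. M \<ge> 1 \<Longrightarrow> real M powr - \<gamma> \<le> k1 * x M"
    using x_lower by (auto simp: lesssim_def)
  obtain k2 where k2: "k2 > 0" "\<And>M. M \<ge> 1 \<Longrightarrow> x M \<le> k2 * (C / \<kappa>)"
    using x_upper by (auto simp: lesssim_def)
  have x_pos: "0 < x M" if "M \<ge> 1" for M
  proof -
    have "0 < real M powr - \<gamma>" using that by simp
    also have "\<dots> \<le> k1 * x M" by (rule k1(2) [OF that])
    finally show ?thesis using k1(1) by (simp add: zero_less_mult_iff)
  qed
  \<comment> \<open>The constant of \<open>frobenius_profile\<close>.\<close>
  define K6 where "K6 = 2 * Cf + 1 + 36 * (2 * Cf / (1 - b))"
  \<comment> \<open>\<open>4 * K6\<close> absorbs \<open>2 * harm M \<le> 4 * ln M\<close>, and \<open>k2\<close> makes the exponential moments of the single rows finite at the optimal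
    parameter, which grows with \<open>x M\<close>.\<close>
  define K8 where "K8 = max (4 * K6) k2"
  have K6: "0 < K6" using Cf b by (simp add: K6_def add_pos_pos)
  have K8: "0 < K8" "4 * K6 \<le> K8" "k2 \<le> K8" using K6 by (auto simp: K8_def)
  \<comment> \<open>The profile at \<open>1 / M\<close> is at most \<open>K4 * M powr b\<close>; the maximum with \<open>cf\<close> makes the mesh fine enough for \<open>symbol_grid\<close>.\<close>
  define K4 where "K4 = max cf (Cf * pi powr b * \<phi> pi)"
  have K4: "0 < K4" "cf \<le> K4" "Cf * pi powr b * \<phi> pi \<le> K4" using cf by (auto simp: K4_def)
  \<comment> \<open>The exponent at one frequency is \<open>N * (y * \<psi>)\<^sup>2 / (64 * F * C)\<close> with \<open>F = (K8 * \<psi> * ln M)\<^sup>2\<close> and \<open>y = x M / (Cf + 1)\<close>.\<close>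
  define K where "K = 64 * K8\<^sup>2 * (Cf + 1)\<^sup>2"
  have K: "K > 0" using K8 Cf by (simp add: K_def)
  \<comment> \<open>The grid has at most \<open>K5 * M powr (2 + b)\<close> points.\<close>
  define K5 where "K5 = 8 * pi * K4 / cf + 4"
  have K5: "K5 > 0" using K4 cf by (simp add: K5_def add_pos_pos)
  show ?thesis
  proof (intro exI [of _ K] conjI K allI impI)
    fix \<beta> :: int
    assume \<beta>: "2 + a + \<gamma> < real_of_int \<beta>"
    define d where "d = real_of_int \<beta> - (2 + b)"
    have d: "d > 0" using \<beta> b by (simp add: d_def)
    \<comment> \<open>For \<open>M \<ge> M0\<close>, \<open>M powr (\<beta> - 2 - b)\<close> is at least \<open>K5\<close>, and \<open>ln M \<ge> 1\<close>.\<close>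
    define M0 where "M0 = max 3 (nat \<lceil>K5 powr (1 / d)\<rceil>)"
    have M0: "K5 * real M powr (2 + b) \<le> real M powr real_of_int \<beta>" "3 \<le> M" if "M0 \<le> M" for M
    proof -
      show M3: "3 \<le> M" using that by (simp add: M0_def)
      have "K5 powr (1 / d) \<le> real M" using that by (simp add: M0_def)
      then have "(K5 powr (1 / d)) powr d \<le> real M powr d" using d by (intro powr_mono2) auto
      then have "K5 \<le> real M powr d" using K5 d by (simp add: powr_powr)
      then have "K5 * real M powr (2 + b) \<le> real M powr d * real M powr (2 + b)" by (intro mult_right_mono) auto
      also have "\<dots> = real M powr real_of_int \<beta>" by (simp add: powr_add [symmetric] d_def)
      finally show "K5 * real M powr (2 + b) \<le> real M powr real_of_int \<beta>" .
    qed
    show "\<exists>M\<^sub>0\<ge>1. \<forall>M\<ge>M\<^sub>0. \<forall>N\<ge>1. op_norm (CC N) \<le> \<kappa> * ln (real M) \<longrightarrow>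
      measure (P M N)
        {\<omega> \<in> space (P M N).
           op_norm (mat_inv_sqrt (R M) * toeplitz_est (data_matrix (CC N) (Z M N \<omega>) (R M))
                      * mat_inv_sqrt (R M) - \<xi> N \<cdot>\<^sub>m 1\<^sub>m M) > x M}
      \<le> 2 * exp (- (real N * (x M)\<^sup>2 / (C * K * (ln (real M))\<^sup>2)) + real_of_int \<beta> * ln (real M))"
    proof (intro exI [of _ M0] conjI allI impI)
      show "1 \<le> M0" by (simp add: M0_def)
      fix M N :: nat
      assume M: "M0 \<le> M" and N: "1 \<le> N" and norm: "op_norm (CC N) \<le> \<kappa> * ln (real M)"
      define l where "l = ln (real M)"
      have M3: "3 \<le> M" and M1: "1 \<le> M" using M0(2) [OF M] by auto
      have l1: "1 \<le> l"
      proof -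
        have "exp 1 \<le> real M" using M3 exp_le by (metis of_nat_le_iff of_nat_numeral order_trans)
        then show ?thesis unfolding l_def using M1 by (subst ln_ge_iff) auto
      qed
      have harm: "2 * harm M \<le> 4 * l"
      proof -
        obtain m where m: "M = Suc m" using M1 by (cases M) auto
        have "harm (Suc m) - ln (real (Suc m)) \<le> (harm (Suc 0) - ln (real (Suc 0)) :: real)"
          using decseqD [OF decseq_harm_diff_ln le0, of m] by simp
        then show ?thesis using l1 by (simp add: l_def m harm_expand)
      qed
      interpret PM: prob_space "P M N" by (rule prob [OF M1 N])
      note rowsM = rows [OF M1 N]
      have cn: "0 \<le> c N n" "c N n \<le> \<kappa> * l" if "n < N" for n
      proof -
        show "0 \<le> c N n" by (rule c_nonneg [OF N that])
        have "c N n \<le> op_norm (CC N)" unfolding CC_def by (rule op_norm_diag_ge [OF that c_nonneg [OF N]])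
        then show "c N n \<le> \<kappa> * l" using norm by (simp add: l_def)
      qed
      have sumsq: "(\<Sum>n<N. (c N n / real N)\<^sup>2) \<le> C / real N"
      proof -
        have "mat_trace (CC N * CC N) = complex_of_real (\<Sum>n<N. (c N n)\<^sup>2)"
          unfolding CC_def mat_diag_diag by (simp add: mat_trace_def mat_diag_def power2_eq_square)
        then have "(\<Sum>n<N. (c N n)\<^sup>2) / real N \<le> C" using trace_bound [OF N] by simp
        then have "((\<Sum>n<N. (c N n)\<^sup>2) / real N) / real N \<le> C / real N" by (intro divide_right_mono) auto
        then show ?thesis by (simp add: power_divide sum_divide_distrib power2_eq_square)
      qed
      define \<mu> where "\<mu> = (\<Sum>n<N. c N n) / real N"
      have \<mu>: "\<xi> N = complex_of_real \<mu>"
        unfolding \<xi>_def \<mu>_def by (simp add: mat_trace_def mat_diag_def)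
      define h where "h = cf / (4 * K4 * real M powr (2 + b))"
      have Mp: "0 < real M powr b" "0 < real M powr (2 + b)" using M1 by auto
      have Mb: "real M powr (2 + b) = (real M)\<^sup>2 * real M powr b" using M1 by (simp add: powr_add)
      have h0: "0 < h" using cf K4 Mp by (simp add: h_def)
      have h4: "4 * (real M)\<^sup>2 * h = cf / (K4 * real M powr b)"
        using M1 K4 Mp unfolding h_def Mb by (simp add: field_simps)
      have h1: "4 * (real M)\<^sup>2 * h \<le> 1"
      proof -
        have "1 \<le> real M powr b" using M1 b by (intro ge_one_powr_ge_zero) auto
        then have "cf * 1 \<le> K4 * real M powr b" using K4 cf by (intro mult_mono) auto
        then show ?thesis unfolding h4 using K4 Mp by simp
      qed
      have Mi: "0 < 1 / real M" "1 / real M \<le> pi"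
      proof -
        show "0 < 1 / real M" using M1 by simp
        have "1 / real M \<le> 1" using M1 by simp
        then show "1 / real M \<le> pi" using pi_gt3 by linarith
      qed
      have h2: "4 * (real M)\<^sup>2 * h * \<phi> (1 / real M) \<le> cf"
      proof -
        have "\<phi> (1 / real M) \<le> Cf * (pi / (1 / real M)) powr b * \<phi> pi" by (rule P4 [OF Mi])
        also have "\<dots> = Cf * pi powr b * \<phi> pi * real M powr b" using M1 by (simp add: powr_mult)
        also have "\<dots> \<le> K4 * real M powr b" using K4 by (intro mult_right_mono) auto
        finally have "cf / (K4 * real M powr b) * \<phi> (1 / real M) \<le> cf / (K4 * real M powr b) * (K4 * real M powr b)"
          using cf K4 Mp by (intro mult_left_mono) auto
        then show ?thesis unfolding h4 using K4 Mp by simp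
      qed
      let ?\<Theta> = "outward_grid h"
      have card: "real (card ?\<Theta>) \<le> real M powr real_of_int \<beta>"
      proof -
        have "real (card ?\<Theta>) \<le> 2 * (pi / h) + 4" by (rule outward_grid_facts(3) [OF h0])
        also have "2 * (pi / h) = 8 * pi * K4 / cf * real M powr (2 + b)"
          using cf K4 Mp by (simp add: h_def)
        also have "4 \<le> 4 * real M powr (2 + b)" using M1 b by (simp add: ge_one_powr_ge_zero)
        finally have "real (card ?\<Theta>) \<le> K5 * real M powr (2 + b)" by (simp add: K5_def algebra_simps)
        also have "\<dots> \<le> real M powr real_of_int \<beta>" by (rule M0(1) [OF M])
        finally show ?thesis .
      qed
      have Rc: "R M \<in> carrier_mat M M" by (simp add: R_def toeplitz_def)
      have eR: "entries (R M) i j = tmat f i j" if "i < M" "j < M" for i j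
        using that by (simp add: entries_def R_def toeplitz_def tmat_def)
      have hR: "hermitian M (entries (R M))" by (rule hermitianI) (simp add: eR hermitianD [OF hermitian_tmat])
      have coercive: "cf * sq_norm M v \<le> Re (sesq M (entries (R M)) v v)" for v
      proof -
        have "sesq M (entries (R M)) v v = sesq M (tmat f) v v" by (rule sesq_cong) (simp_all add: eR)
        moreover have "cf * sq_norm M v \<le> Re (sesq M (tmat f) v v)"
          by (rule tmat_coercive [OF fi]) (use cf fc in \<open>auto elim!: eventually_mono\<close>)
        ultimately show ?thesis by simp
      qed
      note Q = mat_sqrt_coercive [OF Rc hR cf coercive]
      define q where "q = entries (mat_sqrt (R M))"
      have hq: "hermitian M q" unfolding q_def by (rule Q(2))
      have qq: "mm M q q i j = tmat f i j" if "i < M" "j < M" for i j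
        using entries_mult [OF Q(1,1) that] eR [OF that] unfolding Q(3) by (simp add: q_def)
      \<comment> \<open>A symbol bounded by \<open>y\<close> times the profile gives a norm of at most \<open>y * (Cf + 1)\<close>.\<close>
      define y where "y = x M / (Cf + 1)"
      have y: "0 < y" using x_pos [OF M1] Cf by (simp add: y_def)
      have yk: "y * \<kappa> \<le> K8 * C"
      proof -
        have "y \<le> x M" using x_pos [OF M1] Cf by (simp add: y_def field_simps)
        also have "\<dots> \<le> k2 * (C / \<kappa>)" by (rule k2(2) [OF M1])
        finally have "y * \<kappa> \<le> k2 * C" using \<kappa>_pos by (simp add: field_simps)
        also have "\<dots> \<le> K8 * C" using K8 C_pos by (intro mult_right_mono) auto
        finally show ?thesis .
      qed
      define \<psi> where "\<psi> u = \<phi> (max \<bar>u\<bar> (1 / real M))" for u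
      define A where "A u = chaos_mat M q u" for u
      define Sd where "Sd u \<omega> = (\<Sum>n<N. c N n / real N * (herm_form M (A u) (mat_row_fun M (Z M N \<omega>) n) - (\<Sum>i<M. Re (A u i i))))" for u \<omega>
      define bad where "bad u = {\<omega> \<in> space (P M N). y * \<psi> u < \<bar>Sd u \<omega>\<bar>}" for u
      define e where "e = exp (- (real N * (x M)\<^sup>2 / (C * K * l\<^sup>2)))"
      have bad: "bad u \<in> sets (P M N)" "measure (P M N) (bad u) \<le> 2 * e" if u: "u \<in> ?\<Theta>" for u
      proof -
        have "u \<in> {-pi..pi}" using u outward_grid_facts(2) [OF h0] by blast
        then have up: "\<bar>u\<bar> \<le> pi" by (simp add: abs_le_iff)
        have \<tau>: "0 < max \<bar>u\<bar> (1 / real M)" "max \<bar>u\<bar> (1 / real M) \<le> pi" using up Mi by (auto simp: less_max_iff_disj)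
        have \<psi>: "0 < \<psi> u" using \<phi>c [OF \<tau>] cf by (simp add: \<psi>_def)
        define F where "F = (K8 * \<psi> u * l)\<^sup>2"
        have F0: "0 < F" using K8 \<psi> l1 by (simp add: F_def)
        have frob: "(\<Sum>i<M. \<Sum>j<M. (cmod (A u i j))\<^sup>2) \<le> F"
        proof -
          have "(\<Sum>i<M. \<Sum>j<M. (cmod (A u i j))\<^sup>2) = Re (trace4 M (dmat M u) (tmat f) (tmat f))"
            unfolding A_def by (rule chaos_mat_frobenius [OF hq qq])
          also have "\<dots> \<le> (K6 * \<psi> u * (2 * harm M))\<^sup>2"
            unfolding K6_def \<psi>_def by (rule frobenius_profile [OF fi fn cf b(1,2) Cf \<phi>c P2 P3 M1 up])
          also have "\<dots> \<le> F"
            unfolding F_def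
          proof (rule power_mono)
            have "K6 * \<psi> u * (2 * harm M) \<le> K6 * \<psi> u * (4 * l)" using K6 \<psi> harm by (intro mult_left_mono) auto
            also have "\<dots> = 4 * K6 * (\<psi> u * l)" by simp
            also have "\<dots> \<le> K8 * (\<psi> u * l)" using K8 \<psi> l1 by (intro mult_right_mono) auto
            finally show "K6 * \<psi> u * (2 * harm M) \<le> K8 * \<psi> u * l" by (simp add: mult.assoc)
            show "0 \<le> K6 * \<psi> u * (2 * harm M)" using K6 \<psi> harm_nonneg [of M] by (intro mult_nonneg_nonneg) auto
          qed
          finally show ?thesis .
        qed
        \<comment> \<open>The parameter that minimizes \<open>- s * (y * \<psi> u) + 16 * s\<^sup>2 * F * (C / N)\<close>.\<close>
        define s where "s = real N * (y * \<psi> u) / (32 * F * C)"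
        have s0: "0 < s" using N y \<psi> F0 C_pos by (simp add: s_def)
        have herm: "A u b a = cnj (A u a b)" if "a < M" "b < M" for a b
          unfolding A_def by (rule chaos_mat_hermitian [OF hq that])
        \<comment> \<open>This is where the bound \<open>\<kappa> * ln M\<close> on the coefficients and the upper bound on \<open>x M\<close> enter.\<close>
        have sw: "32 * (s * (c N n / real N))\<^sup>2 * F \<le> 1" if n: "n < N" for n
        proof -
          have "s * (c N n / real N) = y * \<psi> u * c N n / (32 * F * C)" using N by (simp add: s_def)
          also have "\<dots> \<le> y * \<psi> u * (\<kappa> * l) / (32 * F * C)"
            using y \<psi> F0 C_pos cn(2) [OF n] by (intro divide_right_mono mult_left_mono) auto
          also have "\<dots> = (y * \<kappa>) * (\<psi> u * l) / (32 * F * C)" by simp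
          also have "\<dots> \<le> (K8 * C) * (\<psi> u * l) / (32 * F * C)"
            using yk \<psi> l1 F0 C_pos by (intro divide_right_mono mult_right_mono) auto
          also have "\<dots> = (K8 * \<psi> u * l) / (32 * F)" using C_pos by simp
          finally have 1: "s * (c N n / real N) \<le> (K8 * \<psi> u * l) / (32 * F)" .
          have "0 \<le> s * (c N n / real N)" using s0 cn(1) [OF n] by simp
          then have "(s * (c N n / real N))\<^sup>2 \<le> ((K8 * \<psi> u * l) / (32 * F))\<^sup>2" using 1 by (intro power_mono)
          also have "\<dots> = F / (32 * F)\<^sup>2" by (simp add: power_divide F_def)
          also have "\<dots> = 1 / (1024 * F)" using F0 by (simp add: power2_eq_square)
          finally have "32 * (s * (c N n / real N))\<^sup>2 * F \<le> 32 * (1 / (1024 * F)) * F"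
            using F0 by (intro mult_right_mono mult_left_mono) auto
          also have "\<dots> \<le> 1" using F0 by simp
          finally show ?thesis .
        qed
        show "bad u \<in> sets (P M N)"
          unfolding bad_def Sd_def by (rule rows_concentration(1) [OF PM.prob_space_axioms rowsM herm frob sw s0])
        have "measure (P M N) (bad u) \<le> 2 * exp (- s * (y * \<psi> u) + 16 * s\<^sup>2 * F * (\<Sum>n<N. (c N n / real N)\<^sup>2))"
          unfolding bad_def Sd_def by (rule rows_concentration(2) [OF PM.prob_space_axioms rowsM herm frob sw s0])
        also have "\<dots> \<le> 2 * e"
        proof -
          have "16 * s\<^sup>2 * F * (\<Sum>n<N. (c N n / real N)\<^sup>2) \<le> 16 * s\<^sup>2 * F * (C / real N)"
            using F0 by (intro mult_left_mono sumsq) auto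
          also have "\<dots> = s * (y * \<psi> u) / 2"
          proof -
            have "s * (32 * F * C) = real N * (y * \<psi> u)" using F0 C_pos by (simp add: s_def)
            then have "s * (s * (32 * F * C)) / (2 * real N) = s * (real N * (y * \<psi> u)) / (2 * real N)" by simp
            then show ?thesis using N by (simp add: power2_eq_square field_simps)
          qed
          finally have "- s * (y * \<psi> u) + 16 * s\<^sup>2 * F * (\<Sum>n<N. (c N n / real N)\<^sup>2) \<le> - (s * (y * \<psi> u) / 2)" by simp
          also have "s * (y * \<psi> u) / 2 = real N * (x M)\<^sup>2 / (C * K * l\<^sup>2)"
          proof -
            have "z * (v / D * w) / (32 * (k * w * l)\<^sup>2 * C) * (v / D * w) / 2 = z * v\<^sup>2 / (C * (64 * k\<^sup>2 * D\<^sup>2) * l\<^sup>2)"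
              if "D \<noteq> 0" "w \<noteq> 0" "k \<noteq> 0" for z v D w k :: real
              using that l1 C_pos by (simp add: field_simps power2_eq_square)
            from this [of "Cf + 1" "\<psi> u" K8] show ?thesis
              unfolding s_def F_def y_def K_def using K8 \<psi> Cf by simp
          qed
          finally show ?thesis unfolding e_def by simp
        qed
        finally show "measure (P M N) (bad u) \<le> 2 * e" .
      qed
      let ?E = "{\<omega> \<in> space (P M N). op_norm (mat_inv_sqrt (R M) * toeplitz_est (data_matrix (CC N) (Z M N \<omega>) (R M))
                      * mat_inv_sqrt (R M) - \<xi> N \<cdot>\<^sub>m 1\<^sub>m M) > x M}"
      have incl: "?E \<subseteq> (\<Union>u\<in>?\<Theta>. bad u)"
      proof
        fix \<omega> assume \<omega>: "\<omega> \<in> ?E"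
        have Zc: "Z M N \<omega> \<in> carrier_mat N M" using rowsM \<omega> by (auto simp: iid_rows_def)
        let ?X = "data_matrix (CC N) (Z M N \<omega>) (R M)"
        have Xc: "?X \<in> carrier_mat N M" unfolding CC_def by (rule data_matrix_index(1) [OF Zc Q(1) cn(1)])
        show "\<omega> \<in> (\<Union>u\<in>?\<Theta>. bad u)"
        proof (rule ccontr)
          assume no: "\<omega> \<notin> (\<Union>u\<in>?\<Theta>. bad u)"
          have "op_norm (mat_inv_sqrt (toeplitz M (autocov f)) * toeplitz M (autocov_est (sample_cov ?X)) * mat_inv_sqrt (toeplitz M (autocov f))
            - complex_of_real \<mu> \<cdot>\<^sub>m 1\<^sub>m M) \<le> y * (Cf + 1)"
          proof (rule op_norm_le_of_grid [where \<phi> = \<phi>, OF fi fc cf Cf \<phi>c anti P1 M1 h0 h1 h2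
                sample_cov_index(1) [OF Xc] hermitian_sample_cov [OF Xc] less_imp_le [OF y]])
            fix u assume u: "u \<in> ?\<Theta>"
            have "Re (symbol M (\<lambda>k. autocov_est (sample_cov ?X) k - complex_of_real \<mu> * autocov f k) u) = Sd u \<omega>"
              unfolding CC_def R_def \<mu>_def Sd_def A_def q_def
              by (rule symbol_deviation [OF Zc N cn(1) Q [unfolded R_def]])
            moreover have "\<bar>Sd u \<omega>\<bar> \<le> y * \<psi> u" using no u \<omega> by (auto simp: bad_def)
            ultimately show "\<bar>Re (symbol M (\<lambda>k. autocov_est (sample_cov ?X) k - complex_of_real \<mu> * autocov f k) u)\<bar>
              \<le> y * \<phi> (max \<bar>u\<bar> (1 / real M))" by (simp add: \<psi>_def)
          qed
          moreover have "toeplitz_est ?X = toeplitz M (autocov_est (sample_cov ?X))"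
            using Xc by (simp add: toeplitz_est_def)
          moreover have "y * (Cf + 1) = x M" using Cf by (simp add: y_def)
          ultimately show False using \<omega> by (simp add: \<mu> R_def)
        qed
      qed
      have fin: "finite ?\<Theta>" by (rule outward_grid_facts(1) [OF h0])
      have Us: "(\<Union>u\<in>?\<Theta>. bad u) \<in> sets (P M N)" using fin bad(1) by (intro sets.finite_UN) auto
      \<comment> \<open>The event itself may fail to be measurable; then its \<open>measure\<close> is 0 by convention.\<close>
      have "measure (P M N) ?E \<le> measure (P M N) (\<Union>u\<in>?\<Theta>. bad u)"
      proof (cases "?E \<in> sets (P M N)")
        case True
        then show ?thesis using incl Us by (intro PM.finite_measure_mono)
      qed (simp add: measure_notin_sets)
      also have "\<dots> \<le> (\<Sum>u\<in>?\<Theta>. measure (P M N) (bad u))"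
        using fin bad(1) by (intro PM.finite_measure_subadditive_finite) auto
      also have "\<dots> \<le> (\<Sum>u\<in>?\<Theta>. 2 * e)" by (intro sum_mono bad(2))
      also have "\<dots> = real (card ?\<Theta>) * (2 * e)" by simp
      also have "\<dots> \<le> real M powr real_of_int \<beta> * (2 * e)"
        using card by (intro mult_right_mono) (auto simp: e_def)
      also have "\<dots> = 2 * exp (- (real N * (x M)\<^sup>2 / (C * K * (ln (real M))\<^sup>2)) + real_of_int \<beta> * ln (real M))"
        using M1 unfolding exp_add by (simp add: e_def l_def powr_def)
      finally show "measure (P M N) ?E
          \<le> 2 * exp (- (real N * (x M)\<^sup>2 / (C * K * (ln (real M))\<^sup>2)) + real_of_int \<beta> * ln (real M))" .
    qed
  qed
qed

end
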